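(* Let $N\ge2$, let $\Omega\subset\mathbb{R}^N$ be a bounded domain with smooth boundary, let $1^*=N/(N-1)$ and $q\in(1,1^* )$. For $\lambda,a>0$ consider the problem $(Q_{\lambda,a})$: $$-\Delta_1u=\lambda H(|u|-a)|u|^{q-2}u+|u|^{1^*-2}u\ \text{ in }\Omega,\qquad u=0\ \text{ on }\partial\Omega .$$ For any $n\in\mathbb{N}$ there exists $\lambda_n>0$ such that for every $\lambda\in[\lambda_n,\infty)$ there exists $a_\lambda>0$ such that problem $(Q_{\lambda,a})$ admits at least $n$ nontrivial solutions for any $a\in(0,a_\lambda)$. Moreover, for each $\lambda\in[\lambda_n,\infty)$ there exists $0<a_0\le a_\lambda$ such that for all $a\in(0,a_0)$, $$\big|\{x\in\Omega:\ |u(x)|>a\}\big|>0$$ whenever $u$ is a nontrivial solution of $(Q_{\lambda,a})$.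
   Context: $|A|$ denotes Lebesgue measure; $H(t)=0$ for $t<0$ and $H(t)=1$ for $t\ge0$. $BV(\Omega)$ is the space of functions of bounded variation on $\Omega$. Let $F_a(s)=\int_0^sH(|t|-a)|t|^{q-2}t\,dt$, a locally Lipschitz function with generalized gradient $\partial F_a(t)=\{|t|^{q-2}t\}$ if $|t|>a$, $\{0\}$ if $|t|<a$, $[0,a^{q-1}]$ if $t=a$, $[-a^{q-1},0]$ if $t=-a$. A solution of $(Q_{\lambda,a})$ is $u\in BV(\Omega)$ for which there exist $\mathbf z\in L^\infty(\Omega;\mathbb{R}^N)$ with $\|\mathbf z\|_\infty\le1$ and $\rho\in L^{p}(\Omega)$, $p=q/(q-1)$, such that $-\int_\Omega u\,\mathrm{div}\,\mathbf z\,dx=\int_\Omega|Du|+\int_{\partial\Omega}|u|\,d\mathcal{H}^{N-1}$ (trace of $u$ on $\partial\Omega$), $-\mathrm{div}\,\mathbf z=\lambda\rho+|u|^{1^*-2}u\in L^N(\Omega)$ a.e. in $\Omega$, and $\rho(x)\in\partial F_a(u(x))$ for a.e. $x\in\Omega$. Nontrivial means $u\not\equiv0$. *)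

theory Defs
  imports "HOL-Analysis.Analysis"
begin

section \<open>Differentiable functions and smooth domains\<close>

definition partial_deriv :: "'n \<Rightarrow> (real^'n \<Rightarrow> real) \<Rightarrow> real^'n \<Rightarrow> real" where
  "partial_deriv i f x = frechet_derivative f (at x) (axis i 1)"

primrec Ck :: "nat \<Rightarrow> (real^'n \<Rightarrow> real) \<Rightarrow> bool" where
  "Ck 0 f \<longleftrightarrow> continuous_on UNIV f"
| "Ck (Suc k) f \<longleftrightarrow> f differentiable_on UNIV \<and> (\<forall>i. Ck k (partial_deriv i f))"

definition smooth :: "(real^'n \<Rightarrow> real) \<Rightarrow> bool" where
  "smooth f \<longleftrightarrow> (\<forall>k. Ck k f)"

definition grad :: "(real^'n \<Rightarrow> real) \<Rightarrow> real^'n \<Rightarrow> real^'n" where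
  "grad f x = (\<chi> i. partial_deriv i f x)"

definition divergence :: "(real^'n \<Rightarrow> real^'n) \<Rightarrow> real^'n \<Rightarrow> real" where
  "divergence \<phi> x = (\<Sum>i\<in>UNIV. partial_deriv i (\<lambda>y. \<phi> y $ i) x)"

text \<open>Compactly supported functions on an open set are represented by their extension
  by zero to the whole space.\<close>

definition compact_support_in :: "(real^'n) set \<Rightarrow> (real^'n \<Rightarrow> 'b::zero) \<Rightarrow> bool" where
  "compact_support_in \<Omega> f \<longleftrightarrow>
     compact (closure {x. f x \<noteq> 0}) \<and> closure {x. f x \<noteq> 0} \<subseteq> \<Omega>"

definition test_functions :: "(real^'n) set \<Rightarrow> (real^'n \<Rightarrow> real) set" where
  "test_functions \<Omega> = {\<phi>. smooth \<phi> \<and> compact_support_in \<Omega> \<phi>}"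

text \<open>Near each boundary point the set is, up to the choice of a coordinate axis
  \<open>i\<close> and of an orientation \<open>\<sigma>\<close>, the region on one side of the graph of a smooth function of the
  remaining coordinates; \<open>\<gamma>\<close> is evaluated at the point with its \<open>i\<close>-th coordinate set to 0.\<close>

definition smooth_boundary :: "(real^'n) set \<Rightarrow> bool" where
  "smooth_boundary \<Omega> \<longleftrightarrow>
     (\<forall>x0\<in>frontier \<Omega>. \<exists>r>0. \<exists>i. \<exists>\<sigma>\<in>{1, -1}. \<exists>\<gamma>. smooth \<gamma> \<and>
        \<Omega> \<inter> ball x0 r = {x \<in> ball x0 r. \<sigma> * x $ i > \<gamma> (x - axis i (x $ i))})"

definition bounded_smooth_domain :: "(real^'n) set \<Rightarrow> bool" where
  "bounded_smooth_domain \<Omega> \<longleftrightarrow>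
     open \<Omega> \<and> connected \<Omega> \<and> \<Omega> \<noteq> {} \<and> bounded \<Omega> \<and> smooth_boundary \<Omega>"


section \<open>Hausdorff measure of integer dimension\<close>

text \<open>The normalisation makes the \<open>k\<close>-dimensional Hausdorff measure agree with surface area
  on \<open>k\<close>-dimensional smooth submanifolds. The outer measure is a
  metric outer measure, hence countably additive on the Borel sets.\<close>

definition hausdorff_content :: "nat \<Rightarrow> real \<Rightarrow> 'a::metric_space set \<Rightarrow> ennreal" where
  "hausdorff_content k \<delta> A =
     (INF C \<in> {C :: nat \<Rightarrow> 'a set. A \<subseteq> (\<Union>j. C j) \<and> (\<forall>j. bounded (C j) \<and> diameter (C j) \<le> \<delta>)}.
        \<Sum>j. if C j = {} then 0 else ennreal (unit_ball_vol (real k) * (diameter (C j) / 2) ^ k))"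

definition hausdorff_outer :: "nat \<Rightarrow> 'a::metric_space set \<Rightarrow> ennreal" where
  "hausdorff_outer k A = (SUP \<delta>\<in>{0<..}. hausdorff_content k \<delta> A)"

definition hausdorff_measure :: "nat \<Rightarrow> 'a::metric_space measure" where
  "hausdorff_measure k = measure_of UNIV (sets borel) (hausdorff_outer k)"


section \<open>Functions of bounded variation and their boundary trace\<close>

definition total_variation :: "(real^'n) set \<Rightarrow> (real^'n \<Rightarrow> real) \<Rightarrow> ereal" where
  "total_variation \<Omega> u =
     (SUP \<phi> \<in> {\<phi> :: real^'n \<Rightarrow> real^'n. (\<forall>i. Ck 1 (\<lambda>x. \<phi> x $ i)) \<and>
                compact_support_in \<Omega> \<phi> \<and> (\<forall>x. norm (\<phi> x) \<le> 1)}.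
        ereal (\<integral>x. u x * divergence \<phi> x \<partial>lebesgue_on \<Omega>))"

definition BV :: "(real^'n) set \<Rightarrow> (real^'n \<Rightarrow> real) set" where
  "BV \<Omega> = {u. integrable (lebesgue_on \<Omega>) u \<and> total_variation \<Omega> u < \<infinity>}"

text \<open>The trace of a BV function at a boundary point is its approximate (Lebesgue) limit from
  inside the domain. For \<open>u \<in> BV \<Omega>\<close> and \<open>\<Omega>\<close> bounded with smooth boundary this limit exists
  almost everywhere on the boundary with respect to the Hausdorff measure; elsewhere the value 0
  is used.\<close>

definition has_trace_at :: "(real^'n) set \<Rightarrow> (real^'n \<Rightarrow> real) \<Rightarrow> real^'n \<Rightarrow> real \<Rightarrow> bool" where
  "has_trace_at \<Omega> u x t \<longleftrightarrow>
     ((\<lambda>r. (\<integral>y. \<bar>u y - t\<bar> \<partial>lebesgue_on (\<Omega> \<inter> ball x r)) / measure lebesgue (\<Omega> \<inter> ball x r))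
        \<longlongrightarrow> 0) (at_right 0)"

definition bv_trace :: "(real^'n) set \<Rightarrow> (real^'n \<Rightarrow> real) \<Rightarrow> real^'n \<Rightarrow> real" where
  "bv_trace \<Omega> u x = (if \<exists>t. has_trace_at \<Omega> u x t then THE t. has_trace_at \<Omega> u x t else 0)"

definition boundary_integral_abs :: "(real^'n) set \<Rightarrow> (real^'n \<Rightarrow> real) \<Rightarrow> ereal" where
  "boundary_integral_abs \<Omega> u =
     enn2ereal (\<integral>\<^sup>+ x \<in> frontier \<Omega>. ennreal \<bar>bv_trace \<Omega> u x\<bar> \<partial>hausdorff_measure (CARD('n) - 1))"


section \<open>Lebesgue spaces and distributional divergence\<close>

definition Lp :: "real \<Rightarrow> (real^'n) set \<Rightarrow> (real^'n \<Rightarrow> real) set" where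
  "Lp p \<Omega> = {f \<in> borel_measurable (lebesgue_on \<Omega>).
              integrable (lebesgue_on \<Omega>) (\<lambda>x. \<bar>f x\<bar> powr p)}"

definition weak_divergence ::
  "(real^'n) set \<Rightarrow> (real^'n \<Rightarrow> real^'n) \<Rightarrow> (real^'n \<Rightarrow> real) \<Rightarrow> bool" where
  "weak_divergence \<Omega> z d \<longleftrightarrow>
     (\<forall>\<phi>\<in>test_functions \<Omega>.
        (\<integral>x. z x \<bullet> grad \<phi> x \<partial>lebesgue_on \<Omega>) = - (\<integral>x. d x * \<phi> x \<partial>lebesgue_on \<Omega>))"


section \<open>The nonlinearity and its generalized gradient\<close>

definition heaviside :: "real \<Rightarrow> real" where
  "heaviside t = (if t < 0 then 0 else 1)"

definition F_trunc :: "real \<Rightarrow> real \<Rightarrow> real \<Rightarrow> real" where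
  "F_trunc q a s = (LBINT t=0..s. heaviside (\<bar>t\<bar> - a) * \<bar>t\<bar> powr (q - 2) * t)"

text \<open>Clarke's generalized directional derivative and generalized gradient on the real line.\<close>

definition clarke_deriv :: "(real \<Rightarrow> real) \<Rightarrow> real \<Rightarrow> real \<Rightarrow> ereal" where
  "clarke_deriv f t v =
     Limsup (nhds t \<times>\<^sub>F at_right 0) (\<lambda>(y, h). ereal ((f (y + h * v) - f y) / h))"

definition clarke_gradient :: "(real \<Rightarrow> real) \<Rightarrow> real \<Rightarrow> real set" where
  "clarke_gradient f t = {\<xi>. \<forall>v. ereal (\<xi> * v) \<le> clarke_deriv f t v}"


text \<open>Clarke's definition gives the expected explicit generalized gradient
  (\<open>clarke_gradient_F_trunc\<close>).\<close>

definition F_density :: "real \<Rightarrow> real \<Rightarrow> real \<Rightarrow> real" where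
  "F_density q a t = heaviside (\<bar>t\<bar> - a) * \<bar>t\<bar> powr (q - 2) * t"

lemma F_density_eq:
  assumes "0 < a"
  shows "F_density q a t =
    (if t \<ge> a then t powr (q - 1) else if t \<le> - a then - ((- t) powr (q - 1)) else 0)"
proof -
  have *: "s powr (q - 2) * s = s powr (q - 1)" if "s > 0" for s :: real
  proof -
    have "s powr (q - 2) * s = s powr (q - 2) * s powr 1" using that by simp
    also have "\<dots> = s powr (q - 1)" by (subst powr_add [symmetric]) simp
    finally show ?thesis .
  qed
  consider "t \<ge> a" | "t \<le> - a" | "- a < t" "t < a" by linarith
  then show ?thesis
  proof cases
    case 1
    then show ?thesis using assms *[of t] by (simp add: F_density_def heaviside_def)
  next
    case 2
    then show ?thesis using assms *[of "- t"] by (simp add: F_density_def heaviside_def)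
  next
    case 3
    then have "\<bar>t\<bar> - a < 0" by linarith
    then show ?thesis using 3 by (simp add: F_density_def heaviside_def)
  qed
qed

lemma F_density_mono:
  assumes "0 < a" "1 < q" "s \<le> t"
  shows "F_density q a s \<le> F_density q a t"
proof -
  consider "s \<ge> a" | "t \<le> - a" | "s < a" "- a < t" by linarith
  then show ?thesis
  proof cases
    case 1
    then show ?thesis using assms by (simp add: F_density_eq powr_mono2)
  next
    case 2
    then show ?thesis using assms by (simp add: F_density_eq powr_mono2)
  next
    case 3
    have "F_density q a s \<le> 0" "0 \<le> F_density q a t"
      using 3 assms by (simp_all add: F_density_eq)
    then show ?thesis by linarith
  qed
qed

lemma F_density_interval_integrable:
  assumes "0 < a" "1 < q"
  shows "interval_lebesgue_integrable lborel (ereal x) (ereal y) (F_density q a)"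
proof -
  have meas [measurable]: "F_density q a \<in> borel_measurable borel"
    unfolding F_density_def [abs_def] heaviside_def [abs_def] by measurable
  have "set_integrable lborel {u<..<v} (F_density q a)" for u v
    unfolding set_integrable_def
  proof (rule integrableI_bounded_set_indicator
      [where B = "max \<bar>F_density q a u\<bar> \<bar>F_density q a v\<bar>"])
    show "emeasure lborel {u<..<v} < \<infinity>"
      by (cases "u \<le> v") auto
    show "AE x in lborel. x \<in> {u<..<v} \<longrightarrow>
        norm (F_density q a x) \<le> max \<bar>F_density q a u\<bar> \<bar>F_density q a v\<bar>"
    proof (intro AE_I2 impI)
      fix x assume "x \<in> {u<..<v}"
      then have "F_density q a u \<le> F_density q a x" "F_density q a x \<le> F_density q a v"
        using F_density_mono [OF assms] by auto
      then show "norm (F_density q a x) \<le> max \<bar>F_density q a u\<bar> \<bar>F_density q a v\<bar>"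
        by auto
    qed
  qed auto
  then show ?thesis
    by (simp add: interval_lebesgue_integrable_def)
qed

lemma F_diff:
  assumes "0 < a" "1 < q"
  shows "F_trunc q a y - F_trunc q a x = (LBINT t=x..y. F_density q a t)"
proof -
  have "(LBINT t=ereal 0..ereal x. F_density q a t) + (LBINT t=ereal x..ereal y. F_density q a t)
      = (LBINT t=ereal 0..ereal y. F_density q a t)"
    by (rule interval_integral_sum)
      (simp add: min_def max_def F_density_interval_integrable [OF assms])
  then show ?thesis
    by (simp add: F_trunc_def F_density_def zero_ereal_def)
qed

lemma F_diff_ge:
  assumes "0 < a" "1 < q" "x \<le> y" "\<And>s. x < s \<Longrightarrow> s < y \<Longrightarrow> c \<le> F_density q a s"
  shows "c * (y - x) \<le> F_trunc q a y - F_trunc q a x"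
proof -
  have "c * (y - x) = (LBINT t:{x<..<y}. c)"
    using assms(3) by (simp add: set_integral_const)
  also have "\<dots> \<le> (LBINT t:{x<..<y}. F_density q a t)"
    using F_density_interval_integrable [OF assms(1,2), of x y] assms(3,4)
    by (intro set_integral_mono) (auto simp: interval_lebesgue_integrable_def set_integrable_def)
  also have "\<dots> = F_trunc q a y - F_trunc q a x"
    using assms(3) by (simp add: F_diff [OF assms(1,2)] interval_lebesgue_integral_def)
  finally show ?thesis .
qed

lemma F_diff_le:
  assumes "0 < a" "1 < q" "x \<le> y" "\<And>s. x < s \<Longrightarrow> s < y \<Longrightarrow> F_density q a s \<le> c"
  shows "F_trunc q a y - F_trunc q a x \<le> c * (y - x)"
proof -
  have "F_trunc q a y - F_trunc q a x = (LBINT t:{x<..<y}. F_density q a t)"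
    using assms(3) by (simp add: F_diff [OF assms(1,2)] interval_lebesgue_integral_def)
  also have "\<dots> \<le> (LBINT t:{x<..<y}. c)"
    using F_density_interval_integrable [OF assms(1,2), of x y] assms(3,4)
    by (intro set_integral_mono) (auto simp: interval_lebesgue_integrable_def set_integrable_def)
  also have "\<dots> = c * (y - x)"
    using assms(3) by (simp add: set_integral_const)
  finally show ?thesis .
qed

lemma clarke_gradient_F_trunc_aux:
  assumes "0 < a" "1 < q"
  shows "\<xi> \<in> clarke_gradient (F_trunc q a) t \<longleftrightarrow>
    (\<forall>s<t. F_density q a s \<le> \<xi>) \<and> (\<forall>s>t. \<xi> \<le> F_density q a s)"
proof (intro iffI conjI allI impI)
  assume \<xi>: "\<xi> \<in> clarke_gradient (F_trunc q a) t"
  {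
    fix s assume s: "s > t"
    have ev: "\<forall>\<^sub>F y in nhds t. y < (s + t) / 2"
      using s by (intro order_tendstoD [OF filterlim_ident]) auto
    have ev': "\<forall>\<^sub>F h in at_right 0. 0 < h \<and> h < (s - t) / 2"
      using s by (auto simp: eventually_at_right_field intro!: exI [of _ "(s - t) / 2"])
    have "clarke_deriv (F_trunc q a) t 1 \<le> ereal (F_density q a s)"
      unfolding clarke_deriv_def
    proof (rule Limsup_bounded)
      show "\<forall>\<^sub>F p in nhds t \<times>\<^sub>F at_right 0.
          (case p of (y, h) \<Rightarrow> ereal ((F_trunc q a (y + h * 1) - F_trunc q a y) / h)) \<le> ereal (F_density q a s)"
        unfolding eventually_prod_filter
      proof (intro exI conjI allI impI)
        show "\<forall>\<^sub>F y in nhds t. y < (s + t) / 2" by fact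
        show "\<forall>\<^sub>F h in at_right 0. 0 < h \<and> h < (s - t) / 2" by fact
        fix y h :: real assume y: "y < (s + t) / 2" and h: "0 < h \<and> h < (s - t) / 2"
        have "y + h \<le> s" using y h by (simp add: field_simps)
        then have "F_trunc q a (y + h) - F_trunc q a y \<le> F_density q a s * (y + h - y)"
          using h by (intro F_diff_le assms F_density_mono) auto
        then show "(case (y, h) of (y, h) \<Rightarrow> ereal ((F_trunc q a (y + h * 1) - F_trunc q a y) / h))
            \<le> ereal (F_density q a s)"
          using h by (simp add: field_simps)
      qed
    qed
    moreover have "ereal (\<xi> * 1) \<le> clarke_deriv (F_trunc q a) t 1"
      using \<xi> unfolding clarke_gradient_def by blast
    ultimately have "ereal (\<xi> * 1) \<le> ereal (F_density q a s)" by (rule order_trans [rotated])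
    then show "\<xi> \<le> F_density q a s" by simp
  next
    fix s assume s: "s < t"
    have ev: "\<forall>\<^sub>F y in nhds t. (s + t) / 2 < y"
      using s by (intro order_tendstoD [OF filterlim_ident]) auto
    have ev': "\<forall>\<^sub>F h in at_right 0. 0 < h \<and> h < (t - s) / 2"
      using s by (auto simp: eventually_at_right_field intro!: exI [of _ "(t - s) / 2"])
    have "clarke_deriv (F_trunc q a) t (-1) \<le> ereal (- F_density q a s)"
      unfolding clarke_deriv_def
    proof (rule Limsup_bounded)
      show "\<forall>\<^sub>F p in nhds t \<times>\<^sub>F at_right 0.
          (case p of (y, h) \<Rightarrow> ereal ((F_trunc q a (y + h * (-1)) - F_trunc q a y) / h)) \<le> ereal (- F_density q a s)"
        unfolding eventually_prod_filter
      proof (intro exI conjI allI impI)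
        show "\<forall>\<^sub>F y in nhds t. (s + t) / 2 < y" by fact
        show "\<forall>\<^sub>F h in at_right 0. 0 < h \<and> h < (t - s) / 2" by fact
        fix y h :: real assume y: "(s + t) / 2 < y" and h: "0 < h \<and> h < (t - s) / 2"
        have "s \<le> y - h" using y h by (simp add: field_simps)
        then have "F_density q a s * (y - (y - h)) \<le> F_trunc q a y - F_trunc q a (y - h)"
          using h by (intro F_diff_ge assms F_density_mono) auto
        then show "(case (y, h) of (y, h) \<Rightarrow> ereal ((F_trunc q a (y + h * (-1)) - F_trunc q a y) / h))
            \<le> ereal (- F_density q a s)"
          using h by (simp add: field_simps)
      qed
    qed
    moreover have "ereal (\<xi> * (-1)) \<le> clarke_deriv (F_trunc q a) t (-1)"
      using \<xi> unfolding clarke_gradient_def by blast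
    ultimately have "ereal (\<xi> * (-1)) \<le> ereal (- F_density q a s)" by (rule order_trans [rotated])
    then show "F_density q a s \<le> \<xi>" by simp
  }
next
  assume \<xi>: "(\<forall>s<t. F_density q a s \<le> \<xi>) \<and> (\<forall>s>t. \<xi> \<le> F_density q a s)"
  have sub: "\<xi> * (y - t) \<le> F_trunc q a y - F_trunc q a t" for y
  proof (cases "t \<le> y")
    case True
    then show ?thesis using \<xi> by (intro F_diff_ge assms) auto
  next
    case False
    then have "F_trunc q a t - F_trunc q a y \<le> \<xi> * (t - y)"
      using \<xi> by (intro F_diff_le assms) auto
    then show ?thesis by (simp add: algebra_simps)
  qed
  have "ereal (\<xi> * v) \<le> clarke_deriv (F_trunc q a) t v" for v
    unfolding clarke_deriv_def
  proof (rule Limsup_greatest)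
    fix P assume "eventually P (nhds t \<times>\<^sub>F at_right (0::real))"
    then obtain Pf Pg where P: "eventually Pf (nhds t)" "eventually Pg (at_right (0::real))"
      "\<And>x y. Pf x \<Longrightarrow> Pg y \<Longrightarrow> P (x, y)"
      unfolding eventually_prod_filter by blast
    have "Pf t" using P(1) by (rule eventually_nhds_x_imp_x)
    from P(2) have "eventually (\<lambda>h. Pg h \<and> 0 < h) (at_right (0::real))"
      by (intro eventually_conj eventually_at_right_less)
    then obtain h where h: "Pg h" "0 < h"
      using eventually_happens' [OF trivial_limit_at_right_real] by blast
    have "\<xi> * v \<le> (F_trunc q a (t + h * v) - F_trunc q a t) / h"
      using sub [of "t + h * v"] h by (simp add: field_simps)
    then have "ereal (\<xi> * v) \<le> (case (t, h) of (y, h) \<Rightarrow> ereal ((F_trunc q a (y + h * v) - F_trunc q a y) / h))"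
      by simp
    moreover have "P (t, h)" using P(3) \<open>Pf t\<close> h(1) by blast
    ultimately show "ereal (\<xi> * v) \<le>
        (SUP p\<in>Collect P. case p of (y, h) \<Rightarrow> ereal ((F_trunc q a (y + h * v) - F_trunc q a y) / h))"
      by (meson SUP_upper2 mem_Collect_eq)
  qed
  then show "\<xi> \<in> clarke_gradient (F_trunc q a) t" by (simp add: clarke_gradient_def)
qed

lemma F_density_ge_right_iff:
  assumes "0 < a" "1 < q"
  shows "(\<forall>s>t. \<xi> \<le> F_density q a s) \<longleftrightarrow>
    \<xi> \<le> (if t \<ge> a then t powr (q - 1) else if t < - a then - ((- t) powr (q - 1)) else 0)"
    (is "?L \<longleftrightarrow> \<xi> \<le> ?R")
proof
  assume L: ?L
  have "(F_density q a \<longlongrightarrow> ?R) (at_right t)"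
  proof -
    consider "t \<ge> a" | "t < - a" | "- a \<le> t" "t < a" by linarith
    then show ?thesis
    proof cases
      case 1
      have "((\<lambda>s. s powr (q - 1)) \<longlongrightarrow> t powr (q - 1)) (at_right t)"
        using 1 assms by (intro tendsto_intros) auto
      moreover have "\<forall>\<^sub>F s in at_right t. s powr (q - 1) = F_density q a s"
        using eventually_at_right_less [of t] by eventually_elim (use 1 assms in \<open>auto simp: F_density_eq\<close>)
      ultimately show ?thesis using 1 by (auto intro: Lim_transform_eventually)
    next
      case 2
      have "((\<lambda>s. - ((- s) powr (q - 1))) \<longlongrightarrow> - ((- t) powr (q - 1))) (at_right t)"
        using 2 assms by (intro tendsto_intros) auto
      moreover have "\<forall>\<^sub>F s in at_right t. - ((- s) powr (q - 1)) = F_density q a s"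
        unfolding eventually_at_right_field
        by (intro exI [of _ "- a"]) (use 2 assms in \<open>auto simp: F_density_eq\<close>)
      ultimately show ?thesis using 2 assms by (auto intro: Lim_transform_eventually)
    next
      case 3
      have "\<forall>\<^sub>F s in at_right t. 0 = F_density q a s"
        unfolding eventually_at_right_field
        by (intro exI [of _ a]) (use 3 assms in \<open>auto simp: F_density_eq\<close>)
      with 3 show ?thesis using tendsto_const [of 0] by (auto intro: Lim_transform_eventually)
    qed
  qed
  then show "\<xi> \<le> ?R"
    by (rule tendsto_lowerbound)
      (use L eventually_at_right_less [of t] in \<open>auto elim: eventually_mono\<close>)
next
  assume R: "\<xi> \<le> ?R"
  show ?L
  proof (intro allI impI)
    fix s assume s: "s > t"
    show "\<xi> \<le> F_density q a s"
    proof (cases "t = - a")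
      case True
      then show ?thesis using R s assms by (auto simp: F_density_eq intro: order_trans)
    next
      case False
      then have "\<xi> \<le> F_density q a t" using R assms by (simp add: F_density_eq split: if_splits)
      also have "\<dots> \<le> F_density q a s" using s assms by (intro F_density_mono) auto
      finally show ?thesis .
    qed
  qed
qed

lemma F_density_minus: "0 < a \<Longrightarrow> F_density q a (- s) = - F_density q a s"
  by (simp add: F_density_def)

lemma F_density_le_left_iff:
  assumes "0 < a" "1 < q"
  shows "(\<forall>s<t. F_density q a s \<le> \<xi>) \<longleftrightarrow>
    (if t \<le> - a then - ((- t) powr (q - 1)) else if t > a then t powr (q - 1) else 0) \<le> \<xi>"
proof -
  have "(\<forall>s<t. F_density q a s \<le> \<xi>) \<longleftrightarrow> (\<forall>s>-t. - \<xi> \<le> F_density q a s)"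
    by (metis F_density_minus assms(1) minus_less_iff neg_le_iff_le minus_minus)
  then show ?thesis
    unfolding F_density_ge_right_iff [OF assms] using assms by auto
qed

lemma clarke_gradient_F_trunc:
  assumes "0 < a" "1 < q"
  shows "clarke_gradient (F_trunc q a) t =
    (if \<bar>t\<bar> > a then {\<bar>t\<bar> powr (q - 2) * t}
     else if \<bar>t\<bar> < a then {0}
     else if t = a then {0..a powr (q - 1)}
     else {- (a powr (q - 1))..0})"
proof -
  have "\<bar>t\<bar> powr (q - 2) * t = (if t > a then t powr (q - 1) else - ((- t) powr (q - 1)))"
    if "\<bar>t\<bar> > a"
    using that assms F_density_eq [OF assms(1), of q t]
    by (auto simp: F_density_def heaviside_def split: if_splits)
  then show ?thesis
    using assms
    by (auto simp: set_eq_iff clarke_gradient_F_trunc_aux F_density_ge_right_iff F_density_le_left_iff)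
qed

section \<open>Solutions\<close>

definition crit_exponent :: "'n itself \<Rightarrow> real" where
  "crit_exponent _ = real CARD('n) / (real CARD('n) - 1)"

text \<open>The condition \<open>norm (z x) \<le> 1\<close> a.e. expresses that \<open>z\<close> lies in the closed unit ball of
  \<open>L\<^sup>\<infinity>\<close>. The function \<open>d\<close> is the divergence of \<open>z\<close> in the sense of
  distributions.\<close>

definition solution ::
  "(real^'n) set \<Rightarrow> real \<Rightarrow> real \<Rightarrow> real \<Rightarrow> (real^'n \<Rightarrow> real) \<Rightarrow> bool" where
  "solution \<Omega> q lam a u \<longleftrightarrow> u \<in> BV \<Omega> \<and>
     (\<exists>z d \<rho>.
        z \<in> borel_measurable (lebesgue_on \<Omega>) \<and> (AE x in lebesgue_on \<Omega>. norm (z x) \<le> 1) \<and>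
        \<rho> \<in> Lp (q / (q - 1)) \<Omega> \<and>
        weak_divergence \<Omega> z d \<and> d \<in> Lp (real CARD('n)) \<Omega> \<and>
        ereal (- (\<integral>x. u x * d x \<partial>lebesgue_on \<Omega>))
          = total_variation \<Omega> u + boundary_integral_abs \<Omega> u \<and>
        (AE x in lebesgue_on \<Omega>.
           - d x = lam * \<rho> x + \<bar>u x\<bar> powr (crit_exponent TYPE('n) - 2) * u x) \<and>
        (AE x in lebesgue_on \<Omega>. \<rho> x \<in> clarke_gradient (F_trunc q a) (u x)))"

definition ae_equal :: "(real^'n) set \<Rightarrow> (real^'n \<Rightarrow> real) \<Rightarrow> (real^'n \<Rightarrow> real) \<Rightarrow> bool" where
  "ae_equal \<Omega> u v \<longleftrightarrow> (AE x in lebesgue_on \<Omega>. u x = v x)"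

definition nontrivial_solution ::
  "(real^'n) set \<Rightarrow> real \<Rightarrow> real \<Rightarrow> real \<Rightarrow> (real^'n \<Rightarrow> real) \<Rightarrow> bool" where
  "nontrivial_solution \<Omega> q lam a u \<longleftrightarrow> solution \<Omega> q lam a u \<and> \<not> ae_equal \<Omega> u (\<lambda>_. 0)"

text \<open>Functions are identified when equal almost everywhere, so the solutions counted
  are required to be pairwise different as equivalence classes.\<close>

definition at_least_nontrivial_solutions ::
  "nat \<Rightarrow> (real^'n) set \<Rightarrow> real \<Rightarrow> real \<Rightarrow> real \<Rightarrow> bool" where
  "at_least_nontrivial_solutions n \<Omega> q lam a \<longleftrightarrow>
     (\<exists>U :: nat \<Rightarrow> real^'n \<Rightarrow> real.
        (\<forall>i<n. nontrivial_solution \<Omega> q lam a (U i)) \<and>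
        (\<forall>i<n. \<forall>j<n. i \<noteq> j \<longrightarrow> \<not> ae_equal \<Omega> (U i) (U j)))"

end

theory Submission
  imports Defs
begin

text \<open>Existence needs no critical point theory. If \<open>c > a\<close> and \<open>lam * c^(q - 1) + c^(1* - 1) = N / r\<close>,
  then \<open>c\<close> times the characteristic function of a closed ball of radius \<open>r\<close> and centre \<open>p\<close> in the
  domain is a solution: take \<open>z = - (x - p) / r\<close> in the ball and
  \<open>z = - r^(N - 1) (x - p) / |x - p|^N\<close>, which is divergence free, outside. Concentric balls of
  different radii give as many solutions as desired once \<open>a\<close> lies below the finitely many
  corresponding values \<open>c\<close>, and any positive \<open>lam\<close> is admissible.

  If \<open>|u| <= a\<close> almost everywhere, then \<open>|div z| <= lam * a^(q - 1) + a^(1* - 1)\<close>, so total variation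
  plus boundary integral of \<open>u\<close> is at most this small number times the \<open>L1\<close> norm of \<open>u\<close>. As the
  \<open>L1\<close> norm is bounded by a constant times total variation plus boundary integral, \<open>u = 0\<close> for
  small \<open>a\<close>.

  The last inequality is dual to a bound for \<open>w\<close> tested with gradients of \<open>C1\<close> functions that do not
  vanish on the boundary. Truncating such a function in a thin boundary strip costs at most the mean of
  \<open>|w|\<close> across the strip, which in the limit is at most a constant times the integral of the trace: in
  a chart, averaging in the transversal direction and a Vitali covering show that the trace exists at
  almost every point, and the Hausdorff measure of the boundary dominates the Lebesgue measure of its
  projection.\<close>

section \<open>Continuously differentiable functions\<close>

text \<open>The trace is defined pointwise as a limit of means, with value \<open>0\<close> where no
  limit exists. A lower bound for the boundary integral therefore says nothing until the limit has
  been shown to exist almost everywhere; this obstacle accounts for the length of the chart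
  analysis. No Gauss-Green formula enters: a single inequality suffices, that strip means of
  \<open>|w|\<close> are controlled by the trace, and it comes from Fubini applied to balls centred
  on the graph. The bound \<open>|u| <= a\<close> supplies a bounded representative
  \<open>w\<close>, on which the dominated convergence arguments rest, but \<open>a\<close> does not
  enter the constant of the Poincare inequality. The estimates for \<open>w\<close> tested with
  gradients involve only the sup norm of the test function, never its derivative, so localisation by
  cutoffs is free of charge. The cutoffs are built from squares of positive parts: these are
  \<open>C1\<close>, which is the class of fields in \<open>total_variation\<close>.\<close>

definition C1 :: "(real^'n \<Rightarrow> real) \<Rightarrow> bool" where
  "C1 f \<longleftrightarrow> (\<exists>G. (\<forall>x. (f has_derivative (\<lambda>v. G x \<bullet> v)) (at x)) \<and> continuous_on UNIV G)"

lemma grad_eqI: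
  assumes "(f has_derivative (\<lambda>v. G \<bullet> v)) (at x)"
  shows "grad f x = G"
  using frechet_derivative_at[OF assms, symmetric]
  by (simp add: vec_eq_iff grad_def partial_deriv_def inner_axis)

lemma C1I:
  assumes "\<And>x. (f has_derivative (\<lambda>v. G x \<bullet> v)) (at x)" "continuous_on UNIV G"
  shows "C1 f" "grad f = G"
  using assms grad_eqI by (auto simp: C1_def fun_eq_iff)

lemma C1_has_derivative: "C1 f \<Longrightarrow> (f has_derivative (\<lambda>v. grad f x \<bullet> v)) (at x)"
  and C1_continuous_grad: "C1 f \<Longrightarrow> continuous_on UNIV (grad f)"
  using C1I unfolding C1_def by metis+

lemma C1_continuous: "C1 f \<Longrightarrow> continuous_on A f"
  by (meson C1_has_derivative UNIV_I continuous_on_eq_continuous_at continuous_on_subset has_derivative_continuous open_UNIV subset_UNIV)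

text \<open>Expanding a vector in the coordinate basis turns the Frechet derivative into an inner
  product with \<open>grad f\<close>, the form in which chain and product rules are used. It
  identifies the class of test fields in \<open>total_variation\<close>.\<close>

lemma Ck_1_iff: "Ck (Suc 0) f \<longleftrightarrow> C1 f"
proof
  assume f: "Ck (Suc 0) f"
  have "(f has_derivative (\<lambda>v. grad f x \<bullet> v)) (at x)" for x
  proof -
    have d: "(f has_derivative frechet_derivative f (at x)) (at x)"
      using f by (simp add: differentiable_on_def frechet_derivative_works)
    interpret linear "frechet_derivative f (at x)" using d has_derivative_linear by blast
    have "frechet_derivative f (at x) v = grad f x \<bullet> v" for v
    proof -
      have "v = (\<Sum>i\<in>UNIV. v $ i *\<^sub>R axis i 1)"
        by (simp add: vec_eq_iff axis_def if_distrib cong: if_cong)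
      then have "frechet_derivative f (at x) v = frechet_derivative f (at x) (\<Sum>i\<in>UNIV. v $ i *\<^sub>R axis i 1)"
        by simp
      also have "\<dots> = (\<Sum>i\<in>UNIV. v $ i * frechet_derivative f (at x) (axis i 1))"
        by (simp add: sum scale)
      finally have "frechet_derivative f (at x) v = (\<Sum>i\<in>UNIV. v $ i * frechet_derivative f (at x) (axis i 1))" .
      then show ?thesis by (simp add: grad_def partial_deriv_def inner_vec_def mult.commute)
    qed
    then have "frechet_derivative f (at x) = (\<lambda>v. grad f x \<bullet> v)" by auto
    with d show ?thesis by simp
  qed
  moreover have "continuous_on UNIV (grad f)"
    unfolding grad_def using f by (intro continuous_on_vec_lambda) auto
  ultimately show "C1 f" by (auto simp: C1_def)
next
  assume f: "C1 f"
  then have "f differentiable_on UNIV"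
    using C1_has_derivative by (auto simp: differentiable_on_def differentiable_def)
  moreover have "continuous_on UNIV (partial_deriv i f)" for i
  proof -
    have "partial_deriv i f = (\<lambda>x. grad f x $ i)" by (simp add: grad_def fun_eq_iff)
    then show ?thesis using C1_continuous_grad[OF f] by (auto intro!: continuous_intros)
  qed
  ultimately show "Ck (Suc 0) f" by simp
qed

lemma smooth_C1: "smooth f \<Longrightarrow> C1 f"
  unfolding smooth_def using Ck_1_iff by blast

lemma C1_const: "C1 (\<lambda>_. c)" and grad_const: "grad (\<lambda>_. c) = (\<lambda>_. 0)"
  using C1I[of "\<lambda>_. c" "\<lambda>_. 0"] by auto

lemma C1_inner: "C1 (\<lambda>x. x \<bullet> c)" and grad_inner: "grad (\<lambda>x. x \<bullet> c) = (\<lambda>_. c)"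
proof -
  have d: "((\<lambda>x. x \<bullet> c) has_derivative (\<lambda>v. c \<bullet> v)) (at x)" for x
    unfolding inner_commute[of c] by (intro derivative_intros)
  show "C1 (\<lambda>x. x \<bullet> c)" "grad (\<lambda>x. x \<bullet> c) = (\<lambda>_. c)"
    using C1I[OF d] by auto
qed

lemma C1_component: "C1 (\<lambda>x. x $ i)"
  using C1_inner[of "axis i 1"] by (simp add: inner_axis)

lemma C1_add: "C1 f \<Longrightarrow> C1 g \<Longrightarrow> C1 (\<lambda>x. f x + g x)"
  and grad_add: "C1 f \<Longrightarrow> C1 g \<Longrightarrow> grad (\<lambda>x. f x + g x) = (\<lambda>x. grad f x + grad g x)"
proof -
  assume *: "C1 f" "C1 g"
  have d: "((\<lambda>x. f x + g x) has_derivative (\<lambda>v. (grad f x + grad g x) \<bullet> v)) (at x)" for x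
    using has_derivative_add[OF C1_has_derivative[OF *(1)] C1_has_derivative[OF *(2)]]
    by (simp add: inner_add_left)
  show "C1 (\<lambda>x. f x + g x)" "grad (\<lambda>x. f x + g x) = (\<lambda>x. grad f x + grad g x)"
    by (rule C1I[OF d], intro continuous_intros C1_continuous_grad *)+
qed

lemma C1_mult: "C1 f \<Longrightarrow> C1 g \<Longrightarrow> C1 (\<lambda>x. f x * g x)"
  and grad_mult: "C1 f \<Longrightarrow> C1 g \<Longrightarrow> grad (\<lambda>x. f x * g x) = (\<lambda>x. g x *\<^sub>R grad f x + f x *\<^sub>R grad g x)"
proof -
  assume *: "C1 f" "C1 g"
  have d: "((\<lambda>x. f x * g x) has_derivative (\<lambda>v. (g x *\<^sub>R grad f x + f x *\<^sub>R grad g x) \<bullet> v)) (at x)" for x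
    using has_derivative_mult[OF C1_has_derivative[OF *(1)] C1_has_derivative[OF *(2)]]
    by (simp add: inner_add_left algebra_simps)
  show "C1 (\<lambda>x. f x * g x)" "grad (\<lambda>x. f x * g x) = (\<lambda>x. g x *\<^sub>R grad f x + f x *\<^sub>R grad g x)"
    by (rule C1I[OF d], intro continuous_intros C1_continuous_grad C1_continuous *)+
qed

lemma C1_cmult: "C1 f \<Longrightarrow> C1 (\<lambda>x. c * f x)"
  and grad_cmult: "C1 f \<Longrightarrow> grad (\<lambda>x. c * f x) = (\<lambda>x. c *\<^sub>R grad f x)"
  using C1_mult[OF C1_const] grad_mult[OF C1_const] by (auto simp: grad_const)

lemma C1_diff: "C1 f \<Longrightarrow> C1 g \<Longrightarrow> C1 (\<lambda>x. f x - g x)"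
  and grad_diff: "C1 f \<Longrightarrow> C1 g \<Longrightarrow> grad (\<lambda>x. f x - g x) = (\<lambda>x. grad f x - grad g x)"
  using C1_add[of f "\<lambda>x. (-1) * g x"] C1_cmult[of g "-1"]
    grad_add[of f "\<lambda>x. (-1) * g x"] grad_cmult[of g "-1"] by auto

lemma C1_minus: "C1 f \<Longrightarrow> C1 (\<lambda>x. - f x)"
  using C1_cmult[of f "-1"] by simp

lemma C1_sum: "(\<And>i. i \<in> I \<Longrightarrow> C1 (f i)) \<Longrightarrow> C1 (\<lambda>x. \<Sum>i\<in>I. f i x)"
  and grad_sum: "(\<And>i. i \<in> I \<Longrightarrow> C1 (f i)) \<Longrightarrow> grad (\<lambda>x. \<Sum>i\<in>I. f i x) = (\<lambda>x. \<Sum>i\<in>I. grad (f i) x)"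
proof -
  have "C1 (\<lambda>x. \<Sum>i\<in>I. f i x) \<and> grad (\<lambda>x. \<Sum>i\<in>I. f i x) = (\<lambda>x. \<Sum>i\<in>I. grad (f i) x)"
    if "\<And>i. i \<in> I \<Longrightarrow> C1 (f i)"
    using that
    by (induction I rule: infinite_finite_induct) (simp_all add: C1_const grad_const C1_add grad_add)
  then show "(\<And>i. i \<in> I \<Longrightarrow> C1 (f i)) \<Longrightarrow> C1 (\<lambda>x. \<Sum>i\<in>I. f i x)"
    "(\<And>i. i \<in> I \<Longrightarrow> C1 (f i)) \<Longrightarrow> grad (\<lambda>x. \<Sum>i\<in>I. f i x) = (\<lambda>x. \<Sum>i\<in>I. grad (f i) x)"
    by blast+
qed

lemma C1_prod: "(\<And>i. i \<in> I \<Longrightarrow> C1 (f i)) \<Longrightarrow> C1 (\<lambda>x. \<Prod>i\<in>I. f i x)"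
  by (induction I rule: infinite_finite_induct) (simp_all add: C1_const C1_mult)

text \<open>The set \<open>S\<close> of values makes room for real powers, which are differentiable
  on the positive half line.\<close>

lemma C1_compose_on:
  assumes f: "C1 f" and S: "\<And>x. f x \<in> S"
    and h: "\<And>t. t \<in> S \<Longrightarrow> (h has_real_derivative h' t) (at t)" "continuous_on S h'"
  shows "C1 (\<lambda>x. h (f x))" "grad (\<lambda>x. h (f x)) = (\<lambda>x. h' (f x) *\<^sub>R grad f x)"
proof -
  have d: "((\<lambda>x. h (f x)) has_derivative (\<lambda>v. (h' (f x) *\<^sub>R grad f x) \<bullet> v)) (at x)" for x
  proof -
    have "(h has_derivative (*) (h' (f x))) (at (f x))"
      using h(1)[OF S] by (simp add: has_field_derivative_def)
    from has_derivative_compose[OF C1_has_derivative[OF f] this] show ?thesis by simp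
  qed
  have c: "continuous_on UNIV (\<lambda>x. h' (f x) *\<^sub>R grad f x)"
    using S by (intro continuous_intros C1_continuous_grad f continuous_on_compose2[OF h(2)] C1_continuous) auto
  show "C1 (\<lambda>x. h (f x))" "grad (\<lambda>x. h (f x)) = (\<lambda>x. h' (f x) *\<^sub>R grad f x)"
    by (rule C1I[OF d c])+
qed

lemmas C1_compose = C1_compose_on[where S = UNIV, simplified]

lemma C1_norm_sq: "C1 (\<lambda>x. (norm (x - p))\<^sup>2)"
  and grad_norm_sq: "grad (\<lambda>x. (norm (x - p))\<^sup>2) = (\<lambda>x. 2 *\<^sub>R (x - p))"
proof -
  have d: "((\<lambda>x. (norm (x - p))\<^sup>2) has_derivative (\<lambda>v. (2 *\<^sub>R (x - p)) \<bullet> v)) (at x)" for x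
    unfolding power2_norm_eq_inner
    by (auto intro!: derivative_eq_intros simp: algebra_simps inner_commute)
  have c: "continuous_on UNIV (\<lambda>x. 2 *\<^sub>R (x - p))" by (intro continuous_intros)
  show "C1 (\<lambda>x. (norm (x - p))\<^sup>2)" "grad (\<lambda>x. (norm (x - p))\<^sup>2) = (\<lambda>x. 2 *\<^sub>R (x - p))"
    by (rule C1I[OF d c])+
qed

text \<open>For functions given by different formulas on overlapping open pieces, such as extensions
  by zero.\<close>

lemma C1_local:
  assumes "\<And>x. \<exists>S g. open S \<and> x \<in> S \<and> C1 g \<and> (\<forall>y\<in>S. f y = g y)"
  shows "C1 f"
proof -
  have *: "\<exists>g. (f has_derivative (\<lambda>v. grad f x \<bullet> v)) (at x) \<and> isCont (grad f) x" for x
  proof -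
    obtain S g where S: "open S" "x \<in> S" "C1 g" "\<And>y. y \<in> S \<Longrightarrow> f y = g y" using assms by metis
    have d: "(f has_derivative (\<lambda>v. grad g y \<bullet> v)) (at y)" if "y \<in> S" for y
      by (rule has_derivative_transform_within_open[OF C1_has_derivative[OF S(3)] S(1) that]) (simp add: S)
    then have eq: "grad f y = grad g y" if "y \<in> S" for y
      using that grad_eqI by blast
    have "isCont (grad g) x"
      using C1_continuous_grad[OF S(3)] by (simp add: continuous_on_eq_continuous_at)
    then have "isCont (grad f) x"
      using eq S by (subst isCont_cong[where g = "grad g"]) (auto simp: eventually_nhds)
    then show ?thesis using d[OF S(2)] eq[OF S(2)] by metis
  qed
  show ?thesis
    by (rule C1I(1)[of f "grad f"]) (use * in \<open>auto simp: continuous_on_eq_continuous_at\<close>)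
qed

lemma grad_eq_0_open:
  assumes "open S" "x \<in> S" "\<And>y. y \<in> S \<Longrightarrow> f y = (0::real)"
  shows "grad f x = 0"
proof (rule grad_eqI)
  have "((\<lambda>_. 0::real) has_derivative (\<lambda>v. 0 \<bullet> v)) (at x)" by simp
  then show "(f has_derivative (\<lambda>v. 0 \<bullet> v)) (at x)"
    by (rule has_derivative_transform_within_open[OF _ assms(1,2)]) (simp add: assms(3))
qed

lemma grad_eq_0_outside:
  "x \<notin> closure {x. f x \<noteq> 0} \<Longrightarrow> grad f x = 0"
  using closure_subset[of "{x. f x \<noteq> 0}"]
  by (intro grad_eq_0_open[of "- closure {x. f x \<noteq> 0}"]) auto

text \<open>The building block of all cutoffs: a function that vanishes on a half line and is still
  continuously differentiable.\<close>

lemma C1_pos_sq: "C1 f \<Longrightarrow> C1 (\<lambda>x. (max 0 (f x))\<^sup>2)"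
  and has_deriv_pos_sq: "((\<lambda>t::real. (max 0 t)\<^sup>2) has_real_derivative 2 * max 0 t) (at t)"
proof -
  have d: "((\<lambda>t::real. (max 0 t)\<^sup>2) has_real_derivative 2 * max 0 t) (at t)" for t
  proof -
    consider "t > 0" | "t < 0" | "t = 0" by linarith
    then show ?thesis
    proof cases
      case 1
      have "((\<lambda>t::real. t\<^sup>2) has_real_derivative 2 * max 0 t) (at t)"
        using 1 by (auto intro!: derivative_eq_intros)
      then show ?thesis
        by (rule has_field_derivative_transform_within_open[of _ _ _ "{0<..}"]) (use 1 in auto)
    next
      case 2
      have "((\<lambda>t::real. 0) has_real_derivative 2 * max 0 t) (at t)"
        using 2 by (auto intro!: derivative_eq_intros)
      then show ?thesis
        by (rule has_field_derivative_transform_within_open[of _ _ _ "{..<0}"]) (use 2 in auto)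
    next
      case 3
      \<comment> \<open>At the corner the difference quotient is at most
        \<open>\<bar>h\<bar>\<close> in absolute value.\<close>
      have "((\<lambda>h. ((max 0 (0 + h))\<^sup>2 - (max 0 0)\<^sup>2) / h) \<longlongrightarrow> (0::real)) (at 0)"
      proof (rule Lim_null_comparison[of _ "\<lambda>h. \<bar>h\<bar>"])
        show "\<forall>\<^sub>F h in at 0. norm (((max 0 (0 + h))\<^sup>2 - (max 0 0)\<^sup>2) / h) \<le> \<bar>h::real\<bar>"
          by (rule always_eventually) (auto simp: max_def power2_eq_square)
        show "((\<lambda>h::real. \<bar>h\<bar>) \<longlongrightarrow> 0) (at 0)" by (intro tendsto_eq_intros) auto
      qed
      then show ?thesis using 3 by (simp add: has_field_derivative_def field_has_derivative_at DERIV_def)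
    qed
  qed
  then show "((\<lambda>t::real. (max 0 t)\<^sup>2) has_real_derivative 2 * max 0 t) (at t)" .
  show "C1 f \<Longrightarrow> C1 (\<lambda>x. (max 0 (f x))\<^sup>2)"
    by (rule C1_compose(1)[OF _ d]) (auto intro!: continuous_intros)
qed

lemma C1_line_deriv:
  "C1 f \<Longrightarrow> ((\<lambda>t. f (x + t *\<^sub>R v)) has_real_derivative grad f (x + t *\<^sub>R v) \<bullet> v) (at t)"
proof -
  assume "C1 f"
  have "((\<lambda>t. x + t *\<^sub>R v) has_derivative (\<lambda>h. h *\<^sub>R v)) (at t)"
    by (auto intro!: derivative_eq_intros)
  from has_derivative_compose[OF this C1_has_derivative[OF \<open>C1 f\<close>]]
  show ?thesis by (simp add: has_field_derivative_def mult_commute_abs)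
qed

section \<open>Compact supports and duality\<close>

abbreviation compactly_supported :: "(real^'n \<Rightarrow> 'b::zero) \<Rightarrow> bool" where
  "compactly_supported f \<equiv> compact_support_in UNIV f"

lemma compact_support_in_mono: "compact_support_in U f \<Longrightarrow> U \<subseteq> V \<Longrightarrow> compact_support_in V f"
  by (auto simp: compact_support_in_def)

lemma compact_support_inI:
  assumes "compact K" "K \<subseteq> U" "\<And>x. x \<notin> K \<Longrightarrow> f x = 0"
  shows "compact_support_in U f"
proof -
  have "closure {x. f x \<noteq> 0} \<subseteq> K"
    using assms by (intro closure_minimal compact_imp_closed) auto
  moreover have "compact (closure {x. f x \<noteq> 0})"
    using compact_Int_closed[OF assms(1) closed_closure[of "{x. f x \<noteq> 0}"]] \<open>_ \<subseteq> K\<close> by (simp add: Int_absorb1)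
  ultimately show ?thesis using assms(2) by (auto simp: compact_support_in_def)
qed

lemma compact_support_in_ex:
  assumes "compact_support_in U f"
  shows "\<exists>K. compact K \<and> K \<subseteq> U \<and> (\<forall>x. x \<notin> K \<longrightarrow> f x = 0)"
  using assms closure_subset[of "{x. f x \<noteq> 0}"] unfolding compact_support_in_def
  by (intro exI[of _ "closure {x. f x \<noteq> 0}"]) auto

lemma compactly_supported_ball:
  assumes "compactly_supported f"
  obtains R where "R > 0" "\<And>x. norm x > R \<Longrightarrow> f x = 0"
proof -
  obtain K where K: "compact K" "K \<subseteq> UNIV" "\<And>x. x \<notin> K \<Longrightarrow> f x = 0" using compact_support_in_ex[OF assms] by blast
  obtain R where "R > 0" "\<And>x. x \<in> K \<Longrightarrow> norm x \<le> R" using compact_imp_bounded[OF K(1)] unfolding bounded_pos by blast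
  then have "f x = 0" if "norm x > R" for x using K(3)[of x] that by fastforce
  then show thesis using that \<open>R > 0\<close> by blast
qed

lemma continuous_cs_bounded:
  fixes f :: "real^'n \<Rightarrow> 'b::real_normed_vector"
  assumes "continuous_on UNIV f" "compactly_supported f"
  obtains B where "B > 0" "\<And>x. norm (f x) \<le> B"
proof -
  obtain K where K: "compact K" "K \<subseteq> UNIV" "\<And>x. x \<notin> K \<Longrightarrow> f x = 0" using compact_support_in_ex[OF assms(2)] by blast
  have "compact (f ` K)" by (rule compact_continuous_image[OF continuous_on_subset[OF assms(1)] K(1)]) simp
  then have "bounded (f ` K)" by (rule compact_imp_bounded)
  then obtain B where "B > 0" "\<And>y. y \<in> f ` K \<Longrightarrow> norm y \<le> B" unfolding bounded_pos by blast
  then have "norm (f x) \<le> B" for x using K(3)[of x] by (cases "x \<in> K") auto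
  then show thesis using that \<open>B > 0\<close> by blast
qed

lemma continuous_cs_integrable:
  fixes f :: "real^'n \<Rightarrow> real"
  assumes "continuous_on UNIV f" "compactly_supported f"
  shows "integrable lborel f"
proof -
  obtain R where R: "\<And>x. norm x > R \<Longrightarrow> f x = 0" using assms(2) compactly_supported_ball by blast
  have "integrable lborel (\<lambda>x. indicator (cball 0 R) x *\<^sub>R f x)"
    by (intro borel_integrable_compact continuous_on_subset[OF assms(1)]) auto
  moreover have "(\<lambda>x. indicator (cball 0 R) x *\<^sub>R f x) = f"
    using R by (auto simp: fun_eq_iff indicator_def not_le)
  ultimately show ?thesis by simp
qed

lemma compactly_supported_grad: "compact_support_in U f \<Longrightarrow> compact_support_in U (grad f)"
  using grad_eq_0_outside[of _ f]
  by (intro compact_support_inI[of "closure {x. f x \<noteq> 0}"]) (auto simp: compact_support_in_def)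

section \<open>Translation invariance and integration by parts on the whole space\<close>

lemma lborel_integral_translate:
  fixes f :: "real^'n \<Rightarrow> real"
  assumes [measurable]: "f \<in> borel_measurable borel"
  shows "(\<integral>x. f (x + c) \<partial>lborel) = (\<integral>x. f x \<partial>lborel)"
proof -
  have "(\<integral>x. f x \<partial>lborel) = (\<integral>x. f x \<partial>distr lborel borel ((+) c))" by (subst lborel_distr_plus) simp
  also have "\<dots> = (\<integral>x. f (x + c) \<partial>lborel)" by (subst integral_distr) (simp_all add: add.commute)
  finally show ?thesis by simp
qed

lemma lborel_integrable_translate:
  fixes f :: "real^'n \<Rightarrow> real"
  assumes "integrable lborel f"
  shows "integrable lborel (\<lambda>x. f (x + c))"
proof -
  have "integrable (distr lborel borel ((+) c)) f" using assms by (subst lborel_distr_plus)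
  then have "integrable lborel (\<lambda>x. f (c + x))" using assms by (subst (asm) integrable_distr_eq) auto
  then show ?thesis by (simp add: add.commute)
qed

text \<open>Difference quotients have integral zero by translation invariance, and they converge
  boundedly, on a fixed ball, to the directional derivative.\<close>

lemma integral_grad_eq_0:
  fixes f :: "real^'n \<Rightarrow> real"
  assumes f: "C1 f" "compactly_supported f"
  shows "(\<integral>x. grad f x \<bullet> v \<partial>lborel) = 0"
proof -
  obtain R where R: "\<And>x. norm x > R \<Longrightarrow> f x = 0" using f(2) compactly_supported_ball by blast
  obtain B where B: "B > 0" "\<And>x. norm (grad f x) \<le> B"
    using continuous_cs_bounded[OF C1_continuous_grad[OF f(1)] compactly_supported_grad[OF f(2)]] by metis
  \<comment> \<open>Increments of length at most \<open>1\<close> keep all quotients supported in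
    the ball of radius \<open>R + norm v\<close>.\<close>
  define F where "F n x = (f (x + inverse (real (Suc n)) *\<^sub>R v) - f x) / inverse (real (Suc n))" for n x
  have meas[measurable]: "f \<in> borel_measurable borel" "grad f \<in> borel_measurable borel"
    using f by (auto intro!: borel_measurable_continuous_onI C1_continuous C1_continuous_grad)
  have int: "integrable lborel f" by (intro continuous_cs_integrable C1_continuous f)
  have "(\<integral>x. F n x \<partial>lborel) = 0" for n
    unfolding F_def using int lborel_integrable_translate[OF int] by (simp add: lborel_integral_translate)
  moreover have "(\<lambda>n. \<integral>x. F n x \<partial>lborel) \<longlonglongrightarrow> (\<integral>x. grad f x \<bullet> v \<partial>lborel)"
  proof (rule integral_dominated_convergence[where w = "\<lambda>x. indicator (cball 0 (R + norm v)) x * (B * norm v)"])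
    show "(\<lambda>x. grad f x \<bullet> v) \<in> borel_measurable lborel" "F n \<in> borel_measurable lborel" for n
      unfolding F_def by measurable
    show "integrable lborel (\<lambda>x. indicator (cball 0 (R + norm v)) x * (B * norm v))"
      by (intro integrable_mult_left integrable_real_indicator) (use emeasure_lborel_cball_finite in auto)
    show "AE x in lborel. (\<lambda>n. F n x) \<longlonglongrightarrow> grad f x \<bullet> v"
    proof (intro AE_I2)
      fix x
      have "((\<lambda>h. (f (x + (0 + h) *\<^sub>R v) - f (x + 0 *\<^sub>R v)) / h) \<longlongrightarrow> grad f (x + 0 *\<^sub>R v) \<bullet> v) (at 0)"
        using C1_line_deriv[OF f(1), of x v 0] unfolding DERIV_def by simp
      then have "((\<lambda>h. (f (x + h *\<^sub>R v) - f x) / h) \<longlongrightarrow> grad f x \<bullet> v) (at 0)" by simp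
      moreover have "filterlim (\<lambda>n. inverse (real (Suc n))) (at 0) sequentially"
        using LIMSEQ_inverse_real_of_nat by (simp add: filterlim_at)
      ultimately show "(\<lambda>n. F n x) \<longlonglongrightarrow> grad f x \<bullet> v"
        unfolding F_def by (rule filterlim_compose)
    qed
    show "AE x in lborel. norm (F n x) \<le> indicator (cball 0 (R + norm v)) x * (B * norm v)" for n
    proof (intro AE_I2)
      fix x
      let ?h = "inverse (real (Suc n))"
      have h: "0 < ?h" "?h \<le> 1" by (auto simp: inverse_le_1_iff)
      show "norm (F n x) \<le> indicator (cball 0 (R + norm v)) x * (B * norm v)"
      proof (cases "x \<in> cball 0 (R + norm v)")
        case True
        obtain z where "f (x + ?h *\<^sub>R v) - f (x + 0 *\<^sub>R v) = (?h - 0) * (grad f (x + z *\<^sub>R v) \<bullet> v)"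
          using MVT2[OF h(1) C1_line_deriv[OF f(1), of x v]] by blast
        then have "F n x = grad f (x + z *\<^sub>R v) \<bullet> v" using h unfolding F_def by simp
        also have "\<bar>\<dots>\<bar> \<le> norm (grad f (x + z *\<^sub>R v)) * norm v" by (rule Cauchy_Schwarz_ineq2)
        also have "\<dots> \<le> B * norm v" by (intro mult_right_mono B) auto
        finally show ?thesis using True by simp
      next
        case False
        then have nx: "norm x > R + norm v" by simp
        have "norm (?h *\<^sub>R v) \<le> norm v" using h by (simp add: mult_left_le_one_le)
        then have "norm (x + ?h *\<^sub>R v) > R" using norm_triangle_ineq4[of "x + ?h *\<^sub>R v" "?h *\<^sub>R v"] nx by simp
        moreover have "norm x > R" using nx norm_ge_zero[of v] by linarith
        ultimately have "f x = 0" "f (x + ?h *\<^sub>R v) = 0" using R by blast+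
        then have "F n x = 0" by (simp add: F_def)
        then show ?thesis using B(1) by simp
      qed
    qed
  qed
  ultimately show ?thesis by (simp add: LIMSEQ_const_iff)
qed

lemma compact_support_mult_left:
  fixes f g :: "real^'n \<Rightarrow> 'b::mult_zero"
  shows "compact_support_in U f \<Longrightarrow> compact_support_in U (\<lambda>x. f x * g x)"
  by (drule compact_support_in_ex, elim exE conjE, rule compact_support_inI) auto

lemma compact_support_mult_right:
  fixes f g :: "real^'n \<Rightarrow> 'b::mult_zero"
  shows "compact_support_in U g \<Longrightarrow> compact_support_in U (\<lambda>x. f x * g x)"
  by (drule compact_support_in_ex, elim exE conjE, rule compact_support_inI) auto

lemma integrable_mult_bounded:
  fixes u f :: "real^'n \<Rightarrow> real"
  assumes "integrable M u" "f \<in> borel_measurable M" "\<And>x. \<bar>f x\<bar> \<le> B"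
  shows "integrable M (\<lambda>x. u x * f x)"
proof (rule Bochner_Integration.integrable_bound[where f = "\<lambda>x. B * u x"])
  show "AE x in M. norm (u x * f x) \<le> norm (B * u x)"
  proof (intro AE_I2)
    fix x
    have "\<bar>u x\<bar> * \<bar>f x\<bar> \<le> \<bar>u x\<bar> * \<bar>B\<bar>" using assms(3)[of x] by (intro mult_left_mono) auto
    then show "norm (u x * f x) \<le> norm (B * u x)" by (simp add: abs_mult mult.commute)
  qed
qed (use assms in auto)

lemma integrable_mult_cs:
  fixes u f :: "real^'n \<Rightarrow> real"
  assumes "integrable lborel u" "continuous_on UNIV f" "compactly_supported f"
  shows "integrable lborel (\<lambda>x. u x * f x)"
proof -
  obtain B where "\<And>x. norm (f x) \<le> B" using continuous_cs_bounded[OF assms(2,3)] by metis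
  then show ?thesis using assms(1,2)
    by (intro integrable_mult_bounded[of _ _ _ B]) (auto intro: borel_measurable_continuous_onI)
qed

section \<open>Approximation of the sign function, and duality for the L1 norm\<close>

lemma real_polynomial_function_C1:
  "real_polynomial_function p \<Longrightarrow> C1 p"
proof (induction rule: real_polynomial_function.induct)
  case (linear f)
  interpret bounded_linear f by fact
  have "f = (\<lambda>x. x \<bullet> adjoint f 1)"
    using adjoint_works[OF linear_axioms] by (auto simp: fun_eq_iff)
  then show ?case using C1_inner by metis
qed (auto intro: C1_const C1_add C1_mult)

text \<open>For \<open>h \<ge> 0\<close> this is
  \<open>sgn y * (max 0 (\<bar>y\<bar> - h))\<^sup>2\<close>, a \<open>C1\<close> soft threshold
  that kills values of size at most \<open>h\<close>. For \<open>h = 0\<close> it fixes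
  \<open>-1\<close>, \<open>0\<close> and \<open>1\<close>, the values of the sign.\<close>

definition soft_square :: "real \<Rightarrow> real \<Rightarrow> real" where
  "soft_square h y = (max 0 (y - h))\<^sup>2 - (max 0 (- y - h))\<^sup>2"

lemma abs_soft_square_le: "0 \<le> h \<Longrightarrow> \<bar>y\<bar> \<le> 1 + h \<Longrightarrow> \<bar>soft_square h y\<bar> \<le> 1"
proof -
  assume h: "0 \<le> h" "\<bar>y\<bar> \<le> 1 + h"
  have "(max 0 (y - h))\<^sup>2 \<le> 1" "(max 0 (- y - h))\<^sup>2 \<le> 1"
    using h by (auto intro!: power_le_one)
  moreover have "0 \<le> (max 0 (y - h))\<^sup>2" "0 \<le> (max 0 (- y - h))\<^sup>2" by auto
  ultimately show ?thesis unfolding soft_square_def by linarith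
qed

text \<open>Continuous approximants of the measurable sign are truncated, cut off near the
  complement of \<open>U\<close> and replaced by polynomials. Polynomials have no compact support; a
  soft threshold above the approximation error restores it.\<close>

lemma approx_sign:
  fixes v :: "real^'n \<Rightarrow> real"
  assumes v: "integrable lborel v" and U: "open U" "bounded U"
  shows "\<exists>s. (\<forall>n. C1 (s n)) \<and> (\<forall>n. compact_support_in U (s n)) \<and> (\<forall>n x. \<bar>s n x\<bar> \<le> 1) \<and>
    (AE x in lborel. (\<lambda>n. s n x) \<longlonglongrightarrow> indicator U x * sgn (v x))"
proof -
  define h where "h x = indicator U x * sgn (v x)" for x
  have [measurable]: "U \<in> sets borel" "v \<in> borel_measurable borel"
    using U v by (auto simp: borel_open borel_measurable_integrable)
  have hm: "h \<in> borel_measurable lebesgue"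
    unfolding h_def by (intro measurable_completion) measurable
  then have "h measurable_on UNIV"
    by (simp add: measurable_on_UNIV lebesgue_measurable_imp_measurable_on)
  then obtain N g where N: "negligible N" and g: "\<And>n. continuous_on UNIV (g n :: real^'n \<Rightarrow> real)"
    and lim: "\<And>x. x \<notin> N \<Longrightarrow> (\<lambda>n. g n x) \<longlonglongrightarrow> h x"
    unfolding measurable_on_def by auto
  obtain R where R: "\<And>x. x \<in> U \<Longrightarrow> norm x \<le> R" using U(2) by (auto simp: bounded_iff)
  have neU: "- U \<noteq> {}" using U(2) not_bounded_UNIV[where 'a = "real^'n"] by (metis double_compl compl_bot_eq)
  \<comment> \<open>For positive \<open>n\<close>: zero at distance at most \<open>1 / n\<close>
    from the complement, one at distance at least \<open>2 / n\<close>.\<close>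
  define cut where "cut n x = min 1 (max 0 (real n * infdist x (- U) - 1))" for n x
  define f where "f n x = max (-1) (min 1 (g n x)) * cut n x" for n x
  have cf: "continuous_on UNIV (f n)" for n
    unfolding f_def cut_def by (intro continuous_intros g)
  have cutb: "0 \<le> cut n x" "cut n x \<le> 1" for n x by (auto simp: cut_def)
  have fb: "\<bar>f n x\<bar> \<le> 1" for n x
  proof -
    have "\<bar>max (-1) (min 1 (g n x))\<bar> * \<bar>cut n x\<bar> \<le> 1 * 1" using cutb[of n x] by (intro mult_mono) auto
    then show ?thesis by (simp add: f_def abs_mult)
  qed
  have fs: "f n x \<noteq> 0 \<Longrightarrow> x \<in> U" for n x
    unfolding f_def cut_def by (cases "x \<in> U") auto
  have flim: "(\<lambda>n. f n x) \<longlonglongrightarrow> h x" if "x \<notin> N" for x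
  proof (cases "x \<in> U")
    case True
    have "infdist x (- U) > 0"
      using U True neU by (intro infdist_pos_not_in_closed) auto
    then obtain n0 where n0: "real n0 * infdist x (- U) > 2" using reals_Archimedean3 by blast
    have ev: "\<forall>\<^sub>F n in sequentially. cut n x = 1"
    proof (rule eventually_sequentiallyI[of n0])
      fix n assume "n0 \<le> n"
      then have "real n0 * infdist x (- U) \<le> real n * infdist x (- U)"
        by (intro mult_right_mono) (auto simp: infdist_nonneg)
      then show "cut n x = 1" using n0 by (simp add: cut_def)
    qed
    have "(\<lambda>n. max (-1) (min 1 (g n x))) \<longlonglongrightarrow> max (-1) (min 1 (h x))"
      by (intro tendsto_intros lim that)
    moreover have "max (-1) (min 1 (h x)) = h x" by (simp add: h_def indicator_def sgn_real_def)
    ultimately have "(\<lambda>n. max (-1) (min 1 (g n x)) * 1) \<longlonglongrightarrow> h x" by simp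
    then show ?thesis
      by (rule Lim_transform_eventually) (use ev in \<open>auto elim!: eventually_mono simp: f_def\<close>)
  next
    case False
    then have "f n x = 0" for n using fs by blast
    then show ?thesis using False by (simp add: h_def)
  qed
  define \<eta> where "\<eta> n = inverse (real (Suc n))" for n
  have \<eta>: "0 < \<eta> n" "\<eta> \<longlonglongrightarrow> 0" for n
    using LIMSEQ_inverse_real_of_nat by (simp_all add: \<eta>_def[abs_def])
  \<comment> \<open>The error stays below half the threshold \<open>\<eta> n\<close>, so the
    thresholded polynomial vanishes wherever \<open>f n\<close> does.\<close>
  have "\<exists>p. real_polynomial_function p \<and> (\<forall>x\<in>cball 0 (R + 1). \<bar>f n x - p x\<bar> < \<eta> n / 2)" for n
    by (rule Stone_Weierstrass_real_polynomial_function[OF compact_cball continuous_on_subset[OF cf], of 0 "R+1" "\<eta> n / 2" n])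
      (use \<eta> in auto)
  then obtain p where p: "\<And>n. real_polynomial_function (p n)"
    "\<And>n x. x \<in> cball 0 (R + 1) \<Longrightarrow> \<bar>f n x - p n x\<bar> < \<eta> n / 2" by metis
  define s where "s n x = (if x \<in> ball 0 (R + 1) then soft_square (\<eta> n) (p n x) else 0)" for n x
  have s0: "s n x = 0" if "f n x = 0" for n x
    using p(2)[of x n] that \<eta>(1)[of n] by (auto simp: s_def soft_square_def max_def)
  \<comment> \<open>The compact set carrying \<open>s n\<close>. On it the polynomial has size at
    least \<open>\<eta> n\<close>, so \<open>f n\<close> is nonzero there and the point lies in
    \<open>U\<close>.\<close>
  define K where "K n = {x \<in> cball 0 R. \<eta> n \<le> \<bar>p n x\<bar>}" for n
  have Cp: "C1 (p n)" for n using p(1) real_polynomial_function_C1 by blast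
  have K: "compact (K n)" "K n \<subseteq> U" for n
  proof -
    have "K n = cball 0 R \<inter> {x. \<eta> n \<le> \<bar>p n x\<bar>}" by (auto simp: K_def)
    moreover have "closed {x. \<eta> n \<le> \<bar>p n x\<bar>}"
      by (intro closed_Collect_le continuous_intros C1_continuous Cp)
    ultimately show "compact (K n)" by (metis compact_Int_closed compact_cball)
    show "K n \<subseteq> U"
    proof
      fix x assume x: "x \<in> K n"
      then have "\<bar>f n x - p n x\<bar> < \<eta> n / 2" by (intro p) (auto simp: K_def)
      then have "f n x \<noteq> 0" using x \<eta>(1)[of n] by (auto simp: K_def)
      then show "x \<in> U" by (rule fs)
    qed
  qed
  have sK: "s n x = 0" if "x \<notin> K n" for n x
  proof (cases "norm x \<le> R")
    case True
    then show ?thesis using that by (auto simp: s_def K_def soft_square_def max_def)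
  next
    case False
    then have "f n x = 0" using fs R by force
    then show ?thesis by (rule s0)
  qed
  show ?thesis
  proof (intro exI[of _ s] conjI allI)
    fix n
    show "compact_support_in U (s n)" using K sK by (intro compact_support_inI[of "K n"]) auto
    have Csq: "C1 (\<lambda>x. soft_square (\<eta> n) (p n x))"
      unfolding soft_square_def by (intro C1_diff C1_pos_sq C1_minus C1_const Cp)
    show "C1 (s n)"
    proof (rule C1_local)
      fix x
      consider "x \<in> ball 0 (R + 1)" | "x \<in> - K n"
        by (cases "x \<in> K n") (auto simp: K_def)
      then show "\<exists>S g. open S \<and> x \<in> S \<and> C1 g \<and> (\<forall>y\<in>S. s n y = g y)"
      proof cases
        case 1
        then show ?thesis using Csq
          by (intro exI[of _ "ball 0 (R + 1)"] exI[of _ "\<lambda>x. soft_square (\<eta> n) (p n x)"]) (auto simp: s_def)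
      next
        case 2
        then show ?thesis using sK K(1) compact_imp_closed[of "K n"]
          by (intro exI[of _ "- K n"] exI[of _ "\<lambda>x. 0"]) (auto simp: C1_const)
      qed
    qed
    show "\<bar>s n x\<bar> \<le> 1" for x
    proof (cases "x \<in> ball 0 (R + 1)")
      case True
      then have "\<bar>p n x\<bar> \<le> 1 + \<eta> n" using p(2)[of x n] fb[of n x] \<eta>(1)[of n]
        unfolding mem_ball mem_cball by linarith
      then show ?thesis using True \<eta>(1)[of n] by (simp add: s_def abs_soft_square_le)
    qed (simp add: s_def)
  next
    have "N \<in> null_sets lebesgue" using N negligible_iff_null_sets by blast
    then have "AE x in lebesgue. x \<notin> N" by (rule AE_not_in)
    then have "AE x in lebesgue. (\<lambda>n. s n x) \<longlonglongrightarrow> indicator U x * sgn (v x)"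
    proof eventually_elim
      fix x assume x: "x \<notin> N"
      show "(\<lambda>n. s n x) \<longlonglongrightarrow> indicator U x * sgn (v x)"
      proof (cases "x \<in> U")
        case True
        then have xb: "x \<in> ball 0 (R + 1)" using R by force
        have "(\<lambda>n. p n x - f n x) \<longlonglongrightarrow> 0"
        proof (rule Lim_null_comparison)
          show "\<forall>\<^sub>F n in sequentially. norm (p n x - f n x) \<le> \<eta> n / 2"
            using p(2)[of x] xb by (intro always_eventually) (auto simp: abs_minus_commute less_imp_le)
          show "(\<lambda>n. \<eta> n / 2) \<longlonglongrightarrow> 0" using \<eta>(2) by (auto intro!: tendsto_eq_intros)
        qed
        from tendsto_add[OF this flim[OF x]] have pl: "(\<lambda>n. p n x) \<longlonglongrightarrow> h x" by simp
        have "(\<lambda>n. soft_square (\<eta> n) (p n x)) \<longlonglongrightarrow> (max 0 (h x - 0))\<^sup>2 - (max 0 (- h x - 0))\<^sup>2"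
          unfolding soft_square_def by (intro tendsto_intros pl \<eta>)
        moreover have "(max 0 (h x - 0))\<^sup>2 - (max 0 (- h x - 0))\<^sup>2 = h x"
          by (simp add: h_def indicator_def sgn_real_def)
        moreover have "s n x = soft_square (\<eta> n) (p n x)" for n using xb by (simp add: s_def)
        ultimately show ?thesis by (simp add: h_def)
      next
        case False
        then have "s n x = 0" for n using s0 fs by blast
        then show ?thesis using False by simp
      qed
    qed
    then show "AE x in lborel. (\<lambda>n. s n x) \<longlonglongrightarrow> indicator U x * sgn (v x)"
      by (simp add: AE_completion_iff)
  qed
qed

text \<open>The sign of \<open>v\<close> on \<open>U\<close> is an almost everywhere limit of
  admissible \<open>s\<close>, and dominated convergence passes to it. The L1 bounds in
  \<open>column_estimate\<close> and \<open>poincare_with_trace\<close> are obtained through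
  this.\<close>

lemma L1_norm_le_by_duality:
  fixes v :: "real^'n \<Rightarrow> real"
  assumes v: "integrable lborel v" and U: "open U" "bounded U"
    and le: "\<And>s. C1 s \<Longrightarrow> compact_support_in U s \<Longrightarrow> (\<And>x. \<bar>s x\<bar> \<le> 1) \<Longrightarrow> (\<integral>x. v x * s x \<partial>lborel) \<le> M"
  shows "(\<integral>x. indicator U x * \<bar>v x\<bar> \<partial>lborel) \<le> M"
proof -
  obtain s where s: "\<And>n. C1 (s n)" "\<And>n. compact_support_in U (s n)" "\<And>n x. \<bar>s n x\<bar> \<le> 1"
    "AE x in lborel. (\<lambda>n. s n x) \<longlonglongrightarrow> indicator U x * sgn (v x)"
    using approx_sign[OF v U] by auto
  have [measurable]: "v \<in> borel_measurable borel" "U \<in> sets borel" "s n \<in> borel_measurable borel" for n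
    using v U s(1) by (auto intro!: borel_measurable_continuous_onI C1_continuous simp: borel_measurable_integrable)
  have "(\<lambda>n. \<integral>x. v x * s n x \<partial>lborel) \<longlonglongrightarrow> (\<integral>x. v x * (indicator U x * sgn (v x)) \<partial>lborel)"
  proof (rule integral_dominated_convergence[where w = "\<lambda>x. \<bar>v x\<bar>"])
    show "AE x in lborel. (\<lambda>n. v x * s n x) \<longlonglongrightarrow> v x * (indicator U x * sgn (v x))"
      using s(4) by eventually_elim (intro tendsto_intros)
    show "AE x in lborel. norm (v x * s n x) \<le> \<bar>v x\<bar>" for n
      using s(3)[of n] by (auto simp: abs_mult mult_left_le)
  qed (use v in auto)
  moreover have "(\<integral>x. v x * (indicator U x * sgn (v x)) \<partial>lborel) = (\<integral>x. indicator U x * \<bar>v x\<bar> \<partial>lborel)"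
    by (rule Bochner_Integration.integral_cong) (auto simp: abs_sgn mult_ac)
  ultimately show ?thesis
    using le[OF s(1,2,3)] by (intro LIMSEQ_le_const2) auto
qed

section \<open>Cutoff functions\<close>

text \<open>A quadratic spline rising from \<open>0\<close> to \<open>1\<close> on the unit
  interval; its derivative \<open>step'\<close> is the tent of height \<open>2\<close>.\<close>

definition step :: "real \<Rightarrow> real" where
  "step t = 2 * (max 0 t)\<^sup>2 - 4 * (max 0 (t - 1/2))\<^sup>2 + 2 * (max 0 (t - 1))\<^sup>2"

definition step' :: "real \<Rightarrow> real" where
  "step' t = 4 * max 0 t - 8 * max 0 (t - 1/2) + 4 * max 0 (t - 1)"

lemma step_has_derivative: "(step has_real_derivative step' t) (at t)"
proof -
  have *: "((\<lambda>t. (max 0 (t - c))\<^sup>2) has_real_derivative 2 * max 0 (t - c)) (at t)" for c t :: real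
  proof -
    have "((\<lambda>t. t - c) has_real_derivative 1) (at t)" by (auto intro!: derivative_eq_intros)
    from DERIV_chain2[OF has_deriv_pos_sq this] show ?thesis by simp
  qed
  have "((\<lambda>t. 2 * (max 0 (t - 0))\<^sup>2 - 4 * (max 0 (t - 1/2))\<^sup>2 + 2 * (max 0 (t - 1))\<^sup>2) has_real_derivative
      2 * (2 * max 0 (t - 0)) - 4 * (2 * max 0 (t - 1/2)) + 2 * (2 * max 0 (t - 1))) (at t)"
    by (intro DERIV_add DERIV_diff DERIV_cmult *)
  then show ?thesis by (simp add: step_def[abs_def] step'_def)
qed

lemma continuous_on_step': "continuous_on A step'"
  unfolding step'_def[abs_def] by (intro continuous_intros)

lemma step'_bounds: "0 \<le> step' t" "step' t \<le> 2"
  by (auto simp: step'_def max_def)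

lemma step'_eq_0: "t \<le> 0 \<or> 1 \<le> t \<Longrightarrow> step' t = 0"
  by (auto simp: step'_def max_def)

lemma step_mono: "s \<le> t \<Longrightarrow> step s \<le> step t"
  using step_has_derivative step'_bounds(1) by (metis DERIV_nonneg_imp_nondecreasing)

lemma step_0: "t \<le> 0 \<Longrightarrow> step t = 0"
  and step_1: "1 \<le> t \<Longrightarrow> step t = 1"
  by (auto simp: step_def max_def power2_eq_square algebra_simps)

lemma step_bounds: "0 \<le> step t" "step t \<le> 1"
  using step_mono[of 0 t] step_0[of t] step_0[of 0] step_mono[of t 1] step_1[of t] step_1[of 1]
  by linarith+

lemma C1_step: "C1 f \<Longrightarrow> C1 (\<lambda>x. step (f x))"
  and grad_step: "C1 f \<Longrightarrow> grad (\<lambda>x. step (f x)) = (\<lambda>x. step' (f x) *\<^sub>R grad f x)"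
  using C1_compose[OF _ step_has_derivative continuous_on_step'] by auto

text \<open>Using the squared distance keeps the function \<open>C1\<close> at the centre as
  well.\<close>

definition bump :: "real^'n \<Rightarrow> real \<Rightarrow> real \<Rightarrow> real^'n \<Rightarrow> real" where
  "bump p r1 r2 x = step ((r2\<^sup>2 - (norm (x - p))\<^sup>2) * inverse (r2\<^sup>2 - r1\<^sup>2))"

lemma C1_bump: "C1 (bump p r1 r2)"
  unfolding bump_def[abs_def] by (intro C1_step C1_mult C1_diff C1_const C1_norm_sq)

lemma grad_bump: "grad (bump p r1 r2) = (\<lambda>x. (- 2 * step' ((r2\<^sup>2 - (norm (x - p))\<^sup>2) * inverse (r2\<^sup>2 - r1\<^sup>2)) * inverse (r2\<^sup>2 - r1\<^sup>2)) *\<^sub>R (x - p))"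
  unfolding bump_def[abs_def]
  by (simp add: grad_step grad_mult grad_diff grad_norm_sq C1_mult C1_diff C1_const C1_norm_sq grad_const fun_eq_iff
      algebra_simps)

lemma bump_bounds: "0 \<le> bump p r1 r2 x" "bump p r1 r2 x \<le> 1"
  by (auto simp: bump_def step_bounds)

lemma bump_eq_1: "0 \<le> r1 \<Longrightarrow> r1 < r2 \<Longrightarrow> norm (x - p) \<le> r1 \<Longrightarrow> bump p r1 r2 x = 1"
proof -
  assume *: "0 \<le> r1" "r1 < r2" "norm (x - p) \<le> r1"
  have "r1\<^sup>2 < r2\<^sup>2" "(norm (x - p))\<^sup>2 \<le> r1\<^sup>2" using * by (auto intro: power_strict_mono power_mono)
  then show ?thesis by (auto simp: bump_def field_simps intro!: step_1)
qed

lemma bump_eq_0: "0 \<le> r1 \<Longrightarrow> r1 < r2 \<Longrightarrow> r2 \<le> norm (x - p) \<Longrightarrow> bump p r1 r2 x = 0"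
proof -
  assume *: "0 \<le> r1" "r1 < r2" "r2 \<le> norm (x - p)"
  have "r1\<^sup>2 < r2\<^sup>2" "r2\<^sup>2 \<le> (norm (x - p))\<^sup>2" using * by (auto intro: power_strict_mono power_mono)
  then show ?thesis by (auto simp: bump_def intro!: step_0 mult_nonpos_nonneg)
qed

lemma compact_support_bump: "0 \<le> r1 \<Longrightarrow> r1 < r2 \<Longrightarrow> cball p r2 \<subseteq> U \<Longrightarrow> compact_support_in U (bump p r1 r2)"
  by (intro compact_support_inI[of "cball p r2"] bump_eq_0) (auto simp: dist_norm norm_minus_commute)

text \<open>One differentiation rule for \<open>fibre_integral\<close>,
  \<open>vertical_primitive\<close> and the segment integral in \<open>poincare_with_trace\<close>.
  The fixed interval \<open>{0..1}\<close> suits the Leibniz rule; moving end points are absorbed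
  into \<open>q\<close> and \<open>p\<close>.\<close>

lemma C1_line_integral:
  fixes f p q :: "real^'n \<Rightarrow> real"
    and e :: "real^'n"
  assumes f: "C1 f" and p: "C1 p" and q: "C1 q"
  defines "A \<equiv> \<lambda>x t. x + (q x + t * p x) *\<^sub>R e"
  shows "C1 (\<lambda>x. integral {0..1} (\<lambda>t. f (A x t)))"
    "grad (\<lambda>x. integral {0..1} (\<lambda>t. f (A x t))) x \<bullet> v =
       integral {0..1} (\<lambda>t. grad f (A x t) \<bullet> (v + (grad q x \<bullet> v + t * (grad p x \<bullet> v)) *\<^sub>R e))"
proof -
  \<comment> \<open>The gradient of \<open>\<lambda>x. f (A x t)\<close>: the chain rule passes the
    derivative along \<open>e\<close> on to the gradients of \<open>q\<close> and
    \<open>p\<close>.\<close>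
  define g where "g x t = grad f (A x t) + (grad f (A x t) \<bullet> e) *\<^sub>R (grad q x + t *\<^sub>R grad p x)" for x t
  have cA: "continuous_on UNIV (\<lambda>z. A (fst z) (snd z))"
    unfolding A_def by (intro continuous_intros continuous_on_compose2[OF C1_continuous[OF p, of UNIV]] continuous_on_compose2[OF C1_continuous[OF q, of UNIV]]) auto
  have cg: "continuous_on UNIV (\<lambda>z. g (fst z) (snd z))"
    unfolding g_def
    by (intro continuous_intros continuous_on_compose2[OF C1_continuous_grad[OF f] cA]
        continuous_on_compose2[OF C1_continuous_grad[OF p]] continuous_on_compose2[OF C1_continuous_grad[OF q]]) auto
  have cgx: "continuous_on S (g x)" for x S
  proof -
    have "continuous_on S (\<lambda>t. (x, t))" by (intro continuous_intros)
    from continuous_on_compose2[OF cg this] show ?thesis by simp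
  qed
  have cfx: "continuous_on S (\<lambda>t. f (A x t))" for x S
    by (intro continuous_on_compose2[OF C1_continuous[OF f, of UNIV]]) (auto simp: A_def intro!: continuous_intros)
  have dA: "((\<lambda>x. A x t) has_derivative (\<lambda>v. v + (grad q x \<bullet> v + t * (grad p x \<bullet> v)) *\<^sub>R e)) (at x)" for x t
    unfolding A_def
    using C1_has_derivative[OF p, of x] C1_has_derivative[OF q, of x]
    by (auto intro!: derivative_eq_intros simp: algebra_simps)
  have g_eq: "g x t \<bullet> v = grad f (A x t) \<bullet> (v + (grad q x \<bullet> v + t * (grad p x \<bullet> v)) *\<^sub>R e)" for x t v
    by (simp add: g_def inner_add_left inner_add_right algebra_simps)
  have d: "((\<lambda>x. f (A x t)) has_derivative blinfun_apply (blinfun_inner_left (g x t))) (at x)" for x t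
  proof -
    have "blinfun_apply (blinfun_inner_left (g x t)) = (\<lambda>v. grad f (A x t) \<bullet> (v + (grad q x \<bullet> v + t * (grad p x \<bullet> v)) *\<^sub>R e))"
      by (rule ext) (simp add: g_eq inner_commute[of _ "g x t"])
    then show ?thesis using has_derivative_compose[OF dA[where x = x and t = t] C1_has_derivative[OF f]] by simp
  qed
  have L: "((\<lambda>x. integral (cbox 0 1) (\<lambda>t. f (A x t))) has_derivative integral (cbox 0 1) (\<lambda>t. blinfun_inner_left (g x t))) (at x within UNIV)" for x
  proof (rule leibniz_rule)
    show "((\<lambda>x. f (A x t)) has_derivative blinfun_apply (blinfun_inner_left (g x t))) (at x within UNIV)" for x t
      using d by simp
    show "(\<lambda>t. f (A x t)) integrable_on cbox 0 1" for x by (intro integrable_continuous cfx)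
    show "continuous_on (UNIV \<times> cbox 0 1) (\<lambda>(x, t). blinfun_inner_left (g x t))"
      unfolding split_beta by (intro continuous_intros continuous_on_subset[OF cg]) auto
  qed auto
  have int: "integral (cbox 0 1) (\<lambda>t. blinfun_inner_left (g x t)) = blinfun_inner_left (integral (cbox 0 1) (g x))" for x
    using integral_linear[OF integrable_continuous[OF cgx[where x = x and S = "cbox 0 1"]] bounded_linear_blinfun_inner_left] by (simp add: o_def)
  have d2: "((\<lambda>x. integral {0..1} (\<lambda>t. f (A x t))) has_derivative (\<lambda>v. integral {0..1} (g x) \<bullet> v)) (at x)" for x
    using L[of x] unfolding int by (simp add: inner_commute)
  have c2: "continuous_on UNIV (\<lambda>x. integral {0..1} (g x))"
  proof -
    have "continuous_on UNIV (\<lambda>x. integral (cbox 0 1) (g x))"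
      by (rule integral_continuous_on_param) (auto simp: split_beta intro: continuous_on_subset[OF cg])
    then show ?thesis by simp
  qed
  show "C1 (\<lambda>x. integral {0..1} (\<lambda>t. f (A x t)))" by (rule C1I[OF d2 c2])
  have "grad (\<lambda>x. integral {0..1} (\<lambda>t. f (A x t))) x \<bullet> v = integral {0..1} (g x) \<bullet> v"
    using C1I(2)[OF d2 c2] by simp
  also have "\<dots> = integral {0..1} (\<lambda>t. g x t \<bullet> v)"
    using integral_linear[OF integrable_continuous_real[OF cgx[where x = x and S = "{0..1}"]] bounded_linear_inner_left[of v]] by (simp add: o_def)
  finally show "grad (\<lambda>x. integral {0..1} (\<lambda>t. f (A x t))) x \<bullet> v =
       integral {0..1} (\<lambda>t. grad f (A x t) \<bullet> (v + (grad q x \<bullet> v + t * (grad p x \<bullet> v)) *\<^sub>R e))"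
    by (simp add: g_eq)
qed

section \<open>Divergence and total variation\<close>

text \<open>Passage from the completed measure on \<open>S\<close>, used in the definitions, to a
  Borel representative on the whole space, where translation and Fubini are available.\<close>

lemma lebesgue_on_integral_eq_lborel:
  fixes f f1 :: "real^'n \<Rightarrow> real"
  assumes S: "S \<in> sets borel" and f: "f \<in> borel_measurable (lebesgue_on S)"
    and f1: "f1 \<in> borel_measurable borel" and eq: "AE x in lebesgue. x \<in> S \<longrightarrow> f x = f1 x"
  shows "(\<integral>x. f x \<partial>lebesgue_on S) = (\<integral>x. indicator S x * f1 x \<partial>lborel)"
    and "integrable (lebesgue_on S) f \<longleftrightarrow> integrable lborel (\<lambda>x. indicator S x * f1 x)"
proof -
  have Sl: "S \<in> sets lebesgue" "S \<inter> space lebesgue \<in> sets lebesgue" using S by auto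
  have m1: "(\<lambda>x. indicator S x *\<^sub>R f x) \<in> borel_measurable lebesgue"
    using f Sl(2) borel_measurable_restrict_space_iff[of S lebesgue f] by blast
  have mb[measurable]: "(\<lambda>x. indicator S x * f1 x) \<in> borel_measurable borel" using S f1 by measurable
  then have m2: "(\<lambda>x. indicator S x * f1 x) \<in> borel_measurable lebesgue" by (intro measurable_completion) simp
  have ae: "AE x in lebesgue. indicator S x *\<^sub>R f x = indicator S x * f1 x"
    using eq by eventually_elim (auto simp: indicator_def)
  have "(\<integral>x. f x \<partial>lebesgue_on S) = (\<integral>x. indicator S x *\<^sub>R f x \<partial>lebesgue)"
    using Sl(2) by (rule integral_restrict_space)
  also have "\<dots> = (\<integral>x. indicator S x * f1 x \<partial>lebesgue)" by (rule integral_cong_AE[OF m1 m2 ae])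
  also have "\<dots> = (\<integral>x. indicator S x * f1 x \<partial>lborel)" by (rule integral_completion) simp
  finally show "(\<integral>x. f x \<partial>lebesgue_on S) = (\<integral>x. indicator S x * f1 x \<partial>lborel)" .
  have "integrable (lebesgue_on S) f \<longleftrightarrow> integrable lebesgue (\<lambda>x. indicator S x *\<^sub>R f x)"
    using Sl(2) by (rule integrable_restrict_space)
  also have "\<dots> \<longleftrightarrow> integrable lebesgue (\<lambda>x. indicator S x * f1 x)"
    by (rule integrable_cong_AE[OF m1 m2 ae])
  also have "\<dots> \<longleftrightarrow> integrable lborel (\<lambda>x. indicator S x * f1 x)" by (rule integrable_completion) simp
  finally show "integrable (lebesgue_on S) f \<longleftrightarrow> integrable lborel (\<lambda>x. indicator S x * f1 x)" .
qed

lemma compact_support_in_cong: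
  assumes "compact_support_in U f" "\<And>x. f x = 0 \<Longrightarrow> g x = 0"
  shows "compact_support_in U g"
proof -
  obtain K where "compact K" "K \<subseteq> U" "\<And>x. x \<notin> K \<Longrightarrow> f x = 0"
    using compact_support_in_ex[OF assms(1)] by auto
  then show ?thesis using assms(2) by (intro compact_support_inI[of K]) auto
qed

lemma divergence_grad: "divergence \<phi> x = (\<Sum>i\<in>UNIV. grad (\<lambda>y. \<phi> y $ i) x $ i)"
  by (simp add: divergence_def grad_def)

lemma divergence_scaleR:
  assumes "C1 \<eta>" "\<And>i. C1 (\<lambda>x. \<phi> x $ i)"
  shows "divergence (\<lambda>x. \<eta> x *\<^sub>R \<phi> x) x = \<eta> x * divergence \<phi> x + grad \<eta> x \<bullet> \<phi> x"
  unfolding divergence_grad using assms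
  by (simp add: grad_mult inner_vec_def sum.distrib sum_distrib_left algebra_simps)

lemma divergence_scaleR_const: "C1 f \<Longrightarrow> divergence (\<lambda>x. f x *\<^sub>R v) x = grad f x \<bullet> v"
  by (subst divergence_scaleR) (simp_all add: C1_const divergence_grad grad_const)

lemma divergence_id: "divergence (\<lambda>x::real^'n. x - p) x = real CARD('n)"
proof -
  have "grad (\<lambda>y::real^'n. (y - p) $ i) = (\<lambda>_. axis i 1)" for i
    using grad_diff[OF C1_inner[of "axis i 1"] C1_const, of "p $ i"] grad_inner[of "axis i (1::real)"]
    by (simp add: inner_axis grad_const)
  then show ?thesis by (simp add: divergence_grad axis_def)
qed

lemma continuous_divergence:
  "(\<And>i. C1 (\<lambda>x. \<phi> x $ i)) \<Longrightarrow> continuous_on A (divergence \<phi>)"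
  unfolding divergence_grad[abs_def]
  by (intro continuous_intros continuous_on_subset[OF C1_continuous_grad]) auto

lemma compact_support_component:
  "compact_support_in U \<phi> \<Longrightarrow> compact_support_in U (\<lambda>x. \<phi> x $ i :: real)"
  by (drule compact_support_in_ex, elim exE conjE, rule compact_support_inI) auto

lemma compact_support_divergence:
  assumes "compact_support_in U \<phi>"
  shows "compact_support_in U (divergence \<phi>)"
proof -
  obtain K where K: "compact K" "K \<subseteq> U" "\<And>x. x \<notin> K \<Longrightarrow> \<phi> x = 0"
    using compact_support_in_ex[OF assms] by auto
  have "divergence \<phi> x = 0" if "x \<notin> K" for x
  proof -
    have "grad (\<lambda>y. \<phi> y $ i) x = 0" for i
      using K compact_imp_closed[OF K(1)] that by (intro grad_eq_0_open[of "- K"]) auto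
    then show ?thesis by (simp add: divergence_grad)
  qed
  then show ?thesis using K by (intro compact_support_inI[of K])
qed

lemma integral_divergence_eq_0:
  assumes "\<And>i. C1 (\<lambda>x. \<phi> x $ i)" "compactly_supported \<phi>"
  shows "(\<integral>x. divergence \<phi> x \<partial>lborel) = 0"
proof -
  have c: "compactly_supported (\<lambda>x. \<phi> x $ i)" for i
    by (intro compact_support_component assms)
  have "integrable lborel (\<lambda>x. grad (\<lambda>y. \<phi> y $ i) x $ i)" for i
    using C1_continuous_grad[OF assms(1)] compact_support_component[OF compactly_supported_grad[OF c]]
    by (intro continuous_cs_integrable continuous_intros) auto
  then have "(\<integral>x. divergence \<phi> x \<partial>lborel) = (\<Sum>i\<in>UNIV. \<integral>x. grad (\<lambda>y. \<phi> y $ i) x $ i \<partial>lborel)"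
    unfolding divergence_grad by (simp add: Bochner_Integration.integral_sum)
  also have "\<dots> = 0"
    using integral_grad_eq_0[OF assms(1) c, of _ "axis i 1" for i] by (simp add: inner_axis sum.neutral)
  finally show ?thesis .
qed

section \<open>Variation tested with unit fields\<close>

definition unit_fields :: "(real^'n) set \<Rightarrow> (real^'n \<Rightarrow> real^'n) set" where
  "unit_fields U = {\<phi>. (\<forall>i. C1 (\<lambda>x. \<phi> x $ i)) \<and> compact_support_in U \<phi> \<and> (\<forall>x. norm (\<phi> x) \<le> 1)}"

text \<open>Test fields vanish off \<open>U\<close>, so the integrals are not affected by the values
  of \<open>w\<close> outside \<open>U\<close>.\<close>

lemma total_variation_lborel:
  fixes u w :: "real^'n \<Rightarrow> real"
  assumes U: "open U" and u: "u \<in> borel_measurable (lebesgue_on U)"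
    and w: "w \<in> borel_measurable borel" and eq: "AE x in lebesgue. x \<in> U \<longrightarrow> u x = w x"
  shows "total_variation U u = (SUP \<phi>\<in>unit_fields U. ereal (\<integral>x. w x * divergence \<phi> x \<partial>lborel))"
proof -
  have "(\<integral>x. u x * divergence \<phi> x \<partial>lebesgue_on U) = (\<integral>x. w x * divergence \<phi> x \<partial>lborel)"
    if "\<phi> \<in> unit_fields U" for \<phi>
  proof -
    have c: "\<And>i. C1 (\<lambda>x. \<phi> x $ i)" "compact_support_in U \<phi>" using that by (auto simp: unit_fields_def)
    have [measurable]: "divergence \<phi> \<in> borel_measurable borel"
      by (intro borel_measurable_continuous_onI continuous_divergence c)
    then have "divergence \<phi> \<in> borel_measurable lebesgue" by (intro measurable_completion) simp
    then have [measurable]: "divergence \<phi> \<in> borel_measurable (lebesgue_on U)" by (rule measurable_restrict_space1)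
    have "(\<integral>x. u x * divergence \<phi> x \<partial>lebesgue_on U) = (\<integral>x. indicator U x * (w x * divergence \<phi> x) \<partial>lborel)"
      using U u w eq by (intro lebesgue_on_integral_eq_lborel) (auto elim!: eventually_mono)
    also have "\<dots> = (\<integral>x. w x * divergence \<phi> x \<partial>lborel)"
    proof (rule Bochner_Integration.integral_cong)
      obtain K where "K \<subseteq> U" "\<And>x. x \<notin> K \<Longrightarrow> divergence \<phi> x = 0"
        using compact_support_in_ex[OF compact_support_divergence[OF c(2)]] by auto
      then show "indicator U x * (w x * divergence \<phi> x) = w x * divergence \<phi> x" for x
        by (cases "x \<in> U") auto
    qed simp
    finally show ?thesis .
  qed
  then show ?thesis
    unfolding total_variation_def unit_fields_def One_nat_def Ck_1_iff by (intro SUP_cong) auto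
qed

lemma unit_fields_scaleR:
  assumes "C1 f" "compact_support_in U f" "\<And>x. \<bar>f x\<bar> \<le> 1" "norm v \<le> 1"
  shows "(\<lambda>x. f x *\<^sub>R v) \<in> unit_fields U"
proof -
  have "compact_support_in U (\<lambda>x. f x *\<^sub>R v)"
    by (rule compact_support_in_cong[OF assms(2)]) simp
  moreover have "norm (f x *\<^sub>R v) \<le> 1" for x using assms(3)[of x] assms(4) by (simp add: mult_le_one)
  ultimately show ?thesis unfolding unit_fields_def using assms by (simp add: C1_mult C1_const)
qed

text \<open>A real upper bound for the variation; it avoids extended reals and a supremum that might
  be infinite.\<close>

definition variation_le :: "(real^'n) set \<Rightarrow> (real^'n \<Rightarrow> real) \<Rightarrow> real \<Rightarrow> bool" where
  "variation_le U w V \<longleftrightarrow> (\<forall>\<phi>\<in>unit_fields U. (\<integral>x. w x * divergence \<phi> x \<partial>lborel) \<le> V)"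

text \<open>The field \<open>f x *\<^sub>R v\<close>, divided by \<open>B\<close>, is a unit field,
  and its divergence is the derivative of \<open>f\<close> along \<open>v\<close> divided by
  \<open>B\<close>.\<close>

lemma variation_le_scalar:
  assumes V: "variation_le U w V" and f: "C1 f" "compact_support_in U f" "\<And>x. \<bar>f x\<bar> \<le> B" and v: "norm v \<le> 1"
  shows "(\<integral>x. w x * (grad f x \<bullet> v) \<partial>lborel) \<le> B * V"
proof (cases "B > 0")
  case True
  have "(\<lambda>x. (inverse B * f x) *\<^sub>R v) \<in> unit_fields U"
  proof (rule unit_fields_scaleR)
    show "C1 (\<lambda>x. inverse B * f x)" using f(1) by (rule C1_cmult)
    show "compact_support_in U (\<lambda>x. inverse B * f x)" using f(2) by (rule compact_support_mult_right)
    show "\<bar>inverse B * f x\<bar> \<le> 1" for x using f(3)[of x] True by (simp add: abs_mult field_simps)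
  qed (fact v)
  then have "(\<integral>x. w x * divergence (\<lambda>x. (inverse B * f x) *\<^sub>R v) x \<partial>lborel) \<le> V"
    using V by (auto simp: variation_le_def)
  moreover have "divergence (\<lambda>x. (inverse B * f x) *\<^sub>R v) x = inverse B * (grad f x \<bullet> v)" for x
    using f(1) by (simp add: divergence_scaleR_const C1_cmult grad_cmult)
  ultimately have "inverse B * (\<integral>x. w x * (grad f x \<bullet> v) \<partial>lborel) \<le> V"
    by (simp add: algebra_simps flip: Bochner_Integration.integral_mult_right_zero)
  then show ?thesis using True by (simp add: field_simps)
next
  case False
  \<comment> \<open>A bound \<open>B\<close> that is not positive leaves only \<open>B = 0\<close>
    and \<open>f = 0\<close>.\<close>
  have "f x = 0 \<and> B = 0" for x using False f(3)[of x] by auto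
  then have "B = 0" "f = (\<lambda>_. 0)" by (auto simp: fun_eq_iff)
  then show ?thesis by (simp add: grad_const)
qed

section \<open>Characteristic functions of balls as solutions\<close>

definition cutoff :: "real^'n \<Rightarrow> real \<Rightarrow> real \<Rightarrow> nat \<Rightarrow> real^'n \<Rightarrow> real" where
  "cutoff p R \<epsilon> k = bump p R (R + \<epsilon> / real (Suc k))"

context
  fixes p :: "real^'n" and R \<epsilon> :: real
  assumes R: "0 < R" and \<epsilon>: "0 < \<epsilon>"
begin

lemma radius: "R < R + \<epsilon> / real (Suc k)" "R + \<epsilon> / real (Suc k) \<le> R + \<epsilon>"
  using \<epsilon> by (auto simp: field_simps)

lemma C1_cutoff: "C1 (cutoff p R \<epsilon> k)"
  unfolding cutoff_def by (rule C1_bump)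

lemma cutoff_bounds: "0 \<le> cutoff p R \<epsilon> k x" "cutoff p R \<epsilon> k x \<le> 1"
  unfolding cutoff_def by (rule bump_bounds)+

lemma cutoff_1: "norm (x - p) \<le> R \<Longrightarrow> cutoff p R \<epsilon> k x = 1"
  unfolding cutoff_def using R radius[of k] by (intro bump_eq_1) auto

lemma cutoff_0: "R + \<epsilon> / real (Suc k) \<le> norm (x - p) \<Longrightarrow> cutoff p R \<epsilon> k x = 0"
  unfolding cutoff_def using R radius[of k] by (intro bump_eq_0) auto

lemma compact_support_cutoff: "compact_support_in (cball p (R + \<epsilon>)) (cutoff p R \<epsilon> k)"
proof -
  have "cball p (R + \<epsilon> / real (Suc k)) \<subseteq> cball p (R + \<epsilon>)" using radius[of k] by (intro subset_cball)
  then show ?thesis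
    unfolding cutoff_def using R radius[of k] by (intro compact_support_bump) auto
qed

text \<open>The gradient points to the centre and lives in a layer of width
  \<open>\<epsilon> / Suc k\<close>. Its radial moment may grow linearly in \<open>k\<close>;
  \<open>sphere_weight_gap\<close> later supplies the compensating factor of order
  \<open>1 / k\<close>.\<close>

lemma grad_cutoff:
  obtains c where "0 \<le> c" "grad (cutoff p R \<epsilon> k) x = - c *\<^sub>R (x - p)"
    "c * (norm (x - p))\<^sup>2 \<le> 4 * (R + \<epsilon>)\<^sup>2 * real (Suc k) / (\<epsilon> * R)"
    "norm (x - p) \<le> R \<or> R + \<epsilon> / real (Suc k) \<le> norm (x - p) \<Longrightarrow> c = 0"
proof -
  define S where "S = R + \<epsilon> / real (Suc k)"
  have S: "R < S" "S \<le> R + \<epsilon>" using radius[of k] by (auto simp: S_def)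
  have SR: "S\<^sup>2 - R\<^sup>2 = (\<epsilon> / real (Suc k)) * (S + R)" by (simp add: S_def power2_eq_square algebra_simps)
  have pos: "0 < S\<^sup>2 - R\<^sup>2" unfolding SR using S R \<epsilon> by (intro mult_pos_pos) auto
  define y where "y = (S\<^sup>2 - (norm (x - p))\<^sup>2) * inverse (S\<^sup>2 - R\<^sup>2)"
  define c where "c = 2 * step' y * inverse (S\<^sup>2 - R\<^sup>2)"
  have g: "grad (cutoff p R \<epsilon> k) x = - c *\<^sub>R (x - p)"
    by (simp add: cutoff_def grad_bump c_def y_def S_def)
  have c0: "0 \<le> c" using pos step'_bounds(1) by (simp add: c_def)
  have z: "c = 0" if "norm (x - p) \<le> R \<or> S \<le> norm (x - p)"
    using that
  proof
    assume "norm (x - p) \<le> R"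
    then have "(norm (x - p))\<^sup>2 \<le> R\<^sup>2" by (intro power_mono) auto
    then have "1 \<le> y" using pos by (simp add: y_def field_simps)
    then show "c = 0" by (simp add: c_def step'_eq_0)
  next
    assume "S \<le> norm (x - p)"
    then have "S\<^sup>2 \<le> (norm (x - p))\<^sup>2" using S R by (intro power_mono) auto
    then have "y \<le> 0" using pos by (simp add: y_def mult_nonpos_nonneg)
    then show "c = 0" by (simp add: c_def step'_eq_0)
  qed
  have "c * (norm (x - p))\<^sup>2 \<le> 4 * (R + \<epsilon>)\<^sup>2 * real (Suc k) / (\<epsilon> * R)"
  proof (cases "S \<le> norm (x - p)")
    case True
    then show ?thesis using z R \<epsilon> by simp
  next
    case False
    have "c \<le> 4 * inverse (S\<^sup>2 - R\<^sup>2)"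
      unfolding c_def using pos step'_bounds(2)[of y] by (intro mult_right_mono) auto
    \<comment> \<open>In the factorisation of \<open>S\<^sup>2 - R\<^sup>2\<close> one factor is the
      layer width, and the other, \<open>S + R\<close>, is bounded below by
      \<open>R\<close>.\<close>
    also have "inverse (S\<^sup>2 - R\<^sup>2) \<le> inverse ((\<epsilon> / real (Suc k)) * R)"
      unfolding SR using S R \<epsilon> by (intro le_imp_inverse_le mult_left_mono mult_pos_pos) auto
    finally have "c \<le> 4 * real (Suc k) / (\<epsilon> * R)" by (simp add: field_simps)
    moreover have "(norm (x - p))\<^sup>2 \<le> (R + \<epsilon>)\<^sup>2" using False S by (intro power_mono) auto
    ultimately have "c * (norm (x - p))\<^sup>2 \<le> 4 * real (Suc k) / (\<epsilon> * R) * (R + \<epsilon>)\<^sup>2"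
      using c0 R \<epsilon> by (intro mult_mono) auto
    then show ?thesis by (simp add: field_simps)
  qed
  then show thesis using that[OF c0 g] z by (simp add: S_def)
qed

lemma cutoff_limit:
  "(\<lambda>k. cutoff p R \<epsilon> k x) \<longlonglongrightarrow> indicator (cball p R) x"
proof (cases "norm (x - p) \<le> R")
  case True
  then show ?thesis by (simp add: cutoff_1 dist_norm norm_minus_commute)
next
  case False
  obtain K where K: "inverse (real (Suc K)) < (norm (x - p) - R) / \<epsilon>"
    using False \<epsilon> reals_Archimedean[of "(norm (x - p) - R) / \<epsilon>"] by auto
  have "cutoff p R \<epsilon> k x = 0" if "K \<le> k" for k
  proof (rule cutoff_0)
    have "inverse (real (Suc k)) \<le> inverse (real (Suc K))" using that by (intro le_imp_inverse_le) auto
    with K have "inverse (real (Suc k)) < (norm (x - p) - R) / \<epsilon>" by linarith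
    then show "R + \<epsilon> / real (Suc k) \<le> norm (x - p)" using \<epsilon> by (simp add: field_simps)
  qed
  then have "\<forall>\<^sub>F k in sequentially. cutoff p R \<epsilon> k x = 0" by (rule eventually_sequentiallyI)
  moreover have "indicator (cball p R) x = (0::real)" using False by (simp add: dist_norm norm_minus_commute)
  ultimately show ?thesis by (simp add: tendsto_eventually)
qed

lemma cutoff_integral_limit:
  assumes g: "continuous_on UNIV g"
  shows "(\<lambda>k. \<integral>x. cutoff p R \<epsilon> k x * g x \<partial>lborel) \<longlonglongrightarrow> (\<integral>x. indicator (cball p R) x * g x \<partial>lborel)"
proof -
  have m: "g \<in> borel_measurable borel" "cutoff p R \<epsilon> k \<in> borel_measurable borel" for k
    by (auto intro!: borel_measurable_continuous_onI g C1_continuous C1_cutoff)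
  have "compact (g ` cball p (R + \<epsilon>))" by (rule compact_continuous_image[OF continuous_on_subset[OF g]]) auto
  then have "bounded (g ` cball p (R + \<epsilon>))" by (rule compact_imp_bounded)
  then obtain B where "\<forall>y\<in>g ` cball p (R + \<epsilon>). norm y \<le> B" unfolding bounded_iff by auto
  then have B: "\<bar>g x\<bar> \<le> B" if "x \<in> cball p (R + \<epsilon>)" for x using that by auto
  show ?thesis
  proof (rule integral_dominated_convergence[where w = "\<lambda>x. indicator (cball p (R + \<epsilon>)) x * B"])
    show "integrable lborel (\<lambda>x. indicator (cball p (R + \<epsilon>)) x * B)"
      by (intro integrable_mult_left integrable_real_indicator) (use emeasure_lborel_cball_finite in auto)
    show "AE x in lborel. (\<lambda>k. cutoff p R \<epsilon> k x * g x) \<longlonglongrightarrow> indicator (cball p R) x * g x"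
      by (intro AE_I2 tendsto_intros cutoff_limit)
    show "AE x in lborel. norm (cutoff p R \<epsilon> k x * g x) \<le> indicator (cball p (R + \<epsilon>)) x * B" for k
    proof (intro AE_I2)
      fix x
      show "norm (cutoff p R \<epsilon> k x * g x) \<le> indicator (cball p (R + \<epsilon>)) x * B"
      proof (cases "x \<in> cball p (R + \<epsilon>)")
        case True
        have "\<bar>cutoff p R \<epsilon> k x\<bar> * \<bar>g x\<bar> \<le> 1 * B" using B[OF True] cutoff_bounds[of k x] by (intro mult_mono) auto
        then show ?thesis using True by (simp add: abs_mult)
      next
        case False
        then have "cutoff p R \<epsilon> k x = 0" using radius[of k] by (intro cutoff_0) (auto simp: dist_norm norm_minus_commute)
        then show ?thesis using False by simp
      qed
    qed
    show "(\<lambda>x. indicator (cball p R) x * g x) \<in> borel_measurable lborel"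
      using m by (intro borel_measurable_times borel_measurable_indicator) auto
    show "(\<lambda>x. cutoff p R \<epsilon> k x * g x) \<in> borel_measurable lborel" for k
      using m by (intro borel_measurable_times) auto
  qed
qed

text \<open>A perimeter bound without surface measure. Integration by parts against the cutoff
  leaves its gradient, which is radial and sits where \<open>norm (x - p) \<ge> R\<close>. It is
  therefore dominated by its moment against \<open>(x - p) / R\<close>, and \<open>x - p\<close> has
  constant divergence.\<close>

lemma cball_divergence_le:
  assumes \<phi>: "\<phi> \<in> unit_fields U"
  shows "(\<integral>x. indicator (cball p R) x * divergence \<phi> x \<partial>lborel) \<le> real CARD('n) / R * measure lborel (cball p R)"
proof -
  let ?E = "cutoff p R \<epsilon>"
  have c: "\<And>i. C1 (\<lambda>x. \<phi> x $ i)" "compact_support_in U \<phi>" "\<And>x. norm (\<phi> x) \<le> 1"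
    using \<phi> by (auto simp: unit_fields_def)
  have cE: "compactly_supported (?E k)" for k
    using compact_support_cutoff by (rule compact_support_in_mono) simp
  have csc: "compactly_supported (\<lambda>x. ?E k x *\<^sub>R f x)" for k and f :: "real^'n \<Rightarrow> real^'n"
    by (rule compact_support_in_cong[OF cE[of k]]) simp
  have cgi: "compactly_supported (\<lambda>x. grad (?E k) x \<bullet> f x)" for k f
    by (rule compact_support_in_cong[OF compactly_supported_grad[OF cE[of k]]]) simp
  have cid: "C1 (\<lambda>x::real^'n. (x - p) $ i)" for i
    using C1_diff[OF C1_component C1_const] by simp
  have cphi: "continuous_on UNIV \<phi>"
  proof -
    have "continuous_on UNIV (\<lambda>x. \<chi> i. \<phi> x $ i)" by (intro continuous_on_vec_lambda C1_continuous c)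
    then show ?thesis by simp
  qed
  have le: "(\<integral>x. ?E k x * divergence \<phi> x \<partial>lborel) \<le> real CARD('n) / R * (\<integral>x. ?E k x * 1 \<partial>lborel)" for k
  proof -
    have cdiv: "compactly_supported (\<lambda>x. ?E k x * f x)" for f by (rule compact_support_mult_left[OF cE])
    have i1: "integrable lborel (\<lambda>x. ?E k x * divergence \<phi> x)" 
      by (intro continuous_cs_integrable continuous_intros C1_continuous C1_cutoff continuous_divergence c cdiv)
    have i1': "integrable lborel (\<lambda>x. ?E k x)" 
      by (intro continuous_cs_integrable C1_continuous C1_cutoff cE)
    have i2: "integrable lborel (\<lambda>x. grad (?E k) x \<bullet> \<phi> x)"
      by (intro continuous_cs_integrable continuous_intros C1_continuous_grad C1_cutoff cphi cgi)
    have i3: "integrable lborel (\<lambda>x. grad (?E k) x \<bullet> (x - p))"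
      by (intro continuous_cs_integrable continuous_intros C1_continuous_grad C1_cutoff cgi)
    have "(\<integral>x. ?E k x * divergence \<phi> x + grad (?E k) x \<bullet> \<phi> x \<partial>lborel) = 0"
      using integral_divergence_eq_0[of "\<lambda>x. ?E k x *\<^sub>R \<phi> x"] c csc
      by (simp add: divergence_scaleR C1_cutoff C1_mult)
    then have 1: "(\<integral>x. ?E k x * divergence \<phi> x \<partial>lborel) = - (\<integral>x. grad (?E k) x \<bullet> \<phi> x \<partial>lborel)"
      using i1 i2 by simp
    have "(\<integral>x. ?E k x * real CARD('n) + grad (?E k) x \<bullet> (x - p) \<partial>lborel) = 0"
      using integral_divergence_eq_0[of "\<lambda>x. ?E k x *\<^sub>R (x - p)"] cid csc
      by (simp only: divergence_scaleR C1_cutoff C1_mult divergence_id vector_scaleR_component real_scaleR_def)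
    then have 2: "real CARD('n) * (\<integral>x. ?E k x \<partial>lborel) = - (\<integral>x. grad (?E k) x \<bullet> (x - p) \<partial>lborel)"
      using i1' i3 by (simp add: mult.commute)
    have "- (\<integral>x. grad (?E k) x \<bullet> \<phi> x \<partial>lborel) = (\<integral>x. - (grad (?E k) x \<bullet> \<phi> x) \<partial>lborel)" by simp
    also have "\<dots> \<le> (\<integral>x. - (grad (?E k) x \<bullet> (x - p)) / R \<partial>lborel)"
    proof (rule integral_mono)
      fix x
      obtain d where d: "0 \<le> d" "grad (?E k) x = - d *\<^sub>R (x - p)" "norm (x - p) \<le> R \<Longrightarrow> d = 0"
        using grad_cutoff[of k x] by metis
      have "- (grad (?E k) x \<bullet> \<phi> x) \<le> norm (grad (?E k) x) * norm (\<phi> x)"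
        using Cauchy_Schwarz_ineq2[of "grad (?E k) x" "\<phi> x"] by linarith
      also have "\<dots> \<le> norm (grad (?E k) x)" using c(3)[of x] by (simp add: mult_left_le)
      also have "\<dots> = d * norm (x - p)" using d by simp
      also have "\<dots> \<le> d * (norm (x - p))\<^sup>2 / R"
      proof (cases "norm (x - p) \<le> R")
        case False
        then have "norm (x - p) * R \<le> (norm (x - p))\<^sup>2" using R by (simp add: power2_eq_square mult_left_mono)
        then have "d * (norm (x - p) * R) \<le> d * (norm (x - p))\<^sup>2" using d(1) by (rule mult_left_mono)
        then show ?thesis using R by (simp add: field_simps)
      qed (use d in simp)
      also have "\<dots> = - (grad (?E k) x \<bullet> (x - p)) / R" using d(2) by (simp add: power2_norm_eq_inner)
      finally show "- (grad (?E k) x \<bullet> \<phi> x) \<le> - (grad (?E k) x \<bullet> (x - p)) / R" .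
    qed (use i2 i3 in auto)
    also have "\<dots> = real CARD('n) / R * (\<integral>x. ?E k x \<partial>lborel)" using 2 by simp
    finally show ?thesis using 1 by simp
  qed
  have "(\<lambda>k. real CARD('n) / R * (\<integral>x. ?E k x * 1 \<partial>lborel)) \<longlonglongrightarrow> real CARD('n) / R * (\<integral>x. indicator (cball p R) x * 1 \<partial>lborel)"
    by (intro tendsto_intros cutoff_integral_limit continuous_on_const)
  moreover have "(\<integral>x. indicator (cball p R) x * 1 \<partial>lborel) = measure lborel (cball p R)" by simp
  ultimately have "(\<lambda>k. real CARD('n) / R * (\<integral>x. ?E k x * 1 \<partial>lborel)) \<longlonglongrightarrow> real CARD('n) / R * measure lborel (cball p R)" by simp
  with cutoff_integral_limit[OF continuous_divergence[OF c(1)]] show ?thesis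
    by (rule LIMSEQ_le) (use le in auto)
qed

end

lemma C1_vec_diff_const: "C1 (\<lambda>x::real^'n. (x - p) $ i)"
  using C1_diff[OF C1_component C1_const] by simp

text \<open>The upper bound is \<open>cball_divergence_le\<close>; radial fields, normalised and cut
  off outside the ball, attain it in the limit.\<close>

lemma total_variation_cball:
  fixes p :: "real^'n"
  assumes \<Omega>: "open \<Omega>" and R: "0 < R" "R < R1" "cball p R1 \<subseteq> \<Omega>" and c: "0 \<le> c"
  shows "total_variation \<Omega> (\<lambda>x. c * indicator (cball p R) x) = ereal (c * (real CARD('n) / R * measure lborel (cball p R)))"
proof -
  let ?B = "measure lborel (cball p R)" and ?N = "real CARD('n)"
  define I where "I \<phi> = (\<integral>x. (c * indicator (cball p R) x) * divergence \<phi> x \<partial>lborel)" for \<phi> :: "real^'n \<Rightarrow> real^'n"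
  have I: "I \<phi> = c * (\<integral>x. indicator (cball p R) x * divergence \<phi> x \<partial>lborel)" for \<phi>
    by (simp add: I_def mult.assoc)
  have "(\<lambda>x. c * indicator (cball p R) x) \<in> borel_measurable lebesgue"
    by (intro borel_measurable_times borel_measurable_indicator) auto
  then have "(\<lambda>x. c * indicator (cball p R) x) \<in> borel_measurable (lebesgue_on \<Omega>)" by (rule measurable_restrict_space1)
  then have tv: "total_variation \<Omega> (\<lambda>x. c * indicator (cball p R) x) = (SUP \<phi>\<in>unit_fields \<Omega>. ereal (I \<phi>))"
    unfolding I_def using \<Omega>
    by (intro total_variation_lborel) (auto intro!: borel_measurable_times borel_measurable_indicator simp: borel_closed)
  have "ereal (I \<phi>) \<le> ereal (c * (?N / R * ?B))" if "\<phi> \<in> unit_fields \<Omega>" for \<phi>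
    using mult_left_mono[OF cball_divergence_le[OF R(1) zero_less_one that, of p] c] unfolding I by simp
  then have le: "(SUP \<phi>\<in>unit_fields \<Omega>. ereal (I \<phi>)) \<le> ereal (c * (?N / R * ?B))" by (intro SUP_least)
  define \<epsilon> where "\<epsilon> = R1 - R"
  have \<epsilon>: "0 < \<epsilon>" "cball p (R + \<epsilon>) \<subseteq> \<Omega>" using R by (auto simp: \<epsilon>_def)
  define S where "S k = R + \<epsilon> / real (Suc k)" for k
  have S: "R < S k" for k using radius[OF R(1) \<epsilon>(1), of k] by (simp add: S_def)
  \<comment> \<open>Division by the outer radius \<open>S k\<close> of the layer keeps the norm at
    most \<open>1\<close>, and \<open>S k\<close> tends to \<open>R\<close>.\<close>
  define \<psi> where "\<psi> k x = (inverse (S k) * cutoff p R \<epsilon> k x) *\<^sub>R (x - p)" for k x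
  note C1c = C1_cutoff[OF R(1) \<epsilon>(1)] C1_cmult
  have \<psi>: "\<psi> k \<in> unit_fields \<Omega>" for k
    unfolding unit_fields_def
  proof (intro CollectI conjI allI)
    show "C1 (\<lambda>x. \<psi> k x $ i)" for i
      unfolding \<psi>_def vector_scaleR_component real_scaleR_def by (intro C1_mult C1c C1_vec_diff_const)
    have "compact_support_in \<Omega> (cutoff p R \<epsilon> k)"
      using compact_support_cutoff[OF R(1) \<epsilon>(1)] \<epsilon>(2) by (rule compact_support_in_mono)
    then show "compact_support_in \<Omega> (\<psi> k)" by (rule compact_support_in_cong) (simp add: \<psi>_def)
    show "norm (\<psi> k x) \<le> 1" for x
    proof (cases "S k \<le> norm (x - p)")
      case True
      then show ?thesis using cutoff_0[OF R(1) \<epsilon>(1), of k x p] by (simp add: \<psi>_def S_def)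
    next
      case False
      have "norm (\<psi> k x) = cutoff p R \<epsilon> k x * (norm (x - p) / S k)"
        using S[of k] R cutoff_bounds(1)[OF R(1) \<epsilon>(1), of p k x] by (simp add: \<psi>_def divide_inverse)
      also have "\<dots> \<le> 1 * 1"
        using False S[of k] R cutoff_bounds[OF R(1) \<epsilon>(1), of p k x] by (intro mult_mono) (auto simp: field_simps)
      finally show ?thesis by simp
    qed
  qed
  have I\<psi>: "I (\<psi> k) = c * (?N / S k * ?B)" for k
  proof -
    have "indicator (cball p R) x * divergence (\<psi> k) x = (?N / S k) * indicator (cball p R) x" for x
    proof (cases "x \<in> cball p R")
      case True
      then have nx: "norm (x - p) \<le> R" by (simp add: dist_norm norm_minus_commute)
      have g0: "grad (cutoff p R \<epsilon> k) x = 0"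
      proof -
        obtain d where "grad (cutoff p R \<epsilon> k) x = - d *\<^sub>R (x - p)" "norm (x - p) \<le> R \<Longrightarrow> d = 0"
          using grad_cutoff[OF R(1) \<epsilon>(1), of p k x] by metis
        then show ?thesis using nx by simp
      qed
      have "divergence (\<psi> k) x = (inverse (S k) * cutoff p R \<epsilon> k x) * ?N + grad (\<lambda>x. inverse (S k) * cutoff p R \<epsilon> k x) x \<bullet> (x - p)"
        unfolding \<psi>_def by (subst divergence_scaleR) (simp_all only: C1c C1_vec_diff_const divergence_id)
      also have "grad (\<lambda>x. inverse (S k) * cutoff p R \<epsilon> k x) x = 0" by (simp add: grad_cmult C1c g0)
      finally show ?thesis using True nx cutoff_1[OF R(1) \<epsilon>(1) nx] by (simp add: divide_inverse)
    qed simp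
    then show ?thesis unfolding I by simp
  qed
  have "(\<lambda>k. ereal (I (\<psi> k))) \<longlonglongrightarrow> ereal (c * (?N / (R + \<epsilon> * 0) * ?B))"
    unfolding I\<psi> S_def divide_inverse[of \<epsilon>] using R(1)
    by (intro tendsto_ereal tendsto_intros LIMSEQ_inverse_real_of_nat) auto
  then have "(\<lambda>k. ereal (I (\<psi> k))) \<longlonglongrightarrow> ereal (c * (?N / R * ?B))" by simp
  then have "ereal (c * (?N / R * ?B)) \<le> (SUP \<phi>\<in>unit_fields \<Omega>. ereal (I \<phi>))"
    by (rule LIMSEQ_le_const2) (intro exI[of _ 0] allI impI SUP_upper \<psi>)
  with le tv show ?thesis by (simp add: antisym)
qed

section \<open>A vector field with constant divergence in a ball and none outside\<close>

text \<open>Outside \<open>ball p R\<close> this is \<open>R ^ (N - 1) / norm (x - p) ^ N\<close>, which makes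
  \<open>radial_weight p R x *\<^sub>R (x - p)\<close> divergence free there; the correction term inside the ball
  removes the singularity at \<open>p\<close> and keeps the function \<open>C1\<close>.\<close>

definition radial_weight :: "real^'n \<Rightarrow> real \<Rightarrow> real^'n \<Rightarrow> real" where
  "radial_weight p R x = R ^ (CARD('n) - 1) *
     ((norm (x - p))\<^sup>2 + (max 0 (R\<^sup>2 - (norm (x - p))\<^sup>2))\<^sup>2 * inverse (R\<^sup>2)) powr (- real CARD('n) / 2)"

lemma radial_weight_eq:
  fixes p :: "real^'n"
  assumes "0 < R" "R \<le> norm (x - p)"
  shows "radial_weight p R x = R ^ (CARD('n) - 1) / norm (x - p) ^ CARD('n)"
proof -
  have "R\<^sup>2 \<le> (norm (x - p))\<^sup>2" using assms by (intro power_mono) auto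
  then have "radial_weight p R x = R ^ (CARD('n) - 1) * ((norm (x - p))\<^sup>2) powr (- real CARD('n) / 2)"
    by (simp add: radial_weight_def)
  also have "((norm (x - p))\<^sup>2) powr (- real CARD('n) / 2) = norm (x - p) powr (- real CARD('n))"
  proof -
    have "((norm (x - p))\<^sup>2) powr (- real CARD('n) / 2) = (norm (x - p) powr 2) powr (- real CARD('n) / 2)"
      using assms by (subst powr_numeral) auto
    also have "\<dots> = norm (x - p) powr (2 * (- real CARD('n) / 2))" by (rule powr_powr)
    finally show ?thesis by simp
  qed
  also have "\<dots> = inverse (norm (x - p) ^ CARD('n))"
  proof -
    have "0 < norm (x - p)" using assms by linarith
    from powr_realpow[OF this, of "CARD('n)"] show ?thesis by (simp add: powr_minus)
  qed
  finally show ?thesis by (simp add: divide_inverse)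
qed

text \<open>The second claim is Euler's relation for a function homogeneous of degree
  \<open>- N\<close> about \<open>p\<close>; it says that
  \<open>radial_weight p R x *\<^sub>R (x - p)\<close> has divergence zero.\<close>

lemma C1_radial_weight: 
  fixes p :: "real^'n"
  assumes R: "0 < R"
  shows "C1 (radial_weight p R)"
    "R \<le> norm (x - p) \<Longrightarrow> grad (radial_weight p R) x \<bullet> (x - p) = - real CARD('n) * radial_weight p R x"
proof -
  let ?N = "real CARD('n)"
  define \<tau> where "\<tau> x = (norm (x - p))\<^sup>2 + (max 0 (R\<^sup>2 - (norm (x - p))\<^sup>2))\<^sup>2 * inverse (R\<^sup>2)" for x
  have C\<tau>: "C1 \<tau>"
    unfolding \<tau>_def by (intro C1_add C1_norm_sq C1_mult C1_pos_sq C1_diff C1_const)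
  have pos: "\<tau> x \<in> {0<..}" for x
  proof (cases "x = p")
    case True then show ?thesis using R by (simp add: \<tau>_def)
  next
    case False
    then have "0 < (norm (x - p))\<^sup>2" by simp
    moreover have "0 \<le> (max 0 (R\<^sup>2 - (norm (x - p))\<^sup>2))\<^sup>2 * inverse (R\<^sup>2)" by simp
    ultimately show ?thesis unfolding \<tau>_def by (simp only: greaterThan_iff add_pos_nonneg)
  qed
  have dh: "((\<lambda>t. t powr (- ?N / 2)) has_real_derivative (- ?N / 2) * t powr (- ?N / 2 - 1)) (at t)" if "t \<in> {0<..}" for t
    using has_real_derivative_powr[of t "- ?N / 2"] that by simp
  have ch: "continuous_on {0<..} (\<lambda>t::real. (- ?N / 2) * t powr (- ?N / 2 - 1))"
    by (intro continuous_intros) auto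
  note Cp = C1_compose_on[OF C\<tau> pos dh ch]
  have eq: "radial_weight p R = (\<lambda>x. R ^ (CARD('n) - 1) * \<tau> x powr (- ?N / 2))"
    by (simp add: radial_weight_def \<tau>_def fun_eq_iff)
  show "C1 (radial_weight p R)" unfolding eq by (intro C1_cmult Cp)
  assume x: "R \<le> norm (x - p)"
  have sq: "R\<^sup>2 \<le> (norm (x - p))\<^sup>2" using x R by (intro power_mono) auto
  \<comment> \<open>A squared positive part has zero derivative up to and including its corner, so
    the correction does not disturb the gradient on the sphere itself.\<close>
  have gpos: "grad (\<lambda>x. (max 0 (R\<^sup>2 - (norm (x - p))\<^sup>2))\<^sup>2) x = 0"
    using C1_compose(2)[OF C1_diff[OF C1_const C1_norm_sq] has_deriv_pos_sq, of "R\<^sup>2" p] sq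
    by (auto simp: continuous_intros continuous_on_max)
  have "grad \<tau> x = 2 *\<^sub>R (x - p)"
    unfolding \<tau>_def
    by (simp add: grad_add grad_mult C1_add C1_norm_sq C1_mult C1_pos_sq C1_diff C1_const gpos grad_norm_sq grad_const)
  moreover have "\<tau> x = (norm (x - p))\<^sup>2" using sq by (simp add: \<tau>_def)
  moreover have "grad (radial_weight p R) x = (R ^ (CARD('n) - 1) * ((- ?N / 2) * \<tau> x powr (- ?N / 2 - 1))) *\<^sub>R grad \<tau> x"
    unfolding eq using fun_cong[OF grad_cmult[OF Cp(1), of "R ^ (CARD('n) - 1)"], of x] fun_cong[OF Cp(2), of x]
    by (simp only: scaleR_scaleR)
  moreover have "((norm (x - p))\<^sup>2) powr (- ?N / 2 - 1) * (norm (x - p))\<^sup>2 = ((norm (x - p))\<^sup>2) powr (- ?N / 2)"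
    using powr_add[of "(norm (x - p))\<^sup>2" "- ?N / 2 - 1" 1] x R by simp
  ultimately show "grad (radial_weight p R) x \<bullet> (x - p) = - ?N * radial_weight p R x"
    by (simp add: eq power2_norm_eq_inner mult.assoc)
qed

text \<open>The two weights agree on the sphere, and Bernoulli's inequality makes their difference
  at most linear in the distance to it. This is just enough against a cutoff gradient that grows
  like the inverse layer width.\<close>

lemma sphere_weight_gap:
  fixes p :: "real^'n"
  assumes R: "0 < R" "R \<le> norm (x - p)"
  shows "0 \<le> 1 / R - radial_weight p R x"
    "1 / R - radial_weight p R x \<le> real CARD('n) / R\<^sup>2 * (norm (x - p) - R)"
proof -
  define s where "s = norm (x - p)"
  let ?N = "CARD('n)"
  have s: "0 < s" "R \<le> s" using R by (auto simp: s_def)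
  have "R ^ ?N = R ^ (?N - 1) * R" by (metis One_nat_def Suc_pred power_Suc2 zero_less_card_finite)
  then have w: "radial_weight p R x = (1 / R) * (R / s) ^ ?N"
    using R by (simp add: radial_weight_eq s_def power_divide)
  have "(R / s) ^ ?N \<le> 1" using s R by (intro power_le_one) auto
  then show "0 \<le> 1 / R - radial_weight p R x" using R unfolding w by (simp add: mult_left_le field_simps)
  have "1 + real ?N * (R / s - 1) \<le> (1 + (R / s - 1)) ^ ?N"
    using s R by (intro Bernoulli_inequality) (simp add: field_simps)
  then have "1 - (R / s) ^ ?N \<le> real ?N * (1 - R / s)" by (simp add: algebra_simps)
  also have "1 - R / s \<le> (s - R) / R"
  proof -
    have "1 - R / s = (s - R) / s" using s by (simp add: field_simps)
    also have "\<dots> \<le> (s - R) / R" using s R by (intro divide_left_mono) auto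
    finally show ?thesis .
  qed
  finally have "1 - (R / s) ^ ?N \<le> real ?N * ((s - R) / R)" by (simp add: mult_left_mono)
  then have "(1 / R) * (1 - (R / s) ^ ?N) \<le> (1 / R) * (real ?N * ((s - R) / R))" using R by (intro mult_left_mono) auto
  then show "1 / R - radial_weight p R x \<le> real ?N / R\<^sup>2 * (norm (x - p) - R)"
    unfolding w s_def[symmetric] using R by (simp add: power2_eq_square field_simps)
qed

definition ball_field :: "real^'n \<Rightarrow> real \<Rightarrow> real^'n \<Rightarrow> real^'n" where
  "ball_field p R x = - (indicator (cball p R) x * (1 / R) + (1 - indicator (cball p R) x) * radial_weight p R x) *\<^sub>R (x - p)"

lemma ball_field_borel: "0 < R \<Longrightarrow> ball_field p R \<in> borel_measurable borel"
  unfolding ball_field_def[abs_def]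
  by (intro borel_measurable_scaleR borel_measurable_uminus borel_measurable_add borel_measurable_times borel_measurable_diff
      borel_measurable_indicator borel_measurable_const borel_measurable_continuous_onI[OF C1_continuous[OF C1_radial_weight(1)]])
    auto

lemma norm_ball_field_le:
  fixes p :: "real^'n"
  assumes R: "0 < R"
  shows "norm (ball_field p R x) \<le> 1"
proof (cases "norm (x - p) \<le> R")
  case True
  then show ?thesis using R by (simp add: ball_field_def dist_norm norm_minus_commute)
next
  case False
  then have "norm (ball_field p R x) = \<bar>radial_weight p R x\<bar> * norm (x - p)"
    by (simp add: ball_field_def dist_norm norm_minus_commute)
  also have "radial_weight p R x = R ^ (CARD('n) - 1) / norm (x - p) ^ CARD('n)"
    using False R by (intro radial_weight_eq) auto
  also have "norm (x - p) ^ CARD('n) = norm (x - p) ^ (CARD('n) - 1) * norm (x - p)"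
    by (metis One_nat_def Suc_pred power_Suc2 zero_less_card_finite)
  also have "\<bar>R ^ (CARD('n) - 1) / (norm (x - p) ^ (CARD('n) - 1) * norm (x - p))\<bar> * norm (x - p) = (R / norm (x - p)) ^ (CARD('n) - 1)"
  proof -
    have "x \<noteq> p" "0 < norm (x - p)" using False R by auto
    then show ?thesis using R by (simp add: power_divide)
  qed
  also have "\<dots> \<le> 1"
  proof (intro power_le_one)
    have "0 < norm (x - p)" using False R by linarith
    then show "R / norm (x - p) \<le> 1" using False by simp
  qed (use R in simp)
  finally show ?thesis .
qed

text \<open>The field is continuous, but its divergence jumps across the sphere. Blending the two
  weights by \<open>cutoff p R 1\<close> gives fields with a classical divergence
  \<open>D k\<close>, which stays bounded and converges pointwise.\<close>

lemma weak_divergence_ball_field: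
  fixes p :: "real^'n"
  assumes \<Omega>: "open \<Omega>" and R: "0 < R"
  shows "weak_divergence \<Omega> (ball_field p R) (\<lambda>x. - (real CARD('n) / R) * indicator (cball p R) x)"
  unfolding weak_divergence_def
proof
  fix \<phi> :: "real^'n \<Rightarrow> real"
  let ?N = "real CARD('n)"
  assume "\<phi> \<in> test_functions \<Omega>"
  then have \<phi>: "C1 \<phi>" "compact_support_in \<Omega> \<phi>" by (auto simp: test_functions_def smooth_C1)
  have cs\<phi>: "compactly_supported \<phi>" using \<phi>(2) by (rule compact_support_in_mono) simp
  have g0: "grad \<phi> x = 0" "\<phi> x = 0" if "x \<notin> \<Omega>" for x
  proof -
    obtain K where "K \<subseteq> \<Omega>" "\<And>x. x \<notin> K \<Longrightarrow> grad \<phi> x = 0"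
      using compact_support_in_ex[OF compactly_supported_grad[OF \<phi>(2)]] by auto
    then show "grad \<phi> x = 0" using that by auto
    obtain K where "K \<subseteq> \<Omega>" "\<And>x. x \<notin> K \<Longrightarrow> \<phi> x = 0"
      using compact_support_in_ex[OF \<phi>(2)] by auto
    then show "\<phi> x = 0" using that by auto
  qed
  define m where "m = radial_weight p R"
  define \<xi> where "\<xi> x = (indicator (cball p R) x :: real)" for x
  define E where "E = cutoff p R 1"
  define \<mu> where "\<mu> k x = E k x * (1 / R) + (1 - E k x) * m x" for k x
  define D where "D k x = ?N * \<mu> k x + grad (\<mu> k) x \<bullet> (x - p)" for k x
  have Cm: "C1 m" unfolding m_def using R by (rule C1_radial_weight)
  have CE: "C1 (E k)" for k unfolding E_def using R by (intro C1_cutoff) auto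
  have C\<mu>: "C1 (\<mu> k)" for k
    unfolding \<mu>_def by (intro C1_add C1_mult C1_diff C1_const CE Cm)
  have E01: "0 \<le> E k x" "E k x \<le> 1" for k x
    unfolding E_def using cutoff_bounds[OF R zero_less_one] by auto
  \<comment> \<open>The outer weight contributes no divergence; what survives is a multiple of the
    cutoff and the cross term between its gradient and the gap of the weights.\<close>
  have D_eq: "D k x = ?N * E k x / R + (1 / R - m x) * (grad (E k) x \<bullet> (x - p))" for k x
  proof -
    have "grad (\<mu> k) x = (1 / R - m x) *\<^sub>R grad (E k) x + (1 - E k x) *\<^sub>R grad m x"
      unfolding \<mu>_def
      by (simp only: grad_add grad_mult grad_diff C1_add C1_mult C1_diff C1_const CE Cm grad_const)
        (simp add: algebra_simps)
    then have "D k x = ?N * \<mu> k x + ((1 / R - m x) * (grad (E k) x \<bullet> (x - p)) + (1 - E k x) * (grad m x \<bullet> (x - p)))"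
      by (simp only: D_def inner_add_left inner_scaleR_left)
    also have "\<dots> = ?N * E k x / R + (1 / R - m x) * (grad (E k) x \<bullet> (x - p)) + (1 - E k x) * (?N * m x + grad m x \<bullet> (x - p))"
      unfolding \<mu>_def by (simp only: distrib_left distrib_right left_diff_distrib right_diff_distrib) simp
    finally have "D k x = ?N * E k x / R + (1 / R - m x) * (grad (E k) x \<bullet> (x - p)) + (1 - E k x) * (?N * m x + grad m x \<bullet> (x - p))" .
    moreover have "(1 - E k x) * (?N * m x + grad m x \<bullet> (x - p)) = 0"
    proof (cases "norm (x - p) \<le> R")
      case True then show ?thesis using cutoff_1[OF R zero_less_one True] by (simp add: E_def)
    next
      case False then show ?thesis using C1_radial_weight(2)[OF R, of x p] by (simp add: m_def)
    qed
    ultimately show ?thesis by simp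
  qed
  \<comment> \<open>The gap bound \<open>N / R\<^sup>2 / Suc k\<close> on the layer times the
    gradient bound \<open>4 * (R + 1)\<^sup>2 * Suc k / R\<close>: the powers of
    \<open>Suc k\<close> cancel.\<close>
  define C where "C = ?N / R\<^sup>2 * (4 * (R + 1)\<^sup>2 / R)"
  have second: "\<bar>(1 / R - m x) * (grad (E k) x \<bullet> (x - p))\<bar> \<le> C"
    "norm (x - p) \<le> R \<or> R + 1 / real (Suc k) \<le> norm (x - p) \<Longrightarrow> (1 / R - m x) * (grad (E k) x \<bullet> (x - p)) = 0" for k x
  proof -
    obtain c where c: "0 \<le> c" "grad (E k) x = - c *\<^sub>R (x - p)"
      "c * (norm (x - p))\<^sup>2 \<le> 4 * (R + 1)\<^sup>2 * real (Suc k) / (1 * R)"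
      "norm (x - p) \<le> R \<or> R + 1 / real (Suc k) \<le> norm (x - p) \<Longrightarrow> c = 0"
      unfolding E_def using grad_cutoff[OF R zero_less_one, of p k x] by metis
    have eq: "(1 / R - m x) * (grad (E k) x \<bullet> (x - p)) = - ((1 / R - m x) * (c * (norm (x - p))\<^sup>2))"
      using c(2) by (simp add: power2_norm_eq_inner)
    show "norm (x - p) \<le> R \<or> R + 1 / real (Suc k) \<le> norm (x - p) \<Longrightarrow> (1 / R - m x) * (grad (E k) x \<bullet> (x - p)) = 0"
      using eq c(4) by simp
    show "\<bar>(1 / R - m x) * (grad (E k) x \<bullet> (x - p))\<bar> \<le> C"
    proof (cases "norm (x - p) \<le> R \<or> R + 1 / real (Suc k) \<le> norm (x - p)")
      case True
      have "0 \<le> C" using R by (simp add: C_def)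
      then show ?thesis using c(4)[OF True] unfolding eq by simp
    next
      case False
      have gap: "0 \<le> 1 / R - m x" "1 / R - m x \<le> ?N / R\<^sup>2 * (norm (x - p) - R)"
        using sphere_weight_gap[OF R, of x p] False by (auto simp: m_def)
      note gap(2)
      also have "?N / R\<^sup>2 * (norm (x - p) - R) \<le> ?N / R\<^sup>2 * (1 / real (Suc k))"
        using False by (intro mult_left_mono) auto
      finally have "(1 / R - m x) * (c * (norm (x - p))\<^sup>2) \<le> (?N / R\<^sup>2 * (1 / real (Suc k))) * (4 * (R + 1)\<^sup>2 * real (Suc k) / (1 * R))"
        using c(1,3) gap(1) by (intro mult_mono) auto
      also have "\<dots> = C" by (simp add: C_def)
      finally have "(1 / R - m x) * (c * (norm (x - p))\<^sup>2) \<le> C" .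
      moreover have "0 \<le> (1 / R - m x) * (c * (norm (x - p))\<^sup>2)" using gap(1) c(1) by simp
      ultimately show ?thesis unfolding eq by linarith
    qed
  qed
  have Dlim: "(\<lambda>k. D k x) \<longlonglongrightarrow> ?N / R * \<xi> x" for x
  proof -
    \<comment> \<open>The layers shrink to the sphere from outside, so at a fixed point the cross
      term is eventually zero.\<close>
    have "(\<lambda>k. (1 / R - m x) * (grad (E k) x \<bullet> (x - p))) \<longlonglongrightarrow> 0"
    proof (cases "norm (x - p) \<le> R")
      case True
      then have "(1 / R - m x) * (grad (E k) x \<bullet> (x - p)) = 0" for k by (intro second(2)) simp
      then show ?thesis by (simp only: tendsto_const)
    next
      case False
      obtain K where K: "inverse (real (Suc K)) < norm (x - p) - R"
        using False reals_Archimedean[of "norm (x - p) - R"] by auto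
      have "(1 / R - m x) * (grad (E k) x \<bullet> (x - p)) = 0" if "K \<le> k" for k
      proof (rule second(2))
        have "inverse (real (Suc k)) \<le> inverse (real (Suc K))" using that by (intro le_imp_inverse_le) auto
        with K show "norm (x - p) \<le> R \<or> R + 1 / real (Suc k) \<le> norm (x - p)" by (simp add: inverse_eq_divide)
      qed
      then show ?thesis by (intro tendsto_eventually eventually_sequentiallyI)
    qed
    then have "(\<lambda>k. ?N * E k x / R + (1 / R - m x) * (grad (E k) x \<bullet> (x - p))) \<longlonglongrightarrow> ?N * \<xi> x / R + 0"
      unfolding E_def \<xi>_def using R by (intro tendsto_intros cutoff_limit) auto
    then show ?thesis unfolding D_eq by simp
  qed
  have Dbound: "\<bar>D k x\<bar> \<le> ?N / R + C" for k x
  proof -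
    have "\<bar>?N * E k x / R\<bar> \<le> ?N / R" using E01[of k x] R by (simp add: divide_right_mono mult_left_le)
    then show ?thesis using second(1)[of x k] unfolding D_eq by linarith
  qed
  have cD: "continuous_on UNIV (D k)" for k
    unfolding D_def[abs_def] by (intro continuous_intros C1_continuous C1_continuous_grad C\<mu>)
  note csm = compact_support_in_cong[OF cs\<phi>] compact_support_in_cong[OF compactly_supported_grad[OF cs\<phi>]]
  have csg: "compactly_supported (\<lambda>x. f x * (grad \<phi> x \<bullet> (x - p)))" for f :: "real^'n \<Rightarrow> real" by (rule csm(2)) simp
  have csp: "compactly_supported (\<lambda>x. \<phi> x * f x)" for f by (rule csm(1)) simp
  have parts: "(\<integral>x. \<mu> k x * (grad \<phi> x \<bullet> (x - p)) \<partial>lborel) = - (\<integral>x. \<phi> x * D k x \<partial>lborel)" for k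
  proof -
    have i1: "integrable lborel (\<lambda>x. \<mu> k x * (grad \<phi> x \<bullet> (x - p)))"
      by (intro continuous_cs_integrable continuous_intros C1_continuous C1_continuous_grad C\<mu> \<phi>(1) csg)
    have i2: "integrable lborel (\<lambda>x. \<phi> x * D k x)"
      by (intro continuous_cs_integrable continuous_intros C1_continuous C1_continuous_grad cD \<phi>(1) csp)
    have "divergence (\<lambda>x. (\<phi> x * \<mu> k x) *\<^sub>R (x - p)) x = \<mu> k x * (grad \<phi> x \<bullet> (x - p)) + \<phi> x * D k x" for x
      using C1_vec_diff_const[of p]
      by (subst divergence_scaleR)
        (simp_all only: C1_mult C\<mu> \<phi>(1) grad_mult divergence_id D_def inner_add_left inner_scaleR_left algebra_simps)
    moreover have "(\<integral>x. divergence (\<lambda>x. (\<phi> x * \<mu> k x) *\<^sub>R (x - p)) x \<partial>lborel) = 0"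
    proof (rule integral_divergence_eq_0)
      show "C1 (\<lambda>x. ((\<phi> x * \<mu> k x) *\<^sub>R (x - p)) $ i)" for i
        unfolding vector_scaleR_component real_scaleR_def by (intro C1_mult \<phi> C\<mu> C1_vec_diff_const)
      show "compactly_supported (\<lambda>x. (\<phi> x * \<mu> k x) *\<^sub>R (x - p))" by (rule csm(1)) simp
    qed
    ultimately show ?thesis using i1 i2 by simp
  qed
  have [measurable]: "m \<in> borel_measurable borel" "grad \<phi> \<in> borel_measurable borel" "\<phi> \<in> borel_measurable borel"
      "\<mu> k \<in> borel_measurable borel" "D k \<in> borel_measurable borel" "\<xi> \<in> borel_measurable borel" for k
    using C1_continuous[OF Cm] C1_continuous_grad[OF \<phi>(1)] C1_continuous[OF \<phi>(1)] C1_continuous[OF C\<mu>] cD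
    unfolding \<xi>_def by (auto intro: borel_measurable_continuous_onI intro!: borel_measurable_indicator simp: borel_closed)
  define \<nu> where "\<nu> x = \<xi> x * (1 / R) + (1 - \<xi> x) * m x" for x
  have L1: "(\<lambda>k. \<integral>x. \<mu> k x * (grad \<phi> x \<bullet> (x - p)) \<partial>lborel) \<longlonglongrightarrow> (\<integral>x. \<nu> x * (grad \<phi> x \<bullet> (x - p)) \<partial>lborel)"
  proof (rule integral_dominated_convergence[where w = "\<lambda>x. (1 / R + \<bar>m x\<bar>) * \<bar>grad \<phi> x \<bullet> (x - p)\<bar>"])
    show "integrable lborel (\<lambda>x. (1 / R + \<bar>m x\<bar>) * \<bar>grad \<phi> x \<bullet> (x - p)\<bar>)"
      by (intro continuous_cs_integrable continuous_intros C1_continuous C1_continuous_grad Cm \<phi>(1) csm(2)) simp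
    show "AE x in lborel. (\<lambda>k. \<mu> k x * (grad \<phi> x \<bullet> (x - p))) \<longlonglongrightarrow> \<nu> x * (grad \<phi> x \<bullet> (x - p))"
      unfolding \<mu>_def \<nu>_def E_def \<xi>_def using R by (intro AE_I2 tendsto_intros cutoff_limit) auto
    show "AE x in lborel. norm (\<mu> k x * (grad \<phi> x \<bullet> (x - p))) \<le> (1 / R + \<bar>m x\<bar>) * \<bar>grad \<phi> x \<bullet> (x - p)\<bar>" for k
    proof (intro AE_I2)
      fix x
      have "\<bar>E k x * (1 / R)\<bar> \<le> 1 / R" using E01[of k x] R by (simp add: field_simps)
      moreover have "\<bar>(1 - E k x) * m x\<bar> \<le> \<bar>m x\<bar>" using E01[of k x] by (simp add: abs_mult mult_left_le_one_le)
      ultimately have "\<bar>\<mu> k x\<bar> \<le> 1 / R + \<bar>m x\<bar>" unfolding \<mu>_def by linarith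
      then show "norm (\<mu> k x * (grad \<phi> x \<bullet> (x - p))) \<le> (1 / R + \<bar>m x\<bar>) * \<bar>grad \<phi> x \<bullet> (x - p)\<bar>"
        by (simp add: abs_mult mult_right_mono)
    qed
  qed (unfold \<nu>_def, measurable)
  have L2: "(\<lambda>k. \<integral>x. \<phi> x * D k x \<partial>lborel) \<longlonglongrightarrow> (\<integral>x. \<phi> x * (?N / R * \<xi> x) \<partial>lborel)"
  proof (rule integral_dominated_convergence[where w = "\<lambda>x. \<bar>\<phi> x\<bar> * (?N / R + C)"])
    show "integrable lborel (\<lambda>x. \<bar>\<phi> x\<bar> * (?N / R + C))"
      by (intro continuous_cs_integrable continuous_intros C1_continuous \<phi>(1) csm(1)) simp
    show "AE x in lborel. (\<lambda>k. \<phi> x * D k x) \<longlonglongrightarrow> \<phi> x * (?N / R * \<xi> x)"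
      by (intro AE_I2 tendsto_intros Dlim)
    show "AE x in lborel. norm (\<phi> x * D k x) \<le> \<bar>\<phi> x\<bar> * (?N / R + C)" for k
      using Dbound[of k] by (intro AE_I2) (simp add: abs_mult mult_left_mono)
  qed measurable
  have "(\<lambda>k. - (\<integral>x. \<phi> x * D k x \<partial>lborel)) \<longlonglongrightarrow> - (\<integral>x. \<phi> x * (?N / R * \<xi> x) \<partial>lborel)"
    by (intro tendsto_intros L2)
  with L1 have main: "(\<integral>x. \<nu> x * (grad \<phi> x \<bullet> (x - p)) \<partial>lborel) = - (\<integral>x. \<phi> x * (?N / R * \<xi> x) \<partial>lborel)"
    unfolding parts by (rule LIMSEQ_unique)
  have on: "(\<integral>x. f x \<partial>lebesgue_on \<Omega>) = (\<integral>x. f x \<partial>lborel)"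
    if f: "f \<in> borel_measurable borel" "\<And>x. x \<notin> \<Omega> \<Longrightarrow> f x = 0" for f :: "real^'n \<Rightarrow> real"
  proof -
    have "f \<in> borel_measurable lebesgue" using f(1) by (intro measurable_completion) simp
    then have "(\<integral>x. f x \<partial>lebesgue_on \<Omega>) = (\<integral>x. indicator \<Omega> x * f x \<partial>lborel)"
      using \<Omega> f(1) by (intro lebesgue_on_integral_eq_lborel) (auto intro: measurable_restrict_space1)
    also have "(\<lambda>x. indicator \<Omega> x * f x) = f" using f(2) by (auto simp: fun_eq_iff indicator_def)
    finally show ?thesis .
  qed
  have bf: "ball_field p R x \<bullet> grad \<phi> x = - (\<nu> x * (grad \<phi> x \<bullet> (x - p)))" for x
    by (simp only: ball_field_def inner_scaleR_left \<nu>_def \<xi>_def m_def minus_mult_left inner_commute[of "x - p" "grad \<phi> x"])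
  have "(\<integral>x. ball_field p R x \<bullet> grad \<phi> x \<partial>lebesgue_on \<Omega>) = (\<integral>x. ball_field p R x \<bullet> grad \<phi> x \<partial>lborel)"
    using ball_field_borel[OF R, of p] g0 by (intro on) auto
  also have "\<dots> = - (\<integral>x. \<nu> x * (grad \<phi> x \<bullet> (x - p)) \<partial>lborel)" unfolding bf by simp
  also have "\<dots> = (\<integral>x. \<phi> x * (?N / R * \<xi> x) \<partial>lborel)" using main by simp
  also have "\<dots> = - (\<integral>x. (- (?N / R) * \<xi> x) * \<phi> x \<partial>lborel)" by (simp add: mult_ac)
  also have "(\<integral>x. (- (?N / R) * \<xi> x) * \<phi> x \<partial>lborel) = (\<integral>x. (- (?N / R) * \<xi> x) * \<phi> x \<partial>lebesgue_on \<Omega>)"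
    using g0 by (intro on[symmetric]) auto
  finally show "(\<integral>x. ball_field p R x \<bullet> grad \<phi> x \<partial>lebesgue_on \<Omega>) =
      - (\<integral>x. (- (?N / R) * indicator (cball p R) x) * \<phi> x \<partial>lebesgue_on \<Omega>)"
    by (simp add: \<xi>_def)
qed

section \<open>Means near the boundary: uniqueness and computation of traces\<close>

lemma measure_lebesgue_open_pos:
  fixes S :: "(real^'n) set"
  assumes "open S" "bounded S" "S \<noteq> {}"
  shows "0 < measure lborel S" "measure lebesgue S = measure lborel S"
proof -
  have "S \<in> lmeasurable" using assms lmeasurable_open by blast
  then have "measure lebesgue S \<noteq> 0" using open_not_negligible[OF assms(1,3)] negligible_iff_measure by blast
  moreover show *: "measure lebesgue S = measure lborel S"
    using assms by (simp add: measure_completion borel_open)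
  ultimately show "0 < measure lborel S" using measure_nonneg[of lborel S] by linarith
qed

lemma has_trace_at_lborel:
  fixes u w :: "real^'n \<Rightarrow> real"
  assumes \<Omega>: "open \<Omega>" "bounded \<Omega>" and u: "u \<in> borel_measurable (lebesgue_on \<Omega>)"
    and w: "w \<in> borel_measurable borel" and eq: "AE x in lebesgue. x \<in> \<Omega> \<longrightarrow> u x = w x"
  shows "has_trace_at \<Omega> u x t \<longleftrightarrow>
    ((\<lambda>r. (\<integral>y. indicator (\<Omega> \<inter> ball x r) y * \<bar>w y - t\<bar> \<partial>lborel) / measure lborel (\<Omega> \<inter> ball x r)) \<longlongrightarrow> 0) (at_right 0)"
proof -
  have "(\<integral>y. \<bar>u y - t\<bar> \<partial>lebesgue_on (\<Omega> \<inter> ball x r)) = (\<integral>y. indicator (\<Omega> \<inter> ball x r) y * \<bar>w y - t\<bar> \<partial>lborel)" for r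
  proof (rule lebesgue_on_integral_eq_lborel)
    have "u \<in> borel_measurable (lebesgue_on (\<Omega> \<inter> ball x r))"
      by (rule measurable_restrict_mono[OF u]) simp
    then show "(\<lambda>y. \<bar>u y - t\<bar>) \<in> borel_measurable (lebesgue_on (\<Omega> \<inter> ball x r))" by measurable
    show "AE y in lebesgue. y \<in> \<Omega> \<inter> ball x r \<longrightarrow> \<bar>u y - t\<bar> = \<bar>w y - t\<bar>"
      using eq by eventually_elim auto
  qed (use \<Omega> w in \<open>auto intro: borel_open\<close>)
  moreover have "measure lebesgue (\<Omega> \<inter> ball x r) = measure lborel (\<Omega> \<inter> ball x r)" for r
    using \<Omega> by (simp add: measure_completion borel_open open_Int)
  ultimately show ?thesis unfolding has_trace_at_def by simp
qed

text \<open>The mean of the constant \<open>\<bar>s - t\<bar>\<close> is at most the sum of the two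
  means. Membership in the closure makes the denominators positive; elsewhere the quotients would be
  \<open>0 / 0 = 0\<close> for small radii and every value would be a trace.\<close>

lemma trace_unique:
  fixes w :: "real^'n \<Rightarrow> real"
  assumes \<Omega>: "open \<Omega>" "bounded \<Omega>" and x: "x \<in> closure \<Omega>" and w: "integrable lborel w"
    and t: "((\<lambda>r. (\<integral>y. indicator (\<Omega> \<inter> ball x r) y * \<bar>w y - t\<bar> \<partial>lborel) / measure lborel (\<Omega> \<inter> ball x r)) \<longlongrightarrow> 0) (at_right 0)"
    and s: "((\<lambda>r. (\<integral>y. indicator (\<Omega> \<inter> ball x r) y * \<bar>w y - s\<bar> \<partial>lborel) / measure lborel (\<Omega> \<inter> ball x r)) \<longlongrightarrow> 0) (at_right 0)"
  shows "s = t"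
proof -
  let ?A = "\<lambda>t r. (\<integral>y. indicator (\<Omega> \<inter> ball x r) y * \<bar>w y - t\<bar> \<partial>lborel) / measure lborel (\<Omega> \<inter> ball x r)"
  have "\<bar>s - t\<bar> \<le> ?A s r + ?A t r" if r: "0 < r" for r
  proof -
    define S where "S = \<Omega> \<inter> ball x r"
    have S: "open S" "bounded S" "S \<noteq> {}"
    proof -
      obtain y where "y \<in> \<Omega>" "dist y x < r" using x r unfolding closure_approachable by auto
      then have "y \<in> S" by (simp add: S_def dist_commute)
      then show "S \<noteq> {}" by auto
    qed (use \<Omega> in \<open>auto simp: S_def bounded_Int\<close>)
    have m: "0 < measure lborel S" using measure_lebesgue_open_pos[OF S] by simp
    have fin: "emeasure lborel S < \<infinity>" using S emeasure_bounded_finite by auto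
    have i: "integrable lborel (\<lambda>y. indicator S y * \<bar>w y - c\<bar>)" for c
    proof -
      have "integrable lborel (\<lambda>y. indicator S y *\<^sub>R (w y - c))"
        unfolding scaleR_diff_right
      proof (rule Bochner_Integration.integrable_diff)
        show "integrable lborel (\<lambda>y. indicator S y *\<^sub>R w y)"
          using S w by (intro integrable_mult_indicator) (auto simp: borel_open)
        show "integrable lborel (\<lambda>y. indicator S y *\<^sub>R c)"
          unfolding real_scaleR_def using S fin by (intro integrable_mult_left integrable_real_indicator) (auto simp: borel_open)
      qed
      then have "integrable lborel (\<lambda>y. \<bar>indicator S y *\<^sub>R (w y - c)\<bar>)" by (rule integrable_abs)
      then show ?thesis by (simp add: abs_mult)
    qed
    have ist: "integrable lborel (\<lambda>y. indicator S y * \<bar>s - t\<bar>)"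
      using S fin by (intro integrable_mult_left integrable_real_indicator) (auto simp: borel_open)
    have "\<bar>s - t\<bar> * measure lborel S = (\<integral>y. indicator S y * \<bar>s - t\<bar> \<partial>lborel)"
      using S by (simp add: borel_open)
    also have "\<dots> \<le> (\<integral>y. indicator S y * \<bar>w y - s\<bar> + indicator S y * \<bar>w y - t\<bar> \<partial>lborel)"
      by (intro integral_mono ist Bochner_Integration.integrable_add i) (auto simp: indicator_def)
    also have "\<dots> = (\<integral>y. indicator S y * \<bar>w y - s\<bar> \<partial>lborel) + (\<integral>y. indicator S y * \<bar>w y - t\<bar> \<partial>lborel)"
      by (intro Bochner_Integration.integral_add i)
    finally show ?thesis using m by (simp add: S_def[symmetric] field_simps)
  qed
  then have "\<forall>\<^sub>F r in at_right 0. \<bar>s - t\<bar> \<le> ?A s r + ?A t r"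
    by (intro eventually_at_right_less[THEN eventually_mono]) auto
  moreover have "((\<lambda>r. ?A s r + ?A t r) \<longlongrightarrow> 0 + 0) (at_right 0)" by (intro tendsto_add s t)
  ultimately have "\<bar>s - t\<bar> \<le> 0 + 0" by (intro tendsto_lowerbound[of _ _ "at_right 0"]) auto
  then show ?thesis by simp
qed

lemma bv_trace_eq:
  fixes u w :: "real^'n \<Rightarrow> real"
  assumes \<Omega>: "open \<Omega>" "bounded \<Omega>" and x: "x \<in> closure \<Omega>" and u: "u \<in> borel_measurable (lebesgue_on \<Omega>)"
    and w: "integrable lborel w" and eq: "AE x in lebesgue. x \<in> \<Omega> \<longrightarrow> u x = w x"
    and t: "has_trace_at \<Omega> u x t"
  shows "bv_trace \<Omega> u x = t"
proof -
  have wb: "w \<in> borel_measurable borel" using w by (auto simp: borel_measurable_integrable)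
  note iff = has_trace_at_lborel[OF \<Omega> u wb eq]
  have "(THE t. has_trace_at \<Omega> u x t) = t"
    using t trace_unique[OF \<Omega> x w] unfolding iff by (intro the_equality) auto
  then show ?thesis using t by (auto simp: bv_trace_def)
qed

lemma integrable_lebesgue_on_indicator:
  fixes \<Omega> :: "(real^'n) set"
  assumes "open \<Omega>"
  shows "integrable (lebesgue_on \<Omega>) (\<lambda>x. c * indicator (cball p R) x :: real)"
    "(\<integral>x. c * indicator (cball p R) x \<partial>lebesgue_on \<Omega>) = c * measure lborel (\<Omega> \<inter> cball p R)"
proof -
  have "(\<lambda>x. c * indicator (cball p R) x :: real) \<in> borel_measurable lebesgue"
    by (intro borel_measurable_times borel_measurable_indicator) auto
  then have m: "(\<lambda>x. c * indicator (cball p R) x :: real) \<in> borel_measurable (lebesgue_on \<Omega>)"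
    by (rule measurable_restrict_space1)
  have eq: "(\<lambda>x. indicator \<Omega> x * (c * indicator (cball p R) x)) = (\<lambda>x. c * indicator (\<Omega> \<inter> cball p R) x)"
    by (auto simp: fun_eq_iff indicator_def)
  have b: "(\<lambda>x. c * indicator (cball p R) x :: real) \<in> borel_measurable borel"
    by (intro borel_measurable_times borel_measurable_indicator) auto
  have O: "\<Omega> \<in> sets borel" using assms by auto
  note L = lebesgue_on_integral_eq_lborel[OF O m b]
  have "emeasure lborel (\<Omega> \<inter> cball p R) < \<infinity>"
    by (rule emeasure_bounded_finite) (auto intro: bounded_subset[OF bounded_cball])
  then have "integrable lborel (\<lambda>x. c * indicator (\<Omega> \<inter> cball p R) x :: real)"
    using O by (intro integrable_mult_right integrable_real_indicator) auto
  then show "integrable (lebesgue_on \<Omega>) (\<lambda>x. c * indicator (cball p R) x :: real)"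
    using L(2) unfolding eq by auto
  have "(\<integral>x. c * indicator (cball p R) x \<partial>lebesgue_on \<Omega>) = (\<integral>x. c * indicator (\<Omega> \<inter> cball p R) x \<partial>lborel)"
    using L(1) unfolding eq by auto
  then show "(\<integral>x. c * indicator (cball p R) x \<partial>lebesgue_on \<Omega>) = c * measure lborel (\<Omega> \<inter> cball p R)"
    using O by simp
qed

text \<open>The function vanishes at distance less than \<open>R1 - R\<close> from the frontier, so
  small means there are exactly zero.\<close>

lemma boundary_integral_abs_cball:
  fixes \<Omega> :: "(real^'n) set"
  assumes \<Omega>: "open \<Omega>" "bounded \<Omega>" and R: "R < R1" "cball p R1 \<subseteq> \<Omega>"
  shows "boundary_integral_abs \<Omega> (\<lambda>x. c * indicator (cball p R) x) = 0"
proof -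
  define u where "u x = c * indicator (cball p R) x" for x :: "real^'n"
  have int: "integrable lborel u" unfolding u_def
    by (intro integrable_mult_right integrable_real_indicator) (use emeasure_lborel_cball_finite in auto)
  have b: "u \<in> borel_measurable borel" using int by (auto simp: borel_measurable_integrable)
  then have "u \<in> borel_measurable lebesgue" by (intro measurable_completion) simp
  then have m: "u \<in> borel_measurable (lebesgue_on \<Omega>)" by (rule measurable_restrict_space1)
  have "bv_trace \<Omega> u x = 0" if x: "x \<in> frontier \<Omega>" for x
  proof (rule bv_trace_eq[OF \<Omega> _ m int])
    show "x \<in> closure \<Omega>" using x by (simp add: frontier_def)
    have "x \<notin> \<Omega>" using x \<Omega>(1) by (simp add: frontier_def interior_open)
    then have d: "R1 < dist p x" using R(2) by (auto simp: subset_iff not_le)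
    have z: "indicator (\<Omega> \<inter> ball x r) y * \<bar>u y - 0\<bar> = 0" if "r < R1 - R" for r y
    proof (cases "y \<in> ball x r")
      case True
      then have "dist p x \<le> dist p y + dist x y" "dist x y < r" using dist_triangle[of p x y] by (auto simp: dist_commute)
      then have "y \<notin> cball p R" using that d by auto
      then show ?thesis by (simp add: u_def)
    qed simp
    have "\<forall>\<^sub>F r in at_right (0::real). r < R1 - R"
      using R(1) by (intro order_tendstoD(2)[OF tendsto_ident_at]) auto
    then have "\<forall>\<^sub>F r in at_right 0. (\<integral>y. indicator (\<Omega> \<inter> ball x r) y * \<bar>u y - 0\<bar> \<partial>lborel) / measure lborel (\<Omega> \<inter> ball x r) = 0"
      by eventually_elim (simp only: z, simp)
    then show "has_trace_at \<Omega> u x 0"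
      unfolding has_trace_at_lborel[OF \<Omega> m b AE_I2[OF impI[OF refl]]] by (rule tendsto_eventually)
  qed auto
  then have "(\<integral>\<^sup>+ x \<in> frontier \<Omega>. ennreal \<bar>bv_trace \<Omega> u x\<bar> \<partial>hausdorff_measure (CARD('n) - 1)) =
      nn_integral (hausdorff_measure (CARD('n) - 1) :: (real^'n) measure) (\<lambda>x. 0)"
    by (intro nn_integral_cong) (auto simp: indicator_def)
  then show ?thesis by (simp add: boundary_integral_abs_def u_def[abs_def] zero_ennreal.rep_eq)
qed

text \<open>Both sides of the energy identity equal \<open>c * N / R\<close> times the volume of the
  ball, and on the ball the equation is the hypothesis on \<open>c\<close>.\<close>

theorem ball_solution:
  fixes \<Omega> :: "(real^'n) set"
  assumes N: "CARD('n) \<ge> 2" and \<Omega>: "open \<Omega>" "bounded \<Omega>" and q: "1 < q" and a: "0 < a" "a < c"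
    and R: "0 < R" "R < R1" "cball p R1 \<subseteq> \<Omega>"
    and eq: "lam * c powr (q - 1) + c powr (crit_exponent TYPE('n) - 1) = real CARD('n) / R"
  shows "nontrivial_solution \<Omega> q lam a (\<lambda>x. c * indicator (cball p R) x)"
proof -
  let ?N = "real CARD('n)" and ?B = "cball p R"
  define u where "u x = c * indicator ?B x" for x :: "real^'n"
  define d where "d x = - (?N / R) * indicator ?B x" for x :: "real^'n"
  define \<rho> where "\<rho> x = c powr (q - 1) * indicator ?B x" for x :: "real^'n"
  have cpos: "0 < c" using a by linarith
  have sub: "?B \<subseteq> \<Omega>" using R subset_cball[of R R1 p] by auto
  then have OB: "\<Omega> \<inter> ?B = ?B" by auto
  note I = integrable_lebesgue_on_indicator[OF \<Omega>(1), of _ p R, unfolded OB]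
  have Lp: "(\<lambda>x. k * indicator ?B x) \<in> Lp s \<Omega>" for k s
  proof -
    have "(\<lambda>x. \<bar>k * indicator ?B x\<bar> powr s) = (\<lambda>x::real^'n. \<bar>k\<bar> powr s * indicator ?B x)"
      by (auto simp: fun_eq_iff indicator_def)
    then show ?thesis using I(1)[of k] I(1)[of "\<bar>k\<bar> powr s"] by (simp add: Lp_def borel_measurable_integrable)
  qed
  have tv: "total_variation \<Omega> u = ereal (c * (?N / R * measure lborel ?B))"
    unfolding u_def using total_variation_cball[OF \<Omega>(1) R] cpos by auto
  have pow: "c powr (s - 2) * c = c powr (s - 1)" for s
    using powr_add[of c "s - 2" 1] cpos by simp
  have bf: "ball_field p R \<in> borel_measurable (lebesgue_on \<Omega>)"
  proof -
    have "ball_field p R \<in> borel_measurable lebesgue" using ball_field_borel[OF R(1)] by (intro measurable_completion) simp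
    then show ?thesis by (rule measurable_restrict_space1)
  qed
  have "solution \<Omega> q lam a u"
    unfolding solution_def
  proof (rule conjI, goal_cases)
    case 1
    show ?case using tv I(1)[of c] by (simp add: BV_def u_def[abs_def])
  next
    case 2
    show ?case
    proof (rule exI[of _ "ball_field p R"], rule exI[of _ d], rule exI[of _ \<rho>], intro conjI)
    show "ball_field p R \<in> borel_measurable (lebesgue_on \<Omega>)" by (rule bf)
    show "AE x in lebesgue_on \<Omega>. norm (ball_field p R x) \<le> 1" using norm_ball_field_le[OF R(1)] by (intro AE_I2)
    show "\<rho> \<in> Lp (q / (q - 1)) \<Omega>" unfolding \<rho>_def by (rule Lp)
    show "weak_divergence \<Omega> (ball_field p R) d" unfolding d_def by (rule weak_divergence_ball_field[OF \<Omega>(1) R(1)])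
    show "d \<in> Lp ?N \<Omega>" unfolding d_def by (rule Lp)
    have "(\<lambda>x. u x * d x) = (\<lambda>x. (- (c * (?N / R))) * indicator ?B x)"
      by (auto simp: u_def d_def fun_eq_iff indicator_def)
    then have "(\<integral>x. u x * d x \<partial>lebesgue_on \<Omega>) = - (c * (?N / R)) * measure lborel ?B"
      by (simp only: I(2))
    then show "ereal (- (\<integral>x. u x * d x \<partial>lebesgue_on \<Omega>)) = total_variation \<Omega> u + boundary_integral_abs \<Omega> u"
      using tv boundary_integral_abs_cball[OF \<Omega> R(2,3), of c] by (simp add: u_def[abs_def])
    show "AE x in lebesgue_on \<Omega>. - d x = lam * \<rho> x + \<bar>u x\<bar> powr (crit_exponent TYPE('n) - 2) * u x"
      using eq pow[of "crit_exponent TYPE('n)"] cpos by (intro AE_I2) (auto simp: d_def \<rho>_def u_def indicator_def)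
    \<comment> \<open>The jump of the nonlinearity is avoided: \<open>u\<close> takes only the
      values \<open>c > a\<close> and \<open>0 < a\<close>, where the generalized gradient is a
      single point.\<close>
    show "AE x in lebesgue_on \<Omega>. \<rho> x \<in> clarke_gradient (F_trunc q a) (u x)"
      using a q pow[of q] by (intro AE_I2) (auto simp: clarke_gradient_F_trunc \<rho>_def u_def indicator_def)
    qed
  qed
  moreover have "\<not> ae_equal \<Omega> u (\<lambda>_. 0)"
  proof
    assume "ae_equal \<Omega> u (\<lambda>_. 0)"
    then have "(\<integral>x. u x \<partial>lebesgue_on \<Omega>) = (\<integral>x. 0 \<partial>lebesgue_on \<Omega>)"
      using I(1)[of c] unfolding ae_equal_def
      by (intro integral_cong_AE) (auto simp: u_def[abs_def] borel_measurable_integrable)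
    then have "c * measure lborel ?B = 0" unfolding u_def by (simp only: I(2)) simp
    moreover have "0 < measure lborel ?B" using content_cball_pos[OF R(1), of p] by simp
    ultimately show False using cpos by simp
  qed
  ultimately show ?thesis by (simp add: nontrivial_solution_def u_def[abs_def])
qed

section \<open>Hausdorff measure on Borel sets\<close>

lemma hausdorff_content_mono: "A \<subseteq> B \<Longrightarrow> hausdorff_content k \<delta> A \<le> hausdorff_content k \<delta> B"
  unfolding hausdorff_content_def by (rule INF_superset_mono) auto

lemma hausdorff_content_antimono: "\<delta> \<le> \<delta>' \<Longrightarrow> hausdorff_content k \<delta>' A \<le> hausdorff_content k \<delta> A"
  unfolding hausdorff_content_def by (rule INF_superset_mono) (auto intro: order_trans)

lemma hausdorff_content_empty: "0 \<le> \<delta> \<Longrightarrow> hausdorff_content k \<delta> {} = 0"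
  unfolding hausdorff_content_def
  by (intro antisym INF_lower2[of "\<lambda>_. {}"]) auto

text \<open>Almost optimal covers with errors \<open>e / 2 ^ (i + 1)\<close> are merged into one
  sequence by \<open>prod_decode\<close>.\<close>

lemma hausdorff_content_UN_le:
  assumes "0 < \<delta>"
  shows "hausdorff_content k \<delta> (\<Union>i. A i) \<le> (\<Sum>i::nat. hausdorff_content k \<delta> (A i))"
proof (rule ennreal_le_epsilon)
  let ?f = "\<lambda>C. if C = {} then 0 else ennreal (unit_ball_vol (real k) * (diameter C / 2) ^ k)"
  fix e :: real assume "(\<Sum>i. hausdorff_content k \<delta> (A i)) < top" "0 < e"
  have fin: "hausdorff_content k \<delta> (A i) < top" for i
    using ennreal_suminf_lessD \<open>(\<Sum>i. hausdorff_content k \<delta> (A i)) < top\<close> by blast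
  have "\<exists>C. A i \<subseteq> (\<Union>j. C j) \<and> (\<forall>j. bounded (C j) \<and> diameter (C j) \<le> \<delta>) \<and>
      (\<Sum>j. ?f (C j)) \<le> hausdorff_content k \<delta> (A i) + ennreal (e * (1/2) ^ Suc i)" for i
  proof -
    have "hausdorff_content k \<delta> (A i) < hausdorff_content k \<delta> (A i) + ennreal (e * (1/2) ^ Suc i)"
    proof -
      obtain r where "0 \<le> r" "hausdorff_content k \<delta> (A i) = ennreal r" using fin[of i] by (cases "hausdorff_content k \<delta> (A i)") auto
      then show ?thesis using \<open>0 < e\<close> by (simp add: ennreal_less_iff flip: ennreal_plus)
    qed
    then show ?thesis
      unfolding hausdorff_content_def[of k \<delta> "A i"] INF_less_iff
      by (elim bexE CollectE conjE) (intro exI conjI, assumption+, rule less_imp_le, assumption)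
  qed
  then have "\<exists>C. \<forall>i. A i \<subseteq> (\<Union>j. C i j) \<and> (\<forall>j. bounded (C i j) \<and> diameter (C i j) \<le> \<delta>) \<and>
      (\<Sum>j. ?f (C i j)) \<le> hausdorff_content k \<delta> (A i) + ennreal (e * (1/2) ^ Suc i)"
    by (intro choice allI)
  then obtain C where C0: "\<forall>i. A i \<subseteq> (\<Union>j. C i j) \<and> (\<forall>j. bounded (C i j) \<and> diameter (C i j) \<le> \<delta>) \<and>
      (\<Sum>j. ?f (C i j)) \<le> hausdorff_content k \<delta> (A i) + ennreal (e * (1/2) ^ Suc i)" ..
  then have C: "\<And>i. A i \<subseteq> (\<Union>j. C i j)" "\<And>i j. bounded (C i j)" "\<And>i j. diameter (C i j) \<le> \<delta>"
    "\<And>i. (\<Sum>j. ?f (C i j)) \<le> hausdorff_content k \<delta> (A i) + ennreal (e * (1/2) ^ Suc i)"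
    by blast+
  define F where "F = (\<lambda>(i, j). ?f (C i j))"
  define D where "D n = (case prod_decode n of (i, j) \<Rightarrow> C i j)" for n
  have "hausdorff_content k \<delta> (\<Union>i. A i) \<le> (\<Sum>n. ?f (D n))"
    unfolding hausdorff_content_def
  proof (rule INF_lower, intro CollectI conjI allI)
    show "(\<Union>i. A i) \<subseteq> (\<Union>n. D n)"
    proof
      fix x assume "x \<in> (\<Union>i. A i)"
      then obtain i j where "x \<in> C i j" using C(1) by blast
      then have "x \<in> D (prod_encode (i, j))" by (simp add: D_def)
      then show "x \<in> (\<Union>n. D n)" by blast
    qed
    show "bounded (D n)" "diameter (D n) \<le> \<delta>" for n
      using C(2,3) by (auto simp: D_def split: prod.split)
  qed
  also have "(\<Sum>n. ?f (D n)) = (\<Sum>n. F (prod_decode n))"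
  proof -
    have "?f (D n) = F (prod_decode n)" for n by (auto simp: D_def F_def split: prod.split)
    then show ?thesis by presburger
  qed
  also have "\<dots> = (\<Sum>i. \<Sum>j. ?f (C i j))"
    by (rule suminf_ennreal_2dimen) (simp add: F_def)
  also have "\<dots> \<le> (\<Sum>i. hausdorff_content k \<delta> (A i) + ennreal (e * (1/2) ^ Suc i))"
    by (intro suminf_le C(4)) auto
  also have "\<dots> = (\<Sum>i. hausdorff_content k \<delta> (A i)) + (\<Sum>i. ennreal (e * (1/2) ^ Suc i))"
    by (intro suminf_add[symmetric]) auto
  also have "(\<Sum>i. ennreal (e * (1/2) ^ Suc i)) = ennreal e"
  proof (rule suminf_ennreal_eq)
    show "(\<lambda>i. e * (1/2) ^ Suc i) sums e"
      using sums_mult[OF power_half_series, of e] by simp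
  qed (use \<open>0 < e\<close> in auto)
  finally show "hausdorff_content k \<delta> (\<Union>i. A i) \<le> (\<Sum>i. hausdorff_content k \<delta> (A i)) + ennreal e" .
qed

lemma hausdorff_outer_mono: "A \<subseteq> B \<Longrightarrow> hausdorff_outer k A \<le> hausdorff_outer k B"
  unfolding hausdorff_outer_def by (intro SUP_mono') (rule hausdorff_content_mono)

lemma hausdorff_outer_empty: "hausdorff_outer k {} = 0"
  unfolding hausdorff_outer_def by (simp add: hausdorff_content_empty)

lemma hausdorff_outer_UN_le: "hausdorff_outer k (\<Union>i. A i) \<le> (\<Sum>i::nat. hausdorff_outer k (A i))"
  unfolding hausdorff_outer_def[of k "\<Union>i. A i"]
proof (rule SUP_least)
  fix \<delta> :: real assume "\<delta> \<in> {0<..}"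
  then have "hausdorff_content k \<delta> (\<Union>i. A i) \<le> (\<Sum>i. hausdorff_content k \<delta> (A i))"
    by (intro hausdorff_content_UN_le) auto
  also have "\<dots> \<le> (\<Sum>i. hausdorff_outer k (A i))"
    unfolding hausdorff_outer_def using \<open>\<delta> \<in> {0<..}\<close> by (intro suminf_le SUP_upper) auto
  finally show "hausdorff_content k \<delta> (\<Union>i. A i) \<le> (\<Sum>i. hausdorff_outer k (A i))" .
qed

lemma hausdorff_outer_Un_le: "hausdorff_outer k (A \<union> B) \<le> hausdorff_outer k A + hausdorff_outer k B"
proof -
  let ?C = "\<lambda>i::nat. if i = 0 then A else if i = 1 then B else {}"
  have "(\<Union>i. ?C i) = A \<union> B" by (auto split: if_splits)
  then have "hausdorff_outer k (A \<union> B) \<le> (\<Sum>i. hausdorff_outer k (?C i))"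
    using hausdorff_outer_UN_le[of k ?C] by simp
  also have "\<dots> = (\<Sum>i\<in>{0,1}. hausdorff_outer k (?C i))"
    by (intro suminf_finite) (auto simp: hausdorff_outer_empty)
  finally show ?thesis by simp
qed

text \<open>A set of diameter at most \<open>\<delta>\<close> meets only one of the two sets, so
  each member of a cover is charged once.\<close>

lemma hausdorff_content_separated:
  assumes sep: "\<And>x y. x \<in> A \<Longrightarrow> y \<in> B \<Longrightarrow> \<delta> < dist x y"
  shows "hausdorff_content k \<delta> A + hausdorff_content k \<delta> B \<le> hausdorff_content k \<delta> (A \<union> B)"
  unfolding hausdorff_content_def[of k \<delta> "A \<union> B"]
proof (rule INF_greatest)
  let ?f = "\<lambda>C. if C = {} then 0 else ennreal (unit_ball_vol (real k) * (diameter C / 2) ^ k)"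
  fix C :: "nat \<Rightarrow> 'a set"
  assume "C \<in> {C. A \<union> B \<subseteq> (\<Union>j. C j) \<and> (\<forall>j. bounded (C j) \<and> diameter (C j) \<le> \<delta>)}"
  then have C: "A \<union> B \<subseteq> (\<Union>j. C j)" "\<And>j. bounded (C j)" "\<And>j. diameter (C j) \<le> \<delta>" by auto
  \<comment> \<open>Members that miss \<open>S\<close> become empty; the empty set costs nothing,
    even in dimension \<open>0\<close>.\<close>
  define P where "P S j = (if C j \<inter> S = {} then {} else C j)" for S j
  have le: "hausdorff_content k \<delta> S \<le> (\<Sum>j. ?f (P S j))" if S: "S \<subseteq> A \<union> B" "S \<noteq> {}" for S
    unfolding hausdorff_content_def
  proof (rule INF_lower, intro CollectI conjI allI)
    show "S \<subseteq> (\<Union>j. P S j)"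
    proof
      fix x assume "x \<in> S"
      moreover from this obtain j where "x \<in> C j" using C(1) S by blast
      ultimately have "x \<in> P S j" by (auto simp: P_def)
      then show "x \<in> (\<Union>j. P S j)" by blast
    qed
    have "0 \<le> \<delta>" using diameter_ge_0[OF C(2)[of 0]] C(3)[of 0] by linarith
    then show "bounded (P S j)" "diameter (P S j) \<le> \<delta>" for j
      using C(2)[of j] C(3)[of j] by (auto simp: P_def)
  qed
  show "hausdorff_content k \<delta> A + hausdorff_content k \<delta> B \<le> (\<Sum>j. ?f (C j))"
  proof (cases "A = {} \<or> B = {}")
    case True
    have "0 \<le> \<delta>" using C(2)[of 0] C(3)[of 0] diameter_ge_0[of "C 0"] by linarith
    have "hausdorff_content k \<delta> (A \<union> B) \<le> (\<Sum>j. ?f (C j))"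
      unfolding hausdorff_content_def[of k \<delta> "A \<union> B"] using C by (intro INF_lower) auto
    then show ?thesis using True \<open>0 \<le> \<delta>\<close> by (auto simp: hausdorff_content_empty)
  next
    case False
    have "hausdorff_content k \<delta> A + hausdorff_content k \<delta> B \<le> (\<Sum>j. ?f (P A j)) + (\<Sum>j. ?f (P B j))"
      using False by (intro add_mono le) auto
    also have "\<dots> = (\<Sum>j. ?f (P A j) + ?f (P B j))" by (rule suminf_add) auto
    also have "\<dots> \<le> (\<Sum>j. ?f (C j))"
    proof (rule suminf_le)
      fix j
      have "C j \<inter> A = {} \<or> C j \<inter> B = {}"
      proof (rule ccontr)
        assume "\<not> ?thesis"
        then obtain x y where "x \<in> C j" "x \<in> A" "y \<in> C j" "y \<in> B" by blast
        then have "dist x y \<le> \<delta>" using diameter_bounded_bound[OF C(2)[of j], of x y] C(3)[of j] by linarith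
        then show False using sep[OF \<open>x \<in> A\<close> \<open>y \<in> B\<close>] by simp
      qed
      then show "?f (P A j) + ?f (P B j) \<le> ?f (C j)" by (auto simp: P_def)
    qed auto
    finally show ?thesis .
  qed
qed

lemma hausdorff_outer_separated:
  assumes \<eta>: "0 < \<eta>" and sep: "\<And>x y. x \<in> A \<Longrightarrow> y \<in> B \<Longrightarrow> \<eta> \<le> dist x y"
  shows "hausdorff_outer k A + hausdorff_outer k B \<le> hausdorff_outer k (A \<union> B)"
proof -
  have "hausdorff_outer k A + hausdorff_outer k B = (SUP \<delta>\<in>{0<..}. hausdorff_content k \<delta> A + hausdorff_content k \<delta> B)"
    unfolding hausdorff_outer_def
  proof (rule SUP_add_directed_ennreal[symmetric])
    fix i j :: real assume "i \<in> {0<..}" "j \<in> {0<..}"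
    then show "\<exists>l\<in>{0<..}. hausdorff_content k i A + hausdorff_content k j B \<le> hausdorff_content k l A + hausdorff_content k l B"
      by (intro bexI[of _ "min i j"] add_mono hausdorff_content_antimono) auto
  qed
  also have "\<dots> \<le> hausdorff_outer k (A \<union> B)"
  proof (rule SUP_least)
    fix \<delta> :: real assume \<delta>: "\<delta> \<in> {0<..}"
    define d where "d = min \<delta> (\<eta> / 2)"
    have d: "0 < d" "d \<le> \<delta>" "d < \<eta>" using \<delta> \<eta> by (auto simp: d_def)
    have "hausdorff_content k \<delta> A + hausdorff_content k \<delta> B \<le> hausdorff_content k d A + hausdorff_content k d B"
      using d by (intro add_mono hausdorff_content_antimono) auto
    also have "\<dots> \<le> hausdorff_content k d (A \<union> B)"
      using sep d by (intro hausdorff_content_separated) force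
    also have "\<dots> \<le> hausdorff_outer k (A \<union> B)"
      unfolding hausdorff_outer_def using d by (intro SUP_upper) auto
    finally show "hausdorff_content k \<delta> A + hausdorff_content k \<delta> B \<le> hausdorff_outer k (A \<union> B)" .
  qed
  finally show ?thesis .
qed


text \<open>Caratheodory's argument for metric outer measures: \<open>A n\<close> keeps distance
  \<open>1 / (n + 1)\<close> from \<open>F\<close>, and the remaining part of the complement splits
  into distance shells \<open>B n\<close>. Shells of equal parity are separated, so their measures
  are summable when \<open>X\<close> has finite measure.\<close>

lemma closed_lambda_system_hausdorff:
  fixes F :: "'a::metric_space set"
  assumes F: "closed F"
  shows "F \<in> lambda_system UNIV UNIV (hausdorff_outer k)"
proof (cases "F = {}")
  case True
  then show ?thesis by (simp add: lambda_system_def hausdorff_outer_empty)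
next
  case ne: False
  let ?H = "hausdorff_outer k"
  have "?H (F \<inter> X) + ?H ((UNIV - F) \<inter> X) = ?H X" for X
  proof (rule antisym)
    show "?H X \<le> ?H (F \<inter> X) + ?H ((UNIV - F) \<inter> X)"
    proof -
      have "X = (F \<inter> X) \<union> ((UNIV - F) \<inter> X)" by auto
      then show ?thesis using hausdorff_outer_Un_le[of k "F \<inter> X" "(UNIV - F) \<inter> X"] by simp
    qed
    show "?H (F \<inter> X) + ?H ((UNIV - F) \<inter> X) \<le> ?H X"
    proof (cases "?H X = \<infinity>")
      case False
      define g where "g n = inverse (real (Suc n))" for n
      have g: "0 < g n" "g (Suc n) < g n" for n by (auto simp: g_def)
      have gmono: "m \<le> n \<Longrightarrow> g n \<le> g m" for m n by (auto simp: g_def)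
      define A where "A n = {x \<in> X. g n \<le> infdist x F}" for n
      define B where "B n = {x \<in> X. g (Suc n) \<le> infdist x F \<and> infdist x F < g n}" for n
      have AF: "?H (F \<inter> X) + ?H (A n) \<le> ?H X" for n
      proof -
        have "?H (F \<inter> X) + ?H (A n) \<le> ?H ((F \<inter> X) \<union> A n)"
        proof (rule hausdorff_outer_separated[OF g(1)[of n]])
          fix x y assume "x \<in> F \<inter> X" "y \<in> A n"
          then have "g n \<le> infdist y F" "infdist y F \<le> dist y x" by (auto simp: A_def intro: infdist_le)
          then show "g n \<le> dist x y" by (simp add: dist_commute)
        qed
        also have "\<dots> \<le> ?H X" by (intro hausdorff_outer_mono) (auto simp: A_def)
        finally show ?thesis .
      qed
      have Bsep: "g (Suc m) - g n \<le> dist x y" if "x \<in> B m" "y \<in> B n" for m n x y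
      proof -
        have "infdist x F \<le> infdist y F + dist x y" by (rule infdist_triangle)
        then show ?thesis using that by (auto simp: B_def)
      qed
      have parity: "(\<Sum>i<N. ?H (B (2 * i + c))) \<le> ?H (\<Union>i<N. B (2 * i + c))" for N c
      proof (induction N)
        case (Suc N)
        have "(\<Sum>i<Suc N. ?H (B (2 * i + c))) \<le> ?H (\<Union>i<N. B (2 * i + c)) + ?H (B (2 * N + c))"
          using Suc by (simp add: add_right_mono)
        also have "\<dots> \<le> ?H ((\<Union>i<N. B (2 * i + c)) \<union> B (2 * N + c))"
        proof (rule hausdorff_outer_separated)
          \<comment> \<open>For \<open>N = 0\<close> the union is empty and any positive number
            serves; otherwise a full shell of the other parity lies in between.\<close>
          show "0 < (if N = 0 then 1 else g (2 * N + c - 1) - g (2 * N + c))"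
            using g(2)[of "2 * N + c - 1"] by (cases N) auto
          fix x y assume "x \<in> (\<Union>i<N. B (2 * i + c))" "y \<in> B (2 * N + c)"
          then obtain i where i: "i < N" "x \<in> B (2 * i + c)" "y \<in> B (2 * N + c)" by auto
          then have "g (2 * N + c - 1) \<le> g (Suc (2 * i + c))" by (intro gmono) auto
          then show "(if N = 0 then 1 else g (2 * N + c - 1) - g (2 * N + c)) \<le> dist x y"
            using Bsep[OF i(2,3)] i(1) by auto
        qed
        also have "(\<Union>i<N. B (2 * i + c)) \<union> B (2 * N + c) = (\<Union>i<Suc N. B (2 * i + c))"
          by (auto simp: less_Suc_eq)
        finally show ?case .
      qed (simp add: hausdorff_outer_empty)
      have parity': "(\<Sum>i<N. ?H (B (2 * i + c))) \<le> ?H X" for N c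
        using parity[of c N] hausdorff_outer_mono[of "\<Union>i<N. B (2 * i + c)" X k] by (auto simp: B_def intro: order_trans)
      have "(\<Sum>n<N. ?H (B n)) \<le> 2 * ?H X" for N
      proof -
        have "(\<Sum>n<N. ?H (B n)) \<le> (\<Sum>n<2*N. ?H (B n))" by (intro sum_mono2) auto
        also have "\<dots> = (\<Sum>i<N. ?H (B (2 * i + 0))) + (\<Sum>i<N. ?H (B (2 * i + 1)))"
          by (induction N) (simp_all add: algebra_simps)
        also have "\<dots> \<le> ?H X + ?H X" by (intro add_mono parity')
        finally show ?thesis by (simp add: mult_2)
      qed
      then have "(\<Sum>n. ?H (B n)) \<le> 2 * ?H X" by (intro suminf_le_const) auto
      also have "\<dots> < \<infinity>" using False by (simp add: ennreal_mult_less_top less_top)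
      finally have fin: "(\<Sum>n. ?H (B n)) \<noteq> top" by simp
      have "?H ((UNIV - F) \<inter> X) \<le> ?H (A n) + (\<Sum>i. ?H (B (i + n)))" for n
      proof -
        have "(UNIV - F) \<inter> X \<subseteq> A n \<union> (\<Union>i. B (i + n))"
        proof
          fix x assume x: "x \<in> (UNIV - F) \<inter> X"
          then have "0 < infdist x F" using F ne by (intro infdist_pos_not_in_closed) auto
          then obtain m where m: "g m < infdist x F" unfolding g_def using reals_Archimedean by blast
          show "x \<in> A n \<union> (\<Union>i. B (i + n))"
          proof (cases "g n \<le> infdist x F")
            case True then show ?thesis using x by (simp add: A_def)
          next
            case False
            define j where "j = (LEAST j. g j \<le> infdist x F)"
            have j: "g j \<le> infdist x F" unfolding j_def by (rule LeastI[of "\<lambda>j. g j \<le> infdist x F" m]) (rule less_imp_le[OF m])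
            have "n < j"
            proof (rule ccontr)
              assume "\<not> n < j"
              then have "g n \<le> g j" by (intro gmono) simp
              then show False using False j by linarith
            qed
            then obtain i where i: "j = Suc (n + i)" using less_imp_Suc_add by blast
            then have i: "j = Suc (i + n)" by simp
            have "\<not> g (i + n) \<le> infdist x F" using not_less_Least[of "i + n" "\<lambda>j. g j \<le> infdist x F"] i by (simp add: j_def)
            then have "x \<in> B (i + n)" using x j i by (simp add: B_def)
            then show ?thesis by blast
          qed
        qed
        then have "?H ((UNIV - F) \<inter> X) \<le> ?H (A n \<union> (\<Union>i. B (i + n)))" by (rule hausdorff_outer_mono)
        also have "\<dots> \<le> ?H (A n) + ?H (\<Union>i. B (i + n))" by (rule hausdorff_outer_Un_le)
        also have "\<dots> \<le> ?H (A n) + (\<Sum>i. ?H (B (i + n)))" by (intro add_left_mono hausdorff_outer_UN_le)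
        finally show ?thesis .
      qed
      then have le: "?H (F \<inter> X) + ?H ((UNIV - F) \<inter> X) \<le> ?H X + (\<Sum>i. ?H (B (i + n)))" for n
      proof -
        have "?H (F \<inter> X) + ?H ((UNIV - F) \<inter> X) \<le> ?H (F \<inter> X) + (?H (A n) + (\<Sum>i. ?H (B (i + n))))"
          by (intro add_left_mono) fact
        also have "\<dots> = ?H (F \<inter> X) + ?H (A n) + (\<Sum>i. ?H (B (i + n)))" by (simp add: add.assoc)
        also have "\<dots> \<le> ?H X + (\<Sum>i. ?H (B (i + n)))" by (intro add_right_mono AF)
        finally show ?thesis .
      qed
      let ?S = "\<Sum>i. ?H (B i)" and ?c = "?H (F \<inter> X) + ?H ((UNIV - F) \<inter> X)"
      \<comment> \<open>Instead of sending the tails to zero, the first \<open>n\<close> shells are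
        added to both sides; in the limit the finite total \<open>?S\<close> cancels.\<close>
      have "?c + (\<Sum>i<n. ?H (B i)) \<le> ?H X + ?S" for n
      proof -
        have "?S = (\<Sum>i. ?H (B (i + n))) + (\<Sum>i<n. ?H (B i))" by (rule suminf_offset) simp
        then show ?thesis using add_right_mono[OF le[of n], of "\<Sum>i<n. ?H (B i)"] by (simp add: add.assoc)
      qed
      moreover have "(\<lambda>n. ?c + (\<Sum>i<n. ?H (B i))) \<longlonglongrightarrow> ?c + ?S"
        by (intro tendsto_add tendsto_const summable_LIMSEQ) simp
      ultimately have "?c + ?S \<le> ?H X + ?S" by (intro LIMSEQ_le_const2) blast+
      then show ?thesis using fin ennreal_add_left_cancel_le[of ?S ?c "?H X"] by (simp add: add.commute)
    qed simp
  qed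
  then show ?thesis by (simp add: lambda_system_def)
qed

text \<open>\<open>measure_of\<close> yields the zero measure unless the given set function is a
  measure; countable additivity on Borel sets is what makes \<open>hausdorff_measure\<close> the
  intended object.\<close>

lemma emeasure_hausdorff_measure:
  fixes A :: "'a::metric_space set"
  assumes "A \<in> sets borel"
  shows "emeasure (hausdorff_measure k) A = hausdorff_outer k A"
proof -
  let ?L = "lambda_system UNIV UNIV (hausdorff_outer k) :: 'a set set"
  interpret U: sigma_algebra UNIV "UNIV :: 'a set set"
    using sigma_algebra_Pow[of UNIV] by simp
  have "outer_measure_space UNIV (hausdorff_outer k :: 'a set \<Rightarrow> ennreal)"
    unfolding outer_measure_space_def positive_def increasing_def countably_subadditive_def
    by (auto simp: hausdorff_outer_empty hausdorff_outer_mono hausdorff_outer_UN_le)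
  from U.caratheodory_lemma[OF this] have L: "measure_space UNIV ?L (hausdorff_outer k)" .
  then interpret L: sigma_algebra UNIV ?L by (simp add: measure_space_def)
  have sub: "sets borel \<subseteq> ?L"
    unfolding borel_eq_closed sets_measure_of_conv using closed_lambda_system_hausdorff L.sigma_sets_subset[of "{S. closed S}"] by auto
  have "positive (sets borel) (hausdorff_outer k :: 'a set \<Rightarrow> ennreal)"
    by (simp add: positive_def hausdorff_outer_empty)
  moreover have "countably_additive (sets borel) (hausdorff_outer k :: 'a set \<Rightarrow> ennreal)"
    using L sub unfolding measure_space_def countably_additive_def by (meson order_trans subset_iff)
  ultimately show ?thesis
    using assms unfolding hausdorff_measure_def
    by (intro emeasure_measure_of_sigma) (auto simp: sets.sigma_algebra_axioms[of borel, simplified])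
qed

lemma sets_hausdorff_measure: "sets (hausdorff_measure k :: 'a::metric_space measure) = sets borel"
  unfolding hausdorff_measure_def using sets.sigma_sets_eq[of "borel :: 'a measure"]
  by (auto simp: sets_measure_of_conv)

section \<open>Averaging along a transversal direction\<close>

lemma integral_affine01:
  fixes F :: "real \<Rightarrow> real"
  assumes F: "continuous_on UNIV F" and ab: "a \<le> b"
  shows "(b - a) * integral {0..1} (\<lambda>t. F (a + t * (b - a))) = integral {a..b} F"
proof -
  have img: "(\<lambda>t. a + t * (b - a)) ` {0..1} \<subseteq> {a..b}"
  proof
    fix y assume "y \<in> (\<lambda>t. a + t * (b - a)) ` {0..1}"
    then obtain t where "t \<in> {0..1}" and t: "y = a + t * (b - a)" by blast
    then have "0 \<le> t" "t \<le> 1" by auto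
    then have "0 \<le> t * (b - a)" "t * (b - a) \<le> 1 * (b - a)" using ab by (auto intro: mult_left_le_one_le)
    then show "y \<in> {a..b}" using t by simp
  qed
  have "((\<lambda>t. (b - a) *\<^sub>R F (a + t * (b - a))) has_integral (integral {a + 0 * (b - a)..a + 1 * (b - a)} F)) {0..1}"
    by (rule has_integral_substitution[where c = a and d = b, OF _ _ img])
      (use ab in \<open>auto intro!: derivative_eq_intros continuous_on_subset[OF F]\<close>)
  then have "integral {0..1} (\<lambda>t. (b - a) * F (a + t * (b - a))) = integral {a..b} F"
    by (simp add: has_integral_iff)
  then show ?thesis by simp
qed

lemma abs_integral_indicator_le:
  fixes F :: "real \<Rightarrow> real"
  assumes F: "continuous_on UNIV F" and le: "\<And>t. \<bar>F t\<bar> \<le> indicator {c..d} t" and cd: "c \<le> d"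
  shows "\<bar>integral {a..b} F\<bar> \<le> d - c"
proof -
  have "F integrable_on {a..b}" by (intro integrable_continuous_real continuous_on_subset[OF F]) simp
  moreover have "(indicator {c..d} :: real \<Rightarrow> real) integrable_on {a..b}" by (subst integrable_on_indicator) auto
  ultimately have "\<bar>integral {a..b} F\<bar> \<le> integral {a..b} (indicator {c..d})"
    using integral_norm_bound_integral[of F "{a..b}" "indicator {c..d}"] le by simp
  also have "\<dots> = measure lebesgue ({c..d} \<inter> {a..b})"
    by (subst integral_indicator) auto
  also have "\<dots> \<le> measure lebesgue {c..d}" by (intro measure_mono_fmeasurable) auto
  finally show ?thesis using cd by simp
qed

text \<open>A \<open>C1\<close> weight at heights between \<open>h / 4\<close> and
  \<open>3 * h / 4\<close>. It has integral one because the integral of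
  \<open>z\<^sup>2 * (h / 2 - z)\<^sup>2\<close> over \<open>{0..h / 2}\<close> is
  \<open>h ^ 5 / 960\<close>.\<close>

definition profile :: "real \<Rightarrow> real \<Rightarrow> real" where
  "profile h t = 960 / h^5 * ((max 0 (t - h/4))\<^sup>2 * (max 0 (3*h/4 - t))\<^sup>2)"

lemma C1_profile: "C1 D \<Longrightarrow> C1 (\<lambda>x. profile h (D x))"
  unfolding profile_def by (intro C1_cmult C1_mult C1_pos_sq C1_diff C1_const)

lemma continuous_profile: "continuous_on A (profile h)"
  unfolding profile_def[abs_def] by (intro continuous_intros)

lemma profile_nonneg: "0 < h \<Longrightarrow> 0 \<le> profile h t"
  by (simp add: profile_def)

lemma profile_eq_0: "\<not> (h/4 < t \<and> t < 3*h/4) \<Longrightarrow> profile h t = 0"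
  by (auto simp: profile_def max_def)

lemma profile_le:
  assumes h: "0 < h"
  shows "profile h t \<le> 4 / h"
proof (cases "h/4 < t \<and> t < 3*h/4")
  case True
  let ?a = "t - h/4" and ?b = "3*h/4 - t"
  have "?a * ?b = (h/4)\<^sup>2 - (t - h/2)\<^sup>2" by (simp add: power2_eq_square field_simps)
  then have "?a * ?b \<le> (h/4)\<^sup>2" by simp
  moreover have "0 \<le> ?a * ?b" using True by simp
  ultimately have "(?a * ?b)\<^sup>2 \<le> ((h/4)\<^sup>2)\<^sup>2" by (intro power_mono)
  then have "?a\<^sup>2 * ?b\<^sup>2 \<le> h^4 / 256" by (simp add: power_mult_distrib power_divide)
  then have "960 / h^5 * (?a\<^sup>2 * ?b\<^sup>2) \<le> 960 / h^5 * (h^4 / 256)" using h by (intro mult_left_mono) auto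
  also have "\<dots> \<le> 4 / h" using h by (simp add: field_simps eval_nat_numeral)
  finally show ?thesis using True by (simp add: profile_def max_def)
qed (use h profile_eq_0[of h t] in simp)

lemma integral_profile:
  assumes h: "0 < h"
  shows "integral {0..h} (profile h) = 1"
proof -
  \<comment> \<open>An antiderivative of \<open>z\<^sup>2 * (h / 2 - z)\<^sup>2\<close>, taken at
    \<open>z = t - h / 4\<close>.\<close>
  define Q where "Q t = ((h/2)\<^sup>2 * (t - h/4)^3 / 3 - (h/2) * (t - h/4)^4 / 2 + (t - h/4)^5 / 5)" for t
  define P where "P t = 960 / h^5 * Q t" for t
  have "(profile h has_integral (P (3*h/4) - P (h/4))) {h/4..3*h/4}"
  proof (rule fundamental_theorem_of_calculus)
    show "h/4 \<le> 3*h/4" using h by simp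
    fix t assume t: "t \<in> {h/4..3*h/4}"
    have "(P has_real_derivative 960 / h^5 * ((h/2)\<^sup>2 * (3 * (t - h/4)^2) / 3 - (h/2) * (4 * (t - h/4)^3) / 2 + (5 * (t - h/4)^4) / 5)) (at t within {h/4..3*h/4})"
      unfolding P_def by (intro DERIV_cmult) (auto simp: Q_def intro!: derivative_eq_intros)
    also have "960 / h^5 * ((h/2)\<^sup>2 * (3 * (t - h/4)^2) / 3 - (h/2) * (4 * (t - h/4)^3) / 2 + (5 * (t - h/4)^4) / 5) = profile h t"
    proof -
      have "(h/2)\<^sup>2 * (3 * z^2) / 3 - (h/2) * (4 * z^3) / 2 + (5 * z^4) / 5 = z\<^sup>2 * (h/2 - z)\<^sup>2" for z
        by (simp add: power2_eq_square power3_eq_cube power4_eq_xxxx field_simps)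
      from this[of "t - h/4"] show ?thesis using t by (simp add: profile_def max_def)
    qed
    finally show "(P has_vector_derivative profile h t) (at t within {h/4..3*h/4})"
      by (simp add: has_real_derivative_iff_has_vector_derivative)
  qed
  moreover have "P (3*h/4) - P (h/4) = 1"
    using h by (simp add: P_def Q_def field_simps eval_nat_numeral)
  ultimately have "(profile h has_integral 1) {h/4..3*h/4}" by simp
  then have "(profile h has_integral 1) {0..h}"
    by (rule has_integral_on_superset) (use h profile_eq_0 in auto)
  then show ?thesis by (rule integral_unique)
qed

text \<open>\<open>D x\<close> is the height of \<open>x\<close> above the graph
  \<open>D = 0\<close>, measured along the unit vector \<open>e\<close>; the fibres are the lines in
  direction \<open>e\<close>.\<close>

locale graph_coordinate =
  fixes D :: "real^'n \<Rightarrow> real" and e :: "real^'n"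
  assumes C1_D: "C1 D" and D_shift: "\<And>x t. D (x + t *\<^sub>R e) = D x + t" and norm_e: "norm e = 1"
begin

text \<open>From a point at height between \<open>0\<close> and \<open>h\<close> the window reaches
  every height in that range, and its symmetry makes the operator self adjoint.\<close>

definition fibre_integral :: "real \<Rightarrow> (real^'n \<Rightarrow> real) \<Rightarrow> real^'n \<Rightarrow> real" where
  "fibre_integral h s x = integral {-h..h} (\<lambda>m. s (x + m *\<^sub>R e))"

text \<open>The primitive of \<open>f\<close> along the fibre, starting on the graph; it is rescaled
  to \<open>{0..1}\<close> for the sake of \<open>C1_line_integral\<close>.\<close>

definition vertical_primitive :: "(real^'n \<Rightarrow> real) \<Rightarrow> real^'n \<Rightarrow> real" where
  "vertical_primitive f x = D x * integral {0..1} (\<lambda>t. f (x + (- D x + t * D x) *\<^sub>R e))"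

lemma D_line: "D (x + (t - D x) *\<^sub>R e) = t"
  by (simp add: D_shift)

lemma continuous_line: "continuous_on UNIV f \<Longrightarrow> continuous_on A (\<lambda>t. f (x + (a + t * b) *\<^sub>R e))"
  by (rule continuous_on_compose2[of UNIV f]) (auto intro!: continuous_intros)

lemma C1_fibre_integral:
  assumes "C1 s" "0 < h"
  shows "C1 (fibre_integral h s)"
proof -
  have "fibre_integral h s x = (2 * h) * integral {0..1} (\<lambda>t. s (x + (- h + t * (2 * h)) *\<^sub>R e))" for x
    using integral_affine01[OF continuous_line[OF C1_continuous[OF assms(1)], of UNIV x 0 1], of "-h" h] assms(2)
    by (simp add: fibre_integral_def)
  then have "fibre_integral h s = (\<lambda>x. (2 * h) * integral {0..1} (\<lambda>t. s (x + (- h + t * (2 * h)) *\<^sub>R e)))" by blast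
  then show ?thesis
    using C1_cmult[OF C1_line_integral(1)[OF assms(1) C1_const[of "2 * h"] C1_const[of "- h"], of e], of "2 * h"] by simp
qed

text \<open>Because \<open>grad D \<bullet> e = 1\<close>, the derivative along \<open>e\<close> is
  the integral over \<open>{0..1}\<close> of the derivative of \<open>t * f (y t)\<close>, and the
  fundamental theorem leaves \<open>f x\<close>.\<close>

lemma C1_vertical_primitive:
  assumes f: "C1 f"
  shows "C1 (vertical_primitive f)" "grad (vertical_primitive f) x \<bullet> e = f x"
proof -
  define G where "G x = integral {0..1} (\<lambda>t. f (x + (- D x + t * D x) *\<^sub>R e))" for x
  have CG: "C1 G" unfolding G_def
    using C1_line_integral(1)[OF f C1_D C1_minus[OF C1_D]] by simp
  have gD: "grad D x \<bullet> e = 1"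
  proof -
    have "((\<lambda>t. D x + t) has_real_derivative 1) (at 0)" by (auto intro!: derivative_eq_intros)
    moreover have "((\<lambda>t. D x + t) has_real_derivative grad D x \<bullet> e) (at 0)"
      using C1_line_deriv[OF C1_D, of x e 0] unfolding D_shift by simp
    ultimately show ?thesis by (rule DERIV_unique[symmetric])
  qed
  have gmD: "grad (\<lambda>x. - D x) x \<bullet> e = - 1"
    using grad_cmult[OF C1_D, of "-1"] gD by simp
  have eq: "vertical_primitive f = (\<lambda>x. D x * G x)" by (simp add: vertical_primitive_def G_def fun_eq_iff)
  show "C1 (vertical_primitive f)" unfolding eq by (intro C1_mult C1_D CG)
  have gG: "grad G x \<bullet> e = integral {0..1} (\<lambda>t. grad f (x + (- D x + t * D x) *\<^sub>R e) \<bullet> (t *\<^sub>R e))"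
    unfolding G_def C1_line_integral(2)[OF f C1_D C1_minus[OF C1_D]] gD gmD by (simp add: algebra_simps)
  define y where "y t = x + (- D x + t * D x) *\<^sub>R e" for t
  have ftc: "((\<lambda>t. f (y t) + D x * (grad f (y t) \<bullet> (t *\<^sub>R e))) has_integral (1 * f (y 1) - 0 * f (y 0))) {0..1}"
  proof (rule fundamental_theorem_of_calculus)
    fix t :: real
    have "((\<lambda>t. y t) has_derivative (\<lambda>h. (h * D x) *\<^sub>R e)) (at t)"
      unfolding y_def by (auto intro!: derivative_eq_intros)
    from has_derivative_compose[OF this C1_has_derivative[OF f]]
    have "((\<lambda>t. f (y t)) has_real_derivative (D x * (grad f (y t) \<bullet> e))) (at t)"
      by (simp add: has_field_derivative_def mult.assoc mult_commute_abs)
    from DERIV_mult[OF DERIV_ident this]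
    have "((\<lambda>t. t * f (y t)) has_real_derivative (f (y t) + D x * (grad f (y t) \<bullet> (t *\<^sub>R e)))) (at t)"
      by (simp add: algebra_simps)
    then show "((\<lambda>t. t * f (y t)) has_vector_derivative (f (y t) + D x * (grad f (y t) \<bullet> (t *\<^sub>R e)))) (at t within {0..1})"
      by (simp add: has_real_derivative_iff_has_vector_derivative has_vector_derivative_at_within)
  qed simp
  have i1: "(\<lambda>t. f (y t)) integrable_on {0..1}"
    unfolding y_def by (intro integrable_continuous_real continuous_line C1_continuous f)
  have i2: "(\<lambda>t. grad f (y t) \<bullet> (t *\<^sub>R e)) integrable_on {0..1}"
    unfolding y_def
    by (intro integrable_continuous_real continuous_intros continuous_on_compose2[OF C1_continuous_grad[OF f]]) auto
  have "grad (vertical_primitive f) x \<bullet> e = G x + D x * (grad G x \<bullet> e)"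
    unfolding eq by (simp add: grad_mult C1_D CG inner_add_left gD)
  also have "\<dots> = integral {0..1} (\<lambda>t. f (y t)) + D x * integral {0..1} (\<lambda>t. grad f (y t) \<bullet> (t *\<^sub>R e))"
    unfolding gG by (simp add: G_def y_def)
  also have "\<dots> = integral {0..1} (\<lambda>t. f (y t) + D x * (grad f (y t) \<bullet> (t *\<^sub>R e)))"
    using integral_add[OF i1 integrable_cmul[OF i2, of "D x"]] by simp
  also have "\<dots> = f (y 1)" using ftc by (simp add: has_integral_iff)
  finally show "grad (vertical_primitive f) x \<bullet> e = f x" by (simp add: y_def)
qed

lemma vertical_primitive_eq:
  assumes "continuous_on UNIV f" "0 \<le> D x"
  shows "vertical_primitive f x = integral {0..D x} (\<lambda>t. f (x + (t - D x) *\<^sub>R e))"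
  using integral_affine01[OF continuous_line[OF assms(1), of UNIV x "- D x" 1], of 0 "D x"] assms(2)
  by (simp add: vertical_primitive_def algebra_simps)

end

section \<open>Fubini along fibres\<close>

lemma slab_integrable:
  fixes H :: "real \<Rightarrow> real^'n \<Rightarrow> real"
  assumes H: "continuous_on UNIV (\<lambda>z. H (fst z) (snd z))"
    and R: "\<And>m x. m \<in> {-h..h} \<Longrightarrow> R < norm x \<Longrightarrow> H m x = 0"
  shows "integrable (lborel \<Otimes>\<^sub>M lborel) (\<lambda>(m, x). indicator {-h..h} m * H m x)"
proof -
  have "integrable lborel (\<lambda>z. indicator ({-h..h} \<times> cball (0::real^'n) R) z *\<^sub>R H (fst z) (snd z))"
    by (intro borel_integrable_compact compact_Times continuous_on_subset[OF H]) auto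
  moreover have "(\<lambda>z. indicator ({-h..h} \<times> cball (0::real^'n) R) z *\<^sub>R H (fst z) (snd z)) = (\<lambda>(m, x). indicator {-h..h} m * H m x)"
    using R by (auto simp: fun_eq_iff indicator_def not_le)
  ultimately show ?thesis by (simp add: lborel_prod)
qed

lemma slab_Fubini:
  fixes H :: "real \<Rightarrow> real^'n \<Rightarrow> real"
  assumes H: "continuous_on UNIV (\<lambda>z. H (fst z) (snd z))"
    and R: "\<And>m x. m \<in> {-h..h} \<Longrightarrow> R < norm x \<Longrightarrow> H m x = 0"
  shows "(\<integral>x. integral {-h..h} (\<lambda>m. H m x) \<partial>lborel) = (\<integral>m. indicator {-h..h} m * (\<integral>x. H m x \<partial>lborel) \<partial>lborel)"
proof -
  have "integral {-h..h} (\<lambda>m. H m x) = (\<integral>m. indicator {-h..h} m * H m x \<partial>lborel)" for x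
  proof -
    have "continuous_on {-h..h} (\<lambda>m. H m x)"
    proof -
      have "continuous_on {-h..h} (\<lambda>m. (m, x))" by (intro continuous_intros)
      from continuous_on_compose2[OF H this] show ?thesis by simp
    qed
    from set_borel_integral_eq_integral(2)[OF borel_integrable_atLeastAtMost'[OF this]] show ?thesis
      by (simp add: set_lebesgue_integral_def)
  qed
  then have "(\<integral>x. integral {-h..h} (\<lambda>m. H m x) \<partial>lborel) = (\<integral>x. \<integral>m. indicator {-h..h} m * H m x \<partial>lborel \<partial>lborel)" by simp
  also have "\<dots> = (\<integral>m. \<integral>x. indicator {-h..h} m * H m x \<partial>lborel \<partial>lborel)"
    by (rule lborel_pair.Fubini_integral) (rule slab_integrable[OF H R])
  finally show ?thesis by simp
qed

context graph_coordinate
begin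

lemma continuous_D: "continuous_on A D"
  using C1_D by (rule C1_continuous)

lemma continuous_fibre_integral:
  assumes "continuous_on UNIV G"
  shows "continuous_on UNIV (fibre_integral h G)"
proof -
  have "continuous_on UNIV (\<lambda>x. integral (cbox (-h) h) (\<lambda>m. G (x + m *\<^sub>R e)))"
    unfolding fibre_integral_def[abs_def]
    by (intro integral_continuous_on_param)
      (auto simp: split_beta intro!: continuous_on_compose2[OF assms] continuous_intros)
  then show ?thesis by (simp add: fibre_integral_def[abs_def])
qed

text \<open>Fubini and a translation by \<open>m *\<^sub>R e\<close> move the shift from
  \<open>G\<close> to \<open>s\<close>; reflecting the symmetric window restores its sign.\<close>

lemma fibre_integral_adjoint:
  assumes G: "continuous_on UNIV G" and s: "continuous_on UNIV s" "compactly_supported s"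
  shows "(\<integral>x. fibre_integral h G x * s x \<partial>lborel) = (\<integral>x. G x * fibre_integral h s x \<partial>lborel)"
proof -
  obtain R where R: "\<And>x. norm x > R \<Longrightarrow> s x = 0" using s(2) compactly_supported_ball by blast
  have [measurable]: "G \<in> borel_measurable borel" "s \<in> borel_measurable borel"
    using G s by (auto intro: borel_measurable_continuous_onI)
  have eq: "fibre_integral h G x * s x = integral {-h..h} (\<lambda>m. G (x + m *\<^sub>R e) * s x)" for x
    by (simp add: fibre_integral_def)
  have "(\<integral>x. fibre_integral h G x * s x \<partial>lborel) = (\<integral>x. integral {-h..h} (\<lambda>m. G (x + m *\<^sub>R e) * s x) \<partial>lborel)"
    by (simp only: eq)
  also have "\<dots> = (\<integral>m. indicator {-h..h} m * (\<integral>x. G (x + m *\<^sub>R e) * s x \<partial>lborel) \<partial>lborel)"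
    by (rule slab_Fubini[where R = R])
      (auto simp: R intro!: continuous_intros continuous_on_compose2[OF G] continuous_on_compose2[OF s(1)])
  also have "(\<lambda>m. \<integral>x. G (x + m *\<^sub>R e) * s x \<partial>lborel) = (\<lambda>m. \<integral>y. G y * s (y - m *\<^sub>R e) \<partial>lborel)"
  proof
    fix m
    show "(\<integral>x. G (x + m *\<^sub>R e) * s x \<partial>lborel) = (\<integral>y. G y * s (y - m *\<^sub>R e) \<partial>lborel)"
      using lborel_integral_translate[of "\<lambda>y. G y * s (y - m *\<^sub>R e)" "m *\<^sub>R e"] by simp
  qed
  also have "(\<integral>m. indicator {-h..h} m * (\<integral>y. G y * s (y - m *\<^sub>R e) \<partial>lborel) \<partial>lborel) = (\<integral>y. integral {-h..h} (\<lambda>m. G y * s (y - m *\<^sub>R e)) \<partial>lborel)"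
  proof (rule slab_Fubini[where R = "R + \<bar>h\<bar>", symmetric])
    show "continuous_on UNIV (\<lambda>z. G (snd z) * s (snd z - fst z *\<^sub>R e))"
      by (intro continuous_intros continuous_on_compose2[OF G] continuous_on_compose2[OF s(1)]) auto
    fix m :: real and x :: "real^'n" assume m: "m \<in> {-h..h}" and x: "R + \<bar>h\<bar> < norm x"
    have "norm x \<le> norm (x - m *\<^sub>R e) + norm (m *\<^sub>R e)" using norm_triangle_ineq[of "x - m *\<^sub>R e" "m *\<^sub>R e"] by simp
    also have "norm (m *\<^sub>R e) \<le> \<bar>h\<bar>" using m norm_e by auto
    finally show "G x * s (x - m *\<^sub>R e) = 0" using x R by simp
  qed
  also have "(\<lambda>y. integral {-h..h} (\<lambda>m. G y * s (y - m *\<^sub>R e))) = (\<lambda>y. G y * fibre_integral h s y)"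
  proof
    fix y
    have "integral {-h..h} (\<lambda>m. s (y - m *\<^sub>R e)) = integral {-h..h} (\<lambda>m. s (y + m *\<^sub>R e))"
      using Henstock_Kurzweil_Integration.integral_reflect_real[of h "-h" "\<lambda>m. s (y + m *\<^sub>R e)"] by simp
    then show "integral {-h..h} (\<lambda>m. G y * s (y - m *\<^sub>R e)) = G y * fibre_integral h s y"
      by (simp add: fibre_integral_def)
  qed
  finally show ?thesis .
qed

text \<open>Subtracting the multiple of \<open>profile h (D x)\<close> with the same integral along the fibre makes
  the vertical primitive of \<open>f\<close> compactly supported, so that it is a test function whose
  derivative in direction \<open>e\<close> is \<open>f\<close>.\<close>

lemma column_test_function:
  assumes K: "\<And>x t. x \<in> K \<Longrightarrow> x + t *\<^sub>R e \<in> K" and \<rho>: "0 < \<rho>" "\<rho> \<le> h"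
    and s: "C1 s" "compact_support_in {x \<in> K. 0 < D x \<and> D x < \<rho>} s" "\<And>x. \<bar>s x\<bar> \<le> 1"
  defines "f \<equiv> \<lambda>x. s x - profile h (D x) * fibre_integral h s x"
  shows "compact_support_in {x \<in> K. 0 < D x \<and> D x < h} (vertical_primitive f)"
    "\<bar>vertical_primitive f x\<bar> \<le> \<rho>" "\<bar>fibre_integral h s x\<bar> \<le> \<rho>" "fibre_integral h s x \<noteq> 0 \<Longrightarrow> x \<in> K" "C1 f"
proof -
  have h: "0 < h" using \<rho> by linarith
  obtain C where C: "compact C" "C \<subseteq> {x \<in> K. 0 < D x \<and> D x < \<rho>}" "\<And>x. x \<notin> C \<Longrightarrow> s x = 0"
    using compact_support_in_ex[OF s(2)] by auto
  have cs: "continuous_on UNIV s" by (rule C1_continuous[OF s(1)])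
  show Cf: "C1 f" unfolding f_def by (intro C1_diff C1_mult s C1_profile C1_D C1_fibre_integral h)
  \<comment> \<open>The function \<open>s\<close> on the fibre of \<open>x\<close>, parametrised by
    height and not by distance from \<open>x\<close>.\<close>
  define l where "l x t = s (x + (t - D x) *\<^sub>R e)" for x t
  have cl: "continuous_on A (l x)" for A x
    unfolding l_def[abs_def] by (intro continuous_on_compose2[OF cs] continuous_intros) auto
  have l_int: "l x integrable_on {a..b}" for x a b by (intro integrable_continuous_real cl)
  have lC: "x + (t - D x) *\<^sub>R e \<in> C" if "l x t \<noteq> 0" for x t using that C(3) by (auto simp: l_def)
  have lb: "0 < t \<and> t < \<rho>" if "l x t \<noteq> 0" for x t
    using lC[OF that] C(2) D_line[of x t] by auto
  have l_le: "\<bar>l x t\<bar> \<le> indicator {0..\<rho>} t" for x t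
    using lb[of x t] s(3)[of "x + (t - D x) *\<^sub>R e"] by (cases "l x t = 0") (auto simp: l_def)
  have intl_le: "\<bar>integral {a..b} (l x)\<bar> \<le> \<rho>" for a b x
    using abs_integral_indicator_le[OF cl[where x = x] l_le[where x = x], where a = a and b = b] \<rho> by simp
  have fib: "fibre_integral h s x = integral {D x - h..D x + h} (l x)" for x
  proof -
    have "integral {-h..h} (l x \<circ> (\<lambda>m. m + D x)) = integral {-h + D x..h + D x} (l x)" by (rule integral_shift) (rule cl)
    then show ?thesis by (simp add: fibre_integral_def l_def o_def add.commute)
  qed
  show "\<bar>fibre_integral h s x\<bar> \<le> \<rho>" unfolding fib by (rule intl_le)
  have fibK: "x \<in> K" if "fibre_integral h s x \<noteq> 0" for x
  proof -
    have "\<exists>t. l x t \<noteq> 0" using that unfolding fib by (metis integral_0 integral_cong)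
    then obtain t where "x + (t - D x) *\<^sub>R e \<in> K" using lC C(2) by blast
    from K[OF this, of "D x - t"] show ?thesis by (simp flip: scaleR_left.add add: add.assoc)
  qed
  then show "fibre_integral h s x \<noteq> 0 \<Longrightarrow> x \<in> K" .
  \<comment> \<open>On each fibre \<open>s\<close> is carried by heights between \<open>0\<close>
    and \<open>\<rho>\<close>, so all intervals containing these give the same integral.\<close>
  have super: "integral {a..b} (l x) = integral {0..h} (l x)" if "a \<le> 0" "\<rho> \<le> b" for a b x
  proof -
    have "(l x has_integral integral {0..h} (l x)) {0..h}" using l_int by (rule integrable_integral)
    then have 1: "(l x has_integral integral {0..h} (l x)) {min a 0..max b h}"
      by (rule has_integral_on_superset) (use lb[of x] \<rho> in force)+
    have "(l x has_integral integral {a..b} (l x)) {a..b}" using l_int by (rule integrable_integral)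
    then have 2: "(l x has_integral integral {a..b} (l x)) {min a 0..max b h}"
      by (rule has_integral_on_superset) (use lb[of x] that in force)+
    show ?thesis using 1 2 has_integral_unique by blast
  qed
  define T where "T x = integral {0..h} (l x)" for x
  have l_shift: "l (x + (t - D x) *\<^sub>R e) = l x" for x t
  proof
    fix t'
    have "(x + (t - D x) *\<^sub>R e) + (t' - D (x + (t - D x) *\<^sub>R e)) *\<^sub>R e = x + (t' - D x) *\<^sub>R e"
      unfolding D_line by (simp add: scaleR_diff_left)
    then show "l (x + (t - D x) *\<^sub>R e) t' = l x t'" by (simp only: l_def)
  qed
  have fline: "f (x + (t - D x) *\<^sub>R e) = l x t - profile h t * T x" if "0 \<le> t" for x t
  proof (cases "t \<le> h")
    case True
    have "fibre_integral h s (x + (t - D x) *\<^sub>R e) = T x"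
      unfolding fib l_shift D_line T_def using True that \<rho> by (intro super) auto
    then show ?thesis by (simp add: f_def D_line l_def)
  next
    case False
    then have "profile h t = 0" using h by (intro profile_eq_0) auto
    then show ?thesis by (simp add: f_def D_line l_def)
  qed
  have p_int: "profile h integrable_on {a..b}" for a b by (intro integrable_continuous_real continuous_profile)
  have vp: "vertical_primitive f x = integral {0..D x} (l x) - T x * integral {0..D x} (profile h)" if "0 \<le> D x" for x
  proof -
    have "vertical_primitive f x = integral {0..D x} (\<lambda>t. f (x + (t - D x) *\<^sub>R e))"
      using Cf that by (intro vertical_primitive_eq C1_continuous)
    also have "\<dots> = integral {0..D x} (\<lambda>t. l x t - T x * profile h t)"
      by (intro integral_cong) (simp add: fline)
    also have "\<dots> = integral {0..D x} (l x) - T x * integral {0..D x} (profile h)"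
      using integral_diff[OF l_int integrable_cmul[OF p_int, of "T x"]] by simp
    finally show ?thesis .
  qed
  have vneg: "vertical_primitive f x = 0" if "D x \<le> 0" for x
  proof -
    have "f (x + (- D x + t * D x) *\<^sub>R e) = 0" if t: "t \<in> {0..1}" for t
    proof -
      have tD: "t * D x \<le> 0" using t \<open>D x \<le> 0\<close> by (simp add: mult_nonneg_nonpos)
      have pt: "x + (- D x + t * D x) *\<^sub>R e = x + (t * D x - D x) *\<^sub>R e" by simp
      have "l x (t * D x) = 0" using lb[of x "t * D x"] tD by auto
      moreover have "profile h (t * D x) = 0" using tD h by (intro profile_eq_0) auto
      ultimately show ?thesis unfolding pt f_def D_line by (simp add: l_def)
    qed
    then have "integral {0..1} (\<lambda>t. f (x + (- D x + t * D x) *\<^sub>R e)) = integral {0..1} (\<lambda>t::real. 0)" by (intro integral_cong)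
    then show ?thesis by (simp add: vertical_primitive_def)
  qed
  have p1: "integral {0..b} (profile h) = 1" if "3 * h / 4 \<le> b" for b
  proof -
    have "(profile h has_integral integral {0..h} (profile h)) {0..h}" using p_int by (rule integrable_integral)
    then have 1: "(profile h has_integral 1) {0..max b h}"
      unfolding integral_profile[OF h] by (rule has_integral_on_superset) (use profile_eq_0[of h] h in auto)
    have "(profile h has_integral integral {0..b} (profile h)) {0..b}" using p_int by (rule integrable_integral)
    then have 2: "(profile h has_integral integral {0..b} (profile h)) {0..max b h}"
      by (rule has_integral_on_superset) (use profile_eq_0[of h] that h in auto)
    show ?thesis using 1 2 has_integral_unique by blast
  qed
  \<comment> \<open>With \<open>k\<close> the profile integral up to height \<open>D x\<close>, the
    value is \<open>1 - k\<close> times the mass of \<open>s\<close> below minus \<open>k\<close>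
    times the mass above. Both masses are at most \<open>\<rho>\<close> in absolute value, whence
    the bound by \<open>\<rho>\<close>.\<close>
  have split: "vertical_primitive f x = (1 - integral {0..D x} (profile h)) * integral {0..D x} (l x)
      - integral {0..D x} (profile h) * integral {D x..h} (l x)" if "0 \<le> D x" "D x \<le> h" for x
  proof -
    have "T x = integral {0..D x} (l x) + integral {D x..h} (l x)"
      unfolding T_def using Henstock_Kurzweil_Integration.integral_combine[OF that l_int] by simp
    then show ?thesis using vp[OF that(1)] by (simp add: algebra_simps)
  qed
  have vbig: "vertical_primitive f x = 0" if "h \<le> D x" for x
    using vp[of x] super[of 0 "D x" x] p1[of "D x"] that h \<rho> by (simp add: T_def)
  show "\<bar>vertical_primitive f x\<bar> \<le> \<rho>"
  proof (cases "0 \<le> D x \<and> D x \<le> h")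
    case True
    define k where "k = integral {0..D x} (profile h)"
    have "0 \<le> k" unfolding k_def using profile_nonneg[OF h] by (intro integral_nonneg p_int)
    moreover have "k \<le> integral {0..h} (profile h)" unfolding k_def
      using True profile_nonneg[OF h] by (intro integral_subset_le p_int) auto
    ultimately have k: "0 \<le> k" "k \<le> 1" using integral_profile[OF h] by auto
    have "\<bar>vertical_primitive f x\<bar> \<le> \<bar>(1 - k) * integral {0..D x} (l x)\<bar> + \<bar>k * integral {D x..h} (l x)\<bar>"
      using split[of x] True unfolding k_def by linarith
    also have "\<dots> \<le> (1 - k) * \<rho> + k * \<rho>"
      using k intl_le by (intro add_mono) (auto simp: abs_mult intro!: mult_left_mono)
    finally show ?thesis by (simp add: algebra_simps)
  next
    case False
    then show ?thesis using vneg[of x] vbig[of x] \<rho> by auto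
  qed
  show "compact_support_in {x \<in> K. 0 < D x \<and> D x < h} (vertical_primitive f)"
  proof (cases "C = {}")
    case True
    then have "s x = 0" for x using C(3) by auto
    then have "vertical_primitive f x = 0" for x
      by (simp add: vertical_primitive_def f_def fibre_integral_def)
    then show ?thesis by (intro compact_support_inI[of "{}"]) auto
  next
    case False
    obtain a where a: "a \<in> C" "\<And>y. y \<in> C \<Longrightarrow> D a \<le> D y" using continuous_attains_inf[OF C(1) False continuous_D] by auto
    obtain b where b: "b \<in> C" "\<And>y. y \<in> C \<Longrightarrow> D y \<le> D b" using continuous_attains_sup[OF C(1) False continuous_D] by auto
    \<comment> \<open>\<open>t1\<close> and \<open>t2\<close> enclose the heights of
      \<open>C\<close> and of the profile; sweeping \<open>C\<close> along its fibres between them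
      gives a compact set carrying the primitive.\<close>
    define t1 where "t1 = min (D a) (h/4)"
    define t2 where "t2 = max (D b) (3*h/4)"
    have t12: "0 < t1" "t2 < h" using a(1) b(1) C(2) h \<rho> by (auto simp: t1_def t2_def)
    define M where "M = (\<lambda>z. fst z + (snd z - D (fst z)) *\<^sub>R e) ` (C \<times> {t1..t2})"
    have M: "compact M" unfolding M_def
      by (intro compact_continuous_image compact_Times C(1) compact_Icc continuous_intros continuous_on_compose2[OF continuous_D[of UNIV]]) auto
    have MU: "M \<subseteq> {x \<in> K. 0 < D x \<and> D x < h}"
      using C(2) t12 by (auto simp: M_def D_line intro!: K)
    have "x \<in> M" if nz: "vertical_primitive f x \<noteq> 0" for x
    proof -
      have Dx: "0 < D x" "D x < h" using nz vneg[of x] vbig[of x] by linarith+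
      have ltb: "D a \<le> t \<and> t \<le> D b" if "l x t \<noteq> 0" for t
        using a(2)[OF lC[OF that]] b(2)[OF lC[OF that]] D_line[of x t] by simp
      have "\<exists>t. l x t \<noteq> 0"
      proof (rule ccontr)
        assume "\<nexists>t. l x t \<noteq> 0"
        then have "l x = (\<lambda>_. 0)" by auto
        then show False using nz vp[of x] Dx by (simp add: T_def)
      qed
      then obtain t where t: "x + (t - D x) *\<^sub>R e \<in> C" using lC by blast
      have "t1 \<le> D x"
      proof (rule ccontr)
        assume lt: "\<not> t1 \<le> D x"
        have "integral {0..D x} (l x) = integral {0..D x} (\<lambda>_. 0)"
          using ltb lt by (intro integral_cong) (force simp: t1_def)
        moreover have "integral {0..D x} (profile h) = integral {0..D x} (\<lambda>_. 0)"
          using lt by (intro integral_cong profile_eq_0) (auto simp: t1_def)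
        ultimately show False using nz vp[of x] Dx by simp
      qed
      moreover have "D x \<le> t2"
      proof (rule ccontr)
        assume lt: "\<not> D x \<le> t2"
        have "integral {D x..h} (l x) = integral {D x..h} (\<lambda>_. 0)"
          using ltb lt by (intro integral_cong) (force simp: t2_def)
        moreover have "integral {0..D x} (profile h) = 1" using lt by (intro p1) (auto simp: t2_def)
        ultimately show False using nz split[of x] Dx by simp
      qed
      ultimately have mem: "(x + (t - D x) *\<^sub>R e, D x) \<in> C \<times> {t1..t2}" using t by simp
      have "x = (x + (t - D x) *\<^sub>R e) + (D x - D (x + (t - D x) *\<^sub>R e)) *\<^sub>R e"
        unfolding D_line by (simp add: scaleR_diff_left)
      then show ?thesis unfolding M_def by (intro image_eqI[OF _ mem]) (simp only: fst_conv snd_conv)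
    qed
    then show ?thesis using M MU by (intro compact_support_inI[of M]) auto
  qed
qed

end

section \<open>Approximation by a continuous function in a thin layer of a column\<close>

lemma integrable_indicator_continuous:
  fixes g :: "real^'n \<Rightarrow> real"
  assumes U: "U \<in> sets borel" "bounded U" and g: "continuous_on UNIV g"
  shows "integrable lborel (\<lambda>x. indicator U x * g x)"
proof -
  have "integrable lborel (\<lambda>x. indicator (closure U) x *\<^sub>R g x)"
    using U by (intro borel_integrable_compact continuous_on_subset[OF g]) auto
  from integrable_mult_indicator[OF _ this, of U] U
  have "integrable lborel (\<lambda>x. indicator U x *\<^sub>R (indicator (closure U) x *\<^sub>R g x))" by simp
  moreover have "(\<lambda>x. indicator U x *\<^sub>R (indicator (closure U) x *\<^sub>R g x)) = (\<lambda>x. indicator U x * g x)"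
    using closure_subset[of U] by (auto simp: fun_eq_iff indicator_def)
  ultimately show ?thesis by simp
qed

context graph_coordinate
begin

text \<open>At heights between \<open>0\<close> and \<open>h\<close> this is the mean of
  \<open>g\<close> over the fibre with weight \<open>profile h\<close>. In this form it is the
  adjoint of the correction subtracted in \<open>column_test_function\<close>.\<close>

definition smoothed :: "real \<Rightarrow> (real^'n \<Rightarrow> real) \<Rightarrow> real^'n \<Rightarrow> real" where
  "smoothed h g = fibre_integral h (\<lambda>y. profile h (D y) * g y)"

lemma continuous_smoothed: "continuous_on UNIV g \<Longrightarrow> continuous_on UNIV (smoothed h g)"
  unfolding smoothed_def
  by (intro continuous_fibre_integral continuous_intros continuous_on_compose2[OF continuous_profile continuous_D]) auto

text \<open>Tested with \<open>s\<close>, the difference \<open>w - smoothed h g\<close> equals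
  \<open>w\<close> tested with the \<open>e\<close> derivative of a function of size
  \<open>\<rho>\<close>, which the variation controls, plus \<open>w - g\<close> tested with a
  correction of size at most \<open>4 / h * \<rho>\<close>. The factor \<open>\<rho>\<close> is the
  thickness of the layer: what remains is a bound for a mean across the layer.\<close>

lemma column_estimate:
  fixes w g :: "real^'n \<Rightarrow> real"
  assumes K: "open K" "\<And>x t. x \<in> K \<Longrightarrow> x + t *\<^sub>R e \<in> K" and \<rho>: "0 < \<rho>" "\<rho> \<le> h"
    and bdd: "bounded {x \<in> K. 0 < D x \<and> D x < h}" and w: "integrable lborel w"
    and V: "variation_le {x \<in> K. 0 < D x \<and> D x < h} w V" and g: "continuous_on UNIV g"
  shows "(\<integral>x. indicator {x \<in> K. 0 < D x \<and> D x < \<rho>} x * \<bar>w x - smoothed h g x\<bar> \<partial>lborel)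
    \<le> \<rho> * (V + 4 / h * (\<integral>x. indicator {x \<in> K. 0 < D x \<and> D x < h} x * \<bar>w x - g x\<bar> \<partial>lborel))"
proof -
  define U where "U = {x \<in> K. 0 < D x \<and> D x < h}"
  define U\<rho> where "U\<rho> = {x \<in> K. 0 < D x \<and> D x < \<rho>}"
  have h: "0 < h" using \<rho> by linarith
  have Uop: "open {x \<in> K. 0 < D x \<and> D x < b}" for b
  proof -
    have "open {x. 0 < D x}" "open {x. D x < b}" by (intro open_Collect_less continuous_intros continuous_D)+
    then have "open (K \<inter> ({x. 0 < D x} \<inter> {x. D x < b}))" using K(1) by (intro open_Int)
    then show ?thesis by (simp add: Int_def conj_ac)
  qed
  have sub: "U\<rho> \<subseteq> U" using \<rho> by (auto simp: U\<rho>_def U_def)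
  have Ub: "bounded U" "bounded U\<rho>" using bdd sub bounded_subset[of U U\<rho>] by (auto simp: U_def)
  have Ubor: "U \<in> sets borel" using Uop by (auto simp: U_def)
  define W where "W = smoothed h g"
  have cW: "continuous_on UNIV W" unfolding W_def using g by (rule continuous_smoothed)
  have wU: "integrable lborel (\<lambda>x. indicator U x * w x)"
    using integrable_mult_indicator[of U lborel w] Ubor w by simp
  have diffU: "integrable lborel (\<lambda>x. indicator U x * (w x - f x))" if "continuous_on UNIV f" for f
    using Bochner_Integration.integrable_diff[OF wU integrable_indicator_continuous[OF Ubor Ub(1) that]] by (simp add: right_diff_distrib)
  define v where "v x = indicator U x * (w x - W x)" for x
  have v: "integrable lborel v" unfolding v_def by (rule diffU[OF cW])
  define Bd where "Bd = V + 4 / h * (\<integral>x. indicator U x * \<bar>w x - g x\<bar> \<partial>lborel)"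
  have "(\<integral>x. indicator U\<rho> x * \<bar>v x\<bar> \<partial>lborel) \<le> \<rho> * Bd"
  proof (rule L1_norm_le_by_duality[OF v _ Ub(2)])
    show "open U\<rho>" unfolding U\<rho>_def by (rule Uop)
    fix s :: "real^'n \<Rightarrow> real"
    assume s: "C1 s" "compact_support_in U\<rho> s" "\<And>x. \<bar>s x\<bar> \<le> 1"
    define \<Sigma> where "\<Sigma> = fibre_integral h s"
    define f where "f x = s x - profile h (D x) * \<Sigma> x" for x
    note T = column_test_function[OF K(2) \<rho> s(1) s(2)[unfolded U\<rho>_def] s(3), folded \<Sigma>_def, folded f_def[abs_def], folded U_def]
    have css: "compactly_supported s" using s(2) by (rule compact_support_in_mono) simp
    have cs: "continuous_on UNIV s" using s(1) by (rule C1_continuous)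
    have c\<Sigma>: "continuous_on UNIV \<Sigma>" unfolding \<Sigma>_def by (intro C1_continuous C1_fibre_integral s h)
    have cp: "continuous_on UNIV (\<lambda>x. profile h (D x))"
      by (rule continuous_on_compose2[OF continuous_profile continuous_D]) auto
    have pU: "x \<in> U" if "profile h (D x) * \<Sigma> x \<noteq> 0" for x
    proof -
      have "h/4 < D x \<and> D x < 3*h/4" using that profile_eq_0[of h "D x"] by auto
      then show ?thesis using that T(4)[of x] h by (auto simp: U_def)
    qed
    have csp: "compactly_supported (\<lambda>x. profile h (D x) * \<Sigma> x)"
    proof (rule compact_support_inI[of "closure U"])
      show "compact (closure U)" using Ub(1) by simp
      show "profile h (D x) * \<Sigma> x = 0" if "x \<notin> closure U" for x using that pU[of x] closure_subset[of U] by auto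
    qed simp
    have csgp: "compactly_supported (\<lambda>x. g x * (profile h (D x) * \<Sigma> x))"
      by (rule compact_support_in_cong[OF csp]) simp
    have i1: "integrable lborel (\<lambda>x. w x * s x)" by (rule integrable_mult_cs[OF w cs css])
    have i2: "integrable lborel (\<lambda>x. w x * (profile h (D x) * \<Sigma> x))"
      by (intro integrable_mult_cs[OF w] csp continuous_intros cp c\<Sigma>)
    have i3: "integrable lborel (\<lambda>x. g x * (profile h (D x) * \<Sigma> x))"
      by (intro continuous_cs_integrable csgp continuous_intros cp c\<Sigma> g)
    have i4: "integrable lborel (\<lambda>x. W x * s x)"
      by (intro continuous_cs_integrable continuous_intros cW cs compact_support_mult_right[OF css])
    have vs: "v x * s x = w x * s x - W x * s x" for x
    proof (cases "x \<in> U")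
      case False
      then have "s x = 0" using sub compact_support_in_ex[OF s(2)] by blast
      then show ?thesis by simp
    qed (simp add: v_def left_diff_distrib)
    have adj: "(\<integral>x. W x * s x \<partial>lborel) = (\<integral>x. g x * (profile h (D x) * \<Sigma> x) \<partial>lborel)"
    proof -
      have "(\<integral>x. W x * s x \<partial>lborel) = (\<integral>x. (profile h (D x) * g x) * fibre_integral h s x \<partial>lborel)"
        unfolding W_def smoothed_def by (intro fibre_integral_adjoint continuous_intros cp g cs css)
      then show ?thesis by (simp add: \<Sigma>_def mult_ac)
    qed
    have gv: "grad (vertical_primitive f) x \<bullet> e = f x" for x by (rule C1_vertical_primitive(2)[OF T(5)])
    have "(\<integral>x. w x * (grad (vertical_primitive f) x \<bullet> e) \<partial>lborel) \<le> \<rho> * V"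
      by (rule variation_le_scalar[OF V[folded U_def] C1_vertical_primitive(1)[OF T(5)] T(1)]) (use T(2) norm_e in auto)
    then have wf: "(\<integral>x. w x * f x \<partial>lborel) \<le> \<rho> * V" by (simp add: gv)
    have wf_eq: "(\<integral>x. w x * f x \<partial>lborel) = (\<integral>x. w x * s x \<partial>lborel) - (\<integral>x. w x * (profile h (D x) * \<Sigma> x) \<partial>lborel)"
      using Bochner_Integration.integral_diff[OF i1 i2] by (simp add: f_def right_diff_distrib)
    have ig: "integrable lborel (\<lambda>x. indicator U x * \<bar>w x - g x\<bar>)"
      using integrable_abs[OF diffU[OF g]] by (simp add: abs_mult)
    have "(\<integral>x. w x * (profile h (D x) * \<Sigma> x) \<partial>lborel) - (\<integral>x. g x * (profile h (D x) * \<Sigma> x) \<partial>lborel)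
        = (\<integral>x. (w x - g x) * (profile h (D x) * \<Sigma> x) \<partial>lborel)"
      using Bochner_Integration.integral_diff[OF i2 i3] by (simp add: left_diff_distrib)
    also have "\<dots> \<le> (\<integral>x. 4 / h * \<rho> * (indicator U x * \<bar>w x - g x\<bar>) \<partial>lborel)"
    proof (rule integral_mono)
      show "integrable lborel (\<lambda>x. (w x - g x) * (profile h (D x) * \<Sigma> x))"
        using Bochner_Integration.integrable_diff[OF i2 i3] by (simp add: left_diff_distrib)
      show "integrable lborel (\<lambda>x. 4 / h * \<rho> * (indicator U x * \<bar>w x - g x\<bar>))" using ig by (rule integrable_mult_right)
      fix x
      show "(w x - g x) * (profile h (D x) * \<Sigma> x) \<le> 4 / h * \<rho> * (indicator U x * \<bar>w x - g x\<bar>)"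
      proof (cases "x \<in> U")
        case True
        have "\<bar>profile h (D x) * \<Sigma> x\<bar> \<le> 4 / h * \<rho>"
          unfolding abs_mult using profile_le[OF h, of "D x"] profile_nonneg[OF h, of "D x"] T(3)[of x] h \<rho> by (intro mult_mono) auto
        then have "\<bar>w x - g x\<bar> * \<bar>profile h (D x) * \<Sigma> x\<bar> \<le> \<bar>w x - g x\<bar> * (4 / h * \<rho>)" by (intro mult_left_mono) auto
        moreover have "(w x - g x) * (profile h (D x) * \<Sigma> x) \<le> \<bar>w x - g x\<bar> * \<bar>profile h (D x) * \<Sigma> x\<bar>"
          by (metis abs_ge_self abs_mult)
        ultimately show ?thesis using True by (simp add: mult_ac)
      next
        case False
        then have "profile h (D x) * \<Sigma> x = 0" using pU by blast
        then show ?thesis using h \<rho> by (simp only: mult_zero_right) simp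
      qed
    qed
    finally have rest: "(\<integral>x. w x * (profile h (D x) * \<Sigma> x) \<partial>lborel) - (\<integral>x. g x * (profile h (D x) * \<Sigma> x) \<partial>lborel)
        \<le> 4 / h * \<rho> * (\<integral>x. indicator U x * \<bar>w x - g x\<bar> \<partial>lborel)" by simp
    have "(\<integral>x. v x * s x \<partial>lborel) = (\<integral>x. w x * s x \<partial>lborel) - (\<integral>x. W x * s x \<partial>lborel)"
      using Bochner_Integration.integral_diff[OF i1 i4] by (simp add: vs)
    also have "\<dots> \<le> \<rho> * V + 4 / h * \<rho> * (\<integral>x. indicator U x * \<bar>w x - g x\<bar> \<partial>lborel)"
      using wf rest unfolding wf_eq adj by linarith
    also have "\<dots> = \<rho> * Bd" by (simp add: Bd_def algebra_simps)
    finally show "(\<integral>x. v x * s x \<partial>lborel) \<le> \<rho> * Bd" .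
  qed
  moreover have "indicator U\<rho> x * \<bar>v x\<bar> = indicator U\<rho> x * \<bar>w x - W x\<bar>" for x
    using sub by (auto simp: v_def indicator_def)
  ultimately show ?thesis by (simp only: U_def U\<rho>_def W_def Bd_def)
qed

end

section \<open>Boundary charts\<close>

text \<open>A real supremum, meaningful only together with some bound
  \<open>variation_le\<close>.\<close>

definition variation :: "(real^'n) set \<Rightarrow> (real^'n \<Rightarrow> real) \<Rightarrow> real" where
  "variation U w = (SUP \<phi>\<in>unit_fields U. \<integral>x. w x * divergence \<phi> x \<partial>lborel)"

lemma zero_unit_field: "(\<lambda>_. 0) \<in> unit_fields U"
  by (auto simp: unit_fields_def C1_const intro!: compact_support_inI[of "{}"])

lemma unit_fields_mono: "U \<subseteq> V \<Longrightarrow> unit_fields U \<subseteq> unit_fields V"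
  by (auto simp: unit_fields_def intro: compact_support_in_mono)

lemma variation_le_mono: "variation_le V w B \<Longrightarrow> U \<subseteq> V \<Longrightarrow> variation_le U w B"
  unfolding variation_le_def using unit_fields_mono by blast

lemma variation_bdd: "variation_le U w B \<Longrightarrow> bdd_above ((\<lambda>\<phi>. \<integral>x. w x * divergence \<phi> x \<partial>lborel) ` unit_fields U)"
  by (auto simp: variation_le_def bdd_above_def)

lemma variation_le_variation: "variation_le U w B \<Longrightarrow> variation_le U w (variation U w)"
proof -
  assume "variation_le U w B"
  from variation_bdd[OF this] show ?thesis
    unfolding variation_le_def variation_def by (intro ballI cSUP_upper)
qed

text \<open>Almost optimal fields on disjoint sets add up to one unit field. This superadditivity
  does the work of the variation measure in the covering argument.\<close>

lemma variation_superadditive: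
  fixes w :: "real^'n \<Rightarrow> real"
  assumes J: "finite J" and disj: "\<And>i j. i \<in> J \<Longrightarrow> j \<in> J \<Longrightarrow> i \<noteq> j \<Longrightarrow> U i \<inter> U j = {}"
    and sub: "\<And>j. j \<in> J \<Longrightarrow> U j \<subseteq> V" and B: "variation_le V w B" and w: "integrable lborel w"
  shows "(\<Sum>j\<in>J. variation (U j) w) \<le> B"
proof (rule field_le_epsilon)
  fix \<epsilon> :: real assume \<epsilon>: "0 < \<epsilon>"
  let ?I = "\<lambda>\<phi>. \<integral>x. w x * divergence \<phi> x \<partial>lborel"
  \<comment> \<open>The total loss stays below \<open>\<epsilon>\<close>; the added \<open>1\<close>
    covers an empty \<open>J\<close>.\<close>
  define d where "d = \<epsilon> / (real (card J) + 1)"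
  have d: "0 < d" using \<epsilon> by (simp add: d_def)
  have "\<exists>\<phi>\<in>unit_fields (U j). variation (U j) w - d < ?I \<phi>" if "j \<in> J" for j
    using variation_le_mono[OF B sub[OF that]] d zero_unit_field[of "U j"]
    by (subst less_cSUP_iff[symmetric]) (auto simp: variation_def intro!: variation_bdd)
  then have "\<exists>\<phi>. \<forall>j\<in>J. \<phi> j \<in> unit_fields (U j) \<and> variation (U j) w - d < ?I (\<phi> j)" by (intro bchoice) auto
  then obtain \<phi> where \<phi>0: "\<forall>j\<in>J. \<phi> j \<in> unit_fields (U j) \<and> variation (U j) w - d < ?I (\<phi> j)" ..
  then have \<phi>: "\<phi> j \<in> unit_fields (U j)" "variation (U j) w - d < ?I (\<phi> j)" if "j \<in> J" for j using that by auto
  have C: "C1 (\<lambda>x. \<phi> j x $ i)" "compact_support_in (U j) (\<phi> j)" "norm (\<phi> j x) \<le> 1" if "j \<in> J" for i j x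
    using \<phi>(1)[OF that] by (auto simp: unit_fields_def)
  have outside: "\<phi> j x = 0" if "j \<in> J" "x \<notin> U j" for j x
    using compact_support_in_ex[OF C(2)[OF that(1)]] that(2) by blast
  define \<psi> where "\<psi> x = (\<Sum>j\<in>J. \<phi> j x)" for x
  have "\<psi> \<in> unit_fields V"
    unfolding unit_fields_def
  proof (intro CollectI conjI allI)
    show "C1 (\<lambda>x. \<psi> x $ i)" for i unfolding \<psi>_def sum_component using C(1) by (intro C1_sum)
    have "\<forall>j\<in>J. \<exists>K. compact K \<and> K \<subseteq> U j \<and> (\<forall>x. x \<notin> K \<longrightarrow> \<phi> j x = 0)"
      using compact_support_in_ex[OF C(2)] by blast
    then have "\<exists>K. \<forall>j\<in>J. compact (K j) \<and> K j \<subseteq> U j \<and> (\<forall>x. x \<notin> K j \<longrightarrow> \<phi> j x = 0)" by (rule bchoice)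
    then obtain K where K: "\<forall>j\<in>J. compact (K j) \<and> K j \<subseteq> U j \<and> (\<forall>x. x \<notin> K j \<longrightarrow> \<phi> j x = 0)" ..
    show "compact_support_in V \<psi>"
    proof (rule compact_support_inI[of "\<Union>j\<in>J. K j"])
      show "compact (\<Union>j\<in>J. K j)" using J K by (intro compact_UN) auto
      show "(\<Union>j\<in>J. K j) \<subseteq> V" using K sub by blast
      show "\<psi> x = 0" if "x \<notin> (\<Union>j\<in>J. K j)" for x unfolding \<psi>_def using that K by (intro sum.neutral) auto
    qed
    show "norm (\<psi> x) \<le> 1" for x
    proof (cases "\<exists>j\<in>J. x \<in> U j")
      case True
      then obtain j where j: "j \<in> J" "x \<in> U j" by blast
      have "\<psi> x = \<phi> j x + (\<Sum>i\<in>J - {j}. \<phi> i x)" unfolding \<psi>_def using J j(1) by (rule sum.remove)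
      also have "(\<Sum>i\<in>J - {j}. \<phi> i x) = 0"
      proof (rule sum.neutral, rule ballI)
        fix i assume "i \<in> J - {j}"
        then have "i \<in> J" "x \<notin> U i" using disj[of i j] j by auto
        then show "\<phi> i x = 0" by (rule outside)
      qed
      finally show ?thesis using C(3)[OF j(1)] by simp
    next
      case False
      then have "\<psi> x = 0" unfolding \<psi>_def using outside by (intro sum.neutral) auto
      then show ?thesis by simp
    qed
  qed
  then have "?I \<psi> \<le> B" using B by (auto simp: variation_le_def)
  moreover have "?I \<psi> = (\<Sum>j\<in>J. ?I (\<phi> j))"
  proof -
    have "divergence \<psi> x = (\<Sum>j\<in>J. divergence (\<phi> j) x)" for x
      unfolding divergence_grad \<psi>_def sum_component
      using C(1) by (simp add: grad_sum sum_component sum.swap[of _ J])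
    then have "?I \<psi> = (\<integral>x. (\<Sum>j\<in>J. w x * divergence (\<phi> j) x) \<partial>lborel)" by (simp add: sum_distrib_left)
    also have "\<dots> = (\<Sum>j\<in>J. ?I (\<phi> j))"
    proof (rule Bochner_Integration.integral_sum)
      fix j assume j: "j \<in> J"
      have "compactly_supported (divergence (\<phi> j))"
        using compact_support_divergence[OF C(2)[OF j]] by (rule compact_support_in_mono) simp
      then show "integrable lborel (\<lambda>x. w x * divergence (\<phi> j) x)"
        by (intro integrable_mult_cs w continuous_divergence C(1)[OF j])
    qed
    finally show ?thesis .
  qed
  moreover have "(\<Sum>j\<in>J. variation (U j) w - d) \<le> (\<Sum>j\<in>J. ?I (\<phi> j))"
    using \<phi>(2) by (intro sum_mono) (auto intro: less_imp_le)
  moreover have "(\<Sum>j\<in>J. variation (U j) w - d) = (\<Sum>j\<in>J. variation (U j) w) - real (card J) * d"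
    by (simp add: sum_subtractf)
  moreover have "real (card J) * d \<le> \<epsilon>" using \<epsilon> by (simp add: d_def field_simps)
  ultimately show "(\<Sum>j\<in>J. variation (U j) w) \<le> B + \<epsilon>" by linarith
qed

section \<open>Construction of boundary charts, and volumes of boxes\<close>

lemma C1_compose_linear:
  fixes A :: "real^'n \<Rightarrow> real^'n"
  assumes f: "C1 f" and A: "linear A"
  shows "C1 (\<lambda>x. f (A x))"
proof (rule C1I(1))
  have bA: "bounded_linear A" using A by (simp add: linear_conv_bounded_linear)
  show "((\<lambda>x. f (A x)) has_derivative (\<lambda>v. adjoint A (grad f (A x)) \<bullet> v)) (at x)" for x
  proof -
    have "(A has_derivative A) (at x)" using bA by (rule bounded_linear_imp_has_derivative)
    from has_derivative_compose[OF this C1_has_derivative[OF f]] show ?thesis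
      by (simp add: adjoint_works[OF A] inner_commute)
  qed
  have "bounded_linear (adjoint A)" using adjoint_linear[OF A] by (simp add: linear_conv_bounded_linear)
  then show "continuous_on UNIV (\<lambda>x. adjoint A (grad f (A x)))"
    by (intro bounded_linear.continuous_on[OF \<open>bounded_linear (adjoint A)\<close>] continuous_on_compose2[OF C1_continuous_grad[OF f]]
        bounded_linear.continuous_on[OF bA] continuous_on_id) auto
qed

lemma C1_lipschitz_cball:
  fixes x0 :: "real^'n"
  assumes f: "C1 f"
  shows "\<exists>L\<ge>1. \<forall>x\<in>cball x0 r. \<forall>y\<in>cball x0 r. \<bar>f x - f y\<bar> \<le> L * norm (x - y)"
proof -
  have "compact (grad f ` cball x0 r)"
    by (rule compact_continuous_image[OF continuous_on_subset[OF C1_continuous_grad[OF f]]]) auto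
  then have "bounded (grad f ` cball x0 r)" by (rule compact_imp_bounded)
  then obtain B where "\<forall>y\<in>grad f ` cball x0 r. norm y \<le> B" unfolding bounded_iff by auto
  then have B: "norm (grad f x) \<le> B" if "x \<in> cball x0 r" for x using that by auto
  have "norm (f x - f y) \<le> max 1 B * norm (x - y)" if xy: "x \<in> cball x0 r" "y \<in> cball x0 r" for x y
  proof (rule differentiable_bound[OF convex_cball _ _ xy])
    show "(f has_derivative (\<lambda>v. grad f z \<bullet> v)) (at z within cball x0 r)" for z
      using C1_has_derivative[OF f] by (rule has_derivative_at_withinI)
    show "onorm (\<lambda>v. grad f z \<bullet> v) \<le> max 1 B" if "z \<in> cball x0 r" for z
    proof (rule onorm_bound)
      fix v
      have "\<bar>grad f z \<bullet> v\<bar> \<le> norm (grad f z) * norm v" by (rule Cauchy_Schwarz_ineq2)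
      also have "\<dots> \<le> max 1 B * norm v" using B[OF that] by (intro mult_right_mono) auto
      finally show "norm (grad f z \<bullet> v) \<le> max 1 B * norm v" by simp
    qed simp
  qed
  then show ?thesis by (intro exI[of _ "max 1 B"]) auto
qed

text \<open>Near \<open>x0\<close> the domain is where the height is positive. Since
  \<open>e\<close> is a signed coordinate axis, tubes around fibres can be replaced by boxes
  parallel to the axes.\<close>

locale boundary_chart = graph_coordinate D e for D :: "real^'n \<Rightarrow> real" and e :: "real^'n" +
  fixes \<Omega> :: "(real^'n) set" and x0 :: "real^'n" and r :: real and i :: 'n and L :: real
  assumes e_axis: "e = axis i 1 \<or> e = - axis i 1" and \<Omega>: "open \<Omega>" "bounded \<Omega>" and r: "0 < r"
    and chart: "\<Omega> \<inter> ball x0 r = {x \<in> ball x0 r. 0 < D x}" and D_x0: "D x0 = 0"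
    and L: "1 \<le> L" and lip: "\<And>x y. x \<in> cball x0 r \<Longrightarrow> y \<in> cball x0 r \<Longrightarrow> \<bar>D x - D y\<bar> \<le> L * norm (x - y)"

text \<open>The height is the signed coordinate minus the graph function. It vanishes at
  \<open>x0\<close>: a positive value would put \<open>x0\<close> into the domain, a negative one
  would keep a whole neighbourhood out of it.\<close>

lemma boundary_chart_exists:
  fixes \<Omega> :: "(real^'n) set"
  assumes \<Omega>: "open \<Omega>" "bounded \<Omega>" "smooth_boundary \<Omega>" and x0: "x0 \<in> frontier \<Omega>"
  shows "\<exists>D e r i L. boundary_chart D e \<Omega> x0 r i L"
proof -
  obtain r i \<sigma> \<gamma> where r: "0 < r" and \<sigma>: "\<sigma> = 1 \<or> \<sigma> = - (1::real)" and \<gamma>: "smooth \<gamma>"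
    and ch: "\<Omega> \<inter> ball x0 r = {x \<in> ball x0 r. \<sigma> * x $ i > \<gamma> (x - axis i (x $ i))}"
    using \<Omega>(3) x0 unfolding smooth_boundary_def by blast
  define e where "e = \<sigma> *\<^sub>R axis i (1::real)"
  define A where "A x = x - axis i (x $ i)" for x :: "real^'n"
  define D where "D x = \<sigma> * x $ i - \<gamma> (A x)" for x
  have "linear A"
    unfolding A_def by (rule linearI) (simp_all add: vec_eq_iff axis_def algebra_simps)
  then have CD: "C1 D"
    unfolding D_def by (intro C1_diff[OF C1_cmult[OF C1_component] C1_compose_linear[OF smooth_C1[OF \<gamma>]]])
  have \<sigma>2: "\<sigma> * \<sigma> = 1" using \<sigma> by auto
  have Ae: "A (x + t *\<^sub>R e) = A x" for x t
    by (simp add: A_def e_def vec_eq_iff axis_def)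
  have ei: "e $ i = \<sigma>" by (simp add: e_def)
  have Ds: "D (x + t *\<^sub>R e) = D x + t" for x t
    using \<sigma>2 by (simp add: D_def Ae ei algebra_simps)
  have ne: "norm e = 1" using \<sigma> by (auto simp: e_def norm_axis_1)
  have chD: "\<Omega> \<inter> ball x0 r = {x \<in> ball x0 r. 0 < D x}" using ch by (auto simp: D_def A_def)
  have x0n: "x0 \<notin> \<Omega>" "x0 \<in> closure \<Omega>" using x0 \<Omega>(1) by (auto simp: frontier_def interior_open)
  have "\<not> 0 < D x0"
  proof
    assume "0 < D x0"
    then have "x0 \<in> {x \<in> ball x0 r. 0 < D x}" using r by simp
    then show False unfolding chD[symmetric] using x0n(1) by simp
  qed
  moreover have "\<not> D x0 < 0"
  proof
    assume "D x0 < 0"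
    then have "x0 \<in> ball x0 r \<inter> {x. D x < 0}" using r by simp
    moreover have "open (ball x0 r \<inter> {x. D x < 0})"
      by (intro open_Int open_ball open_Collect_less continuous_intros C1_continuous CD)
    ultimately obtain y where "y \<in> \<Omega>" "y \<in> ball x0 r \<inter> {x. D x < 0}"
      using x0n(2) open_Int_closure_eq_empty[of "ball x0 r \<inter> {x. D x < 0}" \<Omega>] by blast
    then have "y \<in> \<Omega> \<inter> ball x0 r" and neg: "D y < 0" by auto
    then have "0 < D y" unfolding chD by simp
    then show False using neg by simp
  qed
  ultimately have "D x0 = 0" by linarith
  moreover obtain L where "1 \<le> L" "\<forall>x\<in>cball x0 r. \<forall>y\<in>cball x0 r. \<bar>D x - D y\<bar> \<le> L * norm (x - y)"
    using C1_lipschitz_cball[OF CD] by blast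
  moreover have "e = axis i 1 \<or> e = - axis i 1" using \<sigma> by (auto simp: e_def)
  ultimately have "boundary_chart D e \<Omega> x0 r i L"
    using CD Ds ne \<Omega> r chD by unfold_locales auto
  then show ?thesis by blast
qed

text \<open>Boxes with one distinguished coordinate give explicit volumes for tubes around fibres
  and for covers of a projection.\<close>

lemma emeasure_axis_tube:
  fixes c :: "real^'n"
  assumes "0 \<le> b" "0 \<le> l"
  shows "emeasure lborel {x. (\<forall>k. k \<noteq> i \<longrightarrow> \<bar>x $ k - c $ k\<bar> \<le> b) \<and> \<bar>x $ i - c $ i\<bar> \<le> l}
    = ennreal ((2 * b) ^ (CARD('n) - 1) * (2 * l))"
    "{x. (\<forall>k. k \<noteq> i \<longrightarrow> \<bar>x $ k - c $ k\<bar> \<le> b) \<and> \<bar>x $ i - c $ i\<bar> \<le> l} \<in> sets borel"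
proof -
  define d :: "real^'n" where "d = (\<chi> k. if k = i then l else b)"
  have eq: "{x. (\<forall>k. k \<noteq> i \<longrightarrow> \<bar>x $ k - c $ k\<bar> \<le> b) \<and> \<bar>x $ i - c $ i\<bar> \<le> l} = cbox (c - d) (c + d)"
  proof (intro set_eqI iffI)
    fix x assume x: "x \<in> {x. (\<forall>k. k \<noteq> i \<longrightarrow> \<bar>x $ k - c $ k\<bar> \<le> b) \<and> \<bar>x $ i - c $ i\<bar> \<le> l}"
    have "\<bar>x $ k - c $ k\<bar> \<le> d $ k" for k using x by (cases "k = i") (auto simp: d_def)
    then show "x \<in> cbox (c - d) (c + d)" unfolding mem_box_cart by (simp add: abs_le_iff algebra_simps)
  next
    fix x assume "x \<in> cbox (c - d) (c + d)"
    then have le: "\<bar>x $ k - c $ k\<bar> \<le> d $ k" for k unfolding mem_box_cart by (simp add: abs_le_iff algebra_simps)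
    have "\<bar>x $ k - c $ k\<bar> \<le> b" if "k \<noteq> i" for k using le[of k] that by (simp add: d_def)
    moreover have "\<bar>x $ i - c $ i\<bar> \<le> l" using le[of i] by (simp add: d_def)
    ultimately show "x \<in> {x. (\<forall>k. k \<noteq> i \<longrightarrow> \<bar>x $ k - c $ k\<bar> \<le> b) \<and> \<bar>x $ i - c $ i\<bar> \<le> l}" by simp
  qed
  have d0: "0 \<le> d $ k" for k using assms by (simp add: d_def)
  have ne: "cbox (c - d) (c + d) \<noteq> {}"
    unfolding interval_ne_empty_cart
  proof
    show "(c - d) $ k \<le> (c + d) $ k" for k using d0[of k] by simp
  qed
  have "measure lborel (cbox (c - d) (c + d)) = (\<Prod>k\<in>UNIV. (c + d) $ k - (c - d) $ k)"
    using content_cbox_cart[OF ne] by simp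
  also have "\<dots> = (\<Prod>k\<in>UNIV. 2 * d $ k)" by simp
  also have "\<dots> = 2 * d $ i * (\<Prod>k\<in>UNIV - {i}. 2 * d $ k)" by (rule prod.remove) auto
  also have "(\<Prod>k\<in>UNIV - {i}. 2 * d $ k) = (\<Prod>k\<in>UNIV - {i}. 2 * b)" by (rule prod.cong) (auto simp: d_def)
  finally have "measure lborel (cbox (c - d) (c + d)) = (2 * b) ^ (CARD('n) - 1) * (2 * l)"
    by (simp add: d_def mult.commute card_Diff_singleton)
  moreover have "emeasure lborel (cbox (c - d) (c + d)) = ennreal (measure lborel (cbox (c - d) (c + d)))"
    by (rule emeasure_eq_ennreal_measure) (use emeasure_lborel_cbox_finite[of "c - d" "c + d"] in auto)
  ultimately show "emeasure lborel {x. (\<forall>k. k \<noteq> i \<longrightarrow> \<bar>x $ k - c $ k\<bar> \<le> b) \<and> \<bar>x $ i - c $ i\<bar> \<le> l}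
    = ennreal ((2 * b) ^ (CARD('n) - 1) * (2 * l))" unfolding eq by simp
  show "{x. (\<forall>k. k \<noteq> i \<longrightarrow> \<bar>x $ k - c $ k\<bar> \<le> b) \<and> \<bar>x $ i - c $ i\<bar> \<le> l} \<in> sets borel" unfolding eq by simp
qed

lemma measure_ball_le:
  fixes p :: "real^'n"
  assumes "0 < s"
  shows "measure lborel (ball p s) \<le> (2 * s) ^ CARD('n)"
proof -
  obtain i :: 'n where True by blast
  have "ball p s \<subseteq> {x. (\<forall>k. k \<noteq> i \<longrightarrow> \<bar>x $ k - p $ k\<bar> \<le> s) \<and> \<bar>x $ i - p $ i\<bar> \<le> s}" (is "_ \<subseteq> ?S")
  proof
    fix x assume "x \<in> ball p s"
    then have "norm (x - p) < s" by (simp add: dist_norm norm_minus_commute)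
    then have "\<bar>x $ k - p $ k\<bar> \<le> s" for k using component_le_norm_cart[of "x - p" k] by simp
    then show "x \<in> ?S" by simp
  qed
  then have "emeasure lborel (ball p s) \<le> emeasure lborel ?S"
    using emeasure_axis_tube(2)[of s s i p] assms by (intro emeasure_mono) auto
  also have "\<dots> = ennreal ((2 * s) ^ (CARD('n) - 1) * (2 * s))" using assms by (intro emeasure_axis_tube) auto
  also have "(2 * s) ^ (CARD('n) - 1) * (2 * s) = (2 * s) ^ CARD('n)"
    by (metis One_nat_def Suc_pred power_Suc2 zero_less_card_finite)
  finally show ?thesis using assms by (simp add: measure_def enn2real_leI)
qed

section \<open>Projection to the graph, columns and strips inside a chart\<close>

context boundary_chart
begin

definition proj :: "real^'n \<Rightarrow> real^'n" where "proj x = x - D x *\<^sub>R e"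

definition horiz :: "real^'n \<Rightarrow> real^'n" where "horiz x = x - (x \<bullet> e) *\<^sub>R e"

definition tube :: "real^'n \<Rightarrow> real \<Rightarrow> (real^'n) set" where "tube p s = {x. norm (horiz (x - p)) < s}"

text \<open>Since \<open>D x0 = 0\<close>, projection along \<open>e\<close> enlarges the distance
  to \<open>x0\<close> at most by the factor \<open>1 + L\<close>; points within
  \<open>\<rho>0\<close> thus project into the ball of radius \<open>r / 4\<close>.\<close>

definition \<rho>0 :: real where "\<rho>0 = r / (4 * (1 + L))"

lemma \<rho>0: "0 < \<rho>0" "\<rho>0 \<le> r / 4"
  using r L by (auto simp: \<rho>0_def field_simps)

lemma D_proj: "D (proj x) = 0"
  using D_shift[of x "- D x"] by (simp add: proj_def)

lemma proj_shift: "proj (x + t *\<^sub>R e) = proj x"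
  by (simp add: proj_def D_shift algebra_simps)

lemma continuous_proj: "continuous_on A proj"
  unfolding proj_def[abs_def] by (intro continuous_intros continuous_D)

lemma ee: "e \<bullet> e = 1"
  using norm_e by (simp add: dot_square_norm)

lemma horiz_diff: "horiz (x - y) = horiz x - horiz y"
  by (simp add: horiz_def inner_diff_left algebra_simps)

lemma horiz_shift: "horiz (x + t *\<^sub>R e) = horiz x"
  by (simp add: horiz_def inner_add_left ee algebra_simps)

lemma horiz_proj: "horiz (proj x) = horiz x"
  using horiz_shift[of x "- D x"] by (simp add: proj_def)

lemma norm_horiz_le: "norm (horiz x) \<le> norm x"
proof -
  have "horiz x \<bullet> (x \<bullet> e) *\<^sub>R e = 0" by (simp add: horiz_def inner_diff_left ee)
  then have "(norm (horiz x + (x \<bullet> e) *\<^sub>R e))\<^sup>2 = (norm (horiz x))\<^sup>2 + (norm ((x \<bullet> e) *\<^sub>R e))\<^sup>2"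
    by (intro norm_add_Pythagorean) (simp add: orthogonal_def)
  then have "(norm (horiz x))\<^sup>2 \<le> (norm x)\<^sup>2" by (simp add: horiz_def)
  then show ?thesis by (rule power2_le_imp_le) simp
qed

lemma horiz_component: "horiz x $ k = (if k = i then 0 else x $ k)"
proof -
  have "axis i (1::real) $ k = (if k = i then 1 else 0)" by (simp add: axis_def)
  then show ?thesis using e_axis by (auto simp: horiz_def inner_axis)
qed

lemma abs_component_le_horiz: "k \<noteq> i \<Longrightarrow> \<bar>x $ k\<bar> \<le> norm (horiz x)"
  using component_le_norm_cart[of "horiz x" k] by (simp add: horiz_component)

lemma open_tube: "open (tube p s)"
  unfolding tube_def horiz_def by (intro open_Collect_less continuous_intros)

lemma tube_shift: "x \<in> tube p s \<Longrightarrow> x + t *\<^sub>R e \<in> tube p s"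
proof -
  have "x + t *\<^sub>R e - p = (x - p) + t *\<^sub>R e" by simp
  then show "x \<in> tube p s \<Longrightarrow> x + t *\<^sub>R e \<in> tube p s" unfolding tube_def mem_Collect_eq by (simp only: horiz_shift)
qed

lemma ball_subset_tube: "ball p s \<subseteq> tube p s"
  by (auto simp: tube_def dist_norm norm_minus_commute intro: le_less_trans[OF norm_horiz_le])

lemma proj_near:
  assumes "x \<in> ball x0 \<rho>0"
  shows "proj x \<in> ball x0 (r / 4)"
proof -
  have n: "norm (x - x0) < \<rho>0" using assms by (simp add: dist_norm norm_minus_commute)
  have xr: "x \<in> cball x0 r" using assms \<rho>0 r by auto
  have "\<bar>D x - D x0\<bar> \<le> L * norm (x - x0)" using xr r by (intro lip) auto
  then have "norm (D x *\<^sub>R e) \<le> L * norm (x - x0)" using norm_e D_x0 by simp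
  moreover have "norm (proj x - x0) \<le> norm (x - x0) + norm (D x *\<^sub>R e)"
    using norm_triangle_ineq4[of "x - x0" "D x *\<^sub>R e"] by (simp add: proj_def algebra_simps)
  ultimately have "norm (proj x - x0) \<le> (1 + L) * norm (x - x0)" by (simp add: algebra_simps)
  also have "\<dots> < (1 + L) * \<rho>0" using n L by (intro mult_strict_left_mono) auto
  also have "\<dots> = r / 4" using L by (simp add: \<rho>0_def field_simps)
  finally show ?thesis by (simp add: dist_norm norm_minus_commute)
qed

lemma graph_frontier:
  assumes p: "p \<in> ball x0 r" "D p = 0"
  shows "p \<in> frontier \<Omega>"
proof -
  have "p \<notin> \<Omega>"
  proof
    assume "p \<in> \<Omega>"
    then have "p \<in> \<Omega> \<inter> ball x0 r" using p(1) by (rule IntI)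
    then show False unfolding chart using p(2) by simp
  qed
  moreover have "p \<in> closure \<Omega>"
    unfolding closure_approachable
  proof (intro allI impI)
    fix \<epsilon> :: real assume \<epsilon>: "0 < \<epsilon>"
    obtain d where d: "0 < d" "ball p d \<subseteq> ball x0 r" using p(1) openE[OF open_ball] by blast
    define t where "t = min (d / 2) (\<epsilon> / 2)"
    have t: "0 < t" "t < d" "t < \<epsilon>" using d \<epsilon> by (auto simp: t_def)
    have dt: "dist (p + t *\<^sub>R e) p = t" using t norm_e by (simp add: dist_norm)
    then have "p + t *\<^sub>R e \<in> ball p d" using t by (simp add: dist_commute)
    then have "p + t *\<^sub>R e \<in> ball x0 r" by (rule subsetD[OF d(2)])
    moreover have "0 < D (p + t *\<^sub>R e)" using t p by (simp add: D_shift)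
    ultimately have "p + t *\<^sub>R e \<in> \<Omega>" using chart by blast
    then show "\<exists>y\<in>\<Omega>. dist y p < \<epsilon>" using dt t by (intro bexI[of _ "p + t *\<^sub>R e"]) auto
  qed
  ultimately show ?thesis using \<Omega>(1) by (simp add: frontier_def interior_open)
qed

text \<open>A point of the column is reached from \<open>p\<close> by a horizontal displacement
  shorter than \<open>s\<close> and a vertical one of length at most
  \<open>h + L * s\<close>.\<close>

lemma column_near:
  assumes p: "p \<in> ball x0 (r / 4)" "D p = 0" and s: "(1 + L) * s + h < r / 4" "0 < s" "0 < h"
  shows "{x \<in> tube p s. 0 < D x \<and> D x < h} \<subseteq> ball x0 (r / 2)"
proof
  fix x assume x: "x \<in> {x \<in> tube p s. 0 < D x \<and> D x < h}"
  define y where "y = p + horiz (x - p)"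
  define t where "t = (x - p) \<bullet> e"
  have xy: "x = y + t *\<^sub>R e" by (simp add: y_def t_def horiz_def)
  have hs: "norm (horiz (x - p)) < s" using x by (simp add: tube_def)
  have "0 < L * s" using L s by simp
  then have s4: "s < r / 4" using s by (simp add: algebra_simps)
  have np: "norm (p - x0) < r / 4" using p(1) by (simp add: dist_norm norm_minus_commute)
  have "norm (y - x0) \<le> norm (p - x0) + norm (horiz (x - p))"
    using norm_triangle_ineq[of "p - x0" "horiz (x - p)"] by (simp add: y_def algebra_simps)
  then have "y \<in> cball x0 r" using np hs s4 r by (simp add: dist_norm norm_minus_commute)
  then have "\<bar>D y - D p\<bar> \<le> L * norm (y - p)" using p(1) r by (intro lip) auto
  also have "\<dots> \<le> L * s" using hs L by (intro mult_left_mono) (auto simp: y_def)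
  finally have Dy: "\<bar>D y\<bar> \<le> L * s" using p(2) by simp
  have "D x = D y + t" unfolding xy D_shift ..
  then have "\<bar>t\<bar> \<le> h + L * s" using x Dy by auto
  then have "norm (t *\<^sub>R e) \<le> h + L * s" using norm_e by simp
  have hx: "horiz (x - p) + t *\<^sub>R e = x - p" by (simp add: horiz_def t_def)
  have "norm (x - p) \<le> norm (horiz (x - p)) + norm (t *\<^sub>R e)"
    using norm_triangle_ineq[of "horiz (x - p)" "t *\<^sub>R e"] unfolding hx .
  then have "norm (x - p) < s + (h + L * s)"
    using hs \<open>norm (t *\<^sub>R e) \<le> h + L * s\<close> by linarith
  then have "norm (x - x0) < s + (h + L * s) + r / 4"
    using norm_triangle_ineq[of "x - p" "p - x0"] np by simp
  then show "x \<in> ball x0 (r / 2)" using s by (simp add: dist_norm norm_minus_commute algebra_simps)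
qed

lemma ball_part_subset:
  assumes p: "p \<in> ball x0 (r / 4)" "D p = 0" and s: "0 < s" "s < r / 4"
  shows "\<Omega> \<inter> ball p s \<subseteq> {x \<in> tube p s. 0 < D x \<and> D x < L * s}"
proof
  fix x assume x: "x \<in> \<Omega> \<inter> ball p s"
  have np: "norm (p - x0) < r / 4" and nx: "norm (x - p) < s"
    using p(1) x by (auto simp: dist_norm norm_minus_commute)
  have "norm (x - x0) < r" using norm_triangle_ineq[of "x - p" "p - x0"] np nx s r by simp
  then have xr: "x \<in> ball x0 r" by (simp add: dist_norm norm_minus_commute)
  then have "0 < D x" using x chart by blast
  moreover have "\<bar>D x - D p\<bar> \<le> L * norm (x - p)" using xr p(1) r by (intro lip) auto
  moreover have "L * norm (x - p) < L * s" using nx L by (intro mult_strict_left_mono) auto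
  ultimately show "x \<in> {x \<in> tube p s. 0 < D x \<and> D x < L * s}"
    using p(2) x ball_subset_tube[of p s] by auto
qed

text \<open>The ball of radius \<open>s / (4 * L)\<close> about
  \<open>p + (s / 2) *\<^sub>R e\<close> keeps a positive height and lies in
  \<open>ball p s\<close>. Hence a bound in terms of \<open>s ^ N\<close> is also one in terms of
  the volume of \<open>\<Omega> \<inter> ball p s\<close>.\<close>

lemma measure_ball_part_ge:
  assumes p: "p \<in> ball x0 (r / 4)" "D p = 0" and s: "0 < s" "s < r / 4"
  shows "measure lborel (ball 0 (1 / (4 * L)) :: (real^'n) set) * s ^ CARD('n) \<le> measure lborel (\<Omega> \<inter> ball p s)"
proof -
  define q where "q = p + (s / 2) *\<^sub>R e"
  have np: "norm (p - x0) < r / 4" using p(1) by (simp add: dist_norm norm_minus_commute)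
  have qp: "norm (q - p) = s / 2" using norm_e s by (simp add: q_def)
  have s4: "s / (4 * L) \<le> s / 4" using L s by (intro divide_left_mono) auto
  have "ball q (s / (4 * L)) \<subseteq> \<Omega> \<inter> ball p s"
  proof
    fix x assume "x \<in> ball q (s / (4 * L))"
    then have nx: "norm (x - q) < s / (4 * L)" by (simp add: dist_norm norm_minus_commute)
    have xp: "norm (x - p) < s" using norm_triangle_ineq[of "x - q" "q - p"] nx qp s4 s by simp
    have xr: "x \<in> ball x0 r" using norm_triangle_ineq[of "x - p" "p - x0"] xp np s r by (simp add: dist_norm norm_minus_commute)
    have qr: "q \<in> cball x0 r" using norm_triangle_ineq[of "q - p" "p - x0"] qp np s r by (simp add: dist_norm norm_minus_commute)
    have "\<bar>D x - D q\<bar> \<le> L * norm (x - q)" using xr qr by (intro lip) auto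
    also have "\<dots> < L * (s / (4 * L))" using nx L by (intro mult_strict_left_mono) auto
    also have "\<dots> = s / 4" using L by simp
    finally have "\<bar>D x - s / 2\<bar> < s / 4" using p(2) by (simp add: q_def D_shift)
    then have "0 < D x" using s by linarith
    then show "x \<in> \<Omega> \<inter> ball p s" using chart xr xp by (auto simp: dist_norm norm_minus_commute)
  qed
  then have "measure lborel (ball q (s / (4 * L))) \<le> measure lborel (\<Omega> \<inter> ball p s)"
  proof (rule measure_mono_fmeasurable)
    have "emeasure lborel (\<Omega> \<inter> ball p s) < \<infinity>" using \<Omega>(2) by (intro emeasure_bounded_finite) (simp add: bounded_Int)
    then show "\<Omega> \<inter> ball p s \<in> fmeasurable lborel" using \<Omega>(1) by (intro fmeasurableI) auto
  qed simp
  moreover have "measure lborel (ball q (s / (4 * L))) = measure lborel (ball 0 (1 / (4 * L)) :: (real^'n) set) * s ^ CARD('n)"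
    using content_ball[of "s / (4 * L)" q] content_ball[of "1 / (4 * L)" "0 :: real^'n"] L s
    by (simp add: power_divide power_mult_distrib)
  ultimately show ?thesis by simp
qed

text \<open>An almost optimal field has compact support in the domain and so leaves a thin strip
  near \<open>x0\<close> untouched; superadditivity then allows the strip no more than the missing
  \<open>\<epsilon>\<close>.\<close>

lemma strip_variation_small:
  assumes V: "variation_le \<Omega> w V" and w: "integrable lborel w" and \<epsilon>: "0 < \<epsilon>"
  shows "\<exists>h0>0. \<forall>h. 0 < h \<and> h \<le> h0 \<longrightarrow> variation_le {x \<in> ball x0 (r / 2). 0 < D x \<and> D x < h} w \<epsilon>"
proof -
  have bdd: "bdd_above ((\<lambda>\<phi>. \<integral>x. w x * divergence \<phi> x \<partial>lborel) ` unit_fields \<Omega>)" by (rule variation_bdd[OF V])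
  have "unit_fields \<Omega> \<noteq> {}" using zero_unit_field by blast
  then obtain \<phi> where \<phi>: "\<phi> \<in> unit_fields \<Omega>" "variation \<Omega> w - \<epsilon> < (\<integral>x. w x * divergence \<phi> x \<partial>lborel)"
    using less_cSUP_iff[OF _ bdd, of "variation \<Omega> w - \<epsilon>"] \<epsilon> by (auto simp: variation_def)
  obtain K where K: "compact K" "K \<subseteq> \<Omega>" "\<And>x. x \<notin> K \<Longrightarrow> \<phi> x = 0"
    using compact_support_in_ex[of \<Omega> \<phi>] \<phi>(1) by (auto simp: unit_fields_def)
  have "\<exists>h0>0. \<forall>x\<in>K \<inter> cball x0 (r / 2). h0 < D x"
  proof (cases "K \<inter> cball x0 (r / 2) = {}")
    case False
    have "compact (K \<inter> cball x0 (r / 2))" using K(1) by (intro compact_Int) auto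
    then obtain a where a: "a \<in> K \<inter> cball x0 (r / 2)" "\<And>y. y \<in> K \<inter> cball x0 (r / 2) \<Longrightarrow> D a \<le> D y"
      using continuous_attains_inf[OF _ False continuous_D] by blast
    have "a \<in> \<Omega> \<inter> ball x0 r" using a(1) K(2) r by auto
    then have "0 < D a" using chart by blast
    then show ?thesis using a(2) by (intro exI[of _ "D a / 2"]) force
  qed (auto intro: exI[of _ 1])
  then obtain h0 where h0: "0 < h0" "\<And>x. x \<in> K \<inter> cball x0 (r / 2) \<Longrightarrow> h0 < D x" by blast
  have "variation_le {x \<in> ball x0 (r / 2). 0 < D x \<and> D x < h} w \<epsilon>" if h: "0 < h" "h \<le> h0" for h
  proof -
    define S where "S = {x \<in> ball x0 (r / 2). 0 < D x \<and> D x < h}"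
    \<comment> \<open>A set disjoint from the strip that still contains the support of
      \<open>\<phi>\<close>.\<close>
    define U where "U = \<Omega> \<inter> ({x. h < D x} \<union> - cball x0 (r / 2))"
    have KU: "K \<subseteq> U" using K(2) h0(2) h by (fastforce simp: U_def)
    have S\<Omega>: "S \<subseteq> \<Omega>"
    proof
      fix x assume "x \<in> S"
      then have "x \<in> {x \<in> ball x0 r. 0 < D x}" using r by (auto simp: S_def)
      then show "x \<in> \<Omega>" using chart by blast
    qed
    have sub: "(case b of True \<Rightarrow> U | False \<Rightarrow> S) \<subseteq> \<Omega>" for b using S\<Omega> by (auto simp: U_def split: bool.split)
    have disj: "U \<inter> S = {}" by (auto simp: U_def S_def)
    have "(\<Sum>b\<in>{True, False}. variation (case b of True \<Rightarrow> U | False \<Rightarrow> S) w) \<le> variation \<Omega> w"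
      using sub disj by (intro variation_superadditive[OF _ _ _ variation_le_variation[OF V] w]) (auto split: bool.splits)
    then have "variation U w + variation S w \<le> variation \<Omega> w" by simp
    moreover have "\<phi> \<in> unit_fields U"
      using \<phi>(1) compact_support_inI[OF K(1) KU K(3)] by (auto simp: unit_fields_def)
    then have "(\<integral>x. w x * divergence \<phi> x \<partial>lborel) \<le> variation U w"
      unfolding variation_def using variation_bdd[OF variation_le_mono[OF V], of U]
      by (intro cSUP_upper) (auto simp: U_def)
    ultimately have "variation S w \<le> \<epsilon>" using \<phi>(2) by linarith
    moreover have "variation_le S w (variation S w)"
      using variation_le_mono[OF V S\<Omega>] by (rule variation_le_variation)
    ultimately show ?thesis unfolding S_def[symmetric] by (auto simp: variation_le_def intro: order_trans)
  qed
  then show ?thesis using h0(1) by blast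
qed

end

section \<open>Existence of the trace almost everywhere\<close>

lemma L1_continuous_approx:
  fixes w :: "real^'n \<Rightarrow> real"
  assumes w: "w \<in> borel_measurable borel" "\<And>x. \<bar>w x\<bar> \<le> a" and S: "S \<in> sets borel" "bounded S" and \<delta>: "0 < \<delta>"
  shows "\<exists>g. continuous_on UNIV g \<and> (\<integral>x. indicator S x * \<bar>w x - g x\<bar> \<partial>lborel) < \<delta>"
proof -
  have a0: "0 \<le> a" using w(2)[of 0] abs_ge_zero[of "w 0"] by linarith
  have "w \<in> borel_measurable lebesgue" using w(1) by (intro measurable_completion) simp
  then have "w measurable_on UNIV" by (simp add: lebesgue_measurable_imp_measurable_on)
  then obtain N g where N: "negligible N" and g: "\<And>n. continuous_on UNIV (g n :: real^'n \<Rightarrow> real)"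
    and lim: "\<And>x. x \<notin> N \<Longrightarrow> (\<lambda>n. g n x) \<longlonglongrightarrow> w x"
    unfolding measurable_on_def by auto
  define f where "f n x = max (-a) (min a (g n x))" for n x
  have cf: "continuous_on UNIV (f n)" for n unfolding f_def by (intro continuous_intros g)
  have fb: "\<bar>f n x\<bar> \<le> a" for n x using a0 by (auto simp: f_def)
  have [measurable]: "f n \<in> borel_measurable borel" for n using cf by (rule borel_measurable_continuous_onI)
  note [measurable] = w(1) S(1)
  have "(\<lambda>n. \<integral>x. indicator S x * \<bar>w x - f n x\<bar> \<partial>lborel) \<longlonglongrightarrow> (\<integral>x. 0 \<partial>(lborel :: (real^'n) measure))"
  proof (rule integral_dominated_convergence[where w = "\<lambda>x. indicator S x * (2 * a)"])
    show "integrable lborel (\<lambda>x. indicator S x * (2 * a))"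
      using S emeasure_bounded_finite[OF S(2)] by (intro integrable_mult_left integrable_real_indicator) auto
    have "AE x in lebesgue. x \<notin> N" using N by (intro AE_not_in) (simp add: negligible_iff_null_sets)
    then have "AE x in lebesgue. (\<lambda>n. indicator S x * \<bar>w x - f n x\<bar>) \<longlonglongrightarrow> 0"
    proof eventually_elim
      fix x assume "x \<notin> N"
      then have "(\<lambda>n. indicator S x * \<bar>w x - f n x\<bar>) \<longlonglongrightarrow> indicator S x * \<bar>w x - max (-a) (min a (w x))\<bar>"
        unfolding f_def by (intro tendsto_intros lim)
      moreover have "max (-a) (min a (w x)) = w x" using w(2)[of x] by auto
      ultimately show "(\<lambda>n. indicator S x * \<bar>w x - f n x\<bar>) \<longlonglongrightarrow> 0" by simp
    qed
    then show "AE x in lborel. (\<lambda>n. indicator S x * \<bar>w x - f n x\<bar>) \<longlonglongrightarrow> 0" by (simp add: AE_completion_iff)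
    show "AE x in lborel. norm (indicator S x * \<bar>w x - f n x\<bar>) \<le> indicator S x * (2 * a)" for n
    proof (intro AE_I2)
      fix x
      show "norm (indicator S x * \<bar>w x - f n x\<bar>) \<le> indicator S x * (2 * a)"
        using w(2)[of x] fb[of n x] by (cases "x \<in> S") auto
    qed
  qed measurable
  then have "(\<lambda>n. \<integral>x. indicator S x * \<bar>w x - f n x\<bar> \<partial>lborel) \<longlonglongrightarrow> 0" by simp
  from order_tendstoD(2)[OF this \<delta>] obtain n where "(\<integral>x. indicator S x * \<bar>w x - f n x\<bar> \<partial>lborel) < \<delta>"
    using eventually_happens[of _ sequentially] by auto
  then show ?thesis using cf by blast
qed

lemma emeasure_countable_UN_le:
  assumes C: "countable C" and T: "\<And>j. j \<in> C \<Longrightarrow> T j \<in> sets M"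
    and fin: "\<And>F. finite F \<Longrightarrow> F \<subseteq> C \<Longrightarrow> (\<Sum>j\<in>F. emeasure M (T j)) \<le> b"
  shows "emeasure M (\<Union>j\<in>C. T j) \<le> b"
proof -
  define Cn where "Cn n = {j \<in> C. to_nat_on C j < n}" for n
  have Cf: "finite (Cn n)" for n
  proof (rule finite_imageD)
    show "finite (to_nat_on C ` Cn n)" by (rule finite_subset[of _ "{..<n}"]) (auto simp: Cn_def)
    show "inj_on (to_nat_on C) (Cn n)" using inj_on_to_nat_on[OF C] by (rule inj_on_subset) (auto simp: Cn_def)
  qed
  define Z where "Z n = (\<Union>j\<in>Cn n. T j)" for n
  have Z: "Z n \<in> sets M" for n unfolding Z_def using T Cf by (intro sets.finite_UN) (auto simp: Cn_def)
  have "incseq Z" by (rule incseq_SucI) (auto simp: Z_def Cn_def)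
  have "(\<Union>j\<in>C. T j) = (\<Union>n. Z n)" unfolding Z_def Cn_def by auto
  then have "emeasure M (\<Union>j\<in>C. T j) = (SUP n. emeasure M (Z n))"
    using SUP_emeasure_incseq[of Z M] Z \<open>incseq Z\<close> by (simp add: image_subset_iff)
  also have "\<dots> \<le> b"
  proof (rule SUP_least)
    fix n
    have "emeasure M (Z n) \<le> (\<Sum>j\<in>Cn n. emeasure M (T j))"
      unfolding Z_def using T Cf by (intro emeasure_subadditive_finite) (auto simp: Cn_def)
    also have "\<dots> \<le> b" using Cf by (intro fin) (auto simp: Cn_def)
    finally show "emeasure M (Z n) \<le> b" .
  qed
  finally show ?thesis .
qed

context boundary_chart
begin

definition deviation :: "(real^'n \<Rightarrow> real) \<Rightarrow> real \<Rightarrow> real^'n \<Rightarrow> real \<Rightarrow> real" where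
  "deviation w t p s = (\<integral>y. indicator (\<Omega> \<inter> ball p s) y * \<bar>w y - t\<bar> \<partial>lborel)"

text \<open>By \<open>column_estimate\<close>, the averages of \<open>w\<close> near \<open>p\<close> can only fail to be close to a constant
  if the variation of \<open>w\<close> has positive \<open>N - 1\<close>-dimensional density at \<open>p\<close>; a Vitali covering
  by such columns shows that this happens only on a small set.\<close>

lemma bad_scale:
  fixes w g :: "real^'n \<Rightarrow> real"
  assumes w: "integrable lborel w" "variation_le \<Omega> w V" and g: "continuous_on UNIV g"
    and h: "0 < h" "h \<le> r / 8" and p: "p \<in> ball x0 (r / 4)" "D p = 0" and \<tau>: "0 < \<tau>"
    and bad: "\<not> (\<exists>t\<in>\<rat>. \<exists>s0>0. \<forall>s. 0 < s \<and> s < s0 \<longrightarrow> deviation w t p s \<le> \<tau> * s ^ CARD('n))"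
  defines "U \<equiv> \<lambda>s. {x \<in> tube p s. 0 < D x \<and> D x < h}"
  shows "\<exists>s>0. s \<le> 1 \<and> U s \<subseteq> {x \<in> ball x0 (r / 2). 0 < D x \<and> D x < h} \<and>
    s ^ (CARD('n) - 1) \<le> 2 * L / \<tau> * (variation (U s) w + 4 / h * (\<integral>x. indicator (U s) x * \<bar>w x - g x\<bar> \<partial>lborel))"
proof -
  let ?N = "CARD('n)"
  define W where "W = smoothed h g"
  have cW: "continuous_on UNIV W" unfolding W_def using g by (rule continuous_smoothed)
  \<comment> \<open>An error \<open>2 * \<eta>\<close> on a ball of volume at most
    \<open>(2 * s) ^ N\<close> then uses up exactly half of the deviation
    \<open>\<tau> * s ^ N\<close>.\<close>
  define \<eta> where "\<eta> = \<tau> / (4 * 2 ^ ?N)"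
  have \<eta>: "0 < \<eta>" using \<tau> by (simp add: \<eta>_def)
  obtain t where t: "t \<in> \<rat>" "W p - \<eta> < t" "t < W p + \<eta>" using Rats_dense_in_real[of "W p - \<eta>" "W p + \<eta>"] \<eta> by auto
  have "isCont W p" using cW by (simp add: continuous_on_eq_continuous_at)
  then obtain d where d: "0 < d" "\<And>y. dist y p < d \<Longrightarrow> dist (W y) (W p) < \<eta>"
    using \<eta> unfolding continuous_at_eps_delta by blast
  \<comment> \<open>The entries ensure in turn that \<open>W\<close> is within \<open>\<eta>\<close>
    of \<open>W p\<close>, that the layer height \<open>L * s\<close> is at most \<open>h\<close>,
    that the column stays in the chart, and that the radii are bounded as the Vitali covering
    requires.\<close>
  define s0 where "s0 = Min {d, h / L, r / (8 * (1 + L)), 1}"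
  have s0: "0 < s0" "s0 \<le> d" "s0 \<le> h / L" "s0 \<le> r / (8 * (1 + L))" "s0 \<le> 1" using d h r L by (auto simp: s0_def)
  have "\<exists>s. 0 < s \<and> s < s0 \<and> \<tau> * s ^ ?N < deviation w t p s"
    using bad t(1) s0(1) by (meson not_le)
  then obtain s where s: "0 < s" "s < s0" "\<tau> * s ^ ?N < deviation w t p s" by blast
  have "L * s \<le> L * (h / L)" using s s0(3) L by (intro mult_left_mono) auto
  then have Ls: "0 < L * s" "L * s \<le> h" using s(1) L by auto
  have "(1 + L) * s < (1 + L) * (r / (8 * (1 + L)))" using s(2) s0(4) L by (intro mult_strict_left_mono) auto
  also have "(1 + L) * (r / (8 * (1 + L))) = r / 8" using L by (simp add: field_simps)
  finally have "(1 + L) * s < r / 8" .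
  then have sh: "(1 + L) * s + h < r / 4" using h by linarith
  then have s4: "s < r / 4" using Ls h by (simp add: algebra_simps)
  have USub: "U s \<subseteq> {x \<in> ball x0 (r / 2). 0 < D x \<and> D x < h}"
    using column_near[OF p sh s(1) h(1)] by (auto simp: U_def)
  have U\<Omega>: "U s \<subseteq> \<Omega>"
  proof
    fix x assume "x \<in> U s"
    then have "x \<in> {x \<in> ball x0 r. 0 < D x}" using USub r by auto
    then show "x \<in> \<Omega>" unfolding chart[symmetric] by simp
  qed
  define m where "m = variation (U s) w + 4 / h * (\<integral>x. indicator (U s) x * \<bar>w x - g x\<bar> \<partial>lborel)"
  define A where "A = {x \<in> tube p s. 0 < D x \<and> D x < L * s}"
  define B where "B = \<Omega> \<inter> ball p s"
  have bddU: "bounded (U s)" by (rule bounded_subset[OF bounded_ball[of x0 "r / 2"]]) (use USub in auto)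
  have est: "(\<integral>x. indicator A x * \<bar>w x - W x\<bar> \<partial>lborel) \<le> (L * s) * m"
    unfolding A_def W_def m_def U_def
    by (rule column_estimate[OF open_tube tube_shift Ls _ w(1) _ g])
      (use bddU variation_le_variation[OF variation_le_mono[OF w(2) U\<Omega>]] in \<open>simp_all add: U_def\<close>)
  have Bbor: "B \<in> sets borel" "bounded B" using \<Omega> by (auto simp: B_def bounded_Int)
  have A_alt: "A = tube p s \<inter> ({x. 0 < D x} \<inter> {x. D x < L * s})" by (auto simp: A_def)
  have "open A" unfolding A_alt by (intro open_Int open_tube open_Collect_less continuous_intros continuous_D)
  moreover have "bounded A" using bddU by (rule bounded_subset) (use Ls in \<open>auto simp: A_def U_def\<close>)
  ultimately have Abor: "A \<in> sets borel" "bounded A" by auto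
  have BA: "B \<subseteq> A" unfolding A_def B_def using p s(1) s4 by (rule ball_part_subset)
  have iw: "integrable lborel (\<lambda>x. indicator S x * w x)" if "S \<in> sets borel" for S
    using integrable_mult_indicator[of S lborel w] that w(1) by simp
  have iwf: "integrable lborel (\<lambda>x. indicator S x * \<bar>w x - f x\<bar>)" if "S \<in> sets borel" "bounded S" "continuous_on UNIV f" for S f
    using integrable_abs[OF Bochner_Integration.integrable_diff[OF iw[OF that(1)] integrable_indicator_continuous[OF that]]]
    by (simp add: abs_mult flip: right_diff_distrib)
  have iB: "integrable lborel (\<lambda>x. indicator B x * (2 * \<eta>))"
    using Bbor emeasure_bounded_finite[OF Bbor(2)] by (intro integrable_mult_left integrable_real_indicator) auto
  have "deviation w t p s \<le> (\<integral>x. indicator A x * \<bar>w x - W x\<bar> + indicator B x * (2 * \<eta>) \<partial>lborel)"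
    unfolding deviation_def B_def[symmetric]
  proof (rule integral_mono)
    show "integrable lborel (\<lambda>x. indicator B x * \<bar>w x - t\<bar>)" using Bbor by (intro iwf continuous_on_const)
    show "integrable lborel (\<lambda>x. indicator A x * \<bar>w x - W x\<bar> + indicator B x * (2 * \<eta>))"
      using Abor cW iB by (intro Bochner_Integration.integrable_add iwf)
    fix x
    show "indicator B x * \<bar>w x - t\<bar> \<le> indicator A x * \<bar>w x - W x\<bar> + indicator B x * (2 * \<eta>)"
    proof (cases "x \<in> B")
      case True
      then have "dist x p < d" using s(2) s0(2) by (auto simp: B_def dist_commute)
      then have "\<bar>W x - W p\<bar> < \<eta>" using d(2) by (simp add: dist_real_def)
      then have "\<bar>w x - t\<bar> \<le> \<bar>w x - W x\<bar> + 2 * \<eta>" using t by linarith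
      then show ?thesis using True BA by auto
    qed simp
  qed
  also have "\<dots> = (\<integral>x. indicator A x * \<bar>w x - W x\<bar> \<partial>lborel) + (\<integral>x. indicator B x * (2 * \<eta>) \<partial>lborel)"
    using Abor cW iB by (intro Bochner_Integration.integral_add iwf)
  also have "(\<integral>x. indicator B x * (2 * \<eta>) \<partial>lborel) = 2 * \<eta> * measure lborel B" using Bbor by simp
  also have "measure lborel B \<le> (2 * s) ^ ?N"
  proof -
    have "measure lborel B \<le> measure lborel (ball p s)"
    proof (rule measure_mono_fmeasurable)
      show "ball p s \<in> fmeasurable lborel" using emeasure_bounded_finite[OF bounded_ball, of p s] by (intro fmeasurableI) auto
    qed (use Bbor in \<open>auto simp: B_def\<close>)
    also have "\<dots> \<le> (2 * s) ^ ?N" using s(1) by (rule measure_ball_le)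
    finally show ?thesis .
  qed
  finally have "deviation w t p s \<le> (\<integral>x. indicator A x * \<bar>w x - W x\<bar> \<partial>lborel) + 2 * \<eta> * (2 * s) ^ ?N"
    using \<eta> by (simp add: mult_left_mono)
  also have "2 * \<eta> * (2 * s) ^ ?N = \<tau> / 2 * s ^ ?N" by (simp add: \<eta>_def power_mult_distrib field_simps)
  finally have "\<tau> / 2 * s ^ ?N \<le> (L * s) * m" using s(3) est by linarith
  moreover have "s ^ ?N = s * s ^ (?N - 1)" by (metis One_nat_def Suc_pred power_Suc zero_less_card_finite)
  ultimately have "s * (\<tau> / 2 * s ^ (?N - 1)) \<le> s * (L * m)" by (simp add: mult_ac)
  then have "\<tau> / 2 * s ^ (?N - 1) \<le> L * m" using s(1) by simp
  then have "s ^ (?N - 1) \<le> 2 * L / \<tau> * m" using \<tau> by (simp add: field_simps)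
  then show ?thesis using s s0(5) USub by (intro exI[of _ s]) (auto simp: m_def)
qed


text \<open>Each bad point carries a column whose cross section is paid for by the variation of
  \<open>w\<close> and the distance of \<open>w\<close> from \<open>g\<close>. Both budgets are
  small over the whole strip, and five-fold enlargements of disjoint columns cover all bad
  points.\<close>

lemma bad_set_small:
  fixes w :: "real^'n \<Rightarrow> real"
  assumes w: "integrable lborel w" "variation_le \<Omega> w V" "\<And>x. \<bar>w x\<bar> \<le> a" and \<tau>: "0 < \<tau>" and \<epsilon>: "0 < \<epsilon>"
  shows "\<exists>Z\<in>sets borel. emeasure lborel Z \<le> ennreal \<epsilon> \<and> (\<forall>x\<in>ball x0 \<rho>0. x \<notin> Z \<longrightarrow>
    (\<exists>t\<in>\<rat>. \<exists>s0>0. \<forall>s. 0 < s \<and> s < s0 \<longrightarrow> deviation w t (proj x) s \<le> \<tau> * s ^ CARD('n)))"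
proof -
  let ?N = "CARD('n)"
  define good where "good x \<longleftrightarrow> (\<exists>t\<in>\<rat>. \<exists>s0>0. \<forall>s. 0 < s \<and> s < s0 \<longrightarrow> deviation w t (proj x) s \<le> \<tau> * s ^ ?N)" for x
  \<comment> \<open>The volume of a tube of half width \<open>5 * \<sigma>\<close> and half height
    \<open>\<rho>0\<close>, per unit of \<open>\<sigma> ^ (N - 1)\<close>, times the factor from
    \<open>bad_scale\<close>.\<close>
  define c1 where "c1 = 10 ^ (?N - 1) * (2 * \<rho>0) * (2 * L / \<tau>)"
  have c1: "0 < c1" using \<rho>0 L \<tau> by (simp add: c1_def)
  define \<epsilon>1 where "\<epsilon>1 = \<epsilon> / (2 * c1)"
  have \<epsilon>1: "0 < \<epsilon>1" using c1 \<epsilon> by (simp add: \<epsilon>1_def)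
  obtain h0 where h0: "0 < h0" "\<And>h. 0 < h \<Longrightarrow> h \<le> h0 \<Longrightarrow> variation_le {x \<in> ball x0 (r / 2). 0 < D x \<and> D x < h} w \<epsilon>1"
    using strip_variation_small[OF w(2,1) \<epsilon>1] by auto
  define h where "h = min h0 (r / 8)"
  have h: "0 < h" "h \<le> h0" "h \<le> r / 8" using h0(1) r by (auto simp: h_def)
  define S where "S = {x \<in> ball x0 (r / 2). 0 < D x \<and> D x < h}"
  have VS: "variation_le S w \<epsilon>1" unfolding S_def using h(1,2) by (rule h0(2))
  have S_alt: "S = ball x0 (r / 2) \<inter> ({x. 0 < D x} \<inter> {x. D x < h})" by (auto simp: S_def)
  have "open S" unfolding S_alt by (intro open_Int open_ball open_Collect_less continuous_intros continuous_D)
  moreover have "bounded S" unfolding S_alt by (intro bounded_Int disjI1 bounded_ball)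
  ultimately have Sbor: "S \<in> sets borel" "bounded S" by auto
  have wb: "w \<in> borel_measurable borel" using w(1) by (simp add: borel_measurable_integrable)
  \<comment> \<open>The height \<open>h\<close> is fixed before \<open>g\<close>: the factor
    \<open>4 / h\<close> of \<open>bad_scale\<close> turns this L1 error into another
    \<open>\<epsilon>1\<close>.\<close>
  have "0 < \<epsilon>1 * h / 4" using \<epsilon>1 h by simp
  then obtain g where g: "continuous_on UNIV g" "(\<integral>x. indicator S x * \<bar>w x - g x\<bar> \<partial>lborel) < \<epsilon>1 * h / 4"
    using L1_continuous_approx[OF wb w(3) Sbor] by blast
  define G where "G A = (\<integral>x. indicator A x * \<bar>w x - g x\<bar> \<partial>lborel)" for A
  define U where "U x s = {y \<in> tube (proj x) s. 0 < D y \<and> D y < h}" for x s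
  define B where "B = {x \<in> ball x0 \<rho>0. \<not> good x}"
  have "\<forall>x\<in>B. \<exists>s. 0 < s \<and> s \<le> 1 \<and> U x s \<subseteq> S \<and> s ^ (?N - 1) \<le> 2 * L / \<tau> * (variation (U x s) w + 4 / h * G (U x s))"
  proof
    fix x assume x: "x \<in> B"
    show "\<exists>s. 0 < s \<and> s \<le> 1 \<and> U x s \<subseteq> S \<and> s ^ (?N - 1) \<le> 2 * L / \<tau> * (variation (U x s) w + 4 / h * G (U x s))"
      using bad_scale[OF w(1,2) g(1) h(1,3) proj_near D_proj \<tau>, of x] x
      unfolding B_def good_def U_def S_def G_def by blast
  qed
  then have "\<exists>\<sigma>. \<forall>x\<in>B. 0 < \<sigma> x \<and> \<sigma> x \<le> 1 \<and> U x (\<sigma> x) \<subseteq> S \<and> \<sigma> x ^ (?N - 1) \<le> 2 * L / \<tau> * (variation (U x (\<sigma> x)) w + 4 / h * G (U x (\<sigma> x)))"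
    by (rule bchoice)
  then obtain \<sigma> where \<sigma>0: "\<forall>x\<in>B. 0 < \<sigma> x \<and> \<sigma> x \<le> 1 \<and> U x (\<sigma> x) \<subseteq> S \<and> \<sigma> x ^ (?N - 1) \<le> 2 * L / \<tau> * (variation (U x (\<sigma> x)) w + 4 / h * G (U x (\<sigma> x)))" ..
  then have \<sigma>: "0 < \<sigma> x" "\<sigma> x \<le> 1" "U x (\<sigma> x) \<subseteq> S"
    "\<sigma> x ^ (?N - 1) \<le> 2 * L / \<tau> * (variation (U x (\<sigma> x)) w + 4 / h * G (U x (\<sigma> x)))" if "x \<in> B" for x
    using that by auto
  have cov0: "horiz ` B \<subseteq> (\<Union>x\<in>B. ball (horiz x) (\<sigma> x))" using \<sigma>(1) by auto
  \<comment> \<open>The covering is applied to the horizontal projections, so that disjoint balls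
    give disjoint columns.\<close>
  obtain C where C: "countable C" "C \<subseteq> B"
    "pairwise (\<lambda>x y. disjnt (ball (horiz x) (\<sigma> x)) (ball (horiz y) (\<sigma> y))) C"
    "horiz ` B \<subseteq> (\<Union>x\<in>C. ball (horiz x) (5 * \<sigma> x))"
    by (rule Vitali_covering_lemma_balls[OF cov0, of 1]) (use \<sigma> in auto)
  \<comment> \<open>Horizontal distances control only the coordinates other than \<open>i\<close>;
    coordinate \<open>i\<close> is taken from \<open>x0\<close>, as all bad points lie within
    \<open>\<rho>0\<close> of it.\<close>
  define c :: "real^'n \<Rightarrow> real^'n" where "c x = (\<chi> k. if k = i then x0 $ i else x $ k)" for x
  define T where "T x = {y. (\<forall>k. k \<noteq> i \<longrightarrow> \<bar>y $ k - c x $ k\<bar> \<le> 5 * \<sigma> x) \<and> \<bar>y $ i - c x $ i\<bar> \<le> \<rho>0}" for x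
  have T: "emeasure lborel (T x) = ennreal ((2 * (5 * \<sigma> x)) ^ (?N - 1) * (2 * \<rho>0))" "T x \<in> sets borel" if "x \<in> C" for x
    using emeasure_axis_tube[of "5 * \<sigma> x" \<rho>0 i "c x"] \<sigma>(1)[of x] that C(2) \<rho>0 unfolding T_def by auto
  define Z where "Z = (\<Union>x\<in>C. T x)"
  have Zb: "Z \<in> sets borel" unfolding Z_def by (rule sets.countable_UN'[OF C(1)]) (use T(2) in auto)
  have BZ: "B \<subseteq> Z"
  proof
    fix y assume y: "y \<in> B"
    then obtain x where x: "x \<in> C" "horiz y \<in> ball (horiz x) (5 * \<sigma> x)" using C(4) by blast
    then have n: "norm (horiz (y - x)) < 5 * \<sigma> x" by (simp add: horiz_diff dist_norm norm_minus_commute)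
    have "\<bar>y $ k - c x $ k\<bar> \<le> 5 * \<sigma> x" if "k \<noteq> i" for k
      using abs_component_le_horiz[OF that, of "y - x"] n that by (simp add: c_def)
    moreover have "\<bar>y $ i - c x $ i\<bar> \<le> \<rho>0"
      using component_le_norm_cart[of "y - x0" i] y by (simp add: c_def B_def dist_norm norm_minus_commute)
    ultimately show "y \<in> Z" using x(1) by (auto simp: Z_def T_def)
  qed
  have "emeasure lborel Z \<le> ennreal \<epsilon>"
    unfolding Z_def
  proof (rule emeasure_countable_UN_le[OF C(1)])
    show "T x \<in> sets lborel" if "x \<in> C" for x using T(2)[OF that] by simp
    fix F assume F: "finite F" "F \<subseteq> C"
    have FB: "x \<in> B" if "x \<in> F" for x using that F C(2) by blast
    let ?U = "\<lambda>x. U x (\<sigma> x)"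
    have disj: "?U x \<inter> ?U y = {}" if "x \<in> F" "y \<in> F" "x \<noteq> y" for x y
    proof (rule ccontr)
      assume "?U x \<inter> ?U y \<noteq> {}"
      then obtain z where "norm (horiz (z - proj x)) < \<sigma> x" "norm (horiz (z - proj y)) < \<sigma> y"
        by (auto simp: U_def tube_def)
      then have "horiz z \<in> ball (horiz x) (\<sigma> x)" "horiz z \<in> ball (horiz y) (\<sigma> y)"
        by (auto simp: horiz_diff horiz_proj dist_norm norm_minus_commute)
      moreover have "disjnt (ball (horiz x) (\<sigma> x)) (ball (horiz y) (\<sigma> y))"
        using C(3) that F(2) unfolding pairwise_def by blast
      ultimately show False by (auto simp: disjnt_def)
    qed
    have var: "(\<Sum>x\<in>F. variation (?U x) w) \<le> \<epsilon>1"
      using disj \<sigma>(3) FB by (intro variation_superadditive[OF F(1) _ _ VS w(1)]) auto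
    have opU: "?U x \<in> sets borel" for x
    proof -
      have "?U x = tube (proj x) (\<sigma> x) \<inter> ({y. 0 < D y} \<inter> {y. D y < h})" by (auto simp: U_def)
      also have "open \<dots>" by (intro open_Int open_tube open_Collect_less continuous_intros continuous_D)
      finally show ?thesis by auto
    qed
    have iw: "integrable lborel (\<lambda>x. indicator A x * w x)" if "A \<in> sets borel" for A
      using integrable_mult_indicator[of A lborel w] that w(1) by simp
    have iG: "integrable lborel (\<lambda>x. indicator A x * \<bar>w x - g x\<bar>)" if "A \<in> sets borel" "bounded A" for A
      using integrable_abs[OF Bochner_Integration.integrable_diff[OF iw[OF that(1)] integrable_indicator_continuous[OF that g(1)]]]
      by (simp add: abs_mult flip: right_diff_distrib)
    have iU: "integrable lborel (\<lambda>y. indicator (?U x) y * \<bar>w y - g y\<bar>)" if "x \<in> F" for x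
      using \<sigma>(3)[OF FB[OF that]] bounded_subset[OF Sbor(2)] by (intro iG opU) auto
    have "(\<Sum>x\<in>F. G (?U x)) = (\<integral>y. (\<Sum>x\<in>F. indicator (?U x) y * \<bar>w y - g y\<bar>) \<partial>lborel)"
      unfolding G_def using iU by (intro Bochner_Integration.integral_sum[symmetric])
    also have "\<dots> \<le> G S"
      unfolding G_def
    proof (rule integral_mono)
      show "integrable lborel (\<lambda>y. \<Sum>x\<in>F. indicator (?U x) y * \<bar>w y - g y\<bar>)" using iU by (rule Bochner_Integration.integrable_sum)
      show "integrable lborel (\<lambda>y. indicator S y * \<bar>w y - g y\<bar>)" using Sbor by (rule iG)
      fix y
      have "disjoint_family_on ?U F" using disj by (auto simp: disjoint_family_on_def)
      then have "(\<Sum>x\<in>F. indicator (?U x) y) = (indicator (\<Union>x\<in>F. ?U x) y :: real)"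
        using indicator_UN_disjoint[OF F(1)] by metis
      also have "\<dots> \<le> indicator S y" using \<sigma>(3) FB by (auto simp: indicator_def)
      finally show "(\<Sum>x\<in>F. indicator (?U x) y * \<bar>w y - g y\<bar>) \<le> indicator S y * \<bar>w y - g y\<bar>"
        unfolding sum_distrib_right[symmetric] by (rule mult_right_mono) simp
    qed
    finally have sumG: "(\<Sum>x\<in>F. G (?U x)) \<le> \<epsilon>1 * h / 4" using g(2) by (simp add: G_def)
    have "(\<Sum>x\<in>F. \<sigma> x ^ (?N - 1)) \<le> (\<Sum>x\<in>F. 2 * L / \<tau> * (variation (?U x) w + 4 / h * G (?U x)))"
      by (intro sum_mono \<sigma>(4) FB)
    also have "\<dots> = 2 * L / \<tau> * ((\<Sum>x\<in>F. variation (?U x) w) + 4 / h * (\<Sum>x\<in>F. G (?U x)))"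
      by (simp only: sum_distrib_left[symmetric] sum.distrib)
    also have "\<dots> \<le> 2 * L / \<tau> * (\<epsilon>1 + 4 / h * (\<epsilon>1 * h / 4))"
      using var sumG L \<tau> h(1) by (intro mult_left_mono add_mono) auto
    also have "\<dots> = 2 * L / \<tau> * (2 * \<epsilon>1)" using h(1) by simp
    finally have s: "(\<Sum>x\<in>F. \<sigma> x ^ (?N - 1)) \<le> 2 * L / \<tau> * (2 * \<epsilon>1)" .
    have "(\<Sum>x\<in>F. emeasure lborel (T x)) = (\<Sum>x\<in>F. ennreal ((2 * (5 * \<sigma> x)) ^ (?N - 1) * (2 * \<rho>0)))"
      using T(1) F(2) by (intro sum.cong) auto
    also have "\<dots> = ennreal (\<Sum>x\<in>F. (2 * (5 * \<sigma> x)) ^ (?N - 1) * (2 * \<rho>0))"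
      using \<sigma>(1) FB \<rho>0 by (intro sum_ennreal) (auto intro!: mult_nonneg_nonneg zero_le_power less_imp_le)
    also have "(\<Sum>x\<in>F. (2 * (5 * \<sigma> x)) ^ (?N - 1) * (2 * \<rho>0)) = 10 ^ (?N - 1) * (2 * \<rho>0) * (\<Sum>x\<in>F. \<sigma> x ^ (?N - 1))"
    proof -
      have "(2 * (5 * s)) ^ m * (2 * \<rho>0) = 10 ^ m * (2 * \<rho>0) * s ^ m" for s :: real and m
        by (simp add: power_mult_distrib)
      then show ?thesis by (simp only: sum_distrib_left)
    qed
    also have "\<dots> \<le> 10 ^ (?N - 1) * (2 * \<rho>0) * (2 * L / \<tau> * (2 * \<epsilon>1))"
      using s \<rho>0 by (intro mult_left_mono) auto
    also have "\<dots> = c1 * (2 * \<epsilon>1)" by (simp add: c1_def)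
    also have "\<dots> = \<epsilon>" using c1 by (simp add: \<epsilon>1_def)
    finally show "(\<Sum>x\<in>F. emeasure lborel (T x)) \<le> ennreal \<epsilon>" by (simp add: ennreal_leI)
  qed
  then show ?thesis using Zb BZ unfolding B_def good_def by (intro bexI[of _ Z]) auto
qed

end

text \<open>A cover of \<open>A\<close> by sets of diameter \<open>d j\<close> lifts to a cover of
  the preimage by boxes of volume \<open>(2 * d j) ^ m * (2 * l)\<close> with
  \<open>m = N - 1\<close>, a fixed multiple of the Hausdorff weight. This inequality takes the
  place of an area formula.\<close>

lemma emeasure_projection_le_hausdorff:
  fixes A B :: "(real^'n) set" and P :: "real^'n \<Rightarrow> real^'n"
  assumes l: "0 < l" and B: "\<And>x. x \<in> B \<Longrightarrow> \<bar>x $ i - c $ i\<bar> \<le> l" and P: "\<And>x k. k \<noteq> i \<Longrightarrow> P x $ k = x $ k"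
  shows "ennreal (unit_ball_vol (real (CARD('n) - 1)) / (2 * l * 4 ^ (CARD('n) - 1))) * emeasure lborel (B \<inter> P -` A)
    \<le> hausdorff_outer (CARD('n) - 1) A"
proof -
  define m where "m = CARD('n) - 1"
  define v where "v = unit_ball_vol (real m)"
  have v: "0 < v" by (simp add: v_def)
  define \<kappa> where "\<kappa> = v / (2 * l * 4 ^ m)"
  have \<kappa>: "0 < \<kappa>" using v l by (simp add: \<kappa>_def)
  have "ennreal \<kappa> * emeasure lborel (B \<inter> P -` A) \<le> hausdorff_content m 1 A"
    unfolding hausdorff_content_def
  proof (rule INF_greatest)
    let ?f = "\<lambda>C. if C = {} then 0 else ennreal (unit_ball_vol (real m) * (diameter C / 2) ^ m)"
    fix C :: "nat \<Rightarrow> (real^'n) set"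
    assume "C \<in> {C. A \<subseteq> (\<Union>j. C j) \<and> (\<forall>j. bounded (C j) \<and> diameter (C j) \<le> 1)}"
    then have C: "A \<subseteq> (\<Union>j. C j)" "\<And>j. bounded (C j)" by auto
    define p where "p j = (SOME y. y \<in> C j)" for j
    have p: "p j \<in> C j" if "y \<in> C j" for j y unfolding p_def using that by (rule someI)
    define q :: "nat \<Rightarrow> real^'n" where "q j = (\<chi> k. if k = i then c $ i else p j $ k)" for j
    define d where "d j = diameter (C j)" for j
    have d0: "0 \<le> d j" for j unfolding d_def using C(2) by (rule diameter_ge_0)
    define T where "T j = (if C j = {} then {} else {x. (\<forall>k. k \<noteq> i \<longrightarrow> \<bar>x $ k - q j $ k\<bar> \<le> d j) \<and> \<bar>x $ i - q j $ i\<bar> \<le> l})" for j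
    have Tb: "T j \<in> sets borel" for j
      unfolding T_def using emeasure_axis_tube(2)[OF d0, of l i "q j" j] l by simp
    have TE: "ennreal \<kappa> * emeasure lborel (T j) = ?f (C j)" for j
    proof (cases "C j = {}")
      case False
      then have "emeasure lborel (T j) = ennreal ((2 * d j) ^ m * (2 * l))"
        unfolding T_def m_def using emeasure_axis_tube(1)[OF d0, of l i "q j" j] l by simp
      then have "ennreal \<kappa> * emeasure lborel (T j) = ennreal (\<kappa> * ((2 * d j) ^ m * (2 * l)))"
        using \<kappa> d0[of j] l by (simp add: ennreal_mult')
      also have "\<kappa> * ((2 * d j) ^ m * (2 * l)) = v * (d j / 2) ^ m"
      proof -
        have "(2 * d j) ^ m = 4 ^ m * (d j / 2) ^ m" by (subst power_mult_distrib[symmetric]) simp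
        then show ?thesis using l by (simp add: \<kappa>_def)
      qed
      finally show ?thesis using False by (simp add: v_def d_def)
    qed (simp add: T_def)
    have sub: "B \<inter> P -` A \<subseteq> (\<Union>j. T j)"
    proof
      fix x assume x: "x \<in> B \<inter> P -` A"
      then obtain j where j: "P x \<in> C j" using C(1) by blast
      then have "dist (P x) (p j) \<le> d j" unfolding d_def using C(2) p[OF j] by (intro diameter_bounded_bound)
      then have "\<bar>P x $ k - p j $ k\<bar> \<le> d j" for k
        using component_le_norm_cart[of "P x - p j" k] by (simp add: dist_norm)
      then have "\<bar>x $ k - q j $ k\<bar> \<le> d j" if "k \<noteq> i" for k using P[OF that, of x] that by (simp add: q_def) metis
      moreover have "\<bar>x $ i - q j $ i\<bar> \<le> l" using B x by (simp add: q_def)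
      ultimately have "x \<in> T j" using j by (auto simp: T_def)
      then show "x \<in> (\<Union>j. T j)" by blast
    qed
    have "emeasure lborel (B \<inter> P -` A) \<le> emeasure lborel (\<Union>j. T j)"
      using sub Tb by (intro emeasure_mono) auto
    also have "\<dots> \<le> (\<Sum>j. emeasure lborel (T j))"
      using Tb by (intro emeasure_subadditive_countably) auto
    finally have "ennreal \<kappa> * emeasure lborel (B \<inter> P -` A) \<le> ennreal \<kappa> * (\<Sum>j. emeasure lborel (T j))"
      by (rule mult_left_mono) simp
    also have "\<dots> = (\<Sum>j. ennreal \<kappa> * emeasure lborel (T j))" by (rule ennreal_suminf_cmult[symmetric])
    also have "\<dots> = (\<Sum>j. ?f (C j))" by (simp only: TE)
    finally show "ennreal \<kappa> * emeasure lborel (B \<inter> P -` A) \<le> (\<Sum>j. ?f (C j))" .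
  qed
  also have "\<dots> \<le> hausdorff_outer m A"
    unfolding hausdorff_outer_def by (rule SUP_upper) simp
  finally show ?thesis by (simp add: \<kappa>_def v_def m_def)
qed

section \<open>Almost every fibre meets the graph in a point where the trace exists\<close>

context boundary_chart
begin

lemma AE_deviation_small:
  fixes w :: "real^'n \<Rightarrow> real"
  assumes w: "integrable lborel w" "variation_le \<Omega> w V" "\<And>x. \<bar>w x\<bar> \<le> a" and \<tau>: "0 < \<tau>"
  shows "AE x in lborel. x \<in> ball x0 \<rho>0 \<longrightarrow>
    (\<exists>t\<in>\<rat>. \<exists>s0>0. \<forall>s. 0 < s \<and> s < s0 \<longrightarrow> deviation w t (proj x) s \<le> \<tau> * s ^ CARD('n))"
proof -
  define good where "good x \<longleftrightarrow> (\<exists>t\<in>\<rat>. \<exists>s0>0. \<forall>s. 0 < s \<and> s < s0 \<longrightarrow> deviation w t (proj x) s \<le> \<tau> * s ^ CARD('n))" for x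
  have "\<exists>Z. Z \<in> sets borel \<and> emeasure lborel Z \<le> ennreal (inverse (real (Suc n))) \<and> (\<forall>x\<in>ball x0 \<rho>0. x \<notin> Z \<longrightarrow> good x)" for n
    unfolding good_def using bad_set_small[OF w \<tau>, of "inverse (real (Suc n))"] by auto
  then have "\<exists>Z. \<forall>n. Z n \<in> sets borel \<and> emeasure lborel (Z n) \<le> ennreal (inverse (real (Suc n))) \<and> (\<forall>x\<in>ball x0 \<rho>0. x \<notin> Z n \<longrightarrow> good x)"
    by (intro choice allI)
  then obtain Z where Z0: "\<forall>n. Z n \<in> sets borel \<and> emeasure lborel (Z n) \<le> ennreal (inverse (real (Suc n))) \<and> (\<forall>x\<in>ball x0 \<rho>0. x \<notin> Z n \<longrightarrow> good x)" ..
  then have Z: "Z n \<in> sets borel" "emeasure lborel (Z n) \<le> ennreal (inverse (real (Suc n)))" "\<And>x. x \<in> ball x0 \<rho>0 \<Longrightarrow> x \<notin> Z n \<Longrightarrow> good x" for n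
    by auto
  have Ib: "(\<Inter>n. Z n) \<in> sets lborel" using Z(1) by auto
  have "emeasure lborel (\<Inter>n. Z n) \<le> ennreal (inverse (real (Suc n)))" for n
    using emeasure_mono[of "\<Inter>n. Z n" "Z n" lborel] Z(1,2)[of n] by (auto intro: order_trans)
  moreover have "(\<lambda>n. ennreal (inverse (real (Suc n)))) \<longlonglongrightarrow> ennreal 0"
    by (intro tendsto_ennrealI LIMSEQ_inverse_real_of_nat)
  ultimately have "emeasure lborel (\<Inter>n. Z n) \<le> ennreal 0" by (intro LIMSEQ_le_const) auto
  then have "(\<Inter>n. Z n) \<in> null_sets lborel" using Ib by (auto intro!: null_setsI)
  then have "AE x in lborel. x \<notin> (\<Inter>n. Z n)" by (rule AE_not_in)
  then show ?thesis
    unfolding good_def[symmetric] by eventually_elim (use Z(3) in auto)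
qed

text \<open>Rational values and the radii \<open>1 / (n + 1)\<close> suffice to detect the trace and make this set
  Borel.\<close>

definition trace_points :: "(real^'n \<Rightarrow> real) \<Rightarrow> (real^'n) set" where
  "trace_points w = {p \<in> ball x0 (r / 4). D p = 0 \<and> (\<forall>k. \<exists>q::rat. \<exists>m. \<forall>n\<ge>m.
     deviation w (of_rat q) p (1 / real (Suc n)) \<le> 1 / real (Suc k) * (1 / real (Suc n)) ^ CARD('n))}"

lemma borel_deviation:
  assumes [measurable]: "w \<in> borel_measurable borel"
  shows "(\<lambda>p. deviation w t p s) \<in> borel_measurable borel"
proof -
  have [measurable]: "\<Omega> \<in> sets borel" using \<Omega> by auto
  have "(\<lambda>z. indicator \<Omega> (snd z) * (if dist (fst z) (snd z) < s then 1 else 0) * \<bar>w (snd z) - t\<bar>) \<in> borel_measurable (borel \<Otimes>\<^sub>M lborel)"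
    by measurable
  then have "(\<lambda>p. \<integral>y. indicator \<Omega> y * (if dist p y < s then 1 else 0) * \<bar>w y - t\<bar> \<partial>lborel) \<in> borel_measurable borel"
    by (intro lborel.borel_measurable_lebesgue_integral) (simp add: split_beta')
  moreover have "(indicator \<Omega> y * (if dist p y < s then 1 else 0) * \<bar>w y - t\<bar> :: real) = indicator (\<Omega> \<inter> ball p s) y * \<bar>w y - t\<bar>" for p y
    by (auto simp: indicator_def)
  ultimately show ?thesis unfolding deviation_def by simp
qed

lemma borel_trace_points:
  assumes w: "w \<in> borel_measurable borel"
  shows "trace_points w \<in> sets borel"
proof -
  have 1: "{p. m \<le> n \<longrightarrow> deviation w t p s \<le> c} \<in> sets borel" for t s c and m n :: nat
    using borel_deviation[OF w, of t s] by (cases "m \<le> n") (simp_all add: borel_measurable_iff_le)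
  have "closed {p. D p = 0}" by (intro closed_Collect_eq continuous_intros continuous_D)
  then have 2: "ball x0 (r / 4) \<inter> {p. D p = 0} \<in> sets borel" by auto
  have "trace_points w = ball x0 (r / 4) \<inter> {p. D p = 0} \<inter> (\<Inter>k. \<Union>q::rat. \<Union>m. \<Inter>n.
     {p. m \<le> n \<longrightarrow> deviation w (of_rat q) p (1 / real (Suc n)) \<le> 1 / real (Suc k) * (1 / real (Suc n)) ^ CARD('n)})"
    by (auto simp: trace_points_def)
  also have "\<dots> \<in> sets borel"
    by (intro sets.Int 2 sets.countable_INT'' sets.countable_UN'' 1) auto
  finally show ?thesis .
qed

lemma AE_trace_points:
  fixes w :: "real^'n \<Rightarrow> real"
  assumes w: "integrable lborel w" "variation_le \<Omega> w V" "\<And>x. \<bar>w x\<bar> \<le> a"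
  shows "AE x in lborel. x \<in> ball x0 \<rho>0 \<longrightarrow> proj x \<in> trace_points w"
proof -
  have "AE x in lborel. \<forall>k::nat. x \<in> ball x0 \<rho>0 \<longrightarrow>
    (\<exists>t\<in>\<rat>. \<exists>s0>0. \<forall>s. 0 < s \<and> s < s0 \<longrightarrow> deviation w t (proj x) s \<le> 1 / real (Suc k) * s ^ CARD('n))"
    unfolding AE_all_countable by (intro allI AE_deviation_small[OF w]) simp
  then show ?thesis
  proof eventually_elim
    fix x assume x: "\<forall>k::nat. x \<in> ball x0 \<rho>0 \<longrightarrow>
      (\<exists>t\<in>\<rat>. \<exists>s0>0. \<forall>s. 0 < s \<and> s < s0 \<longrightarrow> deviation w t (proj x) s \<le> 1 / real (Suc k) * s ^ CARD('n))"
    show "x \<in> ball x0 \<rho>0 \<longrightarrow> proj x \<in> trace_points w"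
    proof
      assume xb: "x \<in> ball x0 \<rho>0"
      have "\<exists>q::rat. \<exists>m. \<forall>n\<ge>m. deviation w (of_rat q) (proj x) (1 / real (Suc n)) \<le> 1 / real (Suc k) * (1 / real (Suc n)) ^ CARD('n)" for k
      proof -
        obtain t s0 where t: "t \<in> \<rat>" "0 < s0" "\<And>s. 0 < s \<Longrightarrow> s < s0 \<Longrightarrow> deviation w t (proj x) s \<le> 1 / real (Suc k) * s ^ CARD('n)"
          using x xb by blast
        obtain q where q: "t = of_rat q" using t(1) Rats_cases by blast
        obtain m where m: "inverse (real (Suc m)) < s0" using reals_Archimedean[OF t(2)] by blast
        have "deviation w (of_rat q) (proj x) (1 / real (Suc n)) \<le> 1 / real (Suc k) * (1 / real (Suc n)) ^ CARD('n)" if "m \<le> n" for n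
        proof -
          have "inverse (real (Suc n)) \<le> inverse (real (Suc m))" using that by (intro le_imp_inverse_le) auto
          then have "1 / real (Suc n) < s0" using m by (simp add: inverse_eq_divide)
          then show ?thesis unfolding q[symmetric] by (intro t(3)) auto
        qed
        then show ?thesis by blast
      qed
      then show "proj x \<in> trace_points w" using proj_near[OF xb] D_proj by (simp add: trace_points_def)
    qed
  qed
qed

lemma deviation_facts:
  assumes w: "integrable lborel w"
  shows "deviation w t p s \<le> deviation w t' p s + \<bar>t - t'\<bar> * measure lborel (\<Omega> \<inter> ball p s)"
    "\<bar>t - t'\<bar> * measure lborel (\<Omega> \<inter> ball p s) \<le> deviation w t p s + deviation w t' p s"
    "s \<le> s' \<Longrightarrow> deviation w t p s \<le> deviation w t p s'" "0 \<le> deviation w t p s"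
proof -
  have B: "\<Omega> \<inter> ball p s \<in> sets borel" "bounded (\<Omega> \<inter> ball p s)" for s using \<Omega> by (auto simp: bounded_Int)
  have iw: "integrable lborel (\<lambda>x. indicator (\<Omega> \<inter> ball p s) x * w x)" for s
    using integrable_mult_indicator[of "\<Omega> \<inter> ball p s" lborel w] B w by simp
  have i: "integrable lborel (\<lambda>x. indicator (\<Omega> \<inter> ball p s) x * \<bar>w x - t\<bar>)" for t s
  proof -
    have "integrable lborel (\<lambda>x. indicator (\<Omega> \<inter> ball p s) x * w x - indicator (\<Omega> \<inter> ball p s) x * t)"
      by (rule Bochner_Integration.integrable_diff[OF iw integrable_indicator_continuous[OF B continuous_on_const]])
    from integrable_abs[OF this] show ?thesis by (simp add: abs_mult flip: right_diff_distrib)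
  qed
  have ic: "integrable lborel (\<lambda>x. indicator (\<Omega> \<inter> ball p s) x * \<bar>t - t'\<bar>)"
    by (rule integrable_indicator_continuous[OF B continuous_on_const])
  have m: "(\<integral>x. indicator (\<Omega> \<inter> ball p s) x * \<bar>t - t'\<bar> \<partial>lborel) = \<bar>t - t'\<bar> * measure lborel (\<Omega> \<inter> ball p s)"
    using B by simp
  have "deviation w t p s \<le> (\<integral>x. indicator (\<Omega> \<inter> ball p s) x * \<bar>w x - t'\<bar> + indicator (\<Omega> \<inter> ball p s) x * \<bar>t - t'\<bar> \<partial>lborel)"
    unfolding deviation_def
    by (intro integral_mono i ic Bochner_Integration.integrable_add) (auto simp: indicator_def)
  then show "deviation w t p s \<le> deviation w t' p s + \<bar>t - t'\<bar> * measure lborel (\<Omega> \<inter> ball p s)"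
    using Bochner_Integration.integral_add[OF i ic] m by (simp add: deviation_def mult.commute)
  have "(\<integral>x. indicator (\<Omega> \<inter> ball p s) x * \<bar>t - t'\<bar> \<partial>lborel) \<le>
      (\<integral>x. indicator (\<Omega> \<inter> ball p s) x * \<bar>w x - t\<bar> + indicator (\<Omega> \<inter> ball p s) x * \<bar>w x - t'\<bar> \<partial>lborel)"
    by (intro integral_mono i ic Bochner_Integration.integrable_add) (auto simp: indicator_def)
  then show "\<bar>t - t'\<bar> * measure lborel (\<Omega> \<inter> ball p s) \<le> deviation w t p s + deviation w t' p s"
    using Bochner_Integration.integral_add[OF i i] m by (simp add: deviation_def mult.commute)
  show "s \<le> s' \<Longrightarrow> deviation w t p s \<le> deviation w t p s'"
    unfolding deviation_def by (intro integral_mono i) (auto simp: indicator_def)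
  show "0 \<le> deviation w t p s" unfolding deviation_def by (intro integral_nonneg_AE) auto
qed

text \<open>Two approximate values, for different tolerances, approximate \<open>w\<close> on the
  same small ball of positive volume and are therefore close to each other. They form a Cauchy
  sequence, and its limit is the trace.\<close>

lemma trace_exists:
  fixes w :: "real^'n \<Rightarrow> real"
  assumes w: "integrable lborel w" and p: "p \<in> trace_points w"
  shows "\<exists>t. ((\<lambda>s. deviation w t p s / measure lborel (\<Omega> \<inter> ball p s)) \<longlongrightarrow> 0) (at_right 0)"
proof -
  let ?N = "CARD('n)"
  let ?\<mu> = "\<lambda>s. measure lborel (\<Omega> \<inter> ball p s)"
  have pb: "p \<in> ball x0 (r / 4)" "D p = 0" using p by (auto simp: trace_points_def)
  define c0 where "c0 = measure lborel (ball 0 (1 / (4 * L)) :: (real^'n) set)"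
  have c0: "0 < c0" using L content_ball_pos[of "1 / (4 * L)" "0::real^'n"] by (simp add: c0_def)
  have \<mu>: "c0 * s ^ ?N \<le> ?\<mu> s" "0 < ?\<mu> s" if "0 < s" "s < r / 4" for s
  proof -
    show "c0 * s ^ ?N \<le> ?\<mu> s" unfolding c0_def using pb that by (rule measure_ball_part_ge)
    moreover have "0 < c0 * s ^ ?N" using c0 that by simp
    ultimately show "0 < ?\<mu> s" by linarith
  qed
  \<comment> \<open>The factor \<open>2 ^ N\<close> pays for replacing \<open>s\<close> by a nearby
    radius of the form \<open>1 / (n + 1)\<close>, the factor \<open>1 / c0\<close> for replacing
    \<open>s ^ N\<close> by the volume.\<close>
  define C where "C = 2 ^ ?N / c0"
  have C: "0 < C" using c0 by (simp add: C_def)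
  have "\<forall>k. \<exists>q. \<exists>s0>0. \<forall>s. 0 < s \<and> s < s0 \<longrightarrow> deviation w q p s \<le> C / real (Suc k) * ?\<mu> s"
  proof
    fix k
    obtain q :: rat and m where q: "\<And>n. m \<le> n \<Longrightarrow> deviation w (of_rat q) p (1 / real (Suc n)) \<le> 1 / real (Suc k) * (1 / real (Suc n)) ^ ?N"
      using p unfolding trace_points_def by blast
    have "deviation w (of_rat q) p s \<le> C / real (Suc k) * ?\<mu> s" if s: "0 < s" "s < min (r / 4) (1 / real (Suc (Suc m)))" for s
    proof -
      \<comment> \<open>With this \<open>n\<close> the radius \<open>1 / Suc n\<close> lies between
        \<open>s\<close> and \<open>2 * s\<close>, so the discrete radii control all small
        ones.\<close>
      define n where "n = nat \<lfloor>1 / s\<rfloor> - 1"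
      have big: "real (Suc (Suc m)) < 1 / s" using s by (simp add: field_simps)
      then have fl: "int (Suc (Suc m)) \<le> \<lfloor>1 / s\<rfloor>" by (simp add: le_floor_iff)
      then have n: "real (Suc n) = of_int \<lfloor>1 / s\<rfloor>" "m \<le> n" by (auto simp: n_def)
      have n1: "real (Suc n) \<le> 1 / s" "1 / s < real (Suc n) + 1" unfolding n(1) by linarith+
      have le: "s \<le> 1 / real (Suc n)" using n1(1) s by (simp add: field_simps)
      have "1 < s * (real (Suc n) + 1)" using n1(2) s by (simp add: field_simps)
      also have "\<dots> \<le> s * (2 * real (Suc n))" using s by (intro mult_left_mono) auto
      finally have le2: "1 / real (Suc n) \<le> 2 * s" by (simp add: field_simps)
      have "deviation w (of_rat q) p s \<le> deviation w (of_rat q) p (1 / real (Suc n))" using le by (rule deviation_facts(3)[OF w])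
      also have "\<dots> \<le> 1 / real (Suc k) * (1 / real (Suc n)) ^ ?N" using n(2) by (rule q)
      also have "\<dots> \<le> 1 / real (Suc k) * (2 * s) ^ ?N" using le2 by (intro mult_left_mono power_mono) auto
      also have "\<dots> = C / real (Suc k) * (c0 * s ^ ?N)" using c0 by (simp add: C_def power_mult_distrib)
      also have "\<dots> \<le> C / real (Suc k) * ?\<mu> s" using \<mu>(1)[of s] s C by (intro mult_left_mono) auto
      finally show ?thesis .
    qed
    then show "\<exists>q. \<exists>s0>0. \<forall>s. 0 < s \<and> s < s0 \<longrightarrow> deviation w q p s \<le> C / real (Suc k) * ?\<mu> s"
      using r by (intro exI[of _ "of_rat q"] exI[of _ "min (r / 4) (1 / real (Suc (Suc m)))"]) auto
  qed
  then have "\<exists>q. \<forall>k. \<exists>s0>0. \<forall>s. 0 < s \<and> s < s0 \<longrightarrow> deviation w (q k) p s \<le> C / real (Suc k) * ?\<mu> s" by (rule choice)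
  then obtain q where q0: "\<forall>k. \<exists>s0>0. \<forall>s. 0 < s \<and> s < s0 \<longrightarrow> deviation w (q k) p s \<le> C / real (Suc k) * ?\<mu> s" ..
  have q: "\<forall>\<^sub>F s in at_right 0. 0 < s \<and> s < r / 4 \<and> deviation w (q k) p s \<le> C / real (Suc k) * ?\<mu> s" for k
  proof -
    obtain s0 where "0 < s0" "\<forall>s. 0 < s \<and> s < s0 \<longrightarrow> deviation w (q k) p s \<le> C / real (Suc k) * ?\<mu> s" using q0 by blast
    then show ?thesis unfolding eventually_at_right_field using r by (intro exI[of _ "min s0 (r / 4)"]) auto
  qed
  have qd: "\<bar>q j - q k\<bar> \<le> C / real (Suc j) + C / real (Suc k)" for j k
  proof -
    obtain s where s: "0 < s \<and> s < r / 4 \<and> deviation w (q j) p s \<le> C / real (Suc j) * ?\<mu> s"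
        "0 < s \<and> s < r / 4 \<and> deviation w (q k) p s \<le> C / real (Suc k) * ?\<mu> s"
      using eventually_happens'[OF trivial_limit_at_right_real eventually_conj[OF q[of j] q[of k]]] by auto
    have "\<bar>q j - q k\<bar> * ?\<mu> s \<le> deviation w (q j) p s + deviation w (q k) p s" by (rule deviation_facts(2)[OF w])
    also have "\<dots> \<le> (C / real (Suc j) + C / real (Suc k)) * ?\<mu> s" using s by (simp add: distrib_right)
    finally show "\<bar>q j - q k\<bar> \<le> C / real (Suc j) + C / real (Suc k)" using \<mu>(2)[of s] s by simp
  qed
  have Clim: "(\<lambda>k. C / real (Suc k)) \<longlonglongrightarrow> 0"
    using tendsto_mult[OF tendsto_const[of C] LIMSEQ_inverse_real_of_nat] by (simp add: divide_inverse)
  have "Cauchy q"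
  proof (rule metric_CauchyI)
    fix \<epsilon> :: real assume \<epsilon>: "0 < \<epsilon>"
    then obtain K where K: "\<And>k. K \<le> k \<Longrightarrow> C / real (Suc k) < \<epsilon> / 2"
      using order_tendstoD(2)[OF Clim, of "\<epsilon> / 2"] by (auto simp: eventually_sequentially)
    have "dist (q j) (q k) < \<epsilon>" if "K \<le> j" "K \<le> k" for j k
      using qd[of j k] K[OF that(1)] K[OF that(2)] unfolding dist_real_def by linarith
    then show "\<exists>M. \<forall>m\<ge>M. \<forall>n\<ge>M. dist (q m) (q n) < \<epsilon>" by blast
  qed
  then obtain t where t: "q \<longlonglongrightarrow> t" using Cauchy_convergent convergent_def by blast
  show ?thesis
  proof (rule exI[of _ t], rule tendstoI)
    fix \<epsilon> :: real assume \<epsilon>: "0 < \<epsilon>"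
    have "(\<lambda>k. C / real (Suc k) + \<bar>t - q k\<bar>) \<longlonglongrightarrow> 0 + \<bar>t - t\<bar>" by (intro tendsto_intros Clim t)
    then have "\<forall>\<^sub>F k in sequentially. C / real (Suc k) + \<bar>t - q k\<bar> < \<epsilon>" using \<epsilon> by (intro order_tendstoD(2)) auto
    then obtain k where k: "C / real (Suc k) + \<bar>t - q k\<bar> < \<epsilon>" using eventually_happens[of _ sequentially] by auto
    show "\<forall>\<^sub>F s in at_right 0. dist (deviation w t p s / ?\<mu> s) 0 < \<epsilon>"
      using q[of k]
    proof eventually_elim
      fix s assume s: "0 < s \<and> s < r / 4 \<and> deviation w (q k) p s \<le> C / real (Suc k) * ?\<mu> s"
      have m: "0 < ?\<mu> s" using \<mu>(2) s by blast
      have "deviation w t p s \<le> deviation w (q k) p s + \<bar>t - q k\<bar> * ?\<mu> s" by (rule deviation_facts(1)[OF w])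
      also have "\<dots> \<le> (C / real (Suc k) + \<bar>t - q k\<bar>) * ?\<mu> s" using s by (simp add: distrib_right)
      also have "\<dots> < \<epsilon> * ?\<mu> s" using k m by (intro mult_strict_right_mono)
      finally have "deviation w t p s / ?\<mu> s < \<epsilon>" using m by (simp add: field_simps)
      then show "dist (deviation w t p s / ?\<mu> s) 0 < \<epsilon>"
        using deviation_facts(4)[OF w, of t p s] m by (simp add: dist_real_def)
    qed
  qed
qed

section \<open>Boundary strips and the trace integral\<close>

text \<open>The constant of \<open>emeasure_projection_le_hausdorff\<close> for a slab of half width
  \<open>\<rho>0\<close>.\<close>

definition proj_const :: real where
  "proj_const = unit_ball_vol (real (CARD('n) - 1)) / (2 * \<rho>0 * 4 ^ (CARD('n) - 1))"

text \<open>Half widths \<open>fibre_const * s\<close> add up to a horizontal distance of at most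
  \<open>s / (2 * (1 + L))\<close>, hence to at most \<open>s / 2\<close> after projection.\<close>

definition fibre_const :: real where
  "fibre_const = 1 / (2 * real CARD('n) * (1 + L))"

text \<open>It balances the ball volume bound \<open>(2 * s) ^ N\<close> against the volume of a
  fibre tube, with the Hausdorff constant divided out.\<close>

definition patch_const :: real where
  "patch_const = 2 * 2 ^ CARD('n) / ((2 * fibre_const) ^ (CARD('n) - 1) * \<rho>0) / proj_const"

lemma const_pos: "0 < proj_const" "0 < fibre_const" "0 < patch_const"
proof -
  show a: "0 < proj_const" using \<rho>0 by (simp add: proj_const_def)
  show b: "0 < fibre_const" using L by (simp add: fibre_const_def)
  show "0 < patch_const" using a b \<rho>0 by (simp add: patch_const_def)
qed

definition patch_strip :: "real \<Rightarrow> (real^'n) set" where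
  "patch_strip \<delta> = {y \<in> ball x0 (\<rho>0 / 4). 0 < D y \<and> D y < \<delta>}"

lemma patch_strip_open: "open (patch_strip \<delta>)"
proof -
  have "patch_strip \<delta> = ball x0 (\<rho>0 / 4) \<inter> ({y. 0 < D y} \<inter> {y. D y < \<delta>})" by (auto simp: patch_strip_def)
  also have "open \<dots>" by (intro open_Int open_ball open_Collect_less continuous_intros continuous_D)
  finally show ?thesis .
qed

lemma patch_strip_subset: "patch_strip \<delta> \<subseteq> \<Omega>"
proof
  fix y assume "y \<in> patch_strip \<delta>"
  then have "y \<in> {x \<in> ball x0 r. 0 < D x}" using \<rho>0 r by (auto simp: patch_strip_def)
  then show "y \<in> \<Omega>" unfolding chart[symmetric] by simp
qed

text \<open>A point near the graph lies in the ball about the projection of every point in a thin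
  tube around its fibre. The volume of this tube is the multiplicity in
  \<open>strip_integral_le\<close>.\<close>

lemma fibre_tube_subset:
  assumes y: "y \<in> patch_strip (s / 2)" and s: "0 < s" "s \<le> \<rho>0"
    and x: "\<And>k. k \<noteq> i \<Longrightarrow> \<bar>x $ k - y $ k\<bar> \<le> fibre_const * s" "\<bar>x $ i - y $ i\<bar> \<le> \<rho>0 / 2"
  shows "x \<in> ball x0 \<rho>0" "dist (proj x) y < s"
proof -
  define t where "t = (x - y) \<bullet> e"
  define z where "z = y + t *\<^sub>R e"
  have xz: "x - z = horiz (x - y)" by (simp add: z_def t_def horiz_def)
  have tabs: "\<bar>t\<bar> = \<bar>x $ i - y $ i\<bar>" using e_axis by (auto simp: t_def inner_axis)
  have "norm (horiz (x - y)) \<le> (\<Sum>k\<in>UNIV. \<bar>horiz (x - y) $ k\<bar>)" by (rule norm_le_l1_cart)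
  also have "\<dots> \<le> (\<Sum>k\<in>(UNIV :: 'n set). fibre_const * s)"
    using x(1) const_pos(2) s by (intro sum_mono) (simp add: horiz_component)
  also have "\<dots> = s / (2 * (1 + L))" by (simp add: fibre_const_def)
  finally have nxz: "norm (x - z) \<le> s / (2 * (1 + L))" using xz by simp
  have "s / (2 * (1 + L)) \<le> s / 4" using L s by (intro divide_left_mono) auto
  then have nxz4: "norm (x - z) \<le> s / 4" using nxz by linarith
  have nz: "norm (z - y) \<le> \<rho>0 / 2" using x(2) tabs norm_e by (simp add: z_def)
  have ny: "norm (y - x0) < \<rho>0 / 4" using y by (simp add: patch_strip_def dist_norm norm_minus_commute)
  have "norm (z - x0) \<le> norm (z - y) + norm (y - x0)" using norm_triangle_ineq[of "z - y" "y - x0"] by simp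
  then have nzx0: "norm (z - x0) < 3 * \<rho>0 / 4" using nz ny by linarith
  have "norm (x - x0) \<le> norm (x - z) + norm (z - x0)" using norm_triangle_ineq[of "x - z" "z - x0"] by simp
  then have nxx0: "norm (x - x0) < \<rho>0" using nzx0 nxz4 s by linarith
  then show xb: "x \<in> ball x0 \<rho>0" by (simp add: dist_norm norm_minus_commute)
  have "z \<in> cball x0 r" "x \<in> cball x0 r" using nzx0 nxx0 \<rho>0 r by (auto simp: dist_norm norm_minus_commute)
  then have "\<bar>D x - D z\<bar> \<le> L * norm (x - z)" by (intro lip)
  then have De: "norm ((D x - D z) *\<^sub>R e) \<le> L * norm (x - z)" using norm_e by simp
  have pe: "proj x - proj z = (x - z) - (D x - D z) *\<^sub>R e" by (simp add: proj_def algebra_simps)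
  have "norm (proj x - proj z) \<le> norm (x - z) + norm ((D x - D z) *\<^sub>R e)"
    unfolding pe by (rule norm_triangle_ineq4)
  also have "\<dots> \<le> norm (x - z) + L * norm (x - z)" using De by (rule add_left_mono)
  also have "\<dots> = (1 + L) * norm (x - z)" by (simp add: algebra_simps)
  also have "\<dots> \<le> (1 + L) * (s / (2 * (1 + L)))" using nxz L by (intro mult_left_mono) auto
  also have "\<dots> = s / 2" using L by (simp add: field_simps)
  finally have pz: "norm (proj x - proj z) \<le> s / 2" .
  have "proj z = proj y" unfolding z_def by (rule proj_shift)
  moreover have "norm (proj y - y) < s / 2" using y norm_e by (simp add: proj_def patch_strip_def)
  ultimately show "dist (proj x) y < s"
    using pz norm_triangle_ineq[of "proj x - proj y" "proj y - y"] by (simp add: dist_norm)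
qed

text \<open>The mean of \<open>\<bar>w\<bar>\<close> differs from \<open>\<bar>t\<bar>\<close> by at
  most the mean of \<open>\<bar>w - t\<bar>\<close>.\<close>

lemma trace_limit:
  fixes u w :: "real^'n \<Rightarrow> real"
  assumes u: "u \<in> borel_measurable (lebesgue_on \<Omega>)" and eq: "AE x in lebesgue. x \<in> \<Omega> \<longrightarrow> u x = w x"
    and w: "integrable lborel w" and p: "p \<in> trace_points w"
  shows "(\<lambda>n. deviation w 0 p (1 / real (Suc n)) / measure lborel (\<Omega> \<inter> ball p (1 / real (Suc n)))) \<longlonglongrightarrow> \<bar>bv_trace \<Omega> u p\<bar>"
    "p \<in> frontier \<Omega>"
proof -
  let ?\<mu> = "\<lambda>s. measure lborel (\<Omega> \<inter> ball p s)"
  have pb: "p \<in> ball x0 (r / 4)" "D p = 0" using p by (auto simp: trace_points_def)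
  show fr: "p \<in> frontier \<Omega>" using pb r by (intro graph_frontier) auto
  then have cl: "p \<in> closure \<Omega>" by (simp add: frontier_def)
  have wb: "w \<in> borel_measurable borel" using w by (simp add: borel_measurable_integrable)
  obtain t where t: "((\<lambda>s. deviation w t p s / ?\<mu> s) \<longlongrightarrow> 0) (at_right 0)" using trace_exists[OF w p] by auto
  then have "has_trace_at \<Omega> u p t" unfolding has_trace_at_lborel[OF \<Omega> u wb eq] deviation_def .
  then have tr: "bv_trace \<Omega> u p = t" by (rule bv_trace_eq[OF \<Omega> cl u w eq])
  have "((\<lambda>s. deviation w 0 p s / ?\<mu> s - \<bar>t\<bar>) \<longlongrightarrow> 0) (at_right 0)"
  proof (rule Lim_null_comparison[OF _ t])
    have "\<bar>deviation w 0 p s / ?\<mu> s - \<bar>t\<bar>\<bar> \<le> deviation w t p s / ?\<mu> s" if s: "0 < s" "s < r / 4" for s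
    proof -
      define c where "c = measure lborel (ball 0 (1 / (4 * L)) :: (real^'n) set)"
      have "0 < c" using L content_ball_pos[of "1 / (4 * L)" "0::real^'n"] by (simp add: c_def)
      then have "0 < c * s ^ CARD('n)" using s by simp
      moreover have "c * s ^ CARD('n) \<le> ?\<mu> s" unfolding c_def using pb s by (rule measure_ball_part_ge)
      ultimately have m: "0 < ?\<mu> s" by linarith
      have "deviation w 0 p s \<le> deviation w t p s + \<bar>t\<bar> * ?\<mu> s" using deviation_facts(1)[OF w, of 0 p s t] by simp
      moreover have "\<bar>t\<bar> * ?\<mu> s \<le> deviation w t p s + deviation w 0 p s" using deviation_facts(2)[OF w, of t 0 p s] by simp
      ultimately have "\<bar>deviation w 0 p s - \<bar>t\<bar> * ?\<mu> s\<bar> \<le> deviation w t p s" by linarith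
      then have "\<bar>deviation w 0 p s - \<bar>t\<bar> * ?\<mu> s\<bar> / ?\<mu> s \<le> deviation w t p s / ?\<mu> s" using m by (intro divide_right_mono) auto
      moreover have "\<bar>deviation w 0 p s - \<bar>t\<bar> * ?\<mu> s\<bar> / ?\<mu> s = \<bar>deviation w 0 p s / ?\<mu> s - \<bar>t\<bar>\<bar>"
      proof -
        have "deviation w 0 p s / ?\<mu> s - \<bar>t\<bar> = (deviation w 0 p s - \<bar>t\<bar> * ?\<mu> s) / ?\<mu> s" using m by (simp add: diff_divide_distrib)
        then show ?thesis using m by (simp only: abs_divide abs_of_pos)
      qed
      ultimately show ?thesis by simp
    qed
    then show "\<forall>\<^sub>F s in at_right 0. norm (deviation w 0 p s / ?\<mu> s - \<bar>t\<bar>) \<le> deviation w t p s / ?\<mu> s"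
      unfolding eventually_at_right_field using r by (intro exI[of _ "r / 4"]) auto
  qed
  then have "((\<lambda>s. deviation w 0 p s / ?\<mu> s) \<longlongrightarrow> \<bar>t\<bar>) (at_right 0)" by (rule LIM_zero_cancel)
  moreover have "filterlim (\<lambda>n. 1 / real (Suc n)) (at_right 0) sequentially"
    unfolding filterlim_at using LIMSEQ_inverse_real_of_nat by (auto simp: inverse_eq_divide)
  ultimately show "(\<lambda>n. deviation w 0 p (1 / real (Suc n)) / ?\<mu> (1 / real (Suc n))) \<longlonglongrightarrow> \<bar>bv_trace \<Omega> u p\<bar>"
    unfolding tr by (rule filterlim_compose)
qed

text \<open>Fubini over the pairs with \<open>y\<close> closer than \<open>s\<close> to
  \<open>proj x\<close>: each \<open>y\<close> of the strip is counted with at least the volume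
  \<open>K\<close> of its tube, so the strip mean is dominated by means over balls centred on the
  graph.\<close>

lemma strip_integral_le:
  fixes w :: "real^'n \<Rightarrow> real"
  assumes w: "integrable lborel w" and a: "\<And>x. \<bar>w x\<bar> \<le> a" and s: "0 < s" "s \<le> \<rho>0"
  shows "ennreal (2 / s * (\<integral>y. indicator (patch_strip (s / 2)) y * \<bar>w y\<bar> \<partial>lborel)) \<le>
    ennreal (patch_const * proj_const) * (\<integral>\<^sup>+ x. indicator (ball x0 \<rho>0) x * ennreal (deviation w 0 (proj x) s / measure lborel (\<Omega> \<inter> ball (proj x) s)) \<partial>lborel)"
proof -
  let ?N = "CARD('n)"
  define S where "S = patch_strip (s / 2)"
  define B where "B = ball x0 \<rho>0"
  define c where "c = inverse ((2 * s) ^ ?N)"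
  have c: "0 < c" using s by (simp add: c_def)
  have wb[measurable]: "w \<in> borel_measurable borel" using w by (simp add: borel_measurable_integrable)
  have [measurable]: "\<Omega> \<in> sets borel" "S \<in> sets borel" "B \<in> sets borel"
    using \<Omega> patch_strip_open by (auto simp: S_def B_def)
  have [measurable]: "proj \<in> borel_measurable borel" using continuous_proj by (rule borel_measurable_continuous_onI)
  have dev: "ennreal (deviation w 0 p s) = (\<integral>\<^sup>+ y. indicator \<Omega> y * (if dist p y < s then ennreal \<bar>w y\<bar> else 0) \<partial>lborel)" for p
  proof -
    have "integrable lborel (\<lambda>y. indicator (\<Omega> \<inter> ball p s) y *\<^sub>R \<bar>w y\<bar>)"
      using integrable_abs[OF w] \<Omega> by (intro integrable_mult_indicator) auto
    then have "ennreal (deviation w 0 p s) = (\<integral>\<^sup>+ y. ennreal (indicator (\<Omega> \<inter> ball p s) y * \<bar>w y\<bar>) \<partial>lborel)"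
      unfolding deviation_def by (subst nn_integral_eq_integral) auto
    also have "\<dots> = (\<integral>\<^sup>+ y. indicator \<Omega> y * (if dist p y < s then ennreal \<bar>w y\<bar> else 0) \<partial>lborel)"
      by (intro nn_integral_cong) (auto simp: indicator_def)
    finally show ?thesis .
  qed
  \<comment> \<open>If the volume is zero, the quotient is \<open>0\<close> by convention, and so is
    the deviation because \<open>w\<close> is bounded.\<close>
  have dev_le: "c * deviation w 0 p s \<le> deviation w 0 p s / measure lborel (\<Omega> \<inter> ball p s)" for p
  proof (cases "measure lborel (\<Omega> \<inter> ball p s) = 0")
    case True
    have "deviation w 0 p s \<le> (\<integral>y. indicator (\<Omega> \<inter> ball p s) y * a \<partial>lborel)"
      unfolding deviation_def
    proof (rule integral_mono)
      show "integrable lborel (\<lambda>y. indicator (\<Omega> \<inter> ball p s) y * \<bar>w y - 0\<bar>)"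
        using integrable_mult_indicator[of "\<Omega> \<inter> ball p s" lborel "\<lambda>y. \<bar>w y\<bar>"] integrable_abs[OF w] \<Omega> by simp
      show "integrable lborel (\<lambda>y. indicator (\<Omega> \<inter> ball p s) y * a)"
        using \<Omega> by (intro integrable_indicator_continuous) (auto simp: bounded_Int)
    qed (use a in \<open>auto simp: indicator_def\<close>)
    also have "\<dots> = 0" using True \<Omega> by simp
    finally show ?thesis using True c deviation_facts(4)[OF w, of 0 p s] by (simp add: mult_nonneg_nonpos)
  next
    case False
    then have m: "0 < measure lborel (\<Omega> \<inter> ball p s)" using measure_nonneg[of lborel "\<Omega> \<inter> ball p s"] by linarith
    have "measure lborel (\<Omega> \<inter> ball p s) \<le> measure lborel (ball p s)"
    proof (rule measure_mono_fmeasurable)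
      show "ball p s \<in> fmeasurable lborel" using emeasure_bounded_finite[OF bounded_ball, of p s] by (intro fmeasurableI) auto
    qed (use \<Omega> in auto)
    also have "\<dots> \<le> (2 * s) ^ ?N" using s(1) by (rule measure_ball_le)
    finally have "deviation w 0 p s / (2 * s) ^ ?N \<le> deviation w 0 p s / measure lborel (\<Omega> \<inter> ball p s)"
      using m s deviation_facts(4)[OF w, of 0 p s] by (intro divide_left_mono) auto
    then show ?thesis by (simp add: c_def divide_inverse mult.commute)
  qed
  define K where "K = (2 * (fibre_const * s)) ^ (?N - 1) * (2 * (\<rho>0 / 2))"
  have K: "0 \<le> K" using const_pos s \<rho>0 by (simp add: K_def)
  have tube: "ennreal K * (indicator S y * ennreal \<bar>w y\<bar>) \<le> (\<integral>\<^sup>+ x. indicator B x * (indicator \<Omega> y * (if dist (proj x) y < s then ennreal \<bar>w y\<bar> else 0)) \<partial>lborel)" for y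
  proof (cases "y \<in> S")
    case True
    define T where "T = {x. (\<forall>k. k \<noteq> i \<longrightarrow> \<bar>x $ k - y $ k\<bar> \<le> fibre_const * s) \<and> \<bar>x $ i - y $ i\<bar> \<le> \<rho>0 / 2}"
    have T: "emeasure lborel T = ennreal K" "T \<in> sets borel"
      unfolding T_def K_def using const_pos s \<rho>0 by (intro emeasure_axis_tube; simp)+
    have "y \<in> \<Omega>" using True patch_strip_subset by (auto simp: S_def)
    have "ennreal K * ennreal \<bar>w y\<bar> = (\<integral>\<^sup>+ x. ennreal \<bar>w y\<bar> * indicator T x \<partial>lborel)"
      using T by (subst nn_integral_cmult_indicator) (auto simp: mult.commute)
    also have "\<dots> \<le> (\<integral>\<^sup>+ x. indicator B x * (indicator \<Omega> y * (if dist (proj x) y < s then ennreal \<bar>w y\<bar> else 0)) \<partial>lborel)"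
    proof (rule nn_integral_mono)
      fix x
      show "ennreal \<bar>w y\<bar> * indicator T x \<le> indicator B x * (indicator \<Omega> y * (if dist (proj x) y < s then ennreal \<bar>w y\<bar> else 0))"
      proof (cases "x \<in> T")
        case xT: True
        have "x \<in> B" "dist (proj x) y < s"
          using fibre_tube_subset[OF True[unfolded S_def] s, of x] xT unfolding T_def B_def by auto
        then show ?thesis using \<open>y \<in> \<Omega>\<close> xT by simp
      qed simp
    qed
    finally show ?thesis using True by simp
  qed simp
  have "ennreal K * (\<integral>\<^sup>+ y. indicator S y * ennreal \<bar>w y\<bar> \<partial>lborel) = (\<integral>\<^sup>+ y. ennreal K * (indicator S y * ennreal \<bar>w y\<bar>) \<partial>lborel)"
    by (intro nn_integral_cmult[symmetric]) measurable
  also have "\<dots> \<le> (\<integral>\<^sup>+ y. \<integral>\<^sup>+ x. indicator B x * (indicator \<Omega> y * (if dist (proj x) y < s then ennreal \<bar>w y\<bar> else 0)) \<partial>lborel \<partial>lborel)"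
    by (intro nn_integral_mono tube)
  also have "\<dots> = (\<integral>\<^sup>+ x. \<integral>\<^sup>+ y. indicator B x * (indicator \<Omega> y * (if dist (proj x) y < s then ennreal \<bar>w y\<bar> else 0)) \<partial>lborel \<partial>lborel)"
    by (rule lborel_pair.Fubini') measurable
  also have "\<dots> = (\<integral>\<^sup>+ x. indicator B x * ennreal (deviation w 0 (proj x) s) \<partial>lborel)"
    unfolding dev by (intro nn_integral_cong nn_integral_cmult) measurable
  finally have main: "ennreal K * (\<integral>\<^sup>+ y. indicator S y * ennreal \<bar>w y\<bar> \<partial>lborel) \<le> (\<integral>\<^sup>+ x. indicator B x * ennreal (deviation w 0 (proj x) s) \<partial>lborel)" .
  have iS: "integrable lborel (\<lambda>y. indicator S y *\<^sub>R \<bar>w y\<bar>)"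
    using integrable_abs[OF w] by (intro integrable_mult_indicator) auto
  have "(\<integral>\<^sup>+ y. indicator S y * ennreal \<bar>w y\<bar> \<partial>lborel) = (\<integral>\<^sup>+ y. ennreal (indicator S y *\<^sub>R \<bar>w y\<bar>) \<partial>lborel)"
    by (intro nn_integral_cong) (auto simp: indicator_def)
  also have "\<dots> = ennreal (\<integral>y. indicator S y *\<^sub>R \<bar>w y\<bar> \<partial>lborel)" using iS by (intro nn_integral_eq_integral) auto
  finally have S_int: "(\<integral>\<^sup>+ y. indicator S y * ennreal \<bar>w y\<bar> \<partial>lborel) = ennreal (\<integral>y. indicator S y * \<bar>w y\<bar> \<partial>lborel)" by simp
  have IS0: "0 \<le> (\<integral>y. indicator S y * \<bar>w y\<bar> \<partial>lborel)" by (intro integral_nonneg_AE) auto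
  have const: "2 / s = patch_const * proj_const * c * K"
  proof -
    have "s ^ ?N = s * s ^ (?N - 1)" by (metis One_nat_def Suc_pred power_Suc zero_less_card_finite)
    then show ?thesis
      using s const_pos \<rho>0 unfolding patch_const_def c_def K_def power_mult_distrib by (simp add: field_simps)
  qed
  have "ennreal (2 / s * (\<integral>y. indicator S y * \<bar>w y\<bar> \<partial>lborel)) = ennreal (patch_const * proj_const) * (ennreal c * (ennreal K * ennreal (\<integral>y. indicator S y * \<bar>w y\<bar> \<partial>lborel)))"
    unfolding const using const_pos c K IS0 by (simp add: ennreal_mult' mult.assoc)
  also have "\<dots> \<le> ennreal (patch_const * proj_const) * (ennreal c * (\<integral>\<^sup>+ x. indicator B x * ennreal (deviation w 0 (proj x) s) \<partial>lborel))"
    using main unfolding S_int by (intro mult_left_mono) auto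
  also have "ennreal c * (\<integral>\<^sup>+ x. indicator B x * ennreal (deviation w 0 (proj x) s) \<partial>lborel) = (\<integral>\<^sup>+ x. ennreal c * (indicator B x * ennreal (deviation w 0 (proj x) s)) \<partial>lborel)"
  proof (rule nn_integral_cmult[symmetric])
    have "(\<lambda>x. deviation w 0 (proj x) s) \<in> borel_measurable borel"
      by (rule measurable_compose[OF _ borel_deviation[OF wb]]) measurable
    then show "(\<lambda>x. indicator B x * ennreal (deviation w 0 (proj x) s)) \<in> borel_measurable lborel" by simp
  qed
  also have "\<dots> \<le> (\<integral>\<^sup>+ x. indicator B x * ennreal (deviation w 0 (proj x) s / measure lborel (\<Omega> \<inter> ball (proj x) s)) \<partial>lborel)"
  proof (rule nn_integral_mono)
    fix x
    have "ennreal c * ennreal (deviation w 0 (proj x) s) \<le> ennreal (deviation w 0 (proj x) s / measure lborel (\<Omega> \<inter> ball (proj x) s))"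
      using dev_le[of "proj x"] c by (simp add: ennreal_leI flip: ennreal_mult')
    then show "ennreal c * (indicator B x * ennreal (deviation w 0 (proj x) s)) \<le> indicator B x * ennreal (deviation w 0 (proj x) s / measure lborel (\<Omega> \<inter> ball (proj x) s))"
      by (cases "x \<in> B") auto
  qed
  finally show ?thesis unfolding S_def B_def by (simp add: mult_left_mono)
qed

text \<open>The image under \<open>proj\<close> of Lebesgue measure on the ball, scaled by
  \<open>proj_const\<close>, lies below the Hausdorff measure on every Borel set; integrals inherit
  the inequality.\<close>

lemma projected_trace_integral_le:
  fixes H :: "real^'n \<Rightarrow> ennreal"
  assumes [measurable]: "H \<in> borel_measurable borel"
  shows "ennreal proj_const * (\<integral>\<^sup>+ x. indicator (ball x0 \<rho>0) x * H (proj x) \<partial>lborel)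
    \<le> (\<integral>\<^sup>+ p. H p \<partial>hausdorff_measure (CARD('n) - 1))"
proof -
  let ?m = "CARD('n) - 1"
  define B where "B = ball x0 \<rho>0"
  have [measurable]: "B \<in> sets borel" by (simp add: B_def)
  have [measurable]: "proj \<in> borel_measurable borel" using continuous_proj by (rule borel_measurable_continuous_onI)
  define \<nu> where "\<nu> = distr (density lborel (indicator B)) borel proj"
  define M where "M = scale_measure (ennreal proj_const) \<nu>"
  have sM: "sets M = sets (hausdorff_measure ?m :: (real^'n) measure)" by (simp add: M_def \<nu>_def sets_hausdorff_measure)
  have em: "emeasure M A \<le> emeasure (hausdorff_measure ?m) A" if A: "A \<in> sets borel" for A
  proof -
    have pA: "proj -` A \<in> sets borel" using measurable_sets[of proj borel borel A] A by simp
    have "emeasure \<nu> A = emeasure (density lborel (indicator B)) (proj -` A)"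
      unfolding \<nu>_def using A by (subst emeasure_distr) auto
    also have "\<dots> = (\<integral>\<^sup>+ x. indicator B x * indicator (proj -` A) x \<partial>lborel)"
      using pA by (subst emeasure_density) auto
    also have "\<dots> = (\<integral>\<^sup>+ x. indicator (B \<inter> proj -` A) x \<partial>lborel)"
      by (intro nn_integral_cong) (auto simp: indicator_def)
    also have "\<dots> = emeasure lborel (B \<inter> proj -` A)" using pA by (intro nn_integral_indicator) auto
    finally have "emeasure M A = ennreal proj_const * emeasure lborel (B \<inter> proj -` A)" by (simp add: M_def)
    also have "\<dots> \<le> hausdorff_outer ?m A"
      unfolding proj_const_def
    proof (rule emeasure_projection_le_hausdorff[where c = x0 and i = i])
      show "0 < \<rho>0" by (rule \<rho>0)
      show "\<bar>x $ i - x0 $ i\<bar> \<le> \<rho>0" if "x \<in> B" for x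
        using component_le_norm_cart[of "x - x0" i] that by (simp add: B_def dist_norm norm_minus_commute)
      show "proj x $ k = x $ k" if "k \<noteq> i" for x k
        using horiz_component[of "proj x" k] horiz_component[of x k] that by (simp add: horiz_proj)
    qed
    also have "\<dots> = emeasure (hausdorff_measure ?m) A" using A by (rule emeasure_hausdorff_measure[symmetric])
    finally show ?thesis .
  qed
  have "M \<le> hausdorff_measure ?m"
    unfolding le_measure[OF sM] le_fun_def
  proof
    fix A show "emeasure M A \<le> emeasure (hausdorff_measure ?m) A"
    proof (cases "A \<in> sets borel")
      case True then show ?thesis by (rule em)
    next
      case False then show ?thesis by (simp add: emeasure_notin_sets sM sets_hausdorff_measure)
    qed
  qed
  then have le: "nn_integral M H \<le> nn_integral (hausdorff_measure ?m) H" using sM by (intro nn_integral_mono_measure)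
  have "nn_integral \<nu> H = (\<integral>\<^sup>+ x. indicator B x * H (proj x) \<partial>lborel)"
    unfolding \<nu>_def by (subst nn_integral_distr) (auto simp: nn_integral_density)
  moreover have "nn_integral M H = ennreal proj_const * nn_integral \<nu> H"
    unfolding M_def by (rule nn_integral_scale_measure) (simp add: \<nu>_def)
  ultimately show ?thesis using le by (simp add: B_def)
qed

text \<open>The means over balls of radius \<open>1 / Suc n\<close> are bounded by \<open>a\<close>
  and converge to the absolute trace at the projection of almost every point. Dominated convergence
  turns the right side of \<open>strip_integral_le\<close> into an integral that the Hausdorff
  measure controls.\<close>

theorem patch_estimate:
  fixes u w :: "real^'n \<Rightarrow> real"
  assumes u: "u \<in> borel_measurable (lebesgue_on \<Omega>)" and eq: "AE x in lebesgue. x \<in> \<Omega> \<longrightarrow> u x = w x"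
    and w: "integrable lborel w" and a: "\<And>x. \<bar>w x\<bar> \<le> a" and V: "variation_le \<Omega> w V"
    and b: "0 \<le> b" "(\<integral>\<^sup>+ p \<in> frontier \<Omega>. ennreal \<bar>bv_trace \<Omega> u p\<bar> \<partial>hausdorff_measure (CARD('n) - 1)) \<le> ennreal b"
    and \<eta>: "0 < \<eta>"
  shows "\<forall>\<^sub>F n in sequentially.
    2 * real (Suc n) * (\<integral>y. indicator (patch_strip (1 / (2 * real (Suc n)))) y * \<bar>w y\<bar> \<partial>lborel) \<le> patch_const * b + \<eta>"
proof -
  define s where "s n = 1 / real (Suc n)" for n
  define \<mu> where "\<mu> p n = measure lborel (\<Omega> \<inter> ball p (s n))" for p n
  define A where "A n p = deviation w 0 p (s n) / \<mu> p n" for n p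
  \<comment> \<open>A Borel substitute for the absolute trace, zero off
    \<open>trace_points w\<close>; the trace itself then enters only through monotonicity of the
    integral.\<close>
  define H where "H p = indicator (trace_points w) p * lim (\<lambda>n. A n p)" for p
  have a0: "0 \<le> a" using a[of 0] abs_ge_zero[of "w 0"] by linarith
  have wb: "w \<in> borel_measurable borel" using w by (simp add: borel_measurable_integrable)
  \<comment> \<open>Volume is the deviation of the zero function from \<open>1\<close>, so its
    measurability in \<open>p\<close> is a case of \<open>borel_deviation\<close>.\<close>
  have \<mu>_dev: "\<mu> p n = deviation (\<lambda>_. 0) 1 p (s n)" for p n
    using \<Omega> by (simp add: \<mu>_def deviation_def)
  have mA0[measurable]: "A n \<in> borel_measurable borel" for n
    unfolding A_def \<mu>_dev by (intro borel_measurable_divide borel_deviation wb) simp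
  have [measurable]: "trace_points w \<in> sets borel" by (rule borel_trace_points[OF wb])
  have mproj[measurable]: "proj \<in> borel_measurable borel" using continuous_proj by (rule borel_measurable_continuous_onI)
  have Hm[measurable]: "H \<in> borel_measurable borel"
    unfolding H_def by (intro borel_measurable_times borel_measurable_indicator borel_measurable_lim_metric) auto
  have Alim: "(\<lambda>n. A n p) \<longlonglongrightarrow> H p" "H p = \<bar>bv_trace \<Omega> u p\<bar>" "p \<in> frontier \<Omega>" if "p \<in> trace_points w" for p
  proof -
    have "(\<lambda>n. A n p) \<longlonglongrightarrow> \<bar>bv_trace \<Omega> u p\<bar>"
      unfolding A_def \<mu>_def s_def using trace_limit(1)[OF u eq w that] .
    then show "(\<lambda>n. A n p) \<longlonglongrightarrow> H p" "H p = \<bar>bv_trace \<Omega> u p\<bar>" using that by (auto simp: H_def limI)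
    show "p \<in> frontier \<Omega>" using trace_limit(2)[OF u eq w that] .
  qed
  have A0: "0 \<le> A n p" for n p unfolding A_def \<mu>_def using deviation_facts(4)[OF w] by simp
  have Aa: "A n p \<le> a" for n p
  proof -
    have "deviation w 0 p (s n) \<le> (\<integral>y. indicator (\<Omega> \<inter> ball p (s n)) y * a \<partial>lborel)"
      unfolding deviation_def
    proof (rule integral_mono)
      show "integrable lborel (\<lambda>y. indicator (\<Omega> \<inter> ball p (s n)) y * \<bar>w y - 0\<bar>)"
        using integrable_mult_indicator[of "\<Omega> \<inter> ball p (s n)" lborel "\<lambda>y. \<bar>w y\<bar>"] integrable_abs[OF w] \<Omega> by simp
      show "integrable lborel (\<lambda>y. indicator (\<Omega> \<inter> ball p (s n)) y * a)"
        using \<Omega> by (intro integrable_indicator_continuous) (auto simp: bounded_Int)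
    qed (use a in \<open>auto simp: indicator_def\<close>)
    also have "\<dots> = a * \<mu> p n" using \<Omega> by (simp add: \<mu>_def)
    finally have "deviation w 0 p (s n) \<le> a * \<mu> p n" .
    moreover have "0 \<le> \<mu> p n" by (simp add: \<mu>_def)
    ultimately show ?thesis using a0 by (cases "\<mu> p n = 0") (auto simp: A_def field_simps)
  qed
  let ?J = "\<lambda>f. \<integral>\<^sup>+ x. indicator (ball x0 \<rho>0) x * ennreal (f (proj x)) \<partial>lborel"
  have "ennreal proj_const * ?J H \<le> (\<integral>\<^sup>+ p. ennreal (H p) \<partial>hausdorff_measure (CARD('n) - 1))"
    by (rule projected_trace_integral_le) simp
  also have "\<dots> \<le> (\<integral>\<^sup>+ p \<in> frontier \<Omega>. ennreal \<bar>bv_trace \<Omega> u p\<bar> \<partial>hausdorff_measure (CARD('n) - 1))"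
  proof (rule nn_integral_mono)
    fix p
    show "ennreal (H p) \<le> ennreal \<bar>bv_trace \<Omega> u p\<bar> * indicator (frontier \<Omega>) p"
    proof (cases "p \<in> trace_points w")
      case True then show ?thesis using Alim(2,3)[OF True] by simp
    qed (simp add: H_def)
  qed
  also have "\<dots> \<le> ennreal b" by (rule b(2))
  finally have Jb: "ennreal proj_const * ?J H \<le> ennreal b" .
  have Jlim: "(\<lambda>n. ?J (A n)) \<longlonglongrightarrow> ?J H"
  proof (rule nn_integral_dominated_convergence[where w = "\<lambda>x. ennreal a * indicator (ball x0 \<rho>0) x"])
    show "(\<integral>\<^sup>+ x. ennreal a * indicator (ball x0 \<rho>0) x \<partial>lborel) < \<infinity>"
      using emeasure_bounded_finite[OF bounded_ball, of x0 \<rho>0]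
      by (subst nn_integral_cmult_indicator) (auto simp: ennreal_mult_less_top)
    show "AE x in lborel. indicator (ball x0 \<rho>0) x * ennreal (A n (proj x)) \<le> ennreal a * indicator (ball x0 \<rho>0) x" for n
      using Aa[of n] by (intro AE_I2) (auto simp: indicator_def ennreal_leI)
    show "AE x in lborel. (\<lambda>n. indicator (ball x0 \<rho>0) x * ennreal (A n (proj x))) \<longlonglongrightarrow> indicator (ball x0 \<rho>0) x * ennreal (H (proj x))"
      using AE_trace_points[OF w V a]
    proof eventually_elim
      fix x assume x: "x \<in> ball x0 \<rho>0 \<longrightarrow> proj x \<in> trace_points w"
      show "(\<lambda>n. indicator (ball x0 \<rho>0) x * ennreal (A n (proj x))) \<longlonglongrightarrow> indicator (ball x0 \<rho>0) x * ennreal (H (proj x))"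
      proof (cases "x \<in> ball x0 \<rho>0")
        case True
        then show ?thesis using tendsto_ennrealI[OF Alim(1), of "proj x"] x by simp
      qed simp
    qed
    have mA: "(\<lambda>x. A n (proj x)) \<in> borel_measurable borel" for n by (rule measurable_compose[OF mproj mA0])
    have mH: "(\<lambda>x. H (proj x)) \<in> borel_measurable borel" by (rule measurable_compose[OF mproj Hm])
    have mB: "(indicator (ball x0 \<rho>0) :: real^'n \<Rightarrow> ennreal) \<in> borel_measurable borel" by (intro borel_measurable_indicator) auto
    show "(\<lambda>x. indicator (ball x0 \<rho>0) x * ennreal (A n (proj x))) \<in> borel_measurable lborel" for n
      using mA[of n] mB by (simp add: borel_measurable_times_ennreal)
    show "(\<lambda>x. indicator (ball x0 \<rho>0) x * ennreal (H (proj x))) \<in> borel_measurable lborel"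
      using mH mB by (simp add: borel_measurable_times_ennreal)
    show "(\<lambda>x. ennreal a * indicator (ball x0 \<rho>0) x) \<in> borel_measurable lborel"
      using mB by (simp add: borel_measurable_times_ennreal)
  qed
  have JHlt: "?J H < ennreal (b / proj_const + \<eta> / (patch_const * proj_const))"
  proof -
    have "ennreal (inverse proj_const) * (ennreal proj_const * ?J H) \<le> ennreal (inverse proj_const) * ennreal b"
      using Jb by (rule mult_left_mono) simp
    moreover have "ennreal (inverse proj_const) * (ennreal proj_const * ?J H) = ?J H"
      using const_pos(1) by (simp flip: mult.assoc ennreal_mult)
    moreover have "ennreal (inverse proj_const) * ennreal b = ennreal (b / proj_const)"
      using const_pos(1) b(1) by (simp add: divide_inverse mult.commute flip: ennreal_mult)
    ultimately have "?J H \<le> ennreal (b / proj_const)" by simp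
    also have "\<dots> < ennreal (b / proj_const + \<eta> / (patch_const * proj_const))"
      using const_pos b(1) \<eta> by (intro ennreal_lessI) (auto intro!: add_nonneg_pos)
    finally show ?thesis .
  qed
  from order_tendstoD(2)[OF Jlim JHlt]
  have ev1: "\<forall>\<^sub>F n in sequentially. ?J (A n) < ennreal (b / proj_const + \<eta> / (patch_const * proj_const))" .
  have ev2: "\<forall>\<^sub>F n in sequentially. s n \<le> \<rho>0"
  proof -
    have "(\<lambda>n. s n) \<longlonglongrightarrow> 0" using LIMSEQ_inverse_real_of_nat by (simp add: s_def inverse_eq_divide)
    from order_tendstoD(2)[OF this \<rho>0(1)] show ?thesis by (rule eventually_mono) simp
  qed
  from ev1 ev2 show ?thesis
  proof eventually_elim
    fix n assume n: "?J (A n) < ennreal (b / proj_const + \<eta> / (patch_const * proj_const))" "s n \<le> \<rho>0"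
    let ?I = "\<integral>y. indicator (patch_strip (s n / 2)) y * \<bar>w y\<bar> \<partial>lborel"
    have "ennreal (2 / s n * ?I) \<le> ennreal (patch_const * proj_const) * ?J (A n)"
      unfolding A_def \<mu>_def using n(2) by (intro strip_integral_le[OF w a]) (simp_all add: s_def)
    also have "\<dots> \<le> ennreal (patch_const * proj_const) * ennreal (b / proj_const + \<eta> / (patch_const * proj_const))"
      using n(1) by (intro mult_left_mono) auto
    also have "\<dots> = ennreal ((patch_const * proj_const) * (b / proj_const + \<eta> / (patch_const * proj_const)))"
      using const_pos b(1) \<eta> by (intro ennreal_mult[symmetric]) (auto intro!: add_nonneg_nonneg)
    also have "(patch_const * proj_const) * (b / proj_const + \<eta> / (patch_const * proj_const)) = patch_const * b + \<eta>"
      using const_pos by (simp add: field_simps)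
    finally have "2 / s n * ?I \<le> patch_const * b + \<eta>"
      using const_pos b(1) \<eta> by (subst (asm) ennreal_le_iff) auto
    then show "2 * real (Suc n) * (\<integral>y. indicator (patch_strip (1 / (2 * real (Suc n)))) y * \<bar>w y\<bar> \<partial>lborel) \<le> patch_const * b + \<eta>"
      by (simp add: s_def mult.commute)
  qed
qed

text \<open>A cutoff of the height turns \<open>\<psi>\<close> into a test function on the domain.
  The price is the cutoff gradient, of order \<open>Suc n\<close> on a strip of height
  \<open>1 / (2 * Suc n)\<close>: exactly the strip mean in \<open>patch_estimate\<close>. The
  constant is chosen before \<open>u\<close> and \<open>w\<close>, as the Poincare inequality
  demands.\<close>

lemma single_chart_bound:
  "\<exists>C\<ge>0. \<forall>u w a V b \<psi> M v.
    u \<in> borel_measurable (lebesgue_on \<Omega>) \<longrightarrow> (AE x in lebesgue. x \<in> \<Omega> \<longrightarrow> u x = w x) \<longrightarrow> integrable lborel w \<longrightarrow>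
    (\<forall>x. \<bar>w x\<bar> \<le> a) \<longrightarrow> (\<forall>x. x \<notin> \<Omega> \<longrightarrow> w x = 0) \<longrightarrow> variation_le \<Omega> w V \<longrightarrow> 0 \<le> V \<longrightarrow> 0 \<le> b \<longrightarrow>
    (\<integral>\<^sup>+ p \<in> frontier \<Omega>. ennreal \<bar>bv_trace \<Omega> u p\<bar> \<partial>hausdorff_measure (CARD('n) - 1)) \<le> ennreal b \<longrightarrow>
    C1 \<psi> \<longrightarrow> compact_support_in (ball x0 (\<rho>0 / 4)) \<psi> \<longrightarrow> (\<forall>x. \<bar>\<psi> x\<bar> \<le> M) \<longrightarrow> norm v \<le> 1 \<longrightarrow>
    (\<integral>x. w x * (grad \<psi> x \<bullet> v) \<partial>lborel) \<le> M * (C * (V + b))"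
proof -
  have "compact (grad D ` cball x0 r)"
    by (rule compact_continuous_image[OF continuous_on_subset[OF C1_continuous_grad[OF C1_D]]]) auto
  then have "bounded (grad D ` cball x0 r)" by (rule compact_imp_bounded)
  then obtain G0 where "\<forall>y\<in>grad D ` cball x0 r. norm y \<le> G0" unfolding bounded_iff by auto
  then have G0: "norm (grad D x) \<le> G0" if "x \<in> cball x0 r" for x using that by auto
  define G where "G = max 0 G0"
  have G: "0 \<le> G" "norm (grad D x) \<le> G" if "x \<in> cball x0 r" for x using G0[OF that] by (auto simp: G_def)
  have Gnn: "0 \<le> G" by (simp add: G_def)
  show ?thesis
  \<comment> \<open>The \<open>1\<close> comes from the interior variation. The other term arises
    since the cutoff gradient is at most \<open>8 * Suc n * G\<close>, which is \<open>4 * G\<close>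
    times the normalisation in \<open>Q n\<close>.\<close>
  proof (intro exI[of _ "1 + 4 * G * patch_const"] conjI allI impI)
    show "0 \<le> 1 + 4 * G * patch_const" using Gnn const_pos by simp
    fix u w :: "real^'n \<Rightarrow> real" and a V b \<psi> M and v :: "real^'n"
    assume u: "u \<in> borel_measurable (lebesgue_on \<Omega>)" and eq: "AE x in lebesgue. x \<in> \<Omega> \<longrightarrow> u x = w x"
      and w: "integrable lborel w" and a: "\<forall>x. \<bar>w x\<bar> \<le> a" and w0: "\<forall>x. x \<notin> \<Omega> \<longrightarrow> w x = 0"
      and V: "variation_le \<Omega> w V" "0 \<le> V" and b: "0 \<le> b"
      "(\<integral>\<^sup>+ p \<in> frontier \<Omega>. ennreal \<bar>bv_trace \<Omega> u p\<bar> \<partial>hausdorff_measure (CARD('n) - 1)) \<le> ennreal b"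
      and \<psi>: "C1 \<psi>" "compact_support_in (ball x0 (\<rho>0 / 4)) \<psi>" and M: "\<forall>x. \<bar>\<psi> x\<bar> \<le> M" and v: "norm v \<le> 1"
    have M0: "0 \<le> M" using M[rule_format, of x0] abs_ge_zero[of "\<psi> x0"] by linarith
    obtain K where K: "compact K" "K \<subseteq> ball x0 (\<rho>0 / 4)" "\<And>x. x \<notin> K \<Longrightarrow> \<psi> x = 0" using compact_support_in_ex[OF \<psi>(2)] by auto
    have Kr: "x \<in> ball x0 r" if "x \<in> K" for x using K(2) that \<rho>0 r by auto
    have csw: "compactly_supported \<psi>" using \<psi>(2) by (rule compact_support_in_mono) simp
    \<comment> \<open>Zero up to height \<open>1 / (4 * Suc n)\<close> and one from height
      \<open>1 / (2 * Suc n)\<close> on.\<close>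
    define \<chi>c where "\<chi>c n x = step (4 * real (Suc n) * D x - 1)" for n x
    have C\<chi>: "C1 (\<chi>c n)" for n unfolding \<chi>c_def by (intro C1_step C1_diff C1_cmult C1_D C1_const)
    have g\<chi>: "grad (\<chi>c n) x = (step' (4 * real (Suc n) * D x - 1) * (4 * real (Suc n))) *\<^sub>R grad D x" for n x
      unfolding \<chi>c_def by (simp add: grad_step grad_diff grad_cmult C1_diff C1_cmult C1_D C1_const grad_const)
    have \<chi>01: "0 \<le> \<chi>c n x" "\<chi>c n x \<le> 1" for n x by (auto simp: \<chi>c_def step_bounds)
    define I where "I n = (\<integral>x. w x * (\<chi>c n x * (grad \<psi> x \<bullet> v)) \<partial>lborel)" for n
    define S where "S n = patch_strip (1 / (2 * real (Suc n)))" for n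
    define Q where "Q n = 2 * real (Suc n) * (\<integral>y. indicator (S n) y * \<bar>w y\<bar> \<partial>lborel)" for n
    have csg: "compactly_supported (\<lambda>x. f x * (grad \<psi> x \<bullet> v))" for f :: "real^'n \<Rightarrow> real"
      by (rule compact_support_in_cong[OF compactly_supported_grad[OF csw]]) simp
    have csp: "compactly_supported (\<lambda>x. \<psi> x * f x)" for f :: "real^'n \<Rightarrow> real"
      by (rule compact_support_in_cong[OF csw]) simp
    have cI: "integrable lborel (\<lambda>x. w x * (\<chi>c n x * (grad \<psi> x \<bullet> v)))" for n
      by (intro integrable_mult_cs[OF w] csg continuous_intros C1_continuous C1_continuous_grad C\<chi> \<psi>)
    have cP: "integrable lborel (\<lambda>x. w x * (\<psi> x * (grad (\<chi>c n) x \<bullet> v)))" for n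
      by (intro integrable_mult_cs[OF w] csp continuous_intros C1_continuous C1_continuous_grad C\<chi> \<psi>)
    have iS: "integrable lborel (\<lambda>y. indicator (S n) y * \<bar>w y\<bar>)" for n
      using integrable_mult_indicator[of "S n" lborel "\<lambda>y. \<bar>w y\<bar>"] integrable_abs[OF w] patch_strip_open
      by (simp add: S_def borel_open)
    have step1: "I n \<le> M * V + 4 * M * G * Q n" for n
    proof -
      define F where "F x = \<chi>c n x * \<psi> x" for x
      have CF: "C1 F" unfolding F_def by (intro C1_mult C\<chi> \<psi>)
      have "compact_support_in \<Omega> F"
      proof (rule compact_support_inI[of "K \<inter> {x. 1 / (4 * real (Suc n)) \<le> D x}"])
        show "compact (K \<inter> {x. 1 / (4 * real (Suc n)) \<le> D x})"
          by (intro compact_Int_closed K closed_Collect_le continuous_intros continuous_D)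
        show "K \<inter> {x. 1 / (4 * real (Suc n)) \<le> D x} \<subseteq> \<Omega>"
        proof
          fix x assume x: "x \<in> K \<inter> {x. 1 / (4 * real (Suc n)) \<le> D x}"
          then have "1 / (4 * real (Suc n)) \<le> D x" by simp
          moreover have "0 < 1 / (4 * real (Suc n))" by simp
          ultimately have "0 < D x" by linarith
          then have "x \<in> {x \<in> ball x0 r. 0 < D x}" using Kr x by simp
          then show "x \<in> \<Omega>" unfolding chart[symmetric] by simp
        qed
        show "F x = 0" if "x \<notin> K \<inter> {x. 1 / (4 * real (Suc n)) \<le> D x}" for x
        proof (cases "x \<in> K")
          case True
          then have "D x < 1 / (4 * real (Suc n))" using that by auto
          then have "4 * real (Suc n) * D x < 1" by (simp add: field_simps)
          then show ?thesis by (simp add: F_def \<chi>c_def step_0)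
        qed (simp add: F_def K)
      qed
      moreover have "\<bar>F x\<bar> \<le> M" for x
      proof -
        have "\<bar>\<chi>c n x\<bar> * \<bar>\<psi> x\<bar> \<le> 1 * M" using \<chi>01[of n x] M by (intro mult_mono) auto
        then show ?thesis by (simp add: F_def abs_mult)
      qed
      ultimately have "(\<integral>x. w x * (grad F x \<bullet> v) \<partial>lborel) \<le> M * V"
        using v by (intro variation_le_scalar[OF V(1) CF])
      moreover have "w x * (grad F x \<bullet> v) = w x * (\<chi>c n x * (grad \<psi> x \<bullet> v)) + w x * (\<psi> x * (grad (\<chi>c n) x \<bullet> v))" for x
        unfolding F_def by (simp add: grad_mult C\<chi> \<psi> inner_add_left algebra_simps)
      ultimately have le: "I n + (\<integral>x. w x * (\<psi> x * (grad (\<chi>c n) x \<bullet> v)) \<partial>lborel) \<le> M * V"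
        using Bochner_Integration.integral_add[OF cI cP] by (simp add: I_def)
      have "- (\<integral>x. w x * (\<psi> x * (grad (\<chi>c n) x \<bullet> v)) \<partial>lborel) = (\<integral>x. - (w x * (\<psi> x * (grad (\<chi>c n) x \<bullet> v))) \<partial>lborel)" by simp
      also have "\<dots> \<le> (\<integral>x. (M * (8 * real (Suc n) * G)) * (indicator (S n) x * \<bar>w x\<bar>) \<partial>lborel)"
      proof (rule integral_mono)
        show "integrable lborel (\<lambda>x. - (w x * (\<psi> x * (grad (\<chi>c n) x \<bullet> v))))" using cP by simp
        show "integrable lborel (\<lambda>x. (M * (8 * real (Suc n) * G)) * (indicator (S n) x * \<bar>w x\<bar>))" using iS by (rule integrable_mult_right)
        fix x
        show "- (w x * (\<psi> x * (grad (\<chi>c n) x \<bullet> v))) \<le> (M * (8 * real (Suc n) * G)) * (indicator (S n) x * \<bar>w x\<bar>)"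
        proof (cases "\<psi> x * (grad (\<chi>c n) x \<bullet> v) = 0")
          case True
          then have "- (w x * (\<psi> x * (grad (\<chi>c n) x \<bullet> v))) = 0" by (simp only: mult_zero_right minus_zero)
          moreover have "0 \<le> (M * (8 * real (Suc n) * G)) * (indicator (S n) x * \<bar>w x\<bar>)"
            using M0 Gnn by (intro mult_nonneg_nonneg) auto
          ultimately show ?thesis by linarith
        next
          case False
          then have xK: "x \<in> K" using K(3) by fastforce
          have nz: "step' (4 * real (Suc n) * D x - 1) \<noteq> 0" using False unfolding g\<chi> by auto
          then have "\<not> (4 * real (Suc n) * D x - 1 \<le> 0 \<or> 1 \<le> 4 * real (Suc n) * D x - 1)" by (rule contrapos_nn) (rule step'_eq_0)
          then have "0 < 4 * real (Suc n) * D x - 1" "4 * real (Suc n) * D x - 1 < 1" by linarith+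
          moreover from this have "0 < 4 * real (Suc n) * D x" by linarith
          ultimately have "0 < D x" "D x < 1 / (2 * real (Suc n))"
            using zero_less_mult_pos[of "4 * real (Suc n)" "D x"] by (simp_all add: field_simps)
          then have xS: "x \<in> S n" using xK K(2) by (auto simp: S_def patch_strip_def)
          have xc: "x \<in> cball x0 r" using Kr[OF xK] by simp
          have "\<bar>grad (\<chi>c n) x \<bullet> v\<bar> \<le> norm (grad (\<chi>c n) x) * norm v" by (rule Cauchy_Schwarz_ineq2)
          also have "\<dots> \<le> norm (grad (\<chi>c n) x)" using v by (simp add: mult_left_le)
          also have "\<dots> = step' (4 * real (Suc n) * D x - 1) * (4 * real (Suc n)) * norm (grad D x)"
            unfolding g\<chi> using step'_bounds(1) by (simp add: abs_mult)
          also have "\<dots> \<le> 2 * (4 * real (Suc n)) * G"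
            using step'_bounds G(2)[OF xc] by (intro mult_mono) auto
          finally have "\<bar>grad (\<chi>c n) x \<bullet> v\<bar> \<le> 8 * real (Suc n) * G" by simp
          then have "\<bar>\<psi> x\<bar> * \<bar>grad (\<chi>c n) x \<bullet> v\<bar> \<le> M * (8 * real (Suc n) * G)" using M M0 by (intro mult_mono) auto
          then have "\<bar>w x\<bar> * (\<bar>\<psi> x\<bar> * \<bar>grad (\<chi>c n) x \<bullet> v\<bar>) \<le> \<bar>w x\<bar> * (M * (8 * real (Suc n) * G))" by (intro mult_left_mono) auto
          then have "\<bar>w x * (\<psi> x * (grad (\<chi>c n) x \<bullet> v))\<bar> \<le> \<bar>w x\<bar> * (M * (8 * real (Suc n) * G))" by (simp only: abs_mult)
          then show ?thesis using xS by (simp add: mult.commute)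
        qed
      qed
      also have "\<dots> = 4 * M * G * Q n" by (simp add: Q_def)
      finally show ?thesis using le by linarith
    qed
    have Ilim: "I \<longlonglongrightarrow> (\<integral>x. w x * (grad \<psi> x \<bullet> v) \<partial>lborel)"
      unfolding I_def
    proof (rule integral_dominated_convergence[where w = "\<lambda>x. \<bar>w x * (grad \<psi> x \<bullet> v)\<bar>"])
      have i: "integrable lborel (\<lambda>x. w x * (grad \<psi> x \<bullet> v))"
        using csg[of "\<lambda>_. 1"] by (intro integrable_mult_cs[OF w] continuous_intros C1_continuous_grad \<psi>) auto
      then show "integrable lborel (\<lambda>x. \<bar>w x * (grad \<psi> x \<bullet> v)\<bar>)" by (rule integrable_abs)
      show "(\<lambda>x. w x * (grad \<psi> x \<bullet> v)) \<in> borel_measurable lborel" using i by (rule borel_measurable_integrable)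
      show "(\<lambda>x. w x * (\<chi>c n x * (grad \<psi> x \<bullet> v))) \<in> borel_measurable lborel" for n using cI by (rule borel_measurable_integrable)
      show "AE x in lborel. norm (w x * (\<chi>c n x * (grad \<psi> x \<bullet> v))) \<le> \<bar>w x * (grad \<psi> x \<bullet> v)\<bar>" for n
      proof (intro AE_I2)
        fix x
        have "\<bar>\<chi>c n x\<bar> * \<bar>w x * (grad \<psi> x \<bullet> v)\<bar> \<le> 1 * \<bar>w x * (grad \<psi> x \<bullet> v)\<bar>"
          using \<chi>01[of n x] by (intro mult_right_mono) auto
        then show "norm (w x * (\<chi>c n x * (grad \<psi> x \<bullet> v))) \<le> \<bar>w x * (grad \<psi> x \<bullet> v)\<bar>" by (simp add: abs_mult mult_ac)
      qed
      show "AE x in lborel. (\<lambda>n. w x * (\<chi>c n x * (grad \<psi> x \<bullet> v))) \<longlonglongrightarrow> w x * (grad \<psi> x \<bullet> v)"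
      proof (intro AE_I2)
        fix x
        show "(\<lambda>n. w x * (\<chi>c n x * (grad \<psi> x \<bullet> v))) \<longlonglongrightarrow> w x * (grad \<psi> x \<bullet> v)"
        proof (cases "x \<in> \<Omega> \<and> x \<in> K")
          case True
          then have "x \<in> \<Omega> \<inter> ball x0 r" using Kr by auto
          then have Dx: "0 < D x" unfolding chart by simp
          obtain N where N: "2 / D x < real (Suc N)" using reals_Archimedean2 less_Suc_eq by (metis of_nat_less_iff less_trans lessI)
          have "\<chi>c n x = 1" if "N \<le> n" for n
          proof -
            have "2 / D x < real (Suc n)" using N that by simp
            then have "2 < real (Suc n) * D x" using Dx by (simp add: field_simps)
            then have "1 \<le> 4 * real (Suc n) * D x - 1" unfolding mult.assoc by linarith
            then show ?thesis unfolding \<chi>c_def by (rule step_1)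
          qed
          then have "\<forall>\<^sub>F n in sequentially. w x * (\<chi>c n x * (grad \<psi> x \<bullet> v)) = w x * (grad \<psi> x \<bullet> v)"
            by (intro eventually_sequentiallyI[of N]) simp
          then show ?thesis by (rule tendsto_eventually)
        next
          case False
          have "w x * (grad \<psi> x \<bullet> v) = 0"
          proof (cases "x \<in> \<Omega>")
            case True
            then have "x \<notin> K" using False by simp
            then have "grad \<psi> x = 0" using K compact_imp_closed[OF K(1)] by (intro grad_eq_0_open[of "- K"]) auto
            then show ?thesis by simp
          qed (use w0 in simp)
          then have "w x * (\<chi>c n x * (grad \<psi> x \<bullet> v)) = 0" for n by auto
          then show ?thesis using \<open>w x * (grad \<psi> x \<bullet> v) = 0\<close> by (simp only: tendsto_const)
        qed
      qed
    qed
    have "(\<integral>x. w x * (grad \<psi> x \<bullet> v) \<partial>lborel) \<le> M * V + 4 * M * G * (patch_const * b)"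
    proof (rule field_le_epsilon)
      fix \<epsilon> :: real assume \<epsilon>: "0 < \<epsilon>"
      define \<eta> where "\<eta> = \<epsilon> / (4 * M * G + 1)"
      have den: "0 < 4 * M * G + 1" using M0 Gnn by (simp add: add_nonneg_pos)
      then have \<eta>: "0 < \<eta>" using \<epsilon> by (simp add: \<eta>_def)
      have "\<forall>\<^sub>F n in sequentially. Q n \<le> patch_const * b + \<eta>"
        unfolding Q_def S_def using a by (intro patch_estimate[OF u eq w _ V(1) b \<eta>]) auto
      then have "\<forall>\<^sub>F n in sequentially. I n \<le> M * V + 4 * M * G * (patch_const * b + \<eta>)"
      proof eventually_elim
        fix n assume "Q n \<le> patch_const * b + \<eta>"
        then have "4 * M * G * Q n \<le> 4 * M * G * (patch_const * b + \<eta>)" using M0 Gnn by (intro mult_left_mono) auto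
        then show "I n \<le> M * V + 4 * M * G * (patch_const * b + \<eta>)" using step1[of n] by linarith
      qed
      then have "(\<integral>x. w x * (grad \<psi> x \<bullet> v) \<partial>lborel) \<le> M * V + 4 * M * G * (patch_const * b + \<eta>)"
        by (rule tendsto_upperbound[OF Ilim]) simp
      moreover have "4 * M * G * \<eta> \<le> \<epsilon>"
      proof -
        have "4 * M * G * \<eta> \<le> (4 * M * G + 1) * \<eta>" using \<eta> by (intro mult_right_mono) auto
        also have "\<dots> = \<epsilon>" using den by (simp add: \<eta>_def)
        finally show ?thesis .
      qed
      ultimately show "(\<integral>x. w x * (grad \<psi> x \<bullet> v) \<partial>lborel) \<le> M * V + 4 * M * G * (patch_const * b) + \<epsilon>"
        by (simp add: distrib_left)
    qed
    also have "\<dots> \<le> M * ((1 + 4 * G * patch_const) * (V + b))"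
    proof -
      have "0 \<le> b + 4 * G * patch_const * V" using b V Gnn const_pos by simp
      then have "M * (V + 4 * G * patch_const * b) \<le> M * (V + 4 * G * patch_const * b + (b + 4 * G * patch_const * V))"
        using M0 by (intro mult_left_mono) auto
      then show ?thesis by (simp add: algebra_simps)
    qed
    finally show "(\<integral>x. w x * (grad \<psi> x \<bullet> v) \<partial>lborel) \<le> M * ((1 + 4 * G * patch_const) * (V + b))" .
  qed
qed

end

section \<open>The Poincare inequality with trace\<close>

text \<open>Here \<open>w\<close> is a bounded Borel representative of \<open>u\<close>, extended by zero, while \<open>V\<close> and \<open>b\<close>
  bound the total variation and the boundary integral of the trace.\<close>

definition admissible :: "(real^'n) set \<Rightarrow> (real^'n \<Rightarrow> real) \<Rightarrow> (real^'n \<Rightarrow> real) \<Rightarrow> real \<Rightarrow> real \<Rightarrow> real \<Rightarrow> bool" where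
  "admissible \<Omega> u w a V b \<longleftrightarrow>
    u \<in> borel_measurable (lebesgue_on \<Omega>) \<and> (AE x in lebesgue. x \<in> \<Omega> \<longrightarrow> u x = w x) \<and> integrable lborel w \<and>
    (\<forall>x. \<bar>w x\<bar> \<le> a) \<and> (\<forall>x. x \<notin> \<Omega> \<longrightarrow> w x = 0) \<and> variation_le \<Omega> w V \<and> 0 \<le> V \<and> 0 \<le> b \<and>
    (\<integral>\<^sup>+ p \<in> frontier \<Omega>. ennreal \<bar>bv_trace \<Omega> u p\<bar> \<partial>hausdorff_measure (CARD('n) - 1)) \<le> ennreal b"

lemma local_boundary_bound:
  fixes \<Omega> :: "(real^'n) set"
  assumes \<Omega>: "open \<Omega>" "bounded \<Omega>" "smooth_boundary \<Omega>" and x0: "x0 \<in> frontier \<Omega>"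
  shows "\<exists>\<rho> C. 0 < \<rho> \<and> 0 \<le> C \<and> (\<forall>u w a V b \<psi> M v. admissible \<Omega> u w a V b \<longrightarrow>
    C1 \<psi> \<longrightarrow> compact_support_in (ball x0 \<rho>) \<psi> \<longrightarrow> (\<forall>x. \<bar>\<psi> x\<bar> \<le> M) \<longrightarrow> norm v \<le> 1 \<longrightarrow>
    (\<integral>x. w x * (grad \<psi> x \<bullet> v) \<partial>lborel) \<le> M * (C * (V + b)))"
proof -
  obtain D e r i L where "boundary_chart D e \<Omega> x0 r i L" using boundary_chart_exists[OF \<Omega> x0] by auto
  then interpret boundary_chart D e \<Omega> x0 r i L .
  obtain C where C: "0 \<le> C" and C0: "\<forall>u w a V b \<psi> M v.
    u \<in> borel_measurable (lebesgue_on \<Omega>) \<longrightarrow> (AE x in lebesgue. x \<in> \<Omega> \<longrightarrow> u x = w x) \<longrightarrow> integrable lborel w \<longrightarrow>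
    (\<forall>x. \<bar>w x\<bar> \<le> a) \<longrightarrow> (\<forall>x. x \<notin> \<Omega> \<longrightarrow> w x = 0) \<longrightarrow> variation_le \<Omega> w V \<longrightarrow> 0 \<le> V \<longrightarrow> 0 \<le> b \<longrightarrow>
    (\<integral>\<^sup>+ p \<in> frontier \<Omega>. ennreal \<bar>bv_trace \<Omega> u p\<bar> \<partial>hausdorff_measure (CARD('n) - 1)) \<le> ennreal b \<longrightarrow>
    C1 \<psi> \<longrightarrow> compact_support_in (ball x0 (\<rho>0 / 4)) \<psi> \<longrightarrow> (\<forall>x. \<bar>\<psi> x\<bar> \<le> M) \<longrightarrow> norm v \<le> 1 \<longrightarrow>
    (\<integral>x. w x * (grad \<psi> x \<bullet> v) \<partial>lborel) \<le> M * (C * (V + b))"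
    using single_chart_bound by (elim exE conjE)
  show ?thesis
  proof (rule exI[of _ "\<rho>0 / 4"], rule exI[of _ C], intro conjI allI impI)
    show "0 < \<rho>0 / 4" "0 \<le> C" using \<rho>0(1) C by simp_all
    fix u w \<psi> :: "real^'n \<Rightarrow> real" and a V b M and v :: "real^'n"
    assume adm: "admissible \<Omega> u w a V b"
    assume "C1 \<psi>" "compact_support_in (ball x0 (\<rho>0 / 4)) \<psi>" "\<forall>x. \<bar>\<psi> x\<bar> \<le> M" "norm v \<le> 1"
    with adm C0[THEN spec, of u, THEN spec, of w, THEN spec, of a, THEN spec, of V, THEN spec, of b, THEN spec, of \<psi>,
        THEN spec, of M, THEN spec, of v]
    show "(\<integral>x. w x * (grad \<psi> x \<bullet> v) \<partial>lborel) \<le> M * (C * (V + b))"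
      unfolding admissible_def by (elim conjE) (elim impE, assumption+)
  qed
qed

text \<open>The jump of the indicator is harmless because \<open>f\<close> vanishes near the
  frontier.\<close>

lemma C1_indicator_mult:
  fixes f :: "real^'n \<Rightarrow> real"
  assumes \<Omega>: "open \<Omega>" and f: "C1 f" and W: "open W" "frontier \<Omega> \<subseteq> W" "\<And>x. x \<in> W \<Longrightarrow> f x = 0"
  shows "C1 (\<lambda>x. indicator \<Omega> x * f x)"
proof (rule C1_local)
  fix x
  consider "x \<in> \<Omega>" | "x \<in> - closure \<Omega>" | "x \<in> W"
    using W(2) \<Omega> by (auto simp: frontier_def interior_open)
  then show "\<exists>S g. open S \<and> x \<in> S \<and> C1 g \<and> (\<forall>y\<in>S. indicator \<Omega> y * f y = g y)"
  proof cases
    case 1 then show ?thesis using \<Omega> f by (intro exI[of _ \<Omega>] exI[of _ f]) auto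
  next
    case 2 
    have "indicator \<Omega> y * f y = 0" if "y \<in> - closure \<Omega>" for y using that closure_subset[of \<Omega>] by (auto simp: indicator_def)
    then show ?thesis using 2 by (intro exI[of _ "- closure \<Omega>"] exI[of _ "\<lambda>_. 0"]) (auto simp: C1_const)
  next
    case 3 then show ?thesis using W by (intro exI[of _ W] exI[of _ "\<lambda>_. 0"]) (auto simp: C1_const)
  qed
qed

text \<open>A telescoping partition of unity: multiplying on the factors
  \<open>1 - \<beta> x\<close> one at a time splits off, each time, a function supported in one
  chart. All pieces keep the sup norm bound \<open>M\<close>, so derivatives of the cutoffs never
  enter the estimate. The remainder vanishes near the frontier and is an interior test
  function.\<close>

lemma gradient_bound:
  fixes \<Omega> :: "(real^'n) set"
  assumes \<Omega>: "open \<Omega>" "bounded \<Omega>" "smooth_boundary \<Omega>"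
  shows "\<exists>C\<ge>0. \<forall>u w a V b \<psi> M v. admissible \<Omega> u w a V b \<longrightarrow> C1 \<psi> \<longrightarrow> compactly_supported \<psi> \<longrightarrow>
    (\<forall>x. \<bar>\<psi> x\<bar> \<le> M) \<longrightarrow> norm v \<le> 1 \<longrightarrow> (\<integral>x. w x * (grad \<psi> x \<bullet> v) \<partial>lborel) \<le> M * (C * (V + b))"
proof -
  define bound where "bound x \<rho> C \<longleftrightarrow> 0 < \<rho> \<and> 0 \<le> C \<and> (\<forall>u w a V b \<psi> M v. admissible \<Omega> u w a V b \<longrightarrow>
    C1 \<psi> \<longrightarrow> compact_support_in (ball x \<rho>) \<psi> \<longrightarrow> (\<forall>y. \<bar>\<psi> y\<bar> \<le> M) \<longrightarrow> norm v \<le> 1 \<longrightarrow>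
    (\<integral>y. w y * (grad \<psi> y \<bullet> v) \<partial>lborel) \<le> M * (C * (V + b)))" for x :: "real^'n" and \<rho> C
  have "\<forall>x\<in>frontier \<Omega>. \<exists>\<rho>. \<exists>C. bound x \<rho> C" unfolding bound_def using local_boundary_bound[OF \<Omega>] by blast
  then have "\<exists>\<rho>. \<forall>x\<in>frontier \<Omega>. \<exists>C. bound x (\<rho> x) C" by (rule bchoice)
  then obtain \<rho> where "\<forall>x\<in>frontier \<Omega>. \<exists>C. bound x (\<rho> x) C" ..
  then have "\<exists>C. \<forall>x\<in>frontier \<Omega>. bound x (\<rho> x) (C x)" by (rule bchoice)
  then obtain C where bnd: "\<forall>x\<in>frontier \<Omega>. bound x (\<rho> x) (C x)" ..
  then have \<rho>: "0 < \<rho> x" and C: "0 \<le> C x" if "x \<in> frontier \<Omega>" for x using that by (auto simp: bound_def)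
  have est: "(\<integral>y. w y * (grad \<psi> y \<bullet> v) \<partial>lborel) \<le> M * (C x * (V + b))"
    if "x \<in> frontier \<Omega>" "admissible \<Omega> u w a V b" "C1 \<psi>" "compact_support_in (ball x (\<rho> x)) \<psi>" "\<And>y. \<bar>\<psi> y\<bar> \<le> M" "norm v \<le> 1"
    for x u w a V b \<psi> M and v :: "real^'n"
    using bnd that unfolding bound_def by blast
  have "compact (frontier \<Omega>)" using \<Omega>(2) by (rule compact_frontier_bounded)
  then obtain F where F: "F \<subseteq> frontier \<Omega>" "finite F" "frontier \<Omega> \<subseteq> (\<Union>x\<in>F. ball x (\<rho> x / 2))"
    by (rule compactE_image[of "frontier \<Omega>" "frontier \<Omega>" "\<lambda>x. ball x (\<rho> x / 2)"]) (use \<rho> in force)+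
  \<comment> \<open>The inner radius matches the finite cover, and the outer one keeps the support
    inside the ball of the chart estimate.\<close>
  define \<beta> where "\<beta> x = bump x (\<rho> x / 2) (3 * \<rho> x / 4)" for x
  define P where "P A y = (\<Prod>x\<in>A. 1 - \<beta> x y)" for A y
  have C\<beta>: "C1 (\<beta> x)" for x unfolding \<beta>_def by (rule C1_bump)
  have CP: "C1 (P A)" for A unfolding P_def by (intro C1_prod C1_diff C1_const C\<beta>)
  have \<beta>01: "0 \<le> \<beta> x y" "\<beta> x y \<le> 1" for x y unfolding \<beta>_def by (rule bump_bounds)+
  have P01: "0 \<le> P A y" "P A y \<le> 1" for A y unfolding P_def using \<beta>01 by (auto intro!: prod_nonneg prod_le_1)
  have ind: "(\<integral>y. w y * (grad \<psi> y \<bullet> v) \<partial>lborel) \<le> M * ((\<Sum>x\<in>A. C x) * (V + b)) + (\<integral>y. w y * (grad (\<lambda>y. P A y * \<psi> y) y \<bullet> v) \<partial>lborel)"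
    if adm: "admissible \<Omega> u w a V b" and \<psi>: "C1 \<psi>" "compactly_supported \<psi>" "\<And>y. \<bar>\<psi> y\<bar> \<le> M" and v: "norm v \<le> 1" and A: "finite A" "A \<subseteq> F"
    for u w a V b \<psi> M A and v :: "real^'n"
    using A
  proof (induction A rule: finite_induct)
    case empty
    then show ?case by (simp add: P_def)
  next
    case (insert x A)
    have w: "integrable lborel w" using adm by (simp add: admissible_def)
    have xf: "x \<in> frontier \<Omega>" using insert.prems F(1) by auto
    define f where "f y = P A y * \<psi> y" for y
    define g where "g y = \<beta> x y * f y" for y
    define g' where "g' y = P (insert x A) y * \<psi> y" for y
    have Cf: "C1 f" unfolding f_def by (intro C1_mult CP \<psi>)
    have Cg: "C1 g" unfolding g_def by (intro C1_mult C\<beta> Cf)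
    have Cg': "C1 g'" unfolding g'_def by (intro C1_mult CP \<psi>)
    have feq: "f = (\<lambda>y. g y + g' y)" using insert.hyps by (simp add: fun_eq_iff f_def g_def g'_def P_def algebra_simps)
    have csg: "compactly_supported (grad g)" "compactly_supported (grad g')"
      by (intro compactly_supported_grad compact_support_in_cong[OF \<psi>(2)]; simp add: g_def f_def g'_def)+
    have i: "integrable lborel (\<lambda>y. w y * (grad g y \<bullet> v))" "integrable lborel (\<lambda>y. w y * (grad g' y \<bullet> v))"
      by (intro integrable_mult_cs[OF w] continuous_intros C1_continuous_grad Cg Cg' compact_support_in_cong[OF csg(1)] compact_support_in_cong[OF csg(2)]; simp)+
    have "(\<integral>y. w y * (grad f y \<bullet> v) \<partial>lborel) = (\<integral>y. w y * (grad g y \<bullet> v) + w y * (grad g' y \<bullet> v) \<partial>lborel)"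
      unfolding feq by (simp add: grad_add Cg Cg' inner_add_left distrib_left)
    also have "\<dots> = (\<integral>y. w y * (grad g y \<bullet> v) \<partial>lborel) + (\<integral>y. w y * (grad g' y \<bullet> v) \<partial>lborel)"
      using i by (rule Bochner_Integration.integral_add)
    also have "(\<integral>y. w y * (grad g y \<bullet> v) \<partial>lborel) \<le> M * (C x * (V + b))"
    proof (rule est[OF xf adm Cg _ _ v])
      have "compact_support_in (ball x (\<rho> x)) (\<beta> x)"
        unfolding \<beta>_def using \<rho>[OF xf] by (intro compact_support_bump) auto
      then show "compact_support_in (ball x (\<rho> x)) g" unfolding g_def by (rule compact_support_mult_left)
      show "\<bar>g y\<bar> \<le> M" for y
      proof -
        have "\<bar>\<beta> x y\<bar> * (\<bar>P A y\<bar> * \<bar>\<psi> y\<bar>) \<le> 1 * (1 * M)"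
          using \<beta>01[of x y] P01[of A y] \<psi>(3)[of y] by (intro mult_mono) auto
        then show ?thesis by (simp add: g_def f_def abs_mult)
      qed
    qed
    finally have "(\<integral>y. w y * (grad f y \<bullet> v) \<partial>lborel) \<le> M * (C x * (V + b)) + (\<integral>y. w y * (grad g' y \<bullet> v) \<partial>lborel)" by simp
    moreover have "(\<integral>y. w y * (grad \<psi> y \<bullet> v) \<partial>lborel) \<le> M * ((\<Sum>x\<in>A. C x) * (V + b)) + (\<integral>y. w y * (grad f y \<bullet> v) \<partial>lborel)"
      using insert.IH insert.prems unfolding f_def by auto
    moreover have "M * ((\<Sum>x\<in>insert x A. C x) * (V + b)) = M * (C x * (V + b)) + M * ((\<Sum>x\<in>A. C x) * (V + b))"
      using insert.hyps by (simp add: algebra_simps)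
    ultimately show ?case unfolding g'_def by linarith
  qed
  define W where "W = (\<Union>x\<in>F. ball x (\<rho> x / 2))"
  have Wop: "open W" by (auto simp: W_def)
  have PW: "P F y = 0" if "y \<in> W" for y
  proof -
    from that obtain x where x: "x \<in> F" "y \<in> ball x (\<rho> x / 2)" unfolding W_def by blast
    then have "\<beta> x y = 1" unfolding \<beta>_def using \<rho>[of x] F(1) by (intro bump_eq_1) (auto simp: dist_norm norm_minus_commute)
    then show ?thesis unfolding P_def using x(1) F(2) by (intro prod_zero) auto
  qed
  have S0: "0 \<le> (\<Sum>x\<in>F. C x)" using C F(1) by (intro sum_nonneg) auto
  show ?thesis
  proof (intro exI[of _ "(\<Sum>x\<in>F. C x) + 1"] conjI allI impI)
    show "0 \<le> (\<Sum>x\<in>F. C x) + 1" using S0 by simp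
    fix u w \<psi> :: "real^'n \<Rightarrow> real" and a V b M and v :: "real^'n"
    assume adm: "admissible \<Omega> u w a V b" and \<psi>: "C1 \<psi>" "compactly_supported \<psi>" and M: "\<forall>y. \<bar>\<psi> y\<bar> \<le> M" and v: "norm v \<le> 1"
    have w0: "w y = 0" if "y \<notin> \<Omega>" for y using adm that by (simp add: admissible_def)
    have V: "variation_le \<Omega> w V" "0 \<le> V" "0 \<le> b" using adm by (auto simp: admissible_def)
    have M0: "0 \<le> M" using M[rule_format, of 0] abs_ge_zero[of "\<psi> 0"] by linarith
    define f where "f y = P F y * \<psi> y" for y
    define f1 where "f1 y = indicator \<Omega> y * f y" for y
    have Cf: "C1 f" unfolding f_def by (intro C1_mult CP \<psi>)
    have fW: "f y = 0" if "y \<in> W" for y using PW[OF that] by (simp add: f_def)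
    have Cf1: "C1 f1" unfolding f1_def using fW F(3) by (intro C1_indicator_mult[OF \<Omega>(1) Cf Wop]) (auto simp: W_def)
    have "compact_support_in \<Omega> f1"
    proof (rule compact_support_inI[of "closure \<Omega> - W"])
      show "compact (closure \<Omega> - W)" using \<Omega>(2) Wop by (intro compact_diff) auto
      show "closure \<Omega> - W \<subseteq> \<Omega>" using F(3) \<Omega>(1) by (auto simp: W_def frontier_def interior_open)
      show "f1 y = 0" if "y \<notin> closure \<Omega> - W" for y
        using that fW closure_subset[of \<Omega>] by (auto simp: f1_def indicator_def)
    qed
    moreover have "\<bar>f1 y\<bar> \<le> M" for y
    proof -
      have "\<bar>P F y\<bar> * \<bar>\<psi> y\<bar> \<le> 1 * M" using P01[of F y] M by (intro mult_mono) auto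
      then show ?thesis using M0 by (auto simp: f1_def f_def abs_mult indicator_def)
    qed
    ultimately have "(\<integral>y. w y * (grad f1 y \<bullet> v) \<partial>lborel) \<le> M * V"
      using v by (intro variation_le_scalar[OF V(1) Cf1])
    moreover have "w y * (grad f1 y \<bullet> v) = w y * (grad f y \<bullet> v)" for y
    proof (cases "y \<in> \<Omega>")
      case True
      have "(f1 has_derivative (\<lambda>h. grad f y \<bullet> h)) (at y)"
        by (rule has_derivative_transform_within_open[OF C1_has_derivative[OF Cf] \<Omega>(1) True]) (simp add: f1_def)
      then show ?thesis by (simp add: grad_eqI)
    qed (simp add: w0)
    ultimately have "(\<integral>y. w y * (grad f y \<bullet> v) \<partial>lborel) \<le> M * V" by simp
    moreover have "(\<integral>y. w y * (grad \<psi> y \<bullet> v) \<partial>lborel) \<le> M * ((\<Sum>x\<in>F. C x) * (V + b)) + (\<integral>y. w y * (grad f y \<bullet> v) \<partial>lborel)"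
      unfolding f_def using M by (intro ind[OF adm \<psi> _ v F(2)]) auto
    moreover have "M * V \<le> M * (V + b)" using V M0 by (intro mult_left_mono) auto
    moreover have "M * (((\<Sum>x\<in>F. C x) + 1) * (V + b)) = M * ((\<Sum>x\<in>F. C x) * (V + b)) + M * (V + b)"
      by (simp add: algebra_simps)
    ultimately show "(\<integral>y. w y * (grad \<psi> y \<bullet> v) \<partial>lborel) \<le> M * (((\<Sum>x\<in>F. C x) + 1) * (V + b))" by linarith
  qed
qed

text \<open>On the domain a given \<open>s\<close> is a directional derivative: its integral over a
  segment of length \<open>T\<close> ending at \<open>x\<close> has derivative
  \<open>s x - s (x - T *\<^sub>R e)\<close> along \<open>e\<close>, and the second term vanishes
  for \<open>x\<close> in the domain.\<close>

theorem poincare_with_trace: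
  fixes \<Omega> :: "(real^'n) set"
  assumes \<Omega>: "open \<Omega>" "bounded \<Omega>" "smooth_boundary \<Omega>"
  shows "\<exists>C\<ge>0. \<forall>u w a V b. admissible \<Omega> u w a V b \<longrightarrow> (\<integral>x. \<bar>w x\<bar> \<partial>lborel) \<le> C * (V + b)"
proof -
  obtain C where C: "0 \<le> C" and est: "\<forall>u w a V b \<psi> M v. admissible \<Omega> u w a V b \<longrightarrow> C1 \<psi> \<longrightarrow> compactly_supported \<psi> \<longrightarrow>
    (\<forall>x. \<bar>\<psi> x\<bar> \<le> M) \<longrightarrow> norm v \<le> 1 \<longrightarrow> (\<integral>x. w x * (grad \<psi> x \<bullet> v) \<partial>lborel) \<le> M * (C * (V + b))"
    using gradient_bound[OF \<Omega>] by (elim exE conjE)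
  obtain R where R: "\<And>x. x \<in> \<Omega> \<Longrightarrow> norm x \<le> R" using \<Omega>(2) by (auto simp: bounded_iff)
  \<comment> \<open>Larger than the diameter of the domain, which lies in the ball of radius
    \<open>\<bar>R\<bar>\<close> about the origin.\<close>
  define T where "T = 2 * \<bar>R\<bar> + 1"
  have T: "0 < T" by (simp add: T_def)
  obtain k :: 'n where True by blast
  define e where "e = axis k (1::real)"
  have e: "norm e = 1" by (simp add: e_def norm_axis_1)
  show ?thesis
  proof (intro exI[of _ "T * C"] conjI allI impI)
    show "0 \<le> T * C" using T C by simp
    fix u w :: "real^'n \<Rightarrow> real" and a V b
    assume adm: "admissible \<Omega> u w a V b"
    have w0: "w y = 0" if "y \<notin> \<Omega>" for y using adm that by (simp add: admissible_def)
    have w: "integrable lborel w" using adm by (simp add: admissible_def)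
    have "(\<integral>x. indicator \<Omega> x * \<bar>w x\<bar> \<partial>lborel) \<le> T * C * (V + b)"
    proof (rule L1_norm_le_by_duality[OF w \<Omega>(1,2)])
      fix s :: "real^'n \<Rightarrow> real"
      assume s: "C1 s" "compact_support_in \<Omega> s" "\<And>x. \<bar>s x\<bar> \<le> 1"
      have s0: "s x = 0" if "x \<notin> \<Omega>" for x using compact_support_in_ex[OF s(2)] that by blast
      define y where "y x t = x + (- T + t * T) *\<^sub>R e" for x t
      define G where "G x = integral {0..1} (\<lambda>t. s (y x t))" for x
      define \<psi> where "\<psi> x = T * G x" for x
      note LI = C1_line_integral[OF s(1) C1_const[of T] C1_const[of "- T"], of e, folded y_def, folded G_def[abs_def]]
      have C\<psi>: "C1 \<psi>" unfolding \<psi>_def by (intro C1_cmult LI(1))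
      have cy: "continuous_on A (\<lambda>t. y x t)" for A x unfolding y_def by (intro continuous_intros)
      have si: "(\<lambda>t. s (y x t)) integrable_on {0..1}" for x
        by (intro integrable_continuous_real continuous_on_compose2[OF C1_continuous[OF s(1), of UNIV] cy]) auto
      have G1: "\<bar>G x\<bar> \<le> 1" for x
      proof -
        have "norm (integral {0..1} (\<lambda>t. s (y x t))) \<le> 1 * (1 - 0)"
          by (intro integral_bound continuous_on_compose2[OF C1_continuous[OF s(1), of UNIV] cy]) (use s(3) in auto)
        then show ?thesis by (simp add: G_def)
      qed
      have cs: "compactly_supported \<psi>"
      proof (rule compact_support_inI[of "cball 0 (\<bar>R\<bar> + T)"])
        show "\<psi> x = 0" if x: "x \<notin> cball 0 (\<bar>R\<bar> + T)" for x
        proof -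
          have "s (y x t) = 0" if t: "t \<in> {0..1}" for t
          proof (rule s0, rule notI)
            assume "y x t \<in> \<Omega>"
            then have "norm (y x t) \<le> \<bar>R\<bar>" using R by fastforce
            moreover have "norm ((- T + t * T) *\<^sub>R e) \<le> T"
            proof -
              have "0 \<le> t * T" "t * T \<le> 1 * T" using t T by (auto intro: mult_right_mono)
              then show ?thesis using e by auto
            qed
            moreover have "norm x \<le> norm (y x t) + norm ((- T + t * T) *\<^sub>R e)"
              using norm_triangle_ineq4[of "y x t" "(- T + t * T) *\<^sub>R e"] by (simp add: y_def)
            ultimately show False using x by simp
          qed
          then have "G x = integral {0..1} (\<lambda>t::real. 0)" unfolding G_def by (intro integral_cong)
          then show ?thesis by (simp add: \<psi>_def)
        qed
      qed auto
      have gr: "grad \<psi> x \<bullet> e = s x - s (x - T *\<^sub>R e)" for x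
      proof -
        have "((\<lambda>t. T * (grad s (y x t) \<bullet> e)) has_integral (s (y x 1) - s (y x 0))) {0..1}"
        proof (rule fundamental_theorem_of_calculus)
          fix t :: real
          have "((\<lambda>t. y x t) has_derivative (\<lambda>h. (h * T) *\<^sub>R e)) (at t)"
            unfolding y_def by (auto intro!: derivative_eq_intros)
          from has_derivative_compose[OF this C1_has_derivative[OF s(1)]]
          have "((\<lambda>t. s (y x t)) has_real_derivative (T * (grad s (y x t) \<bullet> e))) (at t)"
            by (simp add: has_field_derivative_def mult.assoc mult_commute_abs)
          then show "((\<lambda>t. s (y x t)) has_vector_derivative (T * (grad s (y x t) \<bullet> e))) (at t within {0..1})"
            by (simp add: has_real_derivative_iff_has_vector_derivative has_vector_derivative_at_within)
        qed simp
        then have "integral {0..1} (\<lambda>t. T * (grad s (y x t) \<bullet> e)) = s (y x 1) - s (y x 0)" by (rule integral_unique)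
        moreover have "grad \<psi> x \<bullet> e = T * integral {0..1} (\<lambda>t. grad s (y x t) \<bullet> e)"
          unfolding \<psi>_def grad_cmult[OF LI(1)] using LI(2)[of x e] by (simp add: grad_const)
        ultimately show ?thesis by (simp add: y_def)
      qed
      have "w x * (grad \<psi> x \<bullet> e) = w x * s x" for x
      proof (cases "x \<in> \<Omega>")
        case True
        have "x - T *\<^sub>R e \<notin> \<Omega>"
        proof
          assume "x - T *\<^sub>R e \<in> \<Omega>"
          then have "norm (x - T *\<^sub>R e) \<le> \<bar>R\<bar>" "norm x \<le> \<bar>R\<bar>" using R True by fastforce+
          moreover have "norm (T *\<^sub>R e) \<le> norm x + norm (x - T *\<^sub>R e)" using norm_triangle_ineq4[of x "x - T *\<^sub>R e"] by simp
          ultimately show False using e T by (simp add: T_def)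
        qed
        then show ?thesis using s0 by (simp add: gr)
      qed (simp add: w0)
      then have "(\<integral>x. w x * s x \<partial>lborel) = (\<integral>x. w x * (grad \<psi> x \<bullet> e) \<partial>lborel)" by (simp only:)
      also have "\<dots> \<le> T * (C * (V + b))"
      proof -
        have "\<bar>\<psi> x\<bar> \<le> T" for x using mult_left_mono[OF G1[of x], of T] T by (simp add: \<psi>_def abs_mult)
        then show ?thesis using e by (intro est[THEN spec, THEN spec, THEN spec, THEN spec, THEN spec, THEN spec, THEN spec, THEN spec,
            THEN mp, THEN mp, THEN mp, THEN mp, THEN mp, OF adm C\<psi> cs]) auto
      qed
      finally show "(\<integral>x. w x * s x \<partial>lborel) \<le> T * C * (V + b)" by (simp add: mult.assoc)
    qed
    moreover have "indicator \<Omega> x * \<bar>w x\<bar> = \<bar>w x\<bar>" for x using w0 by (cases "x \<in> \<Omega>") auto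
    ultimately show "(\<integral>x. \<bar>w x\<bar> \<partial>lborel) \<le> T * C * (V + b)" by simp
  qed
qed

section \<open>Existence and size of solutions\<close>

lemma AE_lebesgue_on_open:
  "open (\<Omega> :: (real^'n) set) \<Longrightarrow> (AE x in lebesgue_on \<Omega>. P x) \<longleftrightarrow> (AE x in lebesgue. x \<in> \<Omega> \<longrightarrow> P x)"
  by (rule AE_restrict_space_iff) simp

text \<open>Clamping to \<open>{- a..a}\<close> makes the bound hold at every point and not only
  almost everywhere.\<close>

lemma bounded_borel_representative:
  fixes u :: "real^'n \<Rightarrow> real"
  assumes \<Omega>: "open \<Omega>" "bounded \<Omega>" and u: "u \<in> borel_measurable (lebesgue_on \<Omega>)"
    and a: "0 < a" "AE x in lebesgue_on \<Omega>. \<bar>u x\<bar> \<le> a"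
  obtains w where "w \<in> borel_measurable borel" "AE x in lebesgue. x \<in> \<Omega> \<longrightarrow> u x = w x" "integrable lborel w"
    "\<And>x. \<bar>w x\<bar> \<le> a" "\<And>x. x \<notin> \<Omega> \<Longrightarrow> w x = 0"
proof -
  have O: "\<Omega> \<in> sets borel" using \<Omega> by simp
  have "(\<lambda>x. indicator \<Omega> x *\<^sub>R u x) \<in> borel_measurable lebesgue"
    using u O borel_measurable_restrict_space_iff[of \<Omega> lebesgue u] by auto
  then obtain g where g: "g \<in> borel_measurable lborel" "AE x in lborel. indicator \<Omega> x *\<^sub>R u x = g x"
    using completion_ex_borel_measurable_real by blast
  define w where "w x = indicator \<Omega> x * max (- a) (min a (g x))" for x
  have wm: "w \<in> borel_measurable borel" unfolding w_def using O g(1) by measurable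
  have wa: "\<bar>w x\<bar> \<le> a" for x using a(1) by (auto simp: w_def indicator_def)
  have w0: "w x = 0" if "x \<notin> \<Omega>" for x using that by (simp add: w_def)
  have "emeasure lborel \<Omega> < \<infinity>" by (rule emeasure_bounded_finite[OF \<Omega>(2)])
  then have "integrable lborel w" using O wm wa
    by (intro integrableI_bounded_set[of \<Omega> _ _ a]) (auto simp: w0)
  moreover have "AE x in lebesgue. x \<in> \<Omega> \<longrightarrow> u x = w x"
    using AE_completion[OF g(2)] a(2)[unfolded AE_lebesgue_on_open[OF \<Omega>(1)]]
  proof eventually_elim
    case (elim x)
    then show ?case by (cases "x \<in> \<Omega>") (auto simp: w_def)
  qed
  ultimately show ?thesis using wm wa w0 by (intro that[of w]) auto
qed

lemma divergence_bound:
  assumes a: "0 < a" "1 < q" "0 \<le> lam" "1 < c" and t: "\<bar>t\<bar> \<le> a"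
    and \<rho>: "\<rho> \<in> clarke_gradient (F_trunc q a) t" and d: "- d = lam * \<rho> + \<bar>t\<bar> powr (c - 2) * t"
  shows "\<bar>d\<bar> \<le> lam * a powr (q - 1) + a powr (c - 1)"
proof -
  have "\<bar>\<rho>\<bar> \<le> a powr (q - 1)"
    using \<rho> t unfolding clarke_gradient_F_trunc[OF a(1,2)] by (auto split: if_splits)
  then have 1: "\<bar>lam * \<rho>\<bar> \<le> lam * a powr (q - 1)" using a by (simp add: abs_mult mult_left_mono)
  have "\<bar>t\<bar> powr (c - 2) * \<bar>t\<bar> = \<bar>t\<bar> powr (c - 1)"
    using powr_add[of "\<bar>t\<bar>" "c - 2" 1] by (cases "t = 0") auto
  also have "\<dots> \<le> a powr (c - 1)" using t a by (intro powr_mono2) auto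
  finally have "\<bar>\<bar>t\<bar> powr (c - 2) * t\<bar> \<le> a powr (c - 1)" by (simp add: abs_mult)
  then show ?thesis using 1 d by linarith
qed

text \<open>The energy identity pays for total variation and boundary integral with the integral of
  \<open>- u * d\<close>, and \<open>\<bar>d\<bar>\<close> is small by
  \<open>divergence_bound\<close> because \<open>u\<close> stays at or below the threshold.\<close>

lemma small_solution_energy:
  fixes \<Omega> :: "(real^'n) set"
  assumes \<Omega>: "open \<Omega>" "bounded \<Omega>" and N: "CARD('n) \<ge> 2" and q: "1 < q" "0 < lam" and a: "0 < a"
    and sol: "solution \<Omega> q lam a u" and small: "AE x in lebesgue_on \<Omega>. \<bar>u x\<bar> \<le> a"
  obtains w V b where "admissible \<Omega> u w a V b"
    "V + b \<le> (lam * a powr (q - 1) + a powr (crit_exponent TYPE('n) - 1)) * (\<integral>x. \<bar>w x\<bar> \<partial>lborel)"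
proof -
  define \<epsilon> where "\<epsilon> = lam * a powr (q - 1) + a powr (crit_exponent TYPE('n) - 1)"
  have \<epsilon>: "0 \<le> \<epsilon>" using q by (simp add: \<epsilon>_def)
  have crit: "1 < crit_exponent TYPE('n)" using N by (simp add: crit_exponent_def field_simps)
  obtain d \<rho> where eq: "ereal (- (\<integral>x. u x * d x \<partial>lebesgue_on \<Omega>)) = total_variation \<Omega> u + boundary_integral_abs \<Omega> u"
    and d: "AE x in lebesgue_on \<Omega>. - d x = lam * \<rho> x + \<bar>u x\<bar> powr (crit_exponent TYPE('n) - 2) * u x"
    and \<rho>: "AE x in lebesgue_on \<Omega>. \<rho> x \<in> clarke_gradient (F_trunc q a) (u x)"
    using sol unfolding solution_def by blast
  have bv: "integrable (lebesgue_on \<Omega>) u" "total_variation \<Omega> u < \<infinity>"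
    using sol by (auto simp: solution_def BV_def)
  have um: "u \<in> borel_measurable (lebesgue_on \<Omega>)" using bv(1) by simp
  obtain w where w: "w \<in> borel_measurable borel" "AE x in lebesgue. x \<in> \<Omega> \<longrightarrow> u x = w x" "integrable lborel w"
    "\<And>x. \<bar>w x\<bar> \<le> a" "\<And>x. x \<notin> \<Omega> \<Longrightarrow> w x = 0"
    by (rule bounded_borel_representative[OF \<Omega> um a small]) (rule that)
  have O: "\<Omega> \<in> sets borel" using \<Omega> by simp
  note TV = total_variation_lborel[OF \<Omega>(1) um w(1,2)]
  have le_TV: "ereal (\<integral>x. w x * divergence \<phi> x \<partial>lborel) \<le> total_variation \<Omega> u" if "\<phi> \<in> unit_fields \<Omega>" for \<phi>
    unfolding TV using that by (rule SUP_upper)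
  from le_TV[OF zero_unit_field] have "0 \<le> total_variation \<Omega> u"
    by (simp add: divergence_grad grad_const zero_ereal_def)
  then obtain V where V: "total_variation \<Omega> u = ereal V" "0 \<le> V"
    using bv(2) by (cases "total_variation \<Omega> u") auto
  define X where "X = (\<integral>\<^sup>+ x \<in> frontier \<Omega>. ennreal \<bar>bv_trace \<Omega> u x\<bar> \<partial>hausdorff_measure (CARD('n) - 1))"
  have eqX: "ereal (- (\<integral>x. u x * d x \<partial>lebesgue_on \<Omega>)) = ereal V + enn2ereal X"
    using eq unfolding V boundary_integral_abs_def X_def .
  \<comment> \<open>The left side of \<open>eqX\<close> is a real number, so the boundary integral
    is finite.\<close>
  then obtain b where b: "X = ennreal b" "0 \<le> b" by (cases X) (auto simp: enn2ereal_top)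
  have Vb: "V + b = - (\<integral>x. u x * d x \<partial>lebesgue_on \<Omega>)" using eqX b by (simp add: enn2ereal_ennreal)
  have "admissible \<Omega> u w a V b"
    unfolding admissible_def variation_le_def
    using um w V(2) b(2) le_TV b(1)[unfolded X_def] by (auto simp: V(1))
  moreover have "V + b \<le> \<epsilon> * (\<integral>x. \<bar>w x\<bar> \<partial>lborel)"
  proof -
    have "(\<integral>x. \<bar>u x\<bar> \<partial>lebesgue_on \<Omega>) = (\<integral>x. indicator \<Omega> x * \<bar>w x\<bar> \<partial>lborel)"
    proof (rule lebesgue_on_integral_eq_lborel(1)[OF O])
      show "AE x in lebesgue. x \<in> \<Omega> \<longrightarrow> \<bar>u x\<bar> = \<bar>w x\<bar>" using w(2) by eventually_elim auto
    qed (use um w in measurable)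
    also have "\<dots> = (\<integral>x. \<bar>w x\<bar> \<partial>lborel)"
      using w(5) by (intro Bochner_Integration.integral_cong) (auto simp: indicator_def)
    finally have i: "(\<integral>x. \<epsilon> * \<bar>u x\<bar> \<partial>lebesgue_on \<Omega>) = \<epsilon> * (\<integral>x. \<bar>w x\<bar> \<partial>lborel)" by simp
    have "AE x in lebesgue_on \<Omega>. - (u x * d x) \<le> \<epsilon> * \<bar>u x\<bar>"
      using small d \<rho>
    proof eventually_elim
      case (elim x)
      have "\<bar>d x\<bar> \<le> \<epsilon>" unfolding \<epsilon>_def using divergence_bound[OF a q(1) _ crit elim(1,3,2)] q(2) by simp
      then have "\<bar>d x\<bar> * \<bar>u x\<bar> \<le> \<epsilon> * \<bar>u x\<bar>" by (rule mult_right_mono) simp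
      then show ?case using abs_ge_minus_self[of "u x * d x"] by (simp add: abs_mult mult.commute)
    qed
    then have "- (\<integral>x. u x * d x \<partial>lebesgue_on \<Omega>) \<le> (\<integral>x. \<epsilon> * \<bar>u x\<bar> \<partial>lebesgue_on \<Omega>)"
    proof (cases "integrable (lebesgue_on \<Omega>) (\<lambda>x. u x * d x)")
      case True
      assume ae: "AE x in lebesgue_on \<Omega>. - (u x * d x) \<le> \<epsilon> * \<bar>u x\<bar>"
      have "(\<integral>x. - (u x * d x) \<partial>lebesgue_on \<Omega>) \<le> (\<integral>x. \<epsilon> * \<bar>u x\<bar> \<partial>lebesgue_on \<Omega>)"
        using True bv(1) ae by (intro integral_mono_AE) auto
      then show ?thesis by simp
    next
      case False
      \<comment> \<open>The Bochner integral of a function that is not integrable is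
        \<open>0\<close>, and the right side is nonnegative.\<close>
      then show ?thesis using \<epsilon> by (simp add: not_integrable_integral_eq)
    qed
    then show ?thesis unfolding Vb i[symmetric] .
  qed
  ultimately show ?thesis using that unfolding \<epsilon>_def by blast
qed

text \<open>The functions differ on the open shell between the two radii, which is nonempty and
  hence not negligible.\<close>

lemma not_ae_equal_cball:
  fixes \<Omega> :: "(real^'n) set"
  assumes \<Omega>: "open \<Omega>" "cball p R \<subseteq> \<Omega>" and R: "0 < S" "S < R" and c: "c \<noteq> 0"
    and eq: "ae_equal \<Omega> (\<lambda>x. c * indicator (cball p R) x) (\<lambda>x. d * indicator (cball p S) x)"
  shows False
proof -
  have "AE x in lebesgue. x \<notin> ball p R - cball p S"
    using eq[unfolded ae_equal_def AE_lebesgue_on_open[OF \<Omega>(1)]]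
  proof eventually_elim
    case (elim x)
    have "x \<in> \<Omega>" if "x \<in> ball p R" using that \<Omega>(2) by auto
    with elim c show ?case by (auto simp: indicator_def split: if_splits)
  qed
  moreover have o: "open (ball p R - cball p S)" by (intro open_Diff) auto
  ultimately have "negligible (ball p R - cball p S)"
    unfolding negligible_iff_null_sets by (subst AE_iff_null_sets) (simp_all add: borel_open)
  moreover have "p + ((R + S) / 2) *\<^sub>R axis undefined 1 \<in> ball p R - cball p S"
    using R by (simp add: dist_norm norm_axis_1)
  ultimately show False using open_not_negligible[OF o] by blast
qed

lemma powr_sum_solvable:
  fixes l s t K :: real
  assumes "0 < l" "0 < s" "0 < t" "0 < K"
  shows "\<exists>c>0. l * c powr s + c powr t = K"
proof -
  \<comment> \<open>At this point the second power alone already equals \<open>K\<close>, so the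
    intermediate value theorem applies on \<open>{0..C}\<close>.\<close>
  define C where "C = K powr (1 / t)"
  have "\<exists>c. 0 \<le> c \<and> c \<le> C \<and> l * c powr s + c powr t = K"
  proof (rule IVT')
    show "K \<le> l * C powr s + C powr t" using assms by (simp add: C_def powr_powr)
    show "continuous_on {0..C} (\<lambda>c. l * c powr s + c powr t)"
      using assms by (intro continuous_intros continuous_on_powr') auto
  qed (use assms in \<open>simp_all add: C_def\<close>)
  then obtain c where "0 \<le> c" "l * c powr s + c powr t = K" by blast
  moreover from this have "c \<noteq> 0" using assms by auto
  ultimately show ?thesis by (intro exI[of _ c]) auto
qed

lemma powr_sum_small:
  fixes l s t C e :: real
  assumes "0 < s" "0 < t" "0 < e"
  shows "\<exists>a0>0. \<forall>a. 0 < a \<and> a < a0 \<longrightarrow> C * (l * a powr s + a powr t) < e"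
proof -
  have "((\<lambda>a. C * (l * a powr s + a powr t)) \<longlongrightarrow> C * (l * 0 powr s + 0 powr t)) (at_right 0)"
    using assms by (intro tendsto_intros tendsto_powr') (auto simp: eventually_at_right_field intro: exI[of _ 1])
  then have "eventually (\<lambda>a. C * (l * a powr s + a powr t) < e) (at_right 0)"
    using assms by (auto dest: order_tendstoD(2)[of _ _ _ e])
  then show ?thesis unfolding eventually_at_right_field by auto
qed

theorem theorem1p2:
  fixes \<Omega> :: "(real^'n) set" and q :: real
  assumes "CARD('n) \<ge> 2"
    and "bounded_smooth_domain \<Omega>"
    and "1 < q" and "q < crit_exponent TYPE('n)"
  shows "\<forall>n::nat. \<exists>lam\<^sub>n>0. \<forall>lam\<ge>lam\<^sub>n. \<exists>a\<^sub>1>0.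
           (\<forall>a. 0 < a \<and> a < a\<^sub>1 \<longrightarrow> at_least_nontrivial_solutions n \<Omega> q lam a) \<and>
           (\<exists>a\<^sub>0>0. a\<^sub>0 \<le> a\<^sub>1 \<and>
              (\<forall>a. 0 < a \<and> a < a\<^sub>0 \<longrightarrow>
                 (\<forall>u. nontrivial_solution \<Omega> q lam a u \<longrightarrow>
                        emeasure lebesgue {x \<in> \<Omega>. \<bar>u x\<bar> > a} > 0)))"
proof -
  have \<Omega>: "open \<Omega>" "bounded \<Omega>" "smooth_boundary \<Omega>" "\<Omega> \<noteq> {}"
    using assms(2) by (auto simp: bounded_smooth_domain_def)
  have crit: "0 < crit_exponent TYPE('n) - 1" using assms(1) by (simp add: crit_exponent_def field_simps)
  have q1: "0 < q - 1" using assms(3) by simp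
  obtain p where "p \<in> \<Omega>" using \<Omega>(4) by blast
  then obtain R where R: "0 < R" "cball p R \<subseteq> \<Omega>" using \<Omega>(1) open_contains_cball by blast
  \<comment> \<open>Distinct radii below \<open>R\<close>, so that every ball keeps a positive
    distance from the boundary.\<close>
  define r where "r j = R / (real j + 2)" for j :: nat
  have r: "0 < r j" "r j < R" for j
  proof -
    show "0 < r j" using R(1) by (simp add: r_def)
    have "R * 1 < R * (real j + 2)" using R(1) by (intro mult_strict_left_mono) auto
    then show "r j < R" by (simp add: r_def divide_less_eq)
  qed
  have rmono: "r j < r i" if "i < j" for i j using that R(1) by (simp add: r_def divide_strict_left_mono)
  obtain C where C: "0 \<le> C" and poincare: "\<forall>u w a V b. admissible \<Omega> u w a V b \<longrightarrow> (\<integral>x. \<bar>w x\<bar> \<partial>lborel) \<le> C * (V + b)"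
    using poincare_with_trace[OF \<Omega>(1-3)] by blast
  \<comment> \<open>Under the smallness condition energy bound and Poincare inequality combine to
    \<open>?I \<le> \<theta> * ?I\<close> with \<open>\<theta> < 1\<close>, which forces
    \<open>u = 0\<close> almost everywhere.\<close>
  have large: "emeasure lebesgue {x \<in> \<Omega>. \<bar>u x\<bar> > a} > 0"
    if lam: "0 < lam" and a: "0 < a" "C * (lam * a powr (q - 1) + a powr (crit_exponent TYPE('n) - 1)) < 1"
      and u: "nontrivial_solution \<Omega> q lam a u" for lam a u
  proof (rule ccontr)
    assume "\<not> emeasure lebesgue {x \<in> \<Omega>. \<bar>u x\<bar> > a} > 0"
    then have null: "emeasure lebesgue {x \<in> \<Omega>. a < \<bar>u x\<bar>} = 0" by simp
    have sol: "solution \<Omega> q lam a u" using u by (simp add: nontrivial_solution_def)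
    then have [measurable]: "u \<in> borel_measurable (lebesgue_on \<Omega>)" by (auto simp: solution_def BV_def)
    \<comment> \<open>A set that is not measurable would also have \<open>emeasure\<close> zero;
      measurability is what makes this one a null set.\<close>
    have "{x \<in> space (lebesgue_on \<Omega>). a < \<bar>u x\<bar>} \<in> sets (lebesgue_on \<Omega>)" by measurable
    then have "{x \<in> \<Omega>. a < \<bar>u x\<bar>} \<in> sets lebesgue"
      using \<Omega>(1) by (simp add: sets_restrict_space_iff)
    then have "{x \<in> \<Omega>. a < \<bar>u x\<bar>} \<in> null_sets lebesgue" using null by auto
    then have "AE x in lebesgue. x \<in> \<Omega> \<longrightarrow> \<bar>u x\<bar> \<le> a" by (rule AE_I') auto
    then have small: "AE x in lebesgue_on \<Omega>. \<bar>u x\<bar> \<le> a" by (simp add: AE_lebesgue_on_open[OF \<Omega>(1)])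
    obtain w V b where adm: "admissible \<Omega> u w a V b"
      and E: "V + b \<le> (lam * a powr (q - 1) + a powr (crit_exponent TYPE('n) - 1)) * (\<integral>x. \<bar>w x\<bar> \<partial>lborel)"
      by (rule small_solution_energy[OF \<Omega>(1,2) assms(1,3) lam a(1) sol small])
    let ?I = "\<integral>x. \<bar>w x\<bar> \<partial>lborel"
    have wi: "integrable lborel w" and uw: "AE x in lebesgue. x \<in> \<Omega> \<longrightarrow> u x = w x"
      using adm by (auto simp: admissible_def)
    have "?I \<le> C * (V + b)" using poincare adm by blast
    also have "\<dots> \<le> C * (lam * a powr (q - 1) + a powr (crit_exponent TYPE('n) - 1)) * ?I"
      using mult_left_mono[OF E C] by (simp add: mult.assoc)
    finally have "?I \<le> C * (lam * a powr (q - 1) + a powr (crit_exponent TYPE('n) - 1)) * ?I" .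
    moreover have "0 \<le> ?I" by simp
    ultimately have "?I = 0" using mult_strict_right_mono[OF a(2), of ?I] by linarith
    then have "AE x in lborel. \<bar>w x\<bar> = 0" using wi by (subst (asm) integral_nonneg_eq_0_iff_AE) auto
    from AE_completion[OF this] uw have "AE x in lebesgue. x \<in> \<Omega> \<longrightarrow> u x = 0" by eventually_elim auto
    then show False using u by (simp add: nontrivial_solution_def ae_equal_def AE_lebesgue_on_open[OF \<Omega>(1)])
  qed
  show ?thesis
  \<comment> \<open>The threshold \<open>1\<close> serves for every \<open>n\<close>, since the
    equation for \<open>c\<close> is solvable for each positive \<open>lam\<close>.\<close>
  proof (rule allI, rule exI[of _ "1::real"], rule conjI, rule zero_less_one, intro allI impI)
    fix n :: nat and lam :: real assume "1 \<le> lam"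
    then have lam: "0 < lam" by simp
    have "\<forall>j. \<exists>c>0. lam * c powr (q - 1) + c powr (crit_exponent TYPE('n) - 1) = real CARD('n) / r j"
      using assms(1) r(1) by (intro allI powr_sum_solvable lam q1 crit) simp
    then obtain c where c: "\<And>j. 0 < c j"
      "\<And>j. lam * c j powr (q - 1) + c j powr (crit_exponent TYPE('n) - 1) = real CARD('n) / r j"
      by metis
    \<comment> \<open>Inserting \<open>1\<close> keeps the minimum defined and positive when
      \<open>n = 0\<close>.\<close>
    define a1 where "a1 = Min (insert 1 (c ` {..<n}))"
    have a1: "0 < a1" "\<And>j. j < n \<Longrightarrow> a1 \<le> c j" using c(1) by (auto simp: a1_def)
    obtain a2 where a2: "0 < a2"
      "\<And>a. 0 < a \<Longrightarrow> a < a2 \<Longrightarrow> C * (lam * a powr (q - 1) + a powr (crit_exponent TYPE('n) - 1)) < 1"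
      using powr_sum_small[OF q1 crit, of 1 C lam] by auto
    define U where "U j x = c j * indicator (cball p (r j)) x" for j and x :: "real^'n"
    have diff: "\<not> ae_equal \<Omega> (U i) (U j)" if "i < j" for i j
      using not_ae_equal_cball[OF \<Omega>(1) _ r(1) rmono[OF that], of p "c i" "c j"] c(1)[of i] R(2) r(2)[of i]
      by (force simp: U_def[abs_def])
    have sym: "ae_equal \<Omega> v u \<longleftrightarrow> ae_equal \<Omega> u v" for u v by (simp add: ae_equal_def eq_commute)
    show "\<exists>a\<^sub>1>0. (\<forall>a. 0 < a \<and> a < a\<^sub>1 \<longrightarrow> at_least_nontrivial_solutions n \<Omega> q lam a) \<and>
           (\<exists>a\<^sub>0>0. a\<^sub>0 \<le> a\<^sub>1 \<and> (\<forall>a. 0 < a \<and> a < a\<^sub>0 \<longrightarrow>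
                 (\<forall>u. nontrivial_solution \<Omega> q lam a u \<longrightarrow> emeasure lebesgue {x \<in> \<Omega>. \<bar>u x\<bar> > a} > 0)))"
    proof (rule exI[of _ a1], intro conjI allI impI)
      fix a assume a: "0 < a \<and> a < a1"
      have "nontrivial_solution \<Omega> q lam a (U i)" if "i < n" for i
        unfolding U_def[abs_def]
        using a a1(2)[OF that] c(2)[of i] r[of i] R(2)
        by (intro ball_solution[OF assms(1) \<Omega>(1,2) assms(3)]) auto
      moreover have "\<not> ae_equal \<Omega> (U i) (U j)" if "i \<noteq> j" for i j
        using that diff sym by (metis linorder_neqE_nat)
      ultimately show "at_least_nontrivial_solutions n \<Omega> q lam a"
        unfolding at_least_nontrivial_solutions_def by blast
    next
      show "\<exists>a\<^sub>0>0. a\<^sub>0 \<le> a1 \<and> (\<forall>a. 0 < a \<and> a < a\<^sub>0 \<longrightarrow>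
                 (\<forall>u. nontrivial_solution \<Omega> q lam a u \<longrightarrow> emeasure lebesgue {x \<in> \<Omega>. \<bar>u x\<bar> > a} > 0))"
        using a1(1) a2 large[OF lam] by (intro exI[of _ "min a1 a2"]) auto
    qed (rule a1)
  qed
qed

end
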